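(* Let $\theta\in\mathbb C\setminus\{0\}$. For every $g\ge2$, both limits $t\to\infty_B$ and $t\to\infty_C$ of the symplectic invariant $F^{(g)}_{\rm JM}(t)$ of the Jimbo–Miwa spectral curve are given by $$\lim_{t\to\infty_{B,C}}F^{(g)}_{\rm JM}(t)=-\frac{B_{2g}}{2g(2g-2)\,\theta^{2g-2}} .$$
   Context: **Bernoulli numbers.** $\frac{u}{e^u-1}-1+\frac u2=\sum_{m\ge1}B_{2m}\frac{u^{2m}}{(2m)!}$. **Notation.** $q_0=q_0(t)$ is a branch of the algebraic function defined by $2q_0^3+tq_0-\theta=0$, considered where $4q_0^3+\theta\neq0$. The ends $\infty_B$, $\infty_C$ are $t\to\infty$ on the branches with $q_0\sim\sqrt{-t/2}$, respectively $q_0\sim-\sqrt{-t/2}$; in both cases $q_0\to\infty$. **Spectral curve.** With $\gamma=\frac12\sqrt{-\theta/q_0}$, the Jimbo–Miwa spectral curve is $$x(z)=-q_0+\gamma\Big(z+\frac1z\Big),\quad y(z)=\gamma\Big(z-\frac1z\Big)\Big(-2q_0+\gamma\Big(z+\frac1z\Big)\Big),$$ with branch points $R=\{1,-1\}$ and conjugation $\bar z=1/z$. **Topological recursion.** $\omega^{(0)}_1=y\,dx$, $\omega^{(0)}_2(z_1,z_2)=\frac{dz_1dz_2}{(z_1-z_2)^2}$, $K(z_0,z)=\frac12\frac{\int_z^{\bar z}\omega^{(0)}_2(\cdot,z_0)}{(y(z)-y(\bar z))dx(z)}$ and $$\omega^{(g)}_{n+1}(z_0,z_1,\dots,z_n)=\sum_{r\in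 R}\mathop{\rm Res}_{z=r}K(z_0,z)\Big[\omega^{(g-1)}_{n+2}(z,\bar z,z_1,\dots,z_n)+\sum'\omega^{(g_1)}_{1+|I|}(z,z_I)\,\omega^{(g_2)}_{1+|J|}(\bar z,z_J)\Big],$$ $\sum'$ being over $g_1+g_2=g$, $I\sqcup J=\{1,\dots,n\}$ with $(g_1,I),(g_2,J)\neq(0,\emptyset)$ (and $\omega^{(-1)}=0$). For $g\ge2$, $F^{(g)}_{\rm JM}=\frac1{2-2g}\sum_{r\in R}\mathop{\rm Res}_{z=r}\Phi(z)\,\omega^{(g)}_1(z)$ with $\Phi(z)=\int_{z_o}^zy\,dx$, $z_o$ an arbitrary generic point. *)

theory Defs
  imports
    "HOL-Complex_Analysis.Complex_Analysis"
    "HOL-Library.Landau_Symbols"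
begin

section \<open>Bernoulli numbers\<close>

definition bernoulli :: "nat \<Rightarrow> complex" where
  "bernoulli n = fact n * fps_nth (fps_X / (fps_exp 1 - 1)) n"


section \<open>Topological recursion in a global coordinate on the Riemann sphere\<close>

text \<open>
  A multidifferential \<open>\<omega> = W(z\<^sub>1,\<dots>,z\<^sub>n) dz\<^sub>1\<dots>dz\<^sub>n\<close> is represented by its coefficient
  function \<open>W\<close>.  Thus the form \<open>dx(z)\<close> becomes \<open>deriv x z\<close>, a form in the conjugate point
  \<open>\<sigma> z\<close> picks up the factor \<open>deriv \<sigma> z\<close>, and the kernel, which is a differential in \<open>z\<^sub>0\<close>
  and the inverse of a differential in \<open>z\<close>, loses its factor \<open>dz\<^sub>0/dz\<close>.
\<close>

definition bergman :: "complex \<Rightarrow> complex \<Rightarrow> complex" where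
  "bergman z1 z2 = 1 / (z1 - z2)\<^sup>2"

text \<open>
  The integral from \<open>z\<close> to \<open>\<sigma> z\<close> does not depend on the path, since the integrand has no
  residue.  In the residues below \<open>z\<close> tends to a fixed point of \<open>\<sigma>\<close> different from \<open>z0\<close>, so
  the straight segment eventually avoids \<open>z0\<close>.
\<close>

definition recursion_kernel ::
  "(complex \<Rightarrow> complex) \<Rightarrow> (complex \<Rightarrow> complex) \<Rightarrow> (complex \<Rightarrow> complex) \<Rightarrow> complex \<Rightarrow> complex \<Rightarrow> complex"
where
  "recursion_kernel x y \<sigma> z0 z =
     1/2 * contour_integral (linepath z (\<sigma> z)) (\<lambda>w. bergman w z0)
         / ((y z - y (\<sigma> z)) * deriv x z)"

text \<open>
  The index set of the primed sum: \<open>(h, I)\<close> stands for \<open>g\<^sub>1 = h\<close>, \<open>g\<^sub>2 = g - h\<close>, and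
  \<open>J\<close> the complement of \<open>I\<close>; positions in a list are counted from \<open>0\<close>.
\<close>

definition splittings :: "nat \<Rightarrow> nat \<Rightarrow> (nat \<times> nat set) set" where
  "splittings g n = {(h, I). h \<le> g \<and> I \<subseteq> {..<n} \<and>
                       (h, I) \<noteq> (0, {}) \<and> (g - h, {..<n} - I) \<noteq> (0, {})}"

lemma length_nths_subset: "I \<subseteq> {..<length zs} \<Longrightarrow> length (nths zs I) = card I"
  by (auto simp: length_nths intro!: arg_cong[where f = card])

lemma splittings_decrease:
  assumes "(h, I) \<in> splittings g (length zs)"
  shows "2 * h + Suc (length (nths zs I)) < 2 * g + Suc (length zs)"
    and "2 * (g - h) + Suc (length (nths zs ({..<length zs} - I))) < 2 * g + Suc (length zs)"
proof -
  let ?n = "length zs"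
  have I: "h \<le> g" "I \<subseteq> {..<?n}" "h = 0 \<Longrightarrow> I \<noteq> {}" "g - h = 0 \<Longrightarrow> {..<?n} - I \<noteq> {}"
    using assms by (auto simp: splittings_def)
  have fin: "finite I" using I(2) finite_subset by blast
  have le: "card I \<le> ?n" using card_mono[OF _ I(2)] by simp
  have c: "card ({..<?n} - I) = ?n - card I" using card_Diff_subset[OF fin I(2)] by simp
  have pos: "h = 0 \<Longrightarrow> card I > 0" using I(3) fin by (simp add: card_gt_0_iff)
  have pos': "g - h = 0 \<Longrightarrow> card ({..<?n} - I) > 0" using I(4) by (simp add: card_gt_0_iff)
  show "2 * h + Suc (length (nths zs I)) < 2 * g + Suc ?n"
    using I(1) pos' c le by (cases "h = g") (auto simp: length_nths_subset[OF I(2)])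
  show "2 * (g - h) + Suc (length (nths zs ({..<?n} - I))) < 2 * g + Suc ?n"
    using I(1) pos c le by (cases "h = 0") (auto simp: length_nths_subset)
qed

text \<open>
  \<open>omega x y \<sigma> R g [z\<^sub>1,\<dots>,z\<^sub>n]\<close> is the coefficient of \<open>\<omega>\<^sup>(\<^sup>g\<^sup>)\<^sub>n\<close>.  There is no form with \<open>n = 0\<close>;
  the value on the empty list is a dummy and is never used.
\<close>

function omega ::
  "(complex \<Rightarrow> complex) \<Rightarrow> (complex \<Rightarrow> complex) \<Rightarrow> (complex \<Rightarrow> complex) \<Rightarrow> complex set \<Rightarrow>
   nat \<Rightarrow> complex list \<Rightarrow> complex"
where
  "omega x y \<sigma> R g [] = 0"
| "omega x y \<sigma> R g (z0 # zs) =
     (if g = 0 \<and> length zs = 0 then y z0 * deriv x z0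
      else if g = 0 \<and> length zs = 1 then bergman z0 (hd zs)
      else \<Sum>r\<in>R. residue (\<lambda>z. recursion_kernel x y \<sigma> z0 z *
             ((if g = 0 then 0 else omega x y \<sigma> R (g - 1) (z # \<sigma> z # zs)) +
              (\<Sum>(h, I)\<in>splittings g (length zs).
                 omega x y \<sigma> R h (z # nths zs I) *
                 omega x y \<sigma> R (g - h) (\<sigma> z # nths zs ({..<length zs} - I)))) *
             deriv \<sigma> z) r)"
  by pat_completeness auto
termination
  by (relation "Wellfounded.measure (\<lambda>(x, y, \<sigma>, R, g, zs). 2 * g + length zs)")
     (auto dest: splittings_decrease)

text \<open>
  The primitive \<open>\<Phi>(z) = \<integral>\<^bsub>z\<^sub>o\<^esub>\<^sup>z y dx\<close> is in general multivalued.  Near the branch point \<open>r\<close>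
  a branch is fixed by a path \<open>p r\<close> from the base point to \<open>r\<close>, continued by the segment
  from \<open>r\<close> to \<open>z\<close>.
\<close>

definition primitive_ydx ::
  "(complex \<Rightarrow> complex) \<Rightarrow> (complex \<Rightarrow> complex) \<Rightarrow> (real \<Rightarrow> complex) \<Rightarrow> complex \<Rightarrow> complex"
where
  "primitive_ydx x y c z =
     contour_integral (c +++ linepath (pathfinish c) z) (\<lambda>w. y w * deriv x w)"

definition symplectic_invariant ::
  "(complex \<Rightarrow> complex) \<Rightarrow> (complex \<Rightarrow> complex) \<Rightarrow> (complex \<Rightarrow> complex) \<Rightarrow> complex set \<Rightarrow>
   (complex \<Rightarrow> real \<Rightarrow> complex) \<Rightarrow> nat \<Rightarrow> complex"
where
  "symplectic_invariant x y \<sigma> R p g =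
     1 / (2 - 2 * of_nat g) *
       (\<Sum>r\<in>R. residue (\<lambda>z. primitive_ydx x y (p r) z * omega x y \<sigma> R g [z]) r)"


section \<open>The Jimbo--Miwa spectral curve\<close>

definition JM_x :: "complex \<Rightarrow> complex \<Rightarrow> complex \<Rightarrow> complex" where
  "JM_x q \<gamma> z = - q + \<gamma> * (z + 1 / z)"

definition JM_y :: "complex \<Rightarrow> complex \<Rightarrow> complex \<Rightarrow> complex" where
  "JM_y q \<gamma> z = \<gamma> * (z - 1 / z) * (- 2 * q + \<gamma> * (z + 1 / z))"

definition JM_branch_points :: "complex set" where
  "JM_branch_points = {1, - 1}"

definition JM_F ::
  "complex \<Rightarrow> complex \<Rightarrow> (complex \<Rightarrow> real \<Rightarrow> complex) \<Rightarrow> nat \<Rightarrow> complex"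
where
  "JM_F q \<gamma> p g =
     symplectic_invariant (JM_x q \<gamma>) (JM_y q \<gamma>) (\<lambda>z. 1 / z) JM_branch_points p g"

text \<open>
  Admissible integration paths for \<open>\<Phi>\<close>: the form \<open>y dx\<close> has its poles at \<open>0\<close> and infinity.
\<close>

definition JM_paths :: "complex \<Rightarrow> (complex \<Rightarrow> real \<Rightarrow> complex) \<Rightarrow> bool" where
  "JM_paths zo p \<longleftrightarrow>
     (\<forall>r\<in>JM_branch_points. valid_path (p r) \<and> pathstart (p r) = zo \<and> pathfinish (p r) = r \<and>
                           0 \<notin> path_image (p r))"

text \<open>
  A single-valued branch of the algebraic function exists only on part of a neighbourhood of
  infinity (for instance on a sector, or on a slit neighbourhood), hence the domain \<open>S\<close>.
\<close>

definition q0_branch :: "complex \<Rightarrow> complex set \<Rightarrow> (complex \<Rightarrow> complex) \<Rightarrow> bool" where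
  "q0_branch \<theta> S q0 \<longleftrightarrow> open S \<and> q0 holomorphic_on S \<and>
     (\<forall>t\<in>S. 2 * q0 t ^ 3 + t * q0 t - \<theta> = 0 \<and> 4 * q0 t ^ 3 + \<theta> \<noteq> 0)"

abbreviation at_infinity_within :: "complex set \<Rightarrow> complex filter" where
  "at_infinity_within S \<equiv> inf at_infinity (principal S)"

text \<open>
  The two ends, relative to a branch \<open>s\<close> of \<open>sqrt (- t / 2)\<close> on \<open>S\<close>.
\<close>

definition end_B :: "complex set \<Rightarrow> (complex \<Rightarrow> complex) \<Rightarrow> (complex \<Rightarrow> complex) \<Rightarrow> bool" where
  "end_B S s q0 \<longleftrightarrow> q0 \<sim>[at_infinity_within S] s"

definition end_C :: "complex set \<Rightarrow> (complex \<Rightarrow> complex) \<Rightarrow> (complex \<Rightarrow> complex) \<Rightarrow> bool" where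
  "end_C S s q0 \<longleftrightarrow> q0 \<sim>[at_infinity_within S] (\<lambda>t. - s t)"

end

theory Submission
  imports Defs "HOL-Probability.Probability" "Jordan_Normal_Form.Determinant"
begin

text \<open>
  In the coordinate \<open>x = z + 1/z\<close> and with \<open>e = \<gamma> / (2 q)\<close> the curve satisfies
  \<open>2 y dx = \<theta> (1 - e x) (x\<^sup>2 - 4) dz/z\<close>.  Up to powers of \<open>\<theta>\<close>, the forms \<open>\<omega>\<close> are therefore
  functions of \<open>x\<close> and \<open>e\<close> alone, produced by a recursion that projects onto the polar part at
  \<open>x = \<plusminus>2\<close>.  They depend on \<open>e\<close> through finitely many functions that are continuous at \<open>0\<close>, and
  \<open>e \<rightarrow> 0\<close> at both ends, so the limit is the value at \<open>e = 0\<close>: the curve of the Gaussian unitary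
  ensemble.

  There the expansion at \<open>x = \<infinity>\<close> turns the recursion into Tutte's loop equations.  The same
  equations hold for the genus expansion of the moments of the \<open>N\<close>-variable Gaussian weight with
  squared Vandermonde density, and they have only one solution.  Hermite polynomials give a Toda
  recursion in \<open>N\<close> for the one-point moments; it forces the genus \<open>g\<close> part of the \<open>2n\<close>-th moment to
  be \<open>C(2n,n) P\<^sub>g(n)\<close> with a polynomial \<open>P\<^sub>g\<close> whose linear coefficient is \<open>- B\<^sub>2\<^sub>g / (2g)\<close>.
  Finally, the residue of \<open>log z\<close>, the multivalued part of \<open>\<Phi>\<close>, against \<open>(x\<^sup>2 - 4)\<^sup>-\<^sup>k dz/z\<close>
  is the linear coefficient of the polynomial in \<open>n\<close> contributed to \<open>P\<^sub>g\<close> by \<open>(x\<^sup>2 - 4)\<^sup>-\<^sup>k\<close>.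
\<close>


section \<open>Residues at the branch points\<close>

text \<open>The term of the recursion with arguments \<open>z\<close> and \<open>1/z\<close> ties an
  argument of a form to the moving residue variable, so an induction over forms at fixed points does
  not close. Hence the reformulated recursion takes functions, not points, as its further arguments:
  it is linear in them and sees only their jets at the branch values, so a moving point enters
  through a finite expansion of its kernel. The same linearity later extracts coefficients at
  infinity in every further variable, by inserting suitable polynomials as arguments.

  The Gaussian side lives at integers \<open>N\<close>, but its genus expansion is polynomial in
  \<open>N\<close>, so the Toda recursion can be compared power by power. The pole structure at the
  branch values is what makes each positive genus part a central binomial times a polynomial in
  \<open>n\<close>. Therefore the Toda identity, valid for large integers \<open>n\<close>, extends
  to all complex \<open>n\<close>; at \<open>n = -1\<close> its right side acquires a double zero in
  \<open>n + 1\<close>, and the linear coefficient there is a recurrence of the Bernoulli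
  numbers.\<close>

lemma residue_meromorphic_add:
  assumes "f meromorphic_on {a}" "g meromorphic_on {a}"
  shows "residue (\<lambda>z. f z + g z) a = residue f a + residue g a"
proof -
  obtain F G where *: "(\<lambda>w. f (a + w)) has_laurent_expansion F" "(\<lambda>w. g (a + w)) has_laurent_expansion G"
    using assms unfolding meromorphic_on_def by auto
  show ?thesis
    using has_laurent_expansion_residue[OF has_laurent_expansion_add[OF *]]
      has_laurent_expansion_residue[OF *(1)] has_laurent_expansion_residue[OF *(2)] by simp
qed

lemma residue_meromorphic_cmult:
  assumes "f meromorphic_on {a}"
  shows "residue (\<lambda>z. c * f z) a = c * residue f a"
proof -
  obtain F where *: "(\<lambda>w. f (a + w)) has_laurent_expansion F"
    using assms unfolding meromorphic_on_def by auto
  show ?thesis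
    using has_laurent_expansion_residue[OF has_laurent_expansion_cmult_left[OF *, of c]]
      has_laurent_expansion_residue[OF *] by simp
qed

lemma residue_meromorphic_lincomb:
  assumes "f meromorphic_on {a}" "g meromorphic_on {a}"
  shows "residue (\<lambda>z. c * f z + d * g z) a = c * residue f a + d * residue g a"
proof -
  have "(\<lambda>z. c * f z) meromorphic_on {a}" "(\<lambda>z. d * g z) meromorphic_on {a}"
    using assms by (auto intro!: meromorphic_intros)
  thus ?thesis
    using assms by (simp add: residue_meromorphic_add residue_meromorphic_cmult)
qed

lemma residue_meromorphic_sum:
  assumes "\<And>i. i \<in> I \<Longrightarrow> f i meromorphic_on {a}"
  shows "residue (\<lambda>z. \<Sum>i\<in>I. f i z) a = (\<Sum>i\<in>I. residue (f i) a)"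
  using assms
  by (induction I rule: infinite_finite_induct)
     (auto simp: residue_const residue_meromorphic_add meromorphic_on_sum)

text \<open>The Laurent series of a derivative has no term of exponent -1. The antiderivative may
  itself have a pole, which is how all reduction formulas for residues below are obtained.\<close>

lemma residue_meromorphic_deriv:
  assumes "f meromorphic_on {a}" "eventually (\<lambda>z. (f has_field_derivative f' z) (at z)) (at a)"
  shows "residue f' a = 0"
proof -
  obtain F where *: "(\<lambda>w. f (a + w)) has_laurent_expansion F"
    using assms unfolding meromorphic_on_def by auto
  have "deriv (\<lambda>w. f (a + w)) = (\<lambda>w. deriv f (a + w))"
    by (rule ext) (subst (1 2) deriv_shift_0, simp add: o_def add_ac)
  hence "(\<lambda>w. deriv f (a + w)) has_laurent_expansion fls_deriv F"
    using has_laurent_expansion_deriv[OF *] by simp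
  hence "residue (deriv f) a = 0"
    using has_laurent_expansion_residue fls_residue_deriv by metis
  moreover have "residue f' a = residue (deriv f) a"
    using assms(2) by (intro residue_cong) (auto elim!: eventually_mono simp: DERIV_imp_deriv)
  ultimately show ?thesis by simp
qed

lemma residue_analytic:
  assumes "f analytic_on {a}"
  shows "residue f a = 0"
proof -
  obtain e where "e > 0" "f holomorphic_on ball a e"
    using assms by (auto simp: analytic_on_def)
  thus ?thesis using residue_holo[of "ball a e" a f] by auto
qed

lemma residue_meromorphic_cong:
  assumes "eventually (\<lambda>z. f z = g z) (at a)"
  shows "residue f a = residue g a"
  using assms by (intro residue_cong) auto

section \<open>The coordinate x = z + 1/z and residues of forms in x\<close>

definition xz :: "complex \<Rightarrow> complex" where "xz z = z + 1 / z"

text \<open>The square root of \<open>x^2 - 4\<close> on the curve, odd under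
  \<open>z \<mapsto> 1/z\<close>. With \<open>dx = u dz/z\<close> and \<open>du = x dz/z\<close> the
  residues below become those of forms in \<open>x\<close> and \<open>u\<close>.\<close>

definition uz :: "complex \<Rightarrow> complex" where "uz z = z - 1 / z"

definition res1 :: "(complex \<Rightarrow> complex) \<Rightarrow> complex" where
  "res1 f = (\<Sum>r\<in>JM_branch_points. residue f r)"

lemma res1_eq: "res1 f = residue f 1 + residue f (- 1)"
  by (simp add: res1_def JM_branch_points_def)

lemma eventually_branch:
  assumes "r \<in> JM_branch_points"
  shows "eventually (\<lambda>z. z \<noteq> 0 \<and> z \<noteq> 1 \<and> z \<noteq> -1) (at r)"
proof -
  have "eventually (\<lambda>z. z \<noteq> c) (at r)" for c
    using eventually_neq_at_within[of c r UNIV] by auto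
  thus ?thesis by (intro eventually_conj)
qed

lemma uz_sq: "z \<noteq> 0 \<Longrightarrow> (uz z)\<^sup>2 = (xz z)\<^sup>2 - 4"
  by (simp add: uz_def xz_def power2_eq_square field_simps)

lemma uz_nz: "z \<noteq> 0 \<Longrightarrow> z \<noteq> 1 \<Longrightarrow> z \<noteq> -1 \<Longrightarrow> uz z \<noteq> 0"
  by (auto simp: uz_def field_simps) (metis power2_eq_square power2_eq_1_iff)

lemma xz_deriv: "z \<noteq> 0 \<Longrightarrow> (xz has_field_derivative 1 - 1 / z\<^sup>2) (at z)"
  unfolding xz_def[abs_def] by (auto intro!: derivative_eq_intros simp: power2_eq_square)

lemma uz_deriv: "z \<noteq> 0 \<Longrightarrow> (uz has_field_derivative 1 + 1 / z\<^sup>2) (at z)"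
  unfolding uz_def[abs_def] by (auto intro!: derivative_eq_intros simp: power2_eq_square)

lemma xz_analytic: "0 \<notin> A \<Longrightarrow> xz analytic_on A"
  unfolding xz_def[abs_def] by (intro analytic_intros) auto

lemma uz_analytic: "0 \<notin> A \<Longrightarrow> uz analytic_on A"
  unfolding uz_def[abs_def] by (intro analytic_intros) auto

lemma xz_mero [meromorphic_intros]: "0 \<notin> A \<Longrightarrow> xz meromorphic_on A"
  by (intro analytic_on_imp_meromorphic_on xz_analytic)

lemma uz_mero [meromorphic_intros]: "0 \<notin> A \<Longrightarrow> uz meromorphic_on A"
  by (intro analytic_on_imp_meromorphic_on uz_analytic)

lemma branch_nz: "r \<in> JM_branch_points \<Longrightarrow> r \<noteq> 0"
  by (auto simp: JM_branch_points_def)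

text \<open>The numerator is \<open>du/dz\<close>, so the form is \<open>du / u^(k+2)\<close>, which
  is exact.\<close>

lemma residue_uz_pow:
  assumes r: "r \<in> JM_branch_points"
  shows "residue (\<lambda>z. (1 + 1 / z\<^sup>2) / uz z ^ Suc (Suc k)) r = 0"
proof (rule residue_meromorphic_deriv)
  show "(\<lambda>z. - 1 / of_nat (Suc k) / uz z ^ Suc k) meromorphic_on {r}"
    using branch_nz[OF r] by (intro meromorphic_intros) auto
  show "\<forall>\<^sub>F z in at r. ((\<lambda>z. - 1 / of_nat (Suc k) / uz z ^ Suc k) has_field_derivative
         (1 + 1 / z\<^sup>2) / uz z ^ Suc (Suc k)) (at z)"
    using eventually_branch[OF r]
  proof eventually_elim
    case (elim z)
    hence u: "uz z \<noteq> 0" using uz_nz by auto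
    have k: "of_nat (Suc k) \<noteq> (0::complex)" using of_nat_neq_0 by blast
    have "((\<lambda>z. uz z ^ Suc k) has_field_derivative of_nat (Suc k) * uz z ^ k * (1 + 1 / z\<^sup>2)) (at z)"
      using DERIV_power[OF uz_deriv[of z], of "Suc k"] elim by (simp add: mult_ac)
    from DERIV_inverse'[OF this] u
    have "((\<lambda>z. inverse (uz z ^ Suc k)) has_field_derivative
            - (inverse (uz z ^ Suc k) * (of_nat (Suc k) * uz z ^ k * (1 + 1 / z\<^sup>2)) * inverse (uz z ^ Suc k))) (at z)"
      by simp
    note D = DERIV_cmult[OF this, of "- 1 / of_nat (Suc k)"]
    have fe: "(\<lambda>z. - 1 / of_nat (Suc k) * inverse (uz z ^ Suc k)) = (\<lambda>z. - 1 / of_nat (Suc k) / uz z ^ Suc k)"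
      by (simp add: divide_inverse)
    have "- 1 / of_nat (Suc k) * - (inverse (uz z ^ Suc k) * (of_nat (Suc k) * uz z ^ k * c) * inverse (uz z ^ Suc k)) =
          c / uz z ^ Suc (Suc k)" for c
      using u k by (simp add: field_simps del: of_nat_Suc)
    with D show ?case unfolding fe by (metis (no_types))
  qed
qed

text \<open>A logarithmic derivative: \<open>uz\<close> has a simple zero at each branch
  point.\<close>

lemma residue_uz_log:
  assumes r: "r \<in> JM_branch_points"
  shows "residue (\<lambda>z. (1 + 1 / z\<^sup>2) / uz z) r = 1"
proof -
  have "residue (\<lambda>z. (1 + 1 / z\<^sup>2) / uz z) r = residue (\<lambda>z. ((z\<^sup>2 + 1) / (z * (z + r))) / (z - r)) r"
  proof (intro residue_meromorphic_cong, use eventually_branch[OF r] in eventually_elim)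
    case (elim z)
    have r2: "r * r = 1" using r by (auto simp: JM_branch_points_def)
    have "z * (z + r) * (z - r) = z\<^sup>2 * uz z"
      using elim r2 by (simp add: uz_def field_simps power2_eq_square)
    moreover have "(1 + 1 / z\<^sup>2) / uz z = (z\<^sup>2 + 1) / (z\<^sup>2 * uz z)"
      using elim uz_nz[of z] by (simp add: field_simps)
    ultimately show ?case by simp
  qed
  also have "\<dots> = (r\<^sup>2 + 1) / (r * (r + r))"
  proof (rule residue_simple)
    show "open (ball r 1)" "r \<in> ball r 1" by auto
    have "z * (z + r) \<noteq> 0" if "z \<in> ball r 1" for z
    proof
      assume "z * (z + r) = 0"
      hence "z = 0 \<or> z = - r" by (auto simp: add_eq_0_iff)
      thus False using that r by (auto simp: JM_branch_points_def dist_norm)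
    qed
    thus "(\<lambda>z. (z\<^sup>2 + 1) / (z * (z + r))) holomorphic_on ball r 1"
      by (intro holomorphic_intros) auto
  qed
  also have "\<dots> = 1" using r by (auto simp: JM_branch_points_def)
  finally show ?thesis .
qed

text \<open>The derivative of \<open>x / (x^2 - 4)^l\<close>, with \<open>x^2\<close> in the
  numerator rewritten as \<open>(x^2 - 4) + 4\<close>, gives this reduction. Its coefficients are
  the same at both branch points.\<close>

lemma residue_dx_pow_Suc:
  assumes r: "r \<in> JM_branch_points"
  shows "8 * of_nat l * residue (\<lambda>z. (1 - 1 / z\<^sup>2) / ((xz z)\<^sup>2 - 4) ^ Suc l) r =
         (1 - 2 * of_nat l) * residue (\<lambda>z. (1 - 1 / z\<^sup>2) / ((xz z)\<^sup>2 - 4) ^ l) r"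
proof -
  let ?f = "\<lambda>l z. (1 - 1 / z\<^sup>2) / ((xz z)\<^sup>2 - 4) ^ l"
  have m: "?f l meromorphic_on {r}" for l
    using branch_nz[OF r] by (intro meromorphic_intros) auto
  have "residue (\<lambda>z. (1 - 2 * of_nat l) * ?f l z + (- 8 * of_nat l) * ?f (Suc l) z) r = 0"
  proof (rule residue_meromorphic_deriv)
    show "(\<lambda>z. xz z / ((xz z)\<^sup>2 - 4) ^ l) meromorphic_on {r}"
      using branch_nz[OF r] by (intro meromorphic_intros) auto
    show "\<forall>\<^sub>F z in at r. ((\<lambda>z. xz z / ((xz z)\<^sup>2 - 4) ^ l) has_field_derivative
            ((1 - 2 * of_nat l) * ?f l z + (- 8 * of_nat l) * ?f (Suc l) z)) (at z)"
      using eventually_branch[OF r]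
    proof eventually_elim
      case (elim z)
      define d where "d = 1 - 1 / z\<^sup>2"
      have dd: "(xz has_field_derivative d) (at z)" using elim xz_deriv by (simp add: d_def)
      have s: "(xz z)\<^sup>2 - 4 \<noteq> 0" using elim uz_nz uz_sq by (metis power_not_zero)
      have "((\<lambda>z. xz z / ((xz z)\<^sup>2 - 4) ^ l) has_field_derivative
              (d * ((xz z)\<^sup>2 - 4) ^ l - xz z * (of_nat l * ((xz z)\<^sup>2 - 4) ^ (l - 1) * (2 * xz z * d)))
               / (((xz z)\<^sup>2 - 4) ^ l * ((xz z)\<^sup>2 - 4) ^ l)) (at z)"
        using s by (auto intro!: derivative_eq_intros dd)
      also have "(d * ((xz z)\<^sup>2 - 4) ^ l - xz z * (of_nat l * ((xz z)\<^sup>2 - 4) ^ (l - 1) * (2 * xz z * d)))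
               / (((xz z)\<^sup>2 - 4) ^ l * ((xz z)\<^sup>2 - 4) ^ l) =
             (1 - 2 * of_nat l) * (d / ((xz z)\<^sup>2 - 4) ^ l) + (- 8 * of_nat l) * (d / ((xz z)\<^sup>2 - 4) ^ Suc l)"
      proof (cases l)
        case (Suc k)
        define S where "S = (xz z)\<^sup>2 - 4"
        have x2: "xz z * xz z = S + 4" by (simp add: S_def power2_eq_square)
        have "xz z * (of_nat l * S ^ (l - 1) * (2 * xz z * d)) = 2 * of_nat l * S^k * d * (xz z * xz z)"
          using Suc by simp
        also have "\<dots> = 2 * of_nat l * S^k * d * (S + 4)" by (simp only: x2)
        finally show ?thesis using s Suc unfolding S_def[symmetric] by (simp add: field_simps del: of_nat_Suc)
      qed (use s in auto)
      finally show ?case by (simp add: d_def)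
    qed
  qed
  moreover have "residue (\<lambda>z. (1 - 2 * of_nat l) * ?f l z + (- 8 * of_nat l) * ?f (Suc l) z) r =
     (1 - 2 * of_nat l) * residue (?f l) r + (- 8 * of_nat l) * residue (?f (Suc l)) r"
    using m by (intro residue_meromorphic_lincomb)
  ultimately show ?thesis by (simp add: algebra_simps)
qed

text \<open>The residues at \<open>1\<close> and \<open>-1\<close> are opposite for
  \<open>l = 1\<close>, namely \<open>r / 2\<close>, and the reduction above keeps them opposite. It
  degenerates at \<open>l = 0\<close>, so the exponents 0 and 1 are treated directly.\<close>

lemma res1_dx_pow: "res1 (\<lambda>z. (1 - 1 / z\<^sup>2) / ((xz z)\<^sup>2 - 4) ^ l) = 0"
proof -
  have base: "residue (\<lambda>z. (1 - 1 / z\<^sup>2) / ((xz z)\<^sup>2 - 4) ^ 1) r = r / 2" if r: "r \<in> JM_branch_points" for r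
  proof -
    have "residue (\<lambda>z. (1 - 1 / z\<^sup>2) / ((xz z)\<^sup>2 - 4) ^ 1) r = residue (\<lambda>z. (1 / (z + r)) / (z - r)) r"
    proof (intro residue_meromorphic_cong, use eventually_branch[OF r] in eventually_elim)
      case (elim z)
      have "(1 - 1 / z\<^sup>2) / (uz z)\<^sup>2 = 1 / (z\<^sup>2 - 1)"
      proof -
        have e: "1 - 1 / z\<^sup>2 = uz z / z" using elim by (simp add: uz_def field_simps power2_eq_square)
        have "z * uz z = z\<^sup>2 - 1" using elim by (simp add: uz_def field_simps power2_eq_square)
        thus ?thesis unfolding e using uz_nz[of z] elim by (simp add: power2_eq_square divide_simps)
      qed
      moreover have "z\<^sup>2 - 1 = (z + r) * (z - r)" using r by (auto simp: JM_branch_points_def algebra_simps power2_eq_square)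
      ultimately show ?case using elim by (simp add: uz_sq)
    qed
    also have "\<dots> = 1 / (r + r)"
    proof (rule residue_simple)
      show "open (ball r 1)" "r \<in> ball r 1" by auto
      have "z + r \<noteq> 0" if "z \<in> ball r 1" for z
      proof
        assume "z + r = 0"
        hence "z = - r" by (auto simp: add_eq_0_iff)
        thus False using that r by (auto simp: JM_branch_points_def dist_norm)
      qed
      thus "(\<lambda>z. 1 / (z + r)) holomorphic_on ball r 1"
        by (intro holomorphic_intros) auto
    qed
    also have "\<dots> = r / 2" using r by (auto simp: JM_branch_points_def)
    finally show ?thesis .
  qed
  show ?thesis
  proof (induction l)
    case 0
    have "residue (\<lambda>z. 1 - 1 / z\<^sup>2) r = 0" if "r \<in> JM_branch_points" for r
      using branch_nz[OF that] by (intro residue_analytic analytic_intros) auto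
    thus ?case by (simp add: res1_def)
  next
    case (Suc l)
    show ?case
    proof (cases "l = 0")
      case True
      thus ?thesis using base[of 1] base[of "- 1"] by (simp add: res1_eq JM_branch_points_def)
    next
      case False
      have "8 * of_nat l * res1 (\<lambda>z. (1 - 1 / z\<^sup>2) / ((xz z)\<^sup>2 - 4) ^ Suc l) =
            (1 - 2 * of_nat l) * res1 (\<lambda>z. (1 - 1 / z\<^sup>2) / ((xz z)\<^sup>2 - 4) ^ l)"
        unfolding res1_def sum_distrib_left by (intro sum.cong refl residue_dx_pow_Suc)
      thus ?thesis using Suc False by simp
    qed
  qed
qed

text \<open>\<open>x dx = u du\<close>, so the form is \<open>du / u^(2l-1)\<close>. It is exact
  except for \<open>l = 1\<close>, where each branch point contributes 1.\<close>

lemma res1_x_dx_pow: "res1 (\<lambda>z. xz z * (1 - 1 / z\<^sup>2) / ((xz z)\<^sup>2 - 4) ^ l) = (if l = 1 then 2 else 0)"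
proof -
  have a: "xz z * (1 - 1 / z\<^sup>2) = uz z * (1 + 1 / z\<^sup>2)" if "z \<noteq> 0" for z
    using that by (simp add: xz_def uz_def field_simps power2_eq_square)
  have "residue (\<lambda>z. xz z * (1 - 1 / z\<^sup>2) / ((xz z)\<^sup>2 - 4) ^ l) r = (if l = 1 then 1 else 0)"
    if r: "r \<in> JM_branch_points" for r
  proof (cases l)
    case 0
    thus ?thesis using branch_nz[OF r] by (auto intro!: residue_analytic analytic_intros xz_analytic)
  next
    case (Suc k)
    have "residue (\<lambda>z. xz z * (1 - 1 / z\<^sup>2) / ((xz z)\<^sup>2 - 4) ^ l) r =
          residue (\<lambda>z. (1 + 1 / z\<^sup>2) / uz z ^ Suc (2 * k)) r"
    proof (intro residue_meromorphic_cong, use eventually_branch[OF r] in eventually_elim)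
      case (elim z)
      have u: "uz z \<noteq> 0" using elim uz_nz by auto
      have "((xz z)\<^sup>2 - 4) ^ l = uz z * uz z ^ Suc (2 * k)"
        unfolding uz_sq[OF conjunct1[OF elim], symmetric] power_mult[symmetric] Suc by simp
      thus ?case using a elim u by simp
    qed
    also have "\<dots> = (if l = 1 then 1 else 0)"
    proof (cases k)
      case 0
      thus ?thesis using Suc residue_uz_log[OF r] by simp
    next
      case (Suc k')
      thus ?thesis using \<open>l = Suc k\<close> residue_uz_pow[OF r, of "2 * k' + 1"] by simp
    qed
    finally show ?thesis .
  qed
  thus ?thesis by (simp add: res1_eq JM_branch_points_def)
qed

section \<open>Projection onto the polar part\<close>

definition bp :: "complex filter" where "bp = sup (at 2) (at (- 2))"

lemma eventually_bp: "eventually P bp \<longleftrightarrow> eventually P (at 2) \<and> eventually P (at (- 2))"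
  by (simp add: bp_def eventually_sup)

lemma eventually_bp_neq: "eventually (\<lambda>x. x \<noteq> c) bp"
  unfolding eventually_bp using eventually_neq_at_within[of c _ UNIV] by auto

lemma sq4_eq_0_iff: "x\<^sup>2 - 4 = 0 \<longleftrightarrow> x \<in> {2, - 2 :: complex}"
proof -
  have "x\<^sup>2 - 4 = (x - 2) * (x + 2)" by (simp add: algebra_simps power2_eq_square)
  moreover have "x + 2 = 0 \<longleftrightarrow> x = - 2" by (simp add: eq_neg_iff_add_eq_0)
  ultimately show ?thesis by auto
qed

lemma eventually_bp_sq4: "eventually (\<lambda>x. x\<^sup>2 - 4 \<noteq> 0) bp"
  using eventually_bp_neq[of 2] eventually_bp_neq[of "- 2"]
  by eventually_elim (simp only: sq4_eq_0_iff, simp)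

text \<open>The identity \<open>z (x - 2 r) = (z - r)^2\<close> keeps \<open>x\<close> off the value
  \<open>2 r\<close>, so punctured neighbourhoods of the branch values pull back to punctured
  neighbourhoods of the branch points.\<close>

lemma filterlim_xz:
  assumes "r \<in> JM_branch_points"
  shows "filterlim xz (at (2 * r)) (at r)"
proof -
  have r: "r \<noteq> 0" "r * r = 1" using assms by (auto simp: JM_branch_points_def)
  have "isCont xz r" using xz_deriv[OF r(1)] DERIV_isCont by blast
  moreover have "xz r = 2 * r" using assms by (auto simp: xz_def JM_branch_points_def)
  ultimately have "xz \<midarrow>r\<rightarrow> 2 * r" by (simp add: isCont_def)
  moreover have "eventually (\<lambda>z. xz z \<noteq> 2 * r) (at r)"
    using eventually_branch[OF assms]
  proof eventually_elim
    case (elim z)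
    have "z * (xz z - 2 * r) = (z - r) * (z - r)"
      using elim r by (simp add: xz_def field_simps)
    moreover have "z \<noteq> r" using elim assms by (auto simp: JM_branch_points_def)
    ultimately show ?case using elim by force
  qed
  ultimately show ?thesis by (simp add: filterlim_at)
qed

lemma eventually_bp_xz:
  assumes "eventually P bp" "r \<in> JM_branch_points"
  shows "eventually (\<lambda>z. P (xz z)) (at r)"
proof -
  have "eventually P (at (2 * r))"
    using assms by (auto simp: eventually_bp JM_branch_points_def)
  thus ?thesis using filterlim_xz[OF assms(2)] by (simp add: filterlim_iff)
qed

section \<open>Functions meromorphic at the branch values\<close>

text \<open>
  \<open>mer M f\<close>: in the coordinate \<open>x\<close>, the function \<open>f\<close> has poles of order at most \<open>M\<close> at the two
  branch values \<open>\<plusminus>2\<close>; the values at \<open>\<plusminus>2\<close> themselves are irrelevant.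
\<close>
definition mer :: "nat \<Rightarrow> (complex \<Rightarrow> complex) \<Rightarrow> bool" where
  "mer M f \<longleftrightarrow> (\<exists>h. h analytic_on {2, - 2} \<and> eventually (\<lambda>x. f x = h x / (x\<^sup>2 - 4) ^ M) bp)"

lemma mer_cong:
  assumes "eventually (\<lambda>x. f x = g x) bp" "mer M f"
  shows "mer M g"
proof -
  obtain h where h: "h analytic_on {2, - 2}" "eventually (\<lambda>x. f x = h x / (x\<^sup>2 - 4) ^ M) bp"
    using assms by (auto simp: mer_def)
  have "eventually (\<lambda>x. g x = h x / (x\<^sup>2 - 4) ^ M) bp"
    using h(2) assms(1) by eventually_elim simp
  thus ?thesis using h(1) by (auto simp: mer_def)
qed

lemma mer_analytic: "h analytic_on {2, - 2} \<Longrightarrow> mer 0 h"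
  by (auto simp: mer_def intro!: exI[of _ h])

lemma mer_const: "mer 0 (\<lambda>_. c)"
  by (intro mer_analytic analytic_intros)

lemma mer_mono:
  assumes "mer M f" "M \<le> M'"
  shows "mer M' f"
proof -
  obtain h where h: "h analytic_on {2, - 2}" "eventually (\<lambda>x. f x = h x / (x\<^sup>2 - 4) ^ M) bp"
    using assms by (auto simp: mer_def)
  have "(\<lambda>x. h x * (x\<^sup>2 - 4) ^ (M' - M)) analytic_on {2, - 2}"
    by (intro analytic_intros h)
  moreover have "eventually (\<lambda>x. f x = h x * (x\<^sup>2 - 4) ^ (M' - M) / (x\<^sup>2 - 4) ^ M') bp"
    using h(2) eventually_bp_sq4
  proof eventually_elim
    case (elim x)
    have "(x\<^sup>2 - 4) ^ M' = (x\<^sup>2 - 4) ^ (M' - M) * (x\<^sup>2 - 4) ^ M"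
      using assms(2) by (simp flip: power_add)
    thus ?case using elim by simp
  qed
  ultimately show ?thesis by (auto simp: mer_def)
qed

lemma mer_mult:
  assumes "mer M f" "mer N g"
  shows "mer (M + N) (\<lambda>x. f x * g x)"
proof -
  obtain h k where h: "h analytic_on {2, - 2}" "eventually (\<lambda>x. f x = h x / (x\<^sup>2 - 4) ^ M) bp"
    and k: "k analytic_on {2, - 2}" "eventually (\<lambda>x. g x = k x / (x\<^sup>2 - 4) ^ N) bp"
    using assms by (auto simp: mer_def)
  have "eventually (\<lambda>x. f x * g x = h x * k x / (x\<^sup>2 - 4) ^ (M + N)) bp"
    using h(2) k(2) by eventually_elim (simp add: power_add)
  thus ?thesis using analytic_on_mult[OF h(1) k(1)] by (auto simp: mer_def intro!: exI[of _ "\<lambda>x. h x * k x"])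
qed

lemma mer_add:
  assumes "mer M f" "mer M g"
  shows "mer M (\<lambda>x. f x + g x)"
proof -
  obtain h k where h: "h analytic_on {2, - 2}" "eventually (\<lambda>x. f x = h x / (x\<^sup>2 - 4) ^ M) bp"
    and k: "k analytic_on {2, - 2}" "eventually (\<lambda>x. g x = k x / (x\<^sup>2 - 4) ^ M) bp"
    using assms by (auto simp: mer_def)
  have "eventually (\<lambda>x. f x + g x = (h x + k x) / (x\<^sup>2 - 4) ^ M) bp"
    using h(2) k(2) by eventually_elim (simp add: add_divide_distrib)
  thus ?thesis using analytic_on_add[OF h(1) k(1)] by (auto simp: mer_def intro!: exI[of _ "\<lambda>x. h x + k x"])
qed

lemma mer_cmult: "mer M f \<Longrightarrow> mer M (\<lambda>x. c * f x)"
  using mer_mult[OF mer_const] by simp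

lemma mer_sum: "(\<And>i. i \<in> I \<Longrightarrow> mer M (f i)) \<Longrightarrow> mer M (\<lambda>x. \<Sum>i\<in>I. f i x)"
  by (induction I rule: infinite_finite_induct)
     (auto intro!: mer_add mer_mono[OF mer_const])

lemma mer_inverse_sq4: "mer k (\<lambda>x. 1 / (x\<^sup>2 - 4) ^ k)"
  by (auto simp: mer_def intro!: exI[of _ "\<lambda>_. 1"] analytic_intros)

lemma mer_divide_sq4:
  assumes "mer M f" shows "mer (M + k) (\<lambda>x. f x / (x\<^sup>2 - 4) ^ k)"
  using mer_mult[OF assms mer_inverse_sq4[of k]] by simp

lemma mer_sq4_mult:
  assumes "mer M f" "M \<le> m" shows "mer 0 (\<lambda>x. (x\<^sup>2 - 4) ^ m * f x)"
proof -
  obtain h where h: "h analytic_on {2, - 2}" "eventually (\<lambda>x. f x = h x / (x\<^sup>2 - 4) ^ M) bp"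
    using assms by (auto simp: mer_def)
  have "(\<lambda>x. (x\<^sup>2 - 4) ^ (m - M) * h x) analytic_on {2, - 2}"
    by (intro analytic_intros h)
  moreover have "eventually (\<lambda>x. (x\<^sup>2 - 4) ^ m * f x = ((x\<^sup>2 - 4) ^ (m - M) * h x) / (x\<^sup>2 - 4) ^ 0) bp"
    using h(2) eventually_bp_sq4
  proof eventually_elim
    case (elim x)
    have "(x\<^sup>2 - 4) ^ m = (x\<^sup>2 - 4) ^ (m - M) * (x\<^sup>2 - 4) ^ M"
      using assms(2) by (simp flip: power_add)
    thus ?case using elim by simp
  qed
  ultimately show ?thesis by (auto simp: mer_def)
qed

lemma mer_meromorphic:
  assumes "mer M f" "r \<in> JM_branch_points"
  shows "(\<lambda>z. f (xz z)) meromorphic_on {r}"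
proof -
  obtain h where h: "h analytic_on {2, - 2}" "eventually (\<lambda>x. f x = h x / (x\<^sup>2 - 4) ^ M) bp"
    using assms by (auto simp: mer_def)
  have "(h \<circ> xz) analytic_on {r}"
    using assms(2) by (intro analytic_on_compose xz_analytic analytic_on_subset[OF h(1)])
      (auto simp: JM_branch_points_def xz_def)
  hence "(\<lambda>z. h (xz z) / ((xz z)\<^sup>2 - 4) ^ M) meromorphic_on {r}"
    using branch_nz[OF assms(2)]
    by (intro meromorphic_intros analytic_on_imp_meromorphic_on) (auto simp: o_def)
  moreover have "eventually (\<lambda>z. f (xz z) = h (xz z) / ((xz z)\<^sup>2 - 4) ^ M) (at r)"
    using eventually_bp_xz[OF h(2) assms(2)] .
  ultimately show ?thesis
    using meromorphic_on_cong[of "{r}" "\<lambda>z. f (xz z)" "\<lambda>z. h (xz z) / ((xz z)\<^sup>2 - 4) ^ M" "{r}"] by auto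
qed

text \<open>A Cauchy integral of \<open>f(x) dx / (x0 - x)\<close> around both branch values. The
  factor 1/2 is there because \<open>z\<close> covers a neighbourhood of each branch value
  twice.\<close>

definition PP :: "(complex \<Rightarrow> complex) \<Rightarrow> complex \<Rightarrow> complex" where
  "PP f x0 = 1/2 * res1 (\<lambda>z. f (xz z) * (1 - 1 / z\<^sup>2) / (x0 - xz z))"

lemma res1_cong_bp:
  assumes "eventually (\<lambda>x. f x = g x) bp"
  shows "res1 (\<lambda>z. f (xz z) * h z) = res1 (\<lambda>z. g (xz z) * h z)"
  unfolding res1_def
proof (intro sum.cong refl residue_meromorphic_cong)
  fix r assume "r \<in> JM_branch_points"
  show "eventually (\<lambda>z. f (xz z) * h z = g (xz z) * h z) (at r)"
    using eventually_bp_xz[OF assms \<open>r \<in> _\<close>] by eventually_elim simp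
qed

lemma PP_cong:
  assumes "eventually (\<lambda>x. f x = g x) bp"
  shows "PP f x0 = PP g x0"
  using res1_cong_bp[OF assms, of "\<lambda>z. (1 - 1 / z\<^sup>2) / (x0 - xz z)"] by (simp add: PP_def)

lemma PP_meromorphic:
  assumes "mer M f" "r \<in> JM_branch_points"
  shows "(\<lambda>z. f (xz z) * (1 - 1 / z\<^sup>2) / (x0 - xz z)) meromorphic_on {r}"
  using branch_nz[OF assms(2)] by (intro meromorphic_intros mer_meromorphic[OF assms]) auto

lemma PP_sum:
  assumes "\<And>i. i \<in> I \<Longrightarrow> mer M (f i)"
  shows "PP (\<lambda>x. \<Sum>i\<in>I. c i * f i x) x0 = (\<Sum>i\<in>I. c i * PP (f i) x0)"
proof -
  have "res1 (\<lambda>z. (\<Sum>i\<in>I. c i * f i (xz z)) * (1 - 1 / z\<^sup>2) / (x0 - xz z)) =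
        (\<Sum>r\<in>JM_branch_points. residue (\<lambda>z. \<Sum>i\<in>I. c i * (f i (xz z) * (1 - 1 / z\<^sup>2) / (x0 - xz z))) r)"
    unfolding res1_def by (simp add: sum_distrib_right sum_divide_distrib mult.assoc)
  also have "\<dots> = (\<Sum>r\<in>JM_branch_points. \<Sum>i\<in>I. c i * residue (\<lambda>z. f i (xz z) * (1 - 1 / z\<^sup>2) / (x0 - xz z)) r)"
  proof (intro sum.cong refl)
    fix r assume r: "r \<in> JM_branch_points"
    note m = PP_meromorphic[OF assms r]
    have "residue (\<lambda>z. \<Sum>i\<in>I. c i * (f i (xz z) * (1 - 1 / z\<^sup>2) / (x0 - xz z))) r =
          (\<Sum>i\<in>I. residue (\<lambda>z. c i * (f i (xz z) * (1 - 1 / z\<^sup>2) / (x0 - xz z))) r)"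
      using m by (intro residue_meromorphic_sum meromorphic_on_mult meromorphic_on_const) auto
    also have "\<dots> = (\<Sum>i\<in>I. c i * residue (\<lambda>z. f i (xz z) * (1 - 1 / z\<^sup>2) / (x0 - xz z)) r)"
      using m by (intro sum.cong refl residue_meromorphic_cmult) auto
    finally show "residue (\<lambda>z. \<Sum>i\<in>I. c i * (f i (xz z) * (1 - 1 / z\<^sup>2) / (x0 - xz z))) r = \<dots>" .
  qed
  also have "\<dots> = (\<Sum>i\<in>I. c i * res1 (\<lambda>z. f i (xz z) * (1 - 1 / z\<^sup>2) / (x0 - xz z)))"
    unfolding res1_def sum_distrib_left by (rule sum.swap)
  finally show ?thesis by (simp add: PP_def sum_distrib_left mult_ac)
qed

lemma PP_add:
  assumes "mer M f" "mer M g"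
  shows "PP (\<lambda>x. f x + g x) x0 = PP f x0 + PP g x0"
  using PP_sum[of "{True, False}" M "\<lambda>b. if b then f else g" "\<lambda>_. 1" x0] assms by simp

lemma PP_cmult:
  assumes "mer M f"
  shows "PP (\<lambda>x. c * f x) x0 = c * PP f x0"
  using PP_sum[of "{True}" M "\<lambda>_. f" "\<lambda>_. c" x0] assms by simp

lemma PP_regular:
  assumes "mer 0 f" "x0 \<notin> {2, - 2}"
  shows "PP f x0 = 0"
proof -
  obtain h where h: "h analytic_on {2, - 2}" "eventually (\<lambda>x. f x = h x) bp"
    using assms by (auto simp: mer_def)
  have "residue (\<lambda>z. h (xz z) * (1 - 1 / z\<^sup>2) / (x0 - xz z)) r = 0" if r: "r \<in> JM_branch_points" for r
  proof (rule residue_analytic)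
    have "(h \<circ> xz) analytic_on {r}"
      using r by (intro analytic_on_compose xz_analytic analytic_on_subset[OF h(1)])
        (auto simp: JM_branch_points_def xz_def)
    moreover have "x0 - xz r \<noteq> 0" using r assms(2) by (auto simp: JM_branch_points_def xz_def)
    ultimately show "(\<lambda>z. h (xz z) * (1 - 1 / z\<^sup>2) / (x0 - xz z)) analytic_on {r}"
      using branch_nz[OF r] by (intro analytic_intros xz_analytic) (auto simp: o_def)
  qed
  hence "PP h x0 = 0" by (simp add: PP_def res1_def)
  thus ?thesis using PP_cong[OF h(2)] by simp
qed

text \<open>Normal form of a rational function with poles only at \<open>2\<close> and
  \<open>-2\<close> that vanishes at infinity. Powers of \<open>x^2 - 4\<close> treat the two branch
  values together.\<close>

definition polar :: "nat \<Rightarrow> (nat \<Rightarrow> complex) \<Rightarrow> (nat \<Rightarrow> complex) \<Rightarrow> complex \<Rightarrow> complex" where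
  "polar m a b x = (\<Sum>k<m. (a k + b k * x) / (x\<^sup>2 - 4) ^ Suc k)"

lemma mer_polar_term: "mer k (\<lambda>x. (a + b * x) / (x\<^sup>2 - 4) ^ k)"
  by (auto simp: mer_def intro!: exI[of _ "\<lambda>x. a + b * x"] analytic_intros)

lemma mer_polar: "mer m (polar m a b)"
  unfolding polar_def[abs_def] by (intro mer_sum mer_mono[OF mer_polar_term]) auto

text \<open>The identity \<open>(x0 - x)(x0 + x) + (x^2 - 4) = x0^2 - 4\<close> lowers the exponent
  by one. Of the terms in which it cancels \<open>x0 - x\<close>, only
  \<open>x dx / (x^2 - 4)\<close> has a nonzero total residue, and it occurs in the last reduction
  only.\<close>

lemma PP_polar_term:
  assumes x0: "x0 \<notin> {2, - 2}"
  shows "PP (\<lambda>x. (a + b * x) / (x\<^sup>2 - 4) ^ Suc k) x0 = (a + b * x0) / (x0\<^sup>2 - 4) ^ Suc k"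
proof -
  have s0: "x0\<^sup>2 - 4 \<noteq> 0" using x0 sq4_eq_0_iff by blast
  let ?f = "\<lambda>n x. (a + b * x) / (x\<^sup>2 - 4) ^ n"
  define d where "d = (\<lambda>z::complex. 1 - 1 / z\<^sup>2)"
  have step: "PP (?f (Suc n)) x0 = ((if n = 0 then a + b * x0 else 0) + PP (?f n) x0) / (x0\<^sup>2 - 4)" for n
  proof -
    define g where "g = (\<lambda>x. (a + b * x) * (x0 + x) / (x\<^sup>2 - 4) ^ Suc n)"
    have "residue (\<lambda>z. ?f (Suc n) (xz z) * d z / (x0 - xz z)) r =
          1 / (x0\<^sup>2 - 4) * residue (\<lambda>z. g (xz z) * d z) r
          + 1 / (x0\<^sup>2 - 4) * residue (\<lambda>z. ?f n (xz z) * d z / (x0 - xz z)) r"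
      if r: "r \<in> JM_branch_points" for r
    proof -
      have "residue (\<lambda>z. ?f (Suc n) (xz z) * d z / (x0 - xz z)) r =
        residue (\<lambda>z. 1 / (x0\<^sup>2 - 4) * (g (xz z) * d z) + 1 / (x0\<^sup>2 - 4) * (?f n (xz z) * d z / (x0 - xz z))) r"
      proof (intro residue_meromorphic_cong,
          use eventually_bp_xz[OF eventually_bp_sq4 r] eventually_bp_xz[OF eventually_bp_neq[of x0] r] in eventually_elim)
        case (elim z)
        define x where "x = xz z"
        define S where "S = x\<^sup>2 - 4"
        have "(x0 - x) * (x0 + x) + S = x0\<^sup>2 - 4" by (simp add: S_def algebra_simps power2_eq_square)
        hence e: "1 / ((x0 - x) * S ^ Suc n) = ((x0 - x) * (x0 + x) + S) / ((x0\<^sup>2 - 4) * ((x0 - x) * S ^ Suc n))"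
          using s0 by simp
        have nz: "x0 - x \<noteq> 0" "S \<noteq> 0" using elim by (auto simp: x_def S_def)
        have "(a + b * x) / S ^ Suc n * d z / (x0 - x) = (a + b * x) * d z * (1 / ((x0 - x) * S ^ Suc n))"
          by (simp add: mult_ac)
        also have "\<dots> = 1 / (x0\<^sup>2 - 4) * ((a + b * x) * (x0 + x) / S ^ Suc n * d z) +
                       1 / (x0\<^sup>2 - 4) * ((a + b * x) / S ^ n * d z / (x0 - x))"
          unfolding e using nz s0 by (simp add: divide_simps) (simp add: algebra_simps)
        finally show ?case by (simp only: x_def S_def g_def)
      qed
      also have "\<dots> = 1 / (x0\<^sup>2 - 4) * residue (\<lambda>z. g (xz z) * d z) r
          + 1 / (x0\<^sup>2 - 4) * residue (\<lambda>z. ?f n (xz z) * d z / (x0 - xz z)) r"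
        unfolding g_def d_def using branch_nz[OF r]
        by (intro residue_meromorphic_lincomb meromorphic_intros) auto
      finally show ?thesis .
    qed
    hence A: "PP (?f (Suc n)) x0 = (res1 (\<lambda>z. g (xz z) * d z) / 2 + PP (?f n) x0) / (x0\<^sup>2 - 4)"
      by (simp add: PP_def res1_def sum.distrib d_def algebra_simps add_divide_distrib
           flip: sum_divide_distrib sum_distrib_left del: power_Suc)
    \<comment> \<open>The numerator \<open>(a + b x)(x0 + x)\<close> is reduced modulo
      \<open>x^2 - 4\<close>; this leaves three forms with known total residues, weighted by
      \<open>c\<close>.\<close>
    define w where "w = (\<lambda>i::nat. \<lambda>z. if i = 0 then d z / ((xz z)\<^sup>2 - 4) ^ Suc n
        else if i = 1 then d z / ((xz z)\<^sup>2 - 4) ^ n else xz z * d z / ((xz z)\<^sup>2 - 4) ^ Suc n)"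
    define c where "c = (\<lambda>i::nat. if i = 0 then a * x0 + 4 * b else if i = 1 then b else a + b * x0)"
    have wm: "w i meromorphic_on {r}" if "r \<in> JM_branch_points" for i r
      unfolding w_def d_def using branch_nz[OF that]
      by (cases "i = 0"; cases "i = 1") (auto intro!: meromorphic_intros simp del: power_Suc)
    have "residue (\<lambda>z. g (xz z) * d z) r = (\<Sum>i<3. c i * residue (w i) r)" if r: "r \<in> JM_branch_points" for r
    proof -
      have "residue (\<lambda>z. g (xz z) * d z) r = residue (\<lambda>z. \<Sum>i<3. c i * w i z) r"
      proof (intro residue_meromorphic_cong, use eventually_bp_xz[OF eventually_bp_sq4 r] in eventually_elim)
        case (elim z)
        have e: "(a + b * x) * (x0 + x) = (a * x0 + 4 * b) + b * (x\<^sup>2 - 4) + (a + b * x0) * x" for x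
          by (simp add: algebra_simps power2_eq_square)
        have "g (xz z) = (a * x0 + 4 * b) / ((xz z)\<^sup>2 - 4) ^ Suc n + b / ((xz z)\<^sup>2 - 4) ^ n
             + (a + b * x0) * xz z / ((xz z)\<^sup>2 - 4) ^ Suc n"
          using elim by (simp add: g_def e add_divide_distrib)
        thus ?case by (simp add: numeral_3_eq_3 c_def w_def algebra_simps del: power_Suc)
      qed
      also have "\<dots> = (\<Sum>i<3. residue (\<lambda>z. c i * w i z) r)"
        using wm[OF r] by (intro residue_meromorphic_sum meromorphic_intros)
      also have "\<dots> = (\<Sum>i<3. c i * residue (w i) r)"
        using wm[OF r] by (intro sum.cong refl residue_meromorphic_cmult)
      finally show ?thesis .
    qed
    hence "res1 (\<lambda>z. g (xz z) * d z) = (\<Sum>r\<in>JM_branch_points. \<Sum>i<3. c i * residue (w i) r)"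
      by (simp add: res1_def)
    also have "\<dots> = (\<Sum>i<3. c i * res1 (w i))"
      unfolding res1_def sum_distrib_left by (rule sum.swap)
    also have "\<dots> = (a + b * x0) * (if n = 0 then 2 else 0)"
      using res1_dx_pow[of "Suc n"] res1_dx_pow[of n] res1_x_dx_pow[of "Suc n"]
      by (simp add: numeral_3_eq_3 c_def w_def d_def del: power_Suc)
    finally show ?thesis by (simp add: A del: power_Suc)
  qed
  show ?thesis
  proof (induction k)
    case 0
    have "PP (?f 0) x0 = 0"
      using x0 by (intro PP_regular mer_analytic analytic_intros) auto
    thus ?case using step[of 0] by simp
  next
    case (Suc k)
    show ?case unfolding step[of "Suc k"] Suc by simp
  qed
qed

lemma PP_polar:
  assumes x0: "x0 \<notin> {2, - 2}"
  shows "PP (polar m a b) x0 = polar m a b x0"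
proof -
  have "PP (\<lambda>x. \<Sum>k<m. 1 * ((a k + b k * x) / (x\<^sup>2 - 4) ^ Suc k)) x0 =
        (\<Sum>k<m. 1 * PP (\<lambda>x. (a k + b k * x) / (x\<^sup>2 - 4) ^ Suc k) x0)"
    by (intro PP_sum[of _ m] mer_mono[OF mer_polar_term]) auto
  thus ?thesis using PP_polar_term[OF x0] by (simp add: polar_def[abs_def] del: power_Suc)
qed

section \<open>Division by x^2 - 4 and the polar part\<close>

lemma analytic_divide_linear:
  assumes "h analytic_on {2, - 2}" "c \<in> {2, - 2}" "h c = 0"
  shows "\<exists>g. g analytic_on {2, - 2} \<and> (\<forall>x. h x = (x - c) * g x)"
proof -
  define g where "g = (\<lambda>x. if x = c then deriv h c else h x / (x - c))"
  have "(\<lambda>z. if z = c then deriv h c else h z / (z - c) - h c / (z - c)) analytic_on {2, - 2}"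
    by (rule pole_theorem_analytic[OF assms(1)]) (auto intro!: exI[of _ 1])
  moreover have "(\<lambda>z. if z = c then deriv h c else h z / (z - c) - h c / (z - c)) = g"
    using assms(3) by (auto simp: g_def)
  ultimately have "g analytic_on {2, - 2}" by simp
  moreover have "\<forall>x. h x = (x - c) * g x" using assms(3) by (auto simp: g_def)
  ultimately show ?thesis by blast
qed

text \<open>\<open>a + b x\<close> interpolates \<open>h\<close> at the two branch values; the two
  zeros of the difference are then divided out in turn.\<close>

lemma analytic_division:
  assumes "h analytic_on {2, - 2}"
  shows "\<exists>a b g. g analytic_on {2, - 2} \<and> (\<forall>x. h x = a + b * x + (x\<^sup>2 - 4) * g x)"
proof -
  define a b where "a = (h 2 + h (- 2)) / 2" and "b = (h 2 - h (- 2)) / 4"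
  define h1 where "h1 = (\<lambda>x. h x - a - b * x)"
  have "h1 analytic_on {2, - 2}" unfolding h1_def by (intro analytic_intros assms)
  moreover have "h1 2 = 0" "h1 (- 2) = 0" by (auto simp: h1_def a_def b_def field_simps)
  ultimately obtain g1 where g1: "g1 analytic_on {2, - 2}" "\<And>x. h1 x = (x - 2) * g1 x"
    using analytic_divide_linear[of h1 2] by auto
  have "g1 (- 2) = 0" using g1(2)[of "- 2"] \<open>h1 (- 2) = 0\<close> by simp
  then obtain g where g: "g analytic_on {2, - 2}" "\<And>x. g1 x = (x + 2) * g x"
    using analytic_divide_linear[of g1 "- 2"] g1 by auto
  have "h x = a + b * x + (x\<^sup>2 - 4) * g x" for x
    using g1(2)[of x] g(2)[of x] by (simp add: h1_def algebra_simps power2_eq_square)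
  thus ?thesis using g(1) by blast
qed

text \<open>The coefficients are the successive remainders of the numerator on division by
  \<open>x^2 - 4\<close>; an analytic quotient is left after \<open>M\<close> divisions.\<close>

lemma mer_decompose:
  assumes "mer M f"
  shows "\<exists>a b. mer 0 (\<lambda>x. f x - polar M a b x)"
proof -
  have "\<exists>a b. mer 0 (\<lambda>x. h x / (x\<^sup>2 - 4) ^ M - polar M a b x)" if "h analytic_on {2, - 2}" for h M
    using that
  proof (induction M arbitrary: h)
    case 0
    thus ?case by (auto simp: polar_def intro: mer_analytic)
  next
    case (Suc M)
    obtain a0 b0 g where g: "g analytic_on {2, - 2}" "\<And>x. h x = a0 + b0 * x + (x\<^sup>2 - 4) * g x"
      using analytic_division[OF Suc.prems] by blast
    obtain a b where ab: "mer 0 (\<lambda>x. g x / (x\<^sup>2 - 4) ^ M - polar M a b x)"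
      using Suc.IH[OF g(1)] by blast
    define a' b' where "a' = a(M := a0)" and "b' = b(M := b0)"
    have "polar (Suc M) a' b' x = polar M a b x + (a0 + b0 * x) / (x\<^sup>2 - 4) ^ Suc M" for x
      unfolding polar_def a'_def b'_def by (simp del: power_Suc)
    moreover have "eventually (\<lambda>x. h x / (x\<^sup>2 - 4) ^ Suc M = g x / (x\<^sup>2 - 4) ^ M + (a0 + b0 * x) / (x\<^sup>2 - 4) ^ Suc M) bp"
      using eventually_bp_sq4 by eventually_elim (simp add: g(2) field_simps)
    ultimately have "eventually (\<lambda>x. g x / (x\<^sup>2 - 4) ^ M - polar M a b x =
        h x / (x\<^sup>2 - 4) ^ Suc M - polar (Suc M) a' b' x) bp"
      by (auto elim!: eventually_mono)
    from mer_cong[OF this ab] show ?case by blast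
  qed
  moreover obtain h where h: "h analytic_on {2, - 2}" "eventually (\<lambda>x. f x = h x / (x\<^sup>2 - 4) ^ M) bp"
    using assms by (auto simp: mer_def)
  ultimately obtain a b where ab: "mer 0 (\<lambda>x. h x / (x\<^sup>2 - 4) ^ M - polar M a b x)" by blast
  have "eventually (\<lambda>x. h x / (x\<^sup>2 - 4) ^ M - polar M a b x = f x - polar M a b x) bp"
    using h(2) by eventually_elim simp
  from mer_cong[OF this ab] show ?thesis by blast
qed

lemma PP_eq_polar:
  assumes "mer M f"
  shows "\<exists>a b. mer 0 (\<lambda>x. f x - polar M a b x) \<and> (\<forall>x0. x0 \<notin> {2, - 2} \<longrightarrow> PP f x0 = polar M a b x0)"
proof -
  obtain a b where ab: "mer 0 (\<lambda>x. f x - polar M a b x)" using mer_decompose[OF assms] by blast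
  have "PP f x0 = polar M a b x0" if "x0 \<notin> {2, - 2}" for x0
    using PP_add[OF mer_polar[of M a b] mer_mono[OF ab], of x0] PP_regular[OF ab that] PP_polar[OF that]
    by simp
  thus ?thesis using ab by blast
qed

section \<open>The recursion in the coordinate x\<close>

text \<open>Structural recursion over ordered splittings into complementary sublists replaces the
  index sets with \<open>nths\<close>, which behave badly under \<open>map\<close>, concatenation
  and nested splittings.\<close>

fun spl :: "('a list \<Rightarrow> 'a list \<Rightarrow> 'b::comm_monoid_add) \<Rightarrow> 'a list \<Rightarrow> 'b" where
  "spl f [] = f [] []"
| "spl f (x # xs) = spl (\<lambda>a b. f (x # a) b) xs + spl (\<lambda>a b. f a (x # b)) xs"

lemma spl_cong_length:
  assumes "\<And>a b. length a + length b = length xs \<Longrightarrow> f a b = g a b"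
  shows "spl f xs = spl g xs"
  using assms
proof (induction xs arbitrary: f g)
  case (Cons x xs)
  show ?case unfolding spl.simps
    by (intro arg_cong2[of _ _ _ _ "(+)"] Cons.IH) (auto intro!: Cons.prems)
qed auto

lemma spl_append: "spl f (xs @ ys) = spl (\<lambda>a b. spl (\<lambda>c d. f (a @ c) (b @ d)) ys) xs"
  by (induction xs arbitrary: f) auto

lemma spl_add: "spl (\<lambda>a b. f a b + g a b) xs = spl f xs + spl g xs"
  by (induction xs arbitrary: f g) (auto simp: algebra_simps)

lemma spl_zero: "spl (\<lambda>a b. 0) xs = 0"
  by (induction xs) auto

lemma spl_sum: "spl (\<lambda>a b. \<Sum>i\<in>I. f i a b) xs = (\<Sum>i\<in>I. spl (f i) xs)"
  by (induction I rule: infinite_finite_induct) (auto simp: spl_add spl_zero)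

lemma spl_cmult: "spl (\<lambda>a b. (c::'b::comm_semiring_0) * f a b) xs = c * spl f xs"
  by (induction xs arbitrary: f) (auto simp: algebra_simps)

lemma spl_map: "spl f (map h xs) = spl (\<lambda>a b. f (map h a) (map h b)) xs"
  by (induction xs arbitrary: f) auto

lemma sum_Pow_lessThan_Suc:
  fixes F :: "nat set \<Rightarrow> 'b::comm_monoid_add"
  shows "(\<Sum>I\<in>Pow {..<Suc n}. F I) =
    (\<Sum>I\<in>Pow {..<n}. F (insert 0 (Suc ` I))) + (\<Sum>I\<in>Pow {..<n}. F (Suc ` I))"
proof -
  have P1: "Pow {..<Suc n} = Pow (Suc ` {..<n}) \<union> insert 0 ` Pow (Suc ` {..<n})"
    by (simp only: lessThan_Suc_eq_insert_0 Pow_insert)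
  have P2: "Pow (Suc ` {..<n}) = image Suc ` Pow {..<n}"
    by (rule image_Pow_surj[symmetric]) (rule refl)
  have P3: "insert 0 ` Pow (Suc ` {..<n}) = (\<lambda>I. insert 0 (Suc ` I)) ` Pow {..<n}"
    unfolding P2 image_image ..
  have inj1: "inj_on (image Suc) (Pow {..<n})"
    by (auto simp: inj_on_def inj_image_eq_iff)
  have inj2: "inj_on (\<lambda>I. insert 0 (Suc ` I)) (Pow {..<n})"
  proof (rule inj_onI)
    fix a b :: "nat set" assume "insert 0 (Suc ` a) = insert 0 (Suc ` b)"
    hence "insert 0 (Suc ` a) - {0} = insert 0 (Suc ` b) - {0}" by (rule arg_cong)
    moreover have "insert 0 (Suc ` c) - {0} = Suc ` c" for c by auto
    ultimately have "Suc ` a = Suc ` b" by metis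
    thus "a = b" by (simp only: inj_image_eq_iff[OF inj_Suc])
  qed
  have disj: "(image Suc) ` Pow {..<n} \<inter> (\<lambda>I. insert 0 (Suc ` I)) ` Pow {..<n} = {}"
    by blast
  have "(\<Sum>I\<in>Pow {..<Suc n}. F I) =
     sum F (image Suc ` Pow {..<n}) + sum F ((\<lambda>I. insert 0 (Suc ` I)) ` Pow {..<n})"
    unfolding P1 P3 unfolding P2 by (rule sum.union_disjoint) (use disj in auto)
  thus ?thesis
    unfolding sum.reindex[OF inj1] sum.reindex[OF inj2] o_def by (simp only: add.commute)
qed

lemma sum_Pow_nths:
  "(\<Sum>I\<in>Pow {..<length xs}. f (nths xs I) (nths xs ({..<length xs} - I))) = spl f xs"
proof (induction xs arbitrary: f)
  case (Cons x xs)
  let ?n = "length xs"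
  have e: "{j. Suc j \<in> Suc ` I} = I" "{j. Suc j \<in> insert 0 (Suc ` I)} = I"
     "{j. Suc j \<in> {..<Suc ?n} - Suc ` I} = {..<?n} - I"
     "{j. Suc j \<in> {..<Suc ?n} - insert 0 (Suc ` I)} = {..<?n} - I" for I by auto
  have n: "0 \<notin> Suc ` I" "0 \<in> insert 0 (Suc ` I)" "0 \<in> {..<Suc ?n} - Suc ` I"
    "0 \<notin> {..<Suc ?n} - insert 0 (Suc ` I)" for I by auto
  have "nths (x # xs) (insert 0 (Suc ` I)) = x # nths xs I"
       "nths (x # xs) (Suc ` I) = nths xs I"
       "nths (x # xs) ({..<Suc ?n} - Suc ` I) = x # nths xs ({..<?n} - I)"
       "nths (x # xs) ({..<Suc ?n} - insert 0 (Suc ` I)) = nths xs ({..<?n} - I)" for I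
    unfolding nths_Cons e using n by simp_all
  thus ?case
    unfolding length_Cons sum_Pow_lessThan_Suc by (simp add: Cons.IH[of "\<lambda>a b. f (x # a) b"] Cons.IH[of "\<lambda>a b. f a (x # b)"])
qed auto

section \<open>The kernel, the recursion and its unstable cases\<close>

text \<open>
  \<open>beta\<close> is the part of the Bergman kernel that is odd under \<open>z \<mapsto> 1/z\<close>, written in the
  coordinate \<open>x = z + 1/z\<close>, and \<open>Fm\<close> is the resulting recursion in that coordinate.
  In \<open>\<omega>\<^sup>(\<^sup>1\<^sup>)\<^sub>1\<close> the kernel occurs on the diagonal \<open>(z, 1/z)\<close>, where it becomes \<open>1/(x\<^sup>2 - 4)\<close>.
\<close>
definition beta :: "complex \<Rightarrow> complex \<Rightarrow> complex" where
  "beta X x = (X * x - 4) / (2 * (X - x)\<^sup>2)"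

function Fm :: "complex \<Rightarrow> nat \<Rightarrow> (complex \<Rightarrow> complex) list \<Rightarrow> complex \<Rightarrow> complex" where
  "Fm e g bs x0 =
     (if g = 0 \<and> length bs = 0 then 0
      else if g = 0 \<and> length bs = 1 then hd bs x0
      else PP (\<lambda>x. ((if g = 0 then 0
                     else if g = 1 \<and> bs = [] then 1 / (x\<^sup>2 - 4)
                     else Fm e (g - 1) ((\<lambda>X. beta X x) # bs) x) +
                    (\<Sum>(h, I)\<in>splittings g (length bs).
                       Fm e h (nths bs I) x * Fm e (g - h) (nths bs ({..<length bs} - I)) x))
                   / ((x\<^sup>2 - 4) * (1 - e * x))) x0)"
  by pat_completeness auto
termination
proof (relation "Wellfounded.measure (\<lambda>(e, g, bs, x). 2 * g + length bs)", goal_cases)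
  case (3 e g bs x0 x p h I)
  thus ?case using splittings_decrease(1)[of h I g bs] by auto
next
  case (4 e g bs x0 x p h I)
  thus ?case using splittings_decrease(2)[of h I g bs] by auto
qed auto

declare Fm.simps [simp del]

text \<open>\<open>n\<close> counts the arguments besides the distinguished one, so the excluded
  pairs belong to \<open>y dx\<close> and to the Bergman kernel.\<close>

definition stable :: "nat \<Rightarrow> nat \<Rightarrow> bool" where
  "stable g n \<longleftrightarrow> (g, n) \<noteq> (0, 0) \<and> (g, n) \<noteq> (0, 1)"

lemma Fm_0_Nil [simp]: "Fm e 0 [] x = 0"
  by (subst Fm.simps) simp

lemma Fm_0_single [simp]: "Fm e 0 [b] x = b x"
  by (subst Fm.simps) simp

text \<open>The term with two tied arguments. The conjugate point \<open>1/z\<close> has the same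
  \<open>x\<close> as \<open>z\<close>, hence the first entry of the list is the kernel based at
  \<open>x\<close> itself.\<close>

definition diag :: "complex \<Rightarrow> nat \<Rightarrow> (complex \<Rightarrow> complex) list \<Rightarrow> complex \<Rightarrow> complex" where
  "diag e g bs x = (if g = 0 then 0 else if g = 1 \<and> bs = [] then 1 / (x\<^sup>2 - 4)
      else Fm e (g - 1) ((\<lambda>X. beta X x) # bs) x)"

text \<open>The sum runs over all splittings: the forbidden ones contribute nothing, because
  \<open>Fm\<close> vanishes in genus 0 without arguments.\<close>

definition Qm :: "complex \<Rightarrow> nat \<Rightarrow> (complex \<Rightarrow> complex) list \<Rightarrow> complex \<Rightarrow> complex" where
  "Qm e g bs x = diag e g bs x + (\<Sum>h\<le>g. spl (\<lambda>a b. Fm e h a x * Fm e (g - h) b x) bs)"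

lemma splittings_sum:
  fixes f :: "nat \<Rightarrow> 'a list \<Rightarrow> 'a list \<Rightarrow> 'b::comm_monoid_add"
  assumes "f 0 [] xs = 0" "f g xs [] = 0"
  shows "(\<Sum>(h, I)\<in>splittings g (length xs). f h (nths xs I) (nths xs ({..<length xs} - I))) =
         (\<Sum>h\<le>g. spl (f h) xs)"
proof -
  let ?n = "length xs"
  have "(\<Sum>h\<le>g. spl (f h) xs) = (\<Sum>h\<le>g. \<Sum>I\<in>Pow {..<?n}. f h (nths xs I) (nths xs ({..<?n} - I)))"
    by (simp add: sum_Pow_nths)
  also have "\<dots> = (\<Sum>(h, I)\<in>{..g} \<times> Pow {..<?n}. f h (nths xs I) (nths xs ({..<?n} - I)))"
    by (rule sum.cartesian_product)
  also have "\<dots> = (\<Sum>(h, I)\<in>splittings g ?n. f h (nths xs I) (nths xs ({..<?n} - I)))"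
  proof (rule sum.mono_neutral_right)
    show "finite ({..g} \<times> Pow {..<?n})" by auto
    show "splittings g ?n \<subseteq> {..g} \<times> Pow {..<?n}" by (auto simp: splittings_def)
    show "\<forall>i\<in>{..g} \<times> Pow {..<?n} - splittings g ?n. (case i of (h, I) \<Rightarrow> f h (nths xs I) (nths xs ({..<?n} - I))) = 0"
    proof (safe, goal_cases)
      case (1 h I)
      have "h = 0 \<and> I = {} \<or> h = g \<and> I = {..<?n}"
        using 1 by (auto simp: splittings_def)
      moreover have "nths xs {..<?n} = xs" by (rule nths_all) auto
      ultimately show ?case using assms by auto
    qed
  qed
  finally show ?thesis ..
qed

lemma Fm_rec:
  assumes "stable g (length bs)"
  shows "Fm e g bs x0 = PP (\<lambda>x. Qm e g bs x / ((x\<^sup>2 - 4) * (1 - e * x))) x0"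
  using assms splittings_sum[of "\<lambda>h a b. Fm e h a x * Fm e (g - h) b x" bs g for x]
  by (subst Fm.simps) (auto simp: stable_def Qm_def diag_def)

text \<open>A Taylor expansion in \<open>X\<close> at both branch values at once, with basis
  \<open>(X^2 - 4)^j\<close> and \<open>(X^2 - 4)^j X\<close> and an exact remainder. It telescopes:
  by \<open>key\<close>, the difference of consecutive remainders is the next term. The coefficients
  have poles in \<open>x\<close> at the branch values only.\<close>

lemma beta_expansion:
  fixes X x :: complex
  assumes "x \<noteq> X" "x\<^sup>2 - 4 \<noteq> 0"
  defines "S \<equiv> X\<^sup>2 - 4" and "s \<equiv> x\<^sup>2 - 4"
  shows "beta X x = (\<Sum>j<M. (2 * (2 * of_nat j + 1) / s ^ Suc j + of_nat j / s ^ j) * S ^ j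
                          + ((2 * of_nat j + 1) / 2 * x / s ^ Suc j) * (S ^ j * X))
           + S ^ M * (((X * x - 4) / 2 + of_nat M * x * (x - X)) / (s ^ M * (x - X)\<^sup>2))"
proof (induction M)
  case 0
  have "(X - x)\<^sup>2 = (x - X)\<^sup>2" by (simp add: power2_eq_square algebra_simps)
  thus ?case by (simp add: beta_def)
next
  case (Suc M)
  define m :: complex where "m = of_nat M"
  have s: "s \<noteq> 0" and d: "x - X \<noteq> 0" using assms by auto
  have key: "s * ((X * x - 4) / 2 + m * x * (x - X)) - S * ((X * x - 4) / 2 + (m + 1) * x * (x - X)) =
     (x - X)\<^sup>2 * (2 * (2 * m + 1) + m * s + (2 * m + 1) / 2 * x * X)"
    unfolding s_def S_def by (simp add: field_simps power2_eq_square)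
  have "S ^ M * (((X * x - 4) / 2 + m * x * (x - X)) / (s ^ M * (x - X)\<^sup>2))
      - S ^ Suc M * (((X * x - 4) / 2 + (m + 1) * x * (x - X)) / (s ^ Suc M * (x - X)\<^sup>2))
      = S ^ M * (s * ((X * x - 4) / 2 + m * x * (x - X)) - S * ((X * x - 4) / 2 + (m + 1) * x * (x - X)))
          / (s ^ Suc M * (x - X)\<^sup>2)"
    using s d by (simp add: divide_simps) (simp add: algebra_simps)
  also have "\<dots> = S ^ M * (2 * (2 * m + 1) + m * s + (2 * m + 1) / 2 * x * X) / s ^ Suc M"
    unfolding key using s d by simp
  also have "\<dots> = (2 * (2 * m + 1) / s ^ Suc M + m / s ^ M) * S ^ M + ((2 * m + 1) / 2 * x / s ^ Suc M) * (S ^ M * X)"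
    using s by (simp add: divide_simps) (simp add: algebra_simps)
  finally have "S ^ M * (((X * x - 4) / 2 + m * x * (x - X)) / (s ^ M * (x - X)\<^sup>2)) =
      ((2 * (2 * m + 1) / s ^ Suc M + m / s ^ M) * S ^ M + ((2 * m + 1) / 2 * x / s ^ Suc M) * (S ^ M * X)) +
      S ^ Suc M * (((X * x - 4) / 2 + (m + 1) * x * (x - X)) / (s ^ Suc M * (x - X)\<^sup>2))"
    by (simp only: diff_eq_eq)
  moreover have "of_nat (Suc M) = m + 1" by (simp add: m_def)
  ultimately show ?case
    unfolding Suc sum.lessThan_Suc m_def[symmetric] by (simp only: add.assoc)
qed

lemma Fm_0_Nil': "Fm e 0 [] = (\<lambda>_. 0)" and Fm_0_single': "Fm e 0 [b] = b"
  by auto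

section \<open>Pole orders and linearity in the arguments\<close>

definition anl :: "(complex \<Rightarrow> complex) \<Rightarrow> bool" where
  "anl b \<longleftrightarrow> b analytic_on {2, - 2}"

lemma polar_mono:
  assumes "m \<le> m'"
  shows "\<exists>a' b'. polar m a b = polar m' a' b'"
proof -
  have "polar m a b x = polar m' (\<lambda>k. if k < m then a k else 0) (\<lambda>k. if k < m then b k else 0) x" for x
    unfolding polar_def using assms by (intro sum.mono_neutral_cong_left) auto
  thus ?thesis by blast
qed

text \<open>
  Structure of \<open>Fm e g bs\<close> for fixed \<open>g\<close> and \<open>length bs\<close>: pole order at most \<open>M\<close>, and linear
  dependence on each entry of \<open>bs\<close> modulo functions vanishing to order \<open>M\<close> at the branch values.
\<close>
definition Fm_struct :: "nat \<Rightarrow> nat \<Rightarrow> nat \<Rightarrow> bool" where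
  "Fm_struct M g n \<longleftrightarrow> (\<forall>e\<in>ball 0 (1/4).
     (\<forall>bs. length bs = n \<longrightarrow> (\<forall>b\<in>set bs. anl b) \<longrightarrow> mer M (Fm e g bs) \<and>
        (stable g n \<longrightarrow> (\<exists>a b. \<forall>x. x \<notin> {2, - 2} \<longrightarrow> Fm e g bs x = polar M a b x))) \<and>
     (stable g n \<longrightarrow> (\<forall>as b cs (I :: (nat \<times> bool) set) c \<phi> h x.
        length as + length cs + 1 = n \<longrightarrow> finite I \<longrightarrow>
        (\<forall>b\<in>set as \<union> set cs. anl b) \<longrightarrow> anl b \<longrightarrow> (\<forall>i\<in>I. anl (\<phi> i)) \<longrightarrow> anl h \<longrightarrow>
        eventually (\<lambda>x. b x = (\<Sum>i\<in>I. c i * \<phi> i x) + (x\<^sup>2 - 4) ^ M * h x) bp \<longrightarrow>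
        x \<notin> {2, - 2} \<longrightarrow>
        Fm e g (as @ b # cs) x = (\<Sum>i\<in>I. c i * Fm e g (as @ \<phi> i # cs) x))))"

lemma Fm_structD_mer:
  "Fm_struct M g n \<Longrightarrow> e \<in> ball 0 (1/4) \<Longrightarrow> length bs = n \<Longrightarrow> (\<And>b. b \<in> set bs \<Longrightarrow> anl b) \<Longrightarrow> mer M (Fm e g bs)"
  unfolding Fm_struct_def by blast

lemma Fm_structD_polar:
  "Fm_struct M g n \<Longrightarrow> e \<in> ball 0 (1/4) \<Longrightarrow> stable g n \<Longrightarrow> length bs = n \<Longrightarrow> (\<And>b. b \<in> set bs \<Longrightarrow> anl b) \<Longrightarrow>
   \<exists>a b. \<forall>x. x \<notin> {2, - 2} \<longrightarrow> Fm e g bs x = polar M a b x"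
  unfolding Fm_struct_def by blast

lemma Fm_structD_lin:
  fixes I :: "(nat \<times> bool) set"
  assumes "Fm_struct M g n" "e \<in> ball 0 (1/4)" "stable g n" "length as + length cs + 1 = n" "finite I"
    "\<And>b. b \<in> set as \<union> set cs \<Longrightarrow> anl b" "anl b" "\<And>i. i \<in> I \<Longrightarrow> anl (\<phi> i)" "anl h"
    "eventually (\<lambda>x. b x = (\<Sum>i\<in>I. c i * \<phi> i x) + (x\<^sup>2 - 4) ^ M * h x) bp" "x \<notin> {2, - 2}"
  shows "Fm e g (as @ b # cs) x = (\<Sum>i\<in>I. c i * Fm e g (as @ \<phi> i # cs) x)"
  using assms unfolding Fm_struct_def by blast

lemma Fm_struct_mono:
  assumes "Fm_struct M g n" "M \<le> M'"
  shows "Fm_struct M' g n"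
  unfolding Fm_struct_def
proof (intro ballI conjI allI impI)
  fix e :: complex and bs :: "(complex \<Rightarrow> complex) list"
  assume e: "e \<in> ball 0 (1/4)" and bs: "length bs = n" "\<forall>b\<in>set bs. anl b"
  show "mer M' (Fm e g bs)"
    using Fm_structD_mer[OF assms(1) e bs(1)] bs(2) assms(2) mer_mono by blast
  assume st: "stable g n"
  obtain a b where "\<forall>x. x \<notin> {2, - 2} \<longrightarrow> Fm e g bs x = polar M a b x"
    using Fm_structD_polar[OF assms(1) e st bs(1)] bs(2) by blast
  thus "\<exists>a b. \<forall>x. x \<notin> {2, - 2} \<longrightarrow> Fm e g bs x = polar M' a b x"
    using polar_mono[OF assms(2), of a b] by metis
next
  fix e :: complex and as b cs and I :: "(nat \<times> bool) set" and c \<phi> h and x :: complex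
  assume e: "e \<in> ball 0 (1/4)" and st: "stable g n" and l: "length as + length cs + 1 = n" "finite I"
    "\<forall>b\<in>set as \<union> set cs. anl b" "anl b" "\<forall>i\<in>I. anl (\<phi> i)" "anl h"
    and ev: "eventually (\<lambda>x. b x = (\<Sum>i\<in>I. c i * \<phi> i x) + (x\<^sup>2 - 4) ^ M' * h x) bp" and x: "x \<notin> {2, - 2}"
  show "Fm e g (as @ b # cs) x = (\<Sum>i\<in>I. c i * Fm e g (as @ \<phi> i # cs) x)"
  proof (rule Fm_structD_lin[OF assms(1) e st l(1,2), where h = "\<lambda>x. (x\<^sup>2 - 4) ^ (M' - M) * h x"])
    show "anl (\<lambda>x. (x\<^sup>2 - 4) ^ (M' - M) * h x)"
      using l(6) unfolding anl_def by (intro analytic_intros)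
    have "(x\<^sup>2 - 4) ^ M' = (x\<^sup>2 - 4) ^ M * (x\<^sup>2 - 4) ^ (M' - M)" for x :: complex
      using assms(2) by (simp flip: power_add)
    thus "eventually (\<lambda>x. b x = (\<Sum>i\<in>I. c i * \<phi> i x) + (x\<^sup>2 - 4) ^ M * ((x\<^sup>2 - 4) ^ (M' - M) * h x)) bp"
      using ev by (simp add: mult.assoc)
  qed (use l x in auto)
qed

definition bidx :: "nat \<Rightarrow> (nat \<times> bool) set" where
  "bidx M = {..<M} \<times> UNIV"

text \<open>Basis for jets at the two branch values, in which \<open>beta\<close> is expanded;
  \<open>cc\<close> collects the coefficient functions of that expansion.\<close>

definition bb :: "nat \<times> bool \<Rightarrow> complex \<Rightarrow> complex" where
  "bb i X = (X\<^sup>2 - 4) ^ fst i * (if snd i then X else 1)"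

definition cc :: "nat \<times> bool \<Rightarrow> complex \<Rightarrow> complex" where
  "cc i x = (if snd i then (2 * of_nat (fst i) + 1) / 2 * x / (x\<^sup>2 - 4) ^ Suc (fst i)
             else 2 * (2 * of_nat (fst i) + 1) / (x\<^sup>2 - 4) ^ Suc (fst i) + of_nat (fst i) / (x\<^sup>2 - 4) ^ fst i)"

lemma finite_bidx [simp]: "finite (bidx M)"
  by (simp add: bidx_def)

lemma sum_bidx: "(\<Sum>i\<in>bidx M. f i) = (\<Sum>j<M. f (j, False) + f (j, True))"
proof -
  have "(\<Sum>i\<in>bidx M. f i) = (\<Sum>j<M. \<Sum>t\<in>UNIV. f (j, t))"
    unfolding bidx_def by (simp add: sum.cartesian_product)
  thus ?thesis by (simp add: UNIV_bool)
qed

lemma anl_bb [simp]: "anl (bb i)"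
  unfolding anl_def bb_def[abs_def] by (cases "snd i") (auto intro!: analytic_intros)

lemma mer_cc:
  assumes "i \<in> bidx M" shows "mer M (cc i)"
proof (cases "snd i")
  case True
  have "cc i = (\<lambda>x. (0 + (2 * of_nat (fst i) + 1) / 2 * x) / (x\<^sup>2 - 4) ^ Suc (fst i))"
    using True by (auto simp: cc_def[abs_def])
  moreover have "Suc (fst i) \<le> M" using assms by (auto simp: bidx_def)
  ultimately show ?thesis using mer_mono[OF mer_polar_term[where k = "Suc (fst i)"]] by metis
next
  case False
  have "cc i = (\<lambda>x. (2 * (2 * of_nat (fst i) + 1) + 0 * x) / (x\<^sup>2 - 4) ^ Suc (fst i) + (of_nat (fst i) + 0 * x) / (x\<^sup>2 - 4) ^ fst i)"
    using False by (auto simp: cc_def[abs_def])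
  moreover have "fst i < M" using assms by (auto simp: bidx_def)
  ultimately show ?thesis
    by (simp only:) (intro mer_add mer_mono[OF mer_polar_term], auto)
qed

lemma anl_beta: "x \<notin> {2, - 2} \<Longrightarrow> anl (\<lambda>X. beta X x)"
  unfolding anl_def beta_def by (intro analytic_intros) auto

lemma beta_bb:
  assumes "x \<notin> {2, - 2}"
  shows "\<exists>h. anl h \<and> eventually (\<lambda>X. beta X x = (\<Sum>i\<in>bidx M. cc i x * bb i X) + (X\<^sup>2 - 4) ^ M * h X) bp"
proof -
  have s: "x\<^sup>2 - 4 \<noteq> 0" using assms sq4_eq_0_iff by blast
  define h where "h = (\<lambda>X. ((X * x - 4) / 2 + of_nat M * x * (x - X)) / ((x\<^sup>2 - 4) ^ M * (x - X)\<^sup>2))"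
  have "anl h" unfolding anl_def h_def using assms s by (intro analytic_intros) auto
  moreover have "eventually (\<lambda>X. beta X x = (\<Sum>i\<in>bidx M. cc i x * bb i X) + (X\<^sup>2 - 4) ^ M * h X) bp"
    using eventually_bp_neq[of x]
  proof eventually_elim
    case (elim X)
    thus ?case using beta_expansion[of x X M] s
      by (simp add: sum_bidx cc_def bb_def h_def del: power_Suc)
  qed
  ultimately show ?thesis by blast
qed

lemma stable_diag: "g \<noteq> 0 \<Longrightarrow> \<not> (g = 1 \<and> bs = []) \<Longrightarrow> stable (g - 1) (Suc (length bs))"
  by (auto simp: stable_def)

text \<open>The entry \<open>beta\<close> depends on the outer variable \<open>x\<close>. Linearity
  modulo order \<open>M\<close> replaces it by fixed basis functions, so the diagonal term becomes a
  finite sum of products visibly meromorphic in \<open>x\<close>.\<close>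

lemma diag_eq_sum:
  assumes "\<And>g' n'. 2 * g' + n' < 2 * g + length bs \<Longrightarrow> Fm_struct M g' n'"
    and "e \<in> ball 0 (1/4)" "\<And>b. b \<in> set bs \<Longrightarrow> anl b" "x \<notin> {2, - 2}" "g \<noteq> 0" "\<not> (g = 1 \<and> bs = [])"
  shows "diag e g bs x = (\<Sum>i\<in>bidx M. cc i x * Fm e (g - 1) (bb i # bs) x)"
proof -
  obtain h where h: "anl h" "eventually (\<lambda>X. beta X x = (\<Sum>i\<in>bidx M. cc i x * bb i X) + (X\<^sup>2 - 4) ^ M * h X) bp"
    using beta_bb[OF assms(4)] by blast
  have "Fm e (g - 1) ([] @ (\<lambda>X. beta X x) # bs) x = (\<Sum>i\<in>bidx M. cc i x * Fm e (g - 1) ([] @ bb i # bs) x)"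
    by (rule Fm_structD_lin[OF assms(1,2) stable_diag[OF assms(5,6)] _ _ _ anl_beta _ h(1,2)])
       (use assms in auto)
  thus ?thesis using assms(5,6) by (auto simp: diag_def)
qed

lemma mer_spl:
  assumes "\<And>a b. length a + length b = length xs \<Longrightarrow> set a \<subseteq> set xs \<Longrightarrow> set b \<subseteq> set xs \<Longrightarrow> mer M (f a b)"
  shows "mer M (\<lambda>x. spl (\<lambda>a b. f a b x) xs)"
  using assms
proof (induction xs arbitrary: f)
  case (Cons y xs)
  show ?case unfolding spl.simps
    by (intro mer_add Cons.IH) (auto intro!: Cons.prems)
qed auto

lemma not_stable_iff: "\<not> stable g (length xs) \<longleftrightarrow> g = 0 \<and> (xs = [] \<or> (\<exists>x. xs = [x]))"
  by (auto simp: stable_def length_Suc_conv)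

text \<open>A product with a factor of genus 0 and no argument vanishes. In every other product both
  factors have smaller complexity \<open>2 g + n\<close>, so an induction hypothesis applies to
  each.\<close>

lemma Fm_prod_cases:
  assumes "h \<le> g" "length a + length b = n"
  obtains "h = 0" "a = []" | "h = g" "b = []"
    | "2 * h + length a < 2 * g + n" "2 * (g - h) + length b < 2 * g + n"
proof (cases "h = 0 \<and> a = [] \<or> h = g \<and> b = []")
  case False
  hence "h \<noteq> 0 \<or> length a \<noteq> 0" "h \<noteq> g \<or> length b \<noteq> 0" by simp_all
  hence "2 * h + length a < 2 * g + n" "2 * (g - h) + length b < 2 * g + n" using assms by linarith+
  thus ?thesis using that by blast
qed (use that in blast)

text \<open>Products of two functions of pole order \<open>M\<close> account for \<open>2 M\<close>;
  the additional 1 makes room for the term \<open>1 / (x^2 - 4)\<close> of genus one.\<close>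

lemma mer_Qm:
  assumes IH: "\<And>g' n'. 2 * g' + n' < 2 * g + length bs \<Longrightarrow> Fm_struct M g' n'"
    and e: "e \<in> ball 0 (1/4)" and bs: "\<And>b. b \<in> set bs \<Longrightarrow> anl b"
  shows "mer (2 * M + 1) (Qm e g bs)"
proof -
  have "mer (2 * M + 1) (diag e g bs)"
  proof (cases "g = 0 \<or> g = 1 \<and> bs = []")
    case True
    have "mer (2 * M + 1) (\<lambda>x. 1 / (x\<^sup>2 - 4))"
      using mer_mono[OF mer_inverse_sq4[of 1], of "2 * M + 1"] by simp
    thus ?thesis using True mer_mono[OF mer_const] by (cases "g = 0") (auto simp: diag_def[abs_def])
  next
    case False
    have "mer (M + M) (\<lambda>x. \<Sum>i\<in>bidx M. cc i x * Fm e (g - 1) (bb i # bs) x)"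
      using False by (intro mer_sum mer_mult mer_cc Fm_structD_mer[OF IH e refl]) (auto simp: bs)
    moreover have "eventually (\<lambda>x. (\<Sum>i\<in>bidx M. cc i x * Fm e (g - 1) (bb i # bs) x) = diag e g bs x) bp"
      using eventually_bp_neq[of 2] eventually_bp_neq[of "- 2"]
    proof eventually_elim
      case (elim x)
      thus ?case using diag_eq_sum[OF IH e bs] False by auto
    qed
    ultimately show ?thesis using mer_cong mer_mono[of "M + M" _ "2 * M + 1"] by fastforce
  qed
  moreover have "mer (2 * M + 1) (\<lambda>x. \<Sum>h\<le>g. spl (\<lambda>a b. Fm e h a x * Fm e (g - h) b x) bs)"
  proof (intro mer_sum mer_spl)
    fix h a b assume *: "h \<in> {..g}" "length a + length b = length bs" "set a \<subseteq> set bs" "set b \<subseteq> set bs"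
    from *(1,2) have "h \<le> g" by simp
    thus "mer (2 * M + 1) (\<lambda>x. Fm e h a x * Fm e (g - h) b x)" using *(2)
    proof (cases rule: Fm_prod_cases)
      case 3
      have "mer M (Fm e h a)" "mer M (Fm e (g - h) b)"
        using 3 * bs by (auto intro!: Fm_structD_mer[OF IH e refl])
      from mer_mult[OF this] show ?thesis by (rule mer_mono) auto
    qed (auto intro!: mer_mono[OF mer_const])
  qed
  ultimately show ?thesis unfolding Qm_def[abs_def] by (intro mer_add)
qed

text \<open>For \<open>|e| < 1/4\<close> the pole \<open>1 / e\<close> lies outside the disc of
  radius 4, away from both branch values.\<close>

lemma mer_inverse_lin:
  assumes "e \<in> ball 0 (1/4)"
  shows "mer 0 (\<lambda>x. 1 / (1 - e * x))"
proof -
  have "1 - e * c \<noteq> 0" if "c \<in> {2, - 2}" for c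
  proof
    assume "1 - e * c = 0"
    hence "e * c = 1" by simp
    hence "norm e * norm c = 1" by (metis norm_mult norm_one)
    moreover have "norm c = 2" using that by auto
    ultimately show False using assms by auto
  qed
  thus ?thesis by (intro mer_analytic analytic_intros) auto
qed

lemma mer_integrand:
  assumes "mer K f" "e \<in> ball 0 (1/4)"
  shows "mer (Suc K) (\<lambda>x. f x / ((x\<^sup>2 - 4) * (1 - e * x)))"
  using mer_mult[OF mer_divide_sq4[OF assms(1), of 1] mer_inverse_lin[OF assms(2)]]
  by simp

lemma spl_insert:
  "spl f (as @ b # cs) =
     spl (\<lambda>A A'. spl (\<lambda>C D. f (A @ b # C) (A' @ D) + f (A @ C) (A' @ b # D)) cs) as"
  by (simp add: spl_append spl_add)

lemma spl_lincomb:
  fixes F :: "'a list \<Rightarrow> 'a list \<Rightarrow> complex"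
  shows "spl F xs - (\<Sum>i\<in>I. c i * spl (G i) xs) = spl (\<lambda>a b. F a b - (\<Sum>i\<in>I. c i * G i a b)) xs"
proof (induction xs arbitrary: F G)
  case (Cons x xs)
  have "spl F (x # xs) - (\<Sum>i\<in>I. c i * spl (G i) (x # xs)) =
    (spl (\<lambda>a b. F (x # a) b) xs - (\<Sum>i\<in>I. c i * spl (\<lambda>a b. G i (x # a) b) xs)) +
    (spl (\<lambda>a b. F a (x # b)) xs - (\<Sum>i\<in>I. c i * spl (\<lambda>a b. G i a (x # b)) xs))"
    by (simp add: sum.distrib distrib_left)
  thus ?case by (simp only: Cons.IH spl.simps)
qed auto

lemma spl_divide:
  fixes F :: "'a list \<Rightarrow> 'a list \<Rightarrow> complex"
  shows "spl F xs / c = spl (\<lambda>a b. F a b / c) xs"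
  by (induction xs arbitrary: F) (auto simp: add_divide_distrib)

text \<open>A stable factor is linear by assumption, so the difference vanishes. An unstable factor
  is the entry \<open>b\<close> itself: the remainder with \<open>(x^2 - 4)^(M+1)\<close> cancels
  the pole of order \<open>M\<close> of the other factor \<open>K\<close> and leaves one power for
  the division by \<open>x^2 - 4\<close> in the recursion.\<close>

lemma mer_lin_factor:
  fixes I :: "(nat \<times> bool) set"
  assumes st: "Fm_struct M h (length A + length C + 1)" and e: "e \<in> ball 0 (1/4)" and I: "finite I"
    and an: "\<And>b. b \<in> set A \<union> set C \<Longrightarrow> anl b" "anl b" "\<And>i. i \<in> I \<Longrightarrow> anl (\<phi> i)" "anl k"
    and ev: "eventually (\<lambda>x. b x = (\<Sum>i\<in>I. c i * \<phi> i x) + (x\<^sup>2 - 4) ^ Suc M * k x) bp"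
    and K: "mer M K"
  shows "mer 0 (\<lambda>x. (Fm e h (A @ b # C) x * K x - (\<Sum>i\<in>I. c i * (Fm e h (A @ \<phi> i # C) x * K x))) / (x\<^sup>2 - 4))"
proof -
  have f: "Fm e h (A @ b # C) x * K x - (\<Sum>i\<in>I. c i * (Fm e h (A @ \<phi> i # C) x * K x)) =
     (Fm e h (A @ b # C) x - (\<Sum>i\<in>I. c i * Fm e h (A @ \<phi> i # C) x)) * K x" for x
    by (simp add: algebra_simps sum_distrib_left)
  show ?thesis
  proof (cases "stable h (length A + length C + 1)")
    case True
    have k': "anl (\<lambda>x. (x\<^sup>2 - 4) * k x)" using an(4) unfolding anl_def by (intro analytic_intros)
    have ev': "eventually (\<lambda>x. b x = (\<Sum>i\<in>I. c i * \<phi> i x) + (x\<^sup>2 - 4) ^ M * ((x\<^sup>2 - 4) * k x)) bp"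
      using ev by (simp add: mult_ac)
    have "eventually (\<lambda>x. 0 = (Fm e h (A @ b # C) x * K x - (\<Sum>i\<in>I. c i * (Fm e h (A @ \<phi> i # C) x * K x))) / (x\<^sup>2 - 4)) bp"
      using eventually_bp_neq[of 2] eventually_bp_neq[of "- 2"]
    proof eventually_elim
      case (elim x)
      have "Fm e h (A @ b # C) x = (\<Sum>i\<in>I. c i * Fm e h (A @ \<phi> i # C) x)"
        by (rule Fm_structD_lin[OF st e True refl I an(1,2,3) k' ev']) (use elim in auto)
      thus ?case unfolding f by simp
    qed
    thus ?thesis by (rule mer_cong) (rule mer_const)
  next
    case False
    hence *: "h = 0" "A = []" "C = []" by (auto simp: stable_def)
    have "mer 0 (\<lambda>x. k x * ((x\<^sup>2 - 4) ^ M * K x))"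
      using mer_mult[OF mer_analytic mer_sq4_mult[OF K order.refl]] an(4) by (simp add: anl_def)
    moreover have "eventually (\<lambda>x. k x * ((x\<^sup>2 - 4) ^ M * K x) =
        (Fm e h (A @ b # C) x * K x - (\<Sum>i\<in>I. c i * (Fm e h (A @ \<phi> i # C) x * K x))) / (x\<^sup>2 - 4)) bp"
      using ev eventually_bp_sq4
    proof eventually_elim
      case (elim x)
      thus ?case unfolding f using * by simp
    qed
    ultimately show ?thesis by (rule mer_cong[rotated])
  qed
qed

text \<open>The distinguished entry falls into the left or the right factor of each product, and in
  both cases the defect of linearity of the integrand is regular at the branch values. The
  projection discards it. The diagonal term is linear without defect.\<close>

lemma Fm_lin_step:
  fixes I :: "(nat \<times> bool) set"
  assumes IH: "\<And>g' n'. 2 * g' + n' < 2 * g + (length as + length cs + 1) \<Longrightarrow> Fm_struct M g' n'"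
    and e: "e \<in> ball 0 (1/4)" and st: "stable g (length as + length cs + 1)" and I: "finite I"
    and an: "\<And>b. b \<in> set as \<union> set cs \<Longrightarrow> anl b" "anl b" "\<And>i. i \<in> I \<Longrightarrow> anl (\<phi> i)" "anl k"
    and ev: "eventually (\<lambda>x. b x = (\<Sum>i\<in>I. c i * \<phi> i x) + (x\<^sup>2 - 4) ^ Suc M * k x) bp"
    and x0: "x0 \<notin> {2, - 2}"
  shows "Fm e g (as @ b # cs) x0 = (\<Sum>i\<in>I. c i * Fm e g (as @ \<phi> i # cs) x0)"
proof -
  let ?n = "length as + length cs + 1"
  have len: "length (as @ b' # cs) = ?n" for b' :: "complex \<Rightarrow> complex" by simp
  define G where "G = (\<lambda>h A A' C D b' x. Fm e h (A @ b' # C) x * Fm e (g - h) (A' @ D) x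
                            + Fm e h (A @ C) x * Fm e (g - h) (A' @ b' # D) x)"
  have Q: "Qm e g (as @ b' # cs) x = diag e g (as @ b' # cs) x
     + (\<Sum>h\<le>g. spl (\<lambda>A A'. spl (\<lambda>C D. G h A A' C D b' x) cs) as)" for b' x
    by (simp add: Qm_def spl_insert G_def)
  have dg: "diag e g (as @ b # cs) x = (\<Sum>i\<in>I. c i * diag e g (as @ \<phi> i # cs) x)" if x: "x \<notin> {2, - 2}" for x
  proof (cases "g = 0")
    case False
    have k': "anl (\<lambda>x. (x\<^sup>2 - 4) * k x)" using an(4) unfolding anl_def by (intro analytic_intros)
    have ev': "eventually (\<lambda>x. b x = (\<Sum>i\<in>I. c i * \<phi> i x) + (x\<^sup>2 - 4) ^ M * ((x\<^sup>2 - 4) * k x)) bp"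
      using ev by (simp add: mult_ac)
    have "Fm e (g - 1) (((\<lambda>X. beta X x) # as) @ b # cs) x =
      (\<Sum>i\<in>I. c i * Fm e (g - 1) (((\<lambda>X. beta X x) # as) @ \<phi> i # cs) x)"
      by (rule Fm_structD_lin[OF IH e _ refl I _ an(2,3) k' ev' x])
        (use False anl_beta[OF x] an(1) in \<open>auto simp: stable_def\<close>)
    thus ?thesis using False by (simp add: diag_def)
  qed (simp add: diag_def)
  have piece: "mer 0 (\<lambda>x. (G h A A' C D b x - (\<Sum>i\<in>I. c i * G h A A' C D (\<phi> i) x)) / (x\<^sup>2 - 4))"
    if h: "h \<le> g" and l: "length A + length A' = length as" "length C + length D = length cs"
      and ss: "set A \<subseteq> set as" "set A' \<subseteq> set as" "set C \<subseteq> set cs" "set D \<subseteq> set cs" for h A A' C D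
  proof -
    have 1: "mer 0 (\<lambda>x. (Fm e h (A @ b # C) x * Fm e (g - h) (A' @ D) x
               - (\<Sum>i\<in>I. c i * (Fm e h (A @ \<phi> i # C) x * Fm e (g - h) (A' @ D) x))) / (x\<^sup>2 - 4))"
    proof -
      have "length (A @ b # C) + length (A' @ D) = ?n" using l by simp
      with h show ?thesis
      proof (cases rule: Fm_prod_cases)
        case 3
        show ?thesis
          by (rule mer_lin_factor[OF IH e I _ an(2,3,4) ev Fm_structD_mer[OF IH e refl]])
             (use 3 an(1) ss in auto)
      qed (use mer_const[of 0] in auto)
    qed
    have 2: "mer 0 (\<lambda>x. (Fm e (g - h) (A' @ b # D) x * Fm e h (A @ C) x
               - (\<Sum>i\<in>I. c i * (Fm e (g - h) (A' @ \<phi> i # D) x * Fm e h (A @ C) x))) / (x\<^sup>2 - 4))"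
    proof -
      have "length (A @ C) + length (A' @ b # D) = ?n" using l by simp
      with h show ?thesis
      proof (cases rule: Fm_prod_cases)
        case 3
        show ?thesis
          by (rule mer_lin_factor[OF IH e I _ an(2,3,4) ev Fm_structD_mer[OF IH e refl]])
             (use 3 an(1) ss in auto)
      qed (use mer_const[of 0] in auto)
    qed
    have "(G h A A' C D b x - (\<Sum>i\<in>I. c i * G h A A' C D (\<phi> i) x)) / (x\<^sup>2 - 4) =
       (Fm e h (A @ b # C) x * Fm e (g - h) (A' @ D) x
               - (\<Sum>i\<in>I. c i * (Fm e h (A @ \<phi> i # C) x * Fm e (g - h) (A' @ D) x))) / (x\<^sup>2 - 4) +
       (Fm e (g - h) (A' @ b # D) x * Fm e h (A @ C) x
               - (\<Sum>i\<in>I. c i * (Fm e (g - h) (A' @ \<phi> i # D) x * Fm e h (A @ C) x))) / (x\<^sup>2 - 4)" for x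
      by (simp add: G_def sum.distrib distrib_left diff_divide_distrib add_divide_distrib mult_ac)
    thus ?thesis using mer_add[OF 1 2] by simp
  qed
  have "mer 0 (\<lambda>x. \<Sum>h\<le>g. spl (\<lambda>A A'. spl (\<lambda>C D.
      (G h A A' C D b x - (\<Sum>i\<in>I. c i * G h A A' C D (\<phi> i) x)) / (x\<^sup>2 - 4)) cs) as)"
    by (intro mer_sum mer_spl piece) auto
  hence m0: "mer 0 (\<lambda>x. (Qm e g (as @ b # cs) x - (\<Sum>i\<in>I. c i * Qm e g (as @ \<phi> i # cs) x)) / (x\<^sup>2 - 4))"
  proof (rule mer_cong[rotated])
    show "\<forall>\<^sub>F x in bp. (\<Sum>h\<le>g. spl (\<lambda>A A'. spl (\<lambda>C D.
      (G h A A' C D b x - (\<Sum>i\<in>I. c i * G h A A' C D (\<phi> i) x)) / (x\<^sup>2 - 4)) cs) as) =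
      (Qm e g (as @ b # cs) x - (\<Sum>i\<in>I. c i * Qm e g (as @ \<phi> i # cs) x)) / (x\<^sup>2 - 4)"
      using eventually_bp_neq[of 2] eventually_bp_neq[of "- 2"]
    proof eventually_elim
      case (elim x)
      let ?P = "\<lambda>h b'. spl (\<lambda>A A'. spl (\<lambda>C D. G h A A' C D b' x) cs) as"
      have "(\<Sum>h\<le>g. spl (\<lambda>A A'. spl (\<lambda>C D.
        (G h A A' C D b x - (\<Sum>i\<in>I. c i * G h A A' C D (\<phi> i) x)) / (x\<^sup>2 - 4)) cs) as)
        = (\<Sum>h\<le>g. ?P h b - (\<Sum>i\<in>I. c i * ?P h (\<phi> i))) / (x\<^sup>2 - 4)"
        unfolding spl_lincomb spl_divide sum_divide_distrib ..
      also have "(\<Sum>h\<le>g. ?P h b - (\<Sum>i\<in>I. c i * ?P h (\<phi> i))) =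
          (\<Sum>h\<le>g. ?P h b) - (\<Sum>i\<in>I. c i * (\<Sum>h\<le>g. ?P h (\<phi> i)))"
        unfolding sum_subtractf sum_distrib_left by (subst sum.swap) (rule refl)
      also have "\<dots> = Qm e g (as @ b # cs) x - (\<Sum>i\<in>I. c i * Qm e g (as @ \<phi> i # cs) x)"
        using dg[of x] elim by (simp add: Q distrib_left sum.distrib)
      finally show ?case .
    qed
  qed
  have mQ: "mer (2 * M + 2) (\<lambda>x. Qm e g (as @ b' # cs) x / ((x\<^sup>2 - 4) * (1 - e * x)))" if "anl b'" for b'
    using mer_integrand[OF mer_Qm[of g "as @ b' # cs" M e] e] IH e an(1) that by auto
  have "PP (\<lambda>x. (\<Sum>i\<in>I. c i * (Qm e g (as @ \<phi> i # cs) x / ((x\<^sup>2 - 4) * (1 - e * x)))) +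
      (Qm e g (as @ b # cs) x - (\<Sum>i\<in>I. c i * Qm e g (as @ \<phi> i # cs) x)) / (x\<^sup>2 - 4) * (1 / (1 - e * x))) x0 =
     (\<Sum>i\<in>I. c i * PP (\<lambda>x. Qm e g (as @ \<phi> i # cs) x / ((x\<^sup>2 - 4) * (1 - e * x))) x0) + 0"
    (is "PP (\<lambda>x. ?S x + ?R x) x0 = _")
  proof -
    have R: "mer 0 ?R" using mer_mult[OF m0 mer_inverse_lin[OF e]] by simp
    have "mer (2 * M + 2) ?S" using mQ an(3) by (intro mer_sum mer_cmult) auto
    from PP_add[OF this mer_mono[OF R]] PP_regular[OF R x0] PP_sum[of I, OF mQ[OF an(3)]]
    show ?thesis by simp
  qed
  also have "(\<lambda>x. ?S x + ?R x) = (\<lambda>x. Qm e g (as @ b # cs) x / ((x\<^sup>2 - 4) * (1 - e * x)))"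
    by (rule ext) (simp add: diff_divide_distrib sum_divide_distrib left_diff_distrib sum_distrib_right)
  finally show ?thesis
    using Fm_rec[of g "as @ b # cs" e x0] Fm_rec[of g "as @ \<phi> i # cs" e x0 for i] st by simp
qed

text \<open>The quadratic expression has poles of order at most \<open>2 M + 1\<close> and the
  kernel adds one. The same bound leaves at least the \<open>M + 1\<close> powers needed for
  linearity.\<close>

lemma Fm_struct_step:
  assumes IH: "\<And>g' n'. 2 * g' + n' < 2 * g + n \<Longrightarrow> Fm_struct M g' n'"
  shows "Fm_struct (2 * M + 2) g n"
proof (cases "stable g n")
  case False
  have "mer (2 * M + 2) (Fm e g bs)" if "length bs = n" "\<forall>b\<in>set bs. anl b" for e bs
  proof -
    have "bs = [] \<or> (\<exists>b. bs = [b])" "g = 0" using False that not_stable_iff by auto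
    thus ?thesis using that mer_mono[OF mer_const[of 0], of "2 * M + 2"]
      by (auto simp: anl_def Fm_0_Nil' Fm_0_single' intro!: mer_mono[OF mer_analytic])
  qed
  thus ?thesis using False by (auto simp: Fm_struct_def)
next
  case True
  show ?thesis unfolding Fm_struct_def
  proof (intro ballI conjI allI impI)
    fix e :: complex and bs :: "(complex \<Rightarrow> complex) list"
    assume e: "e \<in> ball 0 (1/4)" and bs: "length bs = n" "\<forall>b\<in>set bs. anl b"
    have "mer (2 * M + 1) (Qm e g bs)"
      using IH bs by (intro mer_Qm[OF _ e]) auto
    from PP_eq_polar[OF mer_integrand[OF this e]]
    obtain a b where ab: "\<And>x0. x0 \<notin> {2, - 2} \<Longrightarrow> Fm e g bs x0 = polar (2 * M + 2) a b x0"
      using Fm_rec[of g bs e] True bs by auto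
    have "eventually (\<lambda>x. polar (2 * M + 2) a b x = Fm e g bs x) bp"
      using eventually_bp_neq[of 2] eventually_bp_neq[of "- 2"] by eventually_elim (simp add: ab)
    thus "mer (2 * M + 2) (Fm e g bs)" using mer_polar mer_cong by blast
    show "\<exists>a b. \<forall>x. x \<notin> {2, - 2} \<longrightarrow> Fm e g bs x = polar (2 * M + 2) a b x" using ab by blast
  next
    fix e :: complex and as b cs and I :: "(nat \<times> bool) set" and c \<phi> h and x :: complex
    assume e: "e \<in> ball 0 (1/4)" and l: "length as + length cs + 1 = n" "finite I"
      "\<forall>b\<in>set as \<union> set cs. anl b" "anl b" "\<forall>i\<in>I. anl (\<phi> i)" "anl h"
      and ev: "eventually (\<lambda>x. b x = (\<Sum>i\<in>I. c i * \<phi> i x) + (x\<^sup>2 - 4) ^ (2 * M + 2) * h x) bp" and x: "x \<notin> {2, - 2}"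
    show "Fm e g (as @ b # cs) x = (\<Sum>i\<in>I. c i * Fm e g (as @ \<phi> i # cs) x)"
    proof (rule Fm_lin_step[where k = "\<lambda>x. (x\<^sup>2 - 4) ^ (M + 1) * h x" and M = M])
      show "anl (\<lambda>x. (x\<^sup>2 - 4) ^ (M + 1) * h x)"
        using l(6) unfolding anl_def by (intro analytic_intros)
      have "(x\<^sup>2 - 4) ^ (2 * M + 2) = (x\<^sup>2 - 4) ^ Suc M * (x\<^sup>2 - 4) ^ (M + 1)" for x :: complex
        unfolding power_add[symmetric] by (rule arg_cong2[of _ _ _ _ "(^)"]) auto
      thus "eventually (\<lambda>x. b x = (\<Sum>i\<in>I. c i * \<phi> i x) + (x\<^sup>2 - 4) ^ Suc M * ((x\<^sup>2 - 4) ^ (M + 1) * h x)) bp"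
        using ev by (simp only: mult.assoc)
    qed (use l x e True IH in auto)
  qed
qed

lemma Fm_struct_ex: "\<exists>M. \<forall>g n. 2 * g + n < N \<longrightarrow> Fm_struct M g n"
proof (induction N)
  case (Suc N)
  then obtain M where M: "\<And>g n. 2 * g + n < N \<Longrightarrow> Fm_struct M g n" by blast
  have "Fm_struct (2 * M + 2) g n" if "2 * g + n < Suc N" for g n
    using Fm_struct_step[of g n M] M that by (cases "2 * g + n = N") (auto intro: Fm_struct_mono)
  thus ?case by blast
qed auto

text \<open>
  \<open>sep f\<close>: near the branch values, \<open>f e x\<close> is a finite sum of terms \<open>\<alpha> e * v x\<close> with \<open>\<alpha>\<close>
  continuous at \<open>0\<close>.  This form is preserved by the recursion and makes the limit
  \<open>e \<rightarrow> 0\<close> immediate.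
\<close>
section \<open>Dependence on the deformation parameter\<close>

definition sep :: "(complex \<Rightarrow> complex \<Rightarrow> complex) \<Rightarrow> bool" where
  "sep f \<longleftrightarrow> (\<exists>L M. (\<forall>p\<in>set L. isCont (fst p) 0 \<and> mer M (snd p)) \<and>
     (\<forall>e\<in>ball 0 (1/4). eventually (\<lambda>x. f e x = (\<Sum>p\<leftarrow>L. fst p e * snd p x)) bp))"

lemma sep_cong:
  assumes "\<And>e. e \<in> ball 0 (1/4) \<Longrightarrow> eventually (\<lambda>x. f e x = g e x) bp" "sep f"
  shows "sep g"
proof -
  obtain L M where L: "\<forall>p\<in>set L. isCont (fst p) 0 \<and> mer M (snd p)"
    "\<And>e. e \<in> ball 0 (1/4) \<Longrightarrow> eventually (\<lambda>x. f e x = (\<Sum>p\<leftarrow>L. fst p e * snd p x)) bp"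
    using assms(2) unfolding sep_def by blast
  have "eventually (\<lambda>x. g e x = (\<Sum>p\<leftarrow>L. fst p e * snd p x)) bp" if "e \<in> ball 0 (1/4)" for e
    using assms(1)[OF that] L(2)[OF that] by eventually_elim simp
  thus ?thesis using L(1) unfolding sep_def by blast
qed

lemma sep_single:
  assumes "isCont \<alpha> 0" "mer M v"
  shows "sep (\<lambda>e x. \<alpha> e * v x)"
  unfolding sep_def using assms by (intro exI[of _ "[(\<alpha>, v)]"] exI[of _ M]) auto

lemma sep_zero: "sep (\<lambda>e x. 0)"
  unfolding sep_def by (intro exI[of _ "[]"]) auto

lemma sep_add:
  assumes "sep f" "sep g"
  shows "sep (\<lambda>e x. f e x + g e x)"
proof -
  obtain L M where L: "\<forall>p\<in>set L. isCont (fst p) 0 \<and> mer M (snd p)"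
    "\<And>e. e \<in> ball 0 (1/4) \<Longrightarrow> eventually (\<lambda>x. f e x = (\<Sum>p\<leftarrow>L. fst p e * snd p x)) bp"
    using assms(1) unfolding sep_def by blast
  obtain L' M' where L': "\<forall>p\<in>set L'. isCont (fst p) 0 \<and> mer M' (snd p)"
    "\<And>e. e \<in> ball 0 (1/4) \<Longrightarrow> eventually (\<lambda>x. g e x = (\<Sum>p\<leftarrow>L'. fst p e * snd p x)) bp"
    using assms(2) unfolding sep_def by blast
  have "eventually (\<lambda>x. f e x + g e x = (\<Sum>p\<leftarrow>L @ L'. fst p e * snd p x)) bp" if "e \<in> ball 0 (1/4)" for e
    using L(2)[OF that] L'(2)[OF that] by eventually_elim simp
  moreover have "\<forall>p\<in>set (L @ L'). isCont (fst p) 0 \<and> mer (max M M') (snd p)"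
    using L(1) L'(1) mer_mono[of M _ "max M M'"] mer_mono[of M' _ "max M M'"] by auto
  ultimately show ?thesis unfolding sep_def by blast
qed

lemma sum_list_product:
  fixes F G :: "_ \<Rightarrow> complex"
  shows "(\<Sum>p\<leftarrow>L. F p) * (\<Sum>q\<leftarrow>L'. G q) = (\<Sum>pq\<leftarrow>List.product L L'. F (fst pq) * G (snd pq))"
  by (induction L) (auto simp: distrib_right sum_list_const_mult o_def)

lemma sep_mult:
  assumes "sep f" "sep g"
  shows "sep (\<lambda>e x. f e x * g e x)"
proof -
  obtain L M where L: "\<forall>p\<in>set L. isCont (fst p) 0 \<and> mer M (snd p)"
    "\<And>e. e \<in> ball 0 (1/4) \<Longrightarrow> eventually (\<lambda>x. f e x = (\<Sum>p\<leftarrow>L. fst p e * snd p x)) bp"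
    using assms(1) unfolding sep_def by blast
  obtain L' M' where L': "\<forall>p\<in>set L'. isCont (fst p) 0 \<and> mer M' (snd p)"
    "\<And>e. e \<in> ball 0 (1/4) \<Longrightarrow> eventually (\<lambda>x. g e x = (\<Sum>p\<leftarrow>L'. fst p e * snd p x)) bp"
    using assms(2) unfolding sep_def by blast
  define K where "K = map (\<lambda>(p, q). (\<lambda>e. fst p e * fst q e, \<lambda>x. snd p x * snd q x)) (List.product L L')"
  have "eventually (\<lambda>x. f e x * g e x = (\<Sum>p\<leftarrow>K. fst p e * snd p x)) bp" if "e \<in> ball 0 (1/4)" for e
    using L(2)[OF that] L'(2)[OF that]
  proof eventually_elim
    case (elim x)
    show ?case unfolding elim sum_list_product K_def
      by (simp add: o_def case_prod_unfold mult_ac)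
  qed
  moreover have "\<forall>p\<in>set K. isCont (fst p) 0 \<and> mer (M + M') (snd p)"
    using L(1) L'(1) by (auto simp: K_def intro!: mer_mult continuous_intros)
  ultimately show ?thesis unfolding sep_def by blast
qed

lemma sep_sum: "(\<And>i. i \<in> I \<Longrightarrow> sep (f i)) \<Longrightarrow> sep (\<lambda>e x. \<Sum>i\<in>I. f i e x)"
  by (induction I rule: infinite_finite_induct) (auto intro!: sep_add sep_zero)

lemma sep_spl:
  assumes "\<And>a b. length a + length b = length xs \<Longrightarrow> set a \<subseteq> set xs \<Longrightarrow> set b \<subseteq> set xs \<Longrightarrow> sep (f a b)"
  shows "sep (\<lambda>e x. spl (\<lambda>a b. f a b e x) xs)"
  using assms
proof (induction xs arbitrary: f)
  case (Cons y xs)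
  show ?case unfolding spl.simps
    by (intro sep_add Cons.IH) (auto intro!: Cons.prems)
qed auto

lemma mer_sum_list: "(\<And>p. p \<in> set L \<Longrightarrow> mer M (f p)) \<Longrightarrow> mer M (\<lambda>x. \<Sum>p\<leftarrow>L. f p x)"
  by (induction L) (auto intro!: mer_add mer_mono[OF mer_const])

lemma sep_mer:
  assumes "sep f"
  shows "\<exists>M. \<forall>e\<in>ball 0 (1/4). mer M (f e)"
proof -
  obtain L M where L: "\<forall>p\<in>set L. isCont (fst p) 0 \<and> mer M (snd p)"
    "\<And>e. e \<in> ball 0 (1/4) \<Longrightarrow> eventually (\<lambda>x. f e x = (\<Sum>p\<leftarrow>L. fst p e * snd p x)) bp"
    using assms unfolding sep_def by blast
  have "mer M (f e)" if "e \<in> ball 0 (1/4)" for e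
  proof (rule mer_cong)
    show "eventually (\<lambda>x. (\<Sum>p\<leftarrow>L. fst p e * snd p x) = f e x) bp"
      using L(2)[OF that] by eventually_elim simp
    show "mer M (\<lambda>x. \<Sum>p\<leftarrow>L. fst p e * snd p x)"
      using L(1) by (intro mer_sum_list mer_cmult) auto
  qed
  thus ?thesis by blast
qed

lemma PP_sum_list:
  assumes "\<And>p. p \<in> set L \<Longrightarrow> mer M (v p)"
  shows "PP (\<lambda>x. \<Sum>p\<leftarrow>L. c p * v p x) x0 = (\<Sum>p\<leftarrow>L. c p * PP (v p) x0)"
  using assms
proof (induction L)
  case Nil
  have "PP (\<lambda>x. 0 * 0) x0 = 0 * PP (\<lambda>x. 0) x0" by (rule PP_cmult[OF mer_const])
  thus ?case by simp
next
  case (Cons p L)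
  have "mer M (\<lambda>x. \<Sum>p\<leftarrow>L. c p * v p x)" "mer M (\<lambda>x. c p * v p x)"
    using Cons.prems by (auto intro!: mer_sum_list mer_cmult)
  from PP_add[OF this(2,1)] show ?case using Cons PP_cmult[of M "v p" "c p"] by simp
qed

text \<open>Unlike \<open>sep\<close>, an exact identity everywhere off the branch values, with
  polar functions of a common bound. Outputs of the projection have this form, and the final
  residues are taken term by term.\<close>

definition sepol :: "(complex \<Rightarrow> complex \<Rightarrow> complex) \<Rightarrow> bool" where
  "sepol f \<longleftrightarrow> (\<exists>L M. (\<forall>p\<in>set L. isCont (fst p) 0 \<and> (\<exists>a b. snd p = polar M a b)) \<and>
     (\<forall>e\<in>ball 0 (1/4). \<forall>x. x \<notin> {2, - 2} \<longrightarrow> f e x = (\<Sum>p\<leftarrow>L. fst p e * snd p x)))"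

lemma sepol_imp_sep:
  assumes "sepol f" shows "sep f"
proof -
  obtain L M where L: "\<forall>p\<in>set L. isCont (fst p) 0 \<and> (\<exists>a b. snd p = polar M a b)"
     "\<And>e x. e \<in> ball 0 (1/4) \<Longrightarrow> x \<notin> {2, - 2} \<Longrightarrow> f e x = (\<Sum>p\<leftarrow>L. fst p e * snd p x)"
    using assms unfolding sepol_def by blast
  have "\<forall>p\<in>set L. isCont (fst p) 0 \<and> mer M (snd p)" using L(1) mer_polar by metis
  moreover have "eventually (\<lambda>x. f e x = (\<Sum>p\<leftarrow>L. fst p e * snd p x)) bp" if "e \<in> ball 0 (1/4)" for e
    using eventually_bp_neq[of 2] eventually_bp_neq[of "- 2"]
    by eventually_elim (use L(2)[OF that] in auto)
  ultimately show ?thesis unfolding sep_def by blast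
qed

lemma sepol_PP:
  assumes "sep f"
  shows "sepol (\<lambda>e. PP (f e))"
proof -
  obtain L M where L: "\<forall>p\<in>set L. isCont (fst p) 0 \<and> mer M (snd p)"
    "\<And>e. e \<in> ball 0 (1/4) \<Longrightarrow> eventually (\<lambda>x. f e x = (\<Sum>p\<leftarrow>L. fst p e * snd p x)) bp"
    using assms unfolding sep_def by blast
  have "\<forall>p\<in>set L. \<exists>v. (\<exists>a b. v = polar M a b) \<and> (\<forall>x. x \<notin> {2, - 2} \<longrightarrow> PP (snd p) x = v x)"
    using PP_eq_polar[of M] L(1) by metis
  then obtain w where w: "\<And>p. p \<in> set L \<Longrightarrow> \<exists>a b. w p = polar M a b"
      "\<And>p x. p \<in> set L \<Longrightarrow> x \<notin> {2, - 2} \<Longrightarrow> PP (snd p) x = w p x" by metis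
  have "PP (f e) x = (\<Sum>p\<leftarrow>map (\<lambda>p. (fst p, w p)) L. fst p e * snd p x)"
    if "e \<in> ball 0 (1/4)" "x \<notin> {2, - 2}" for e x
  proof -
    have "PP (f e) x = PP (\<lambda>x. \<Sum>p\<leftarrow>L. fst p e * snd p x) x"
      by (rule PP_cong[OF L(2)[OF that(1)]])
    also have "\<dots> = (\<Sum>p\<leftarrow>L. fst p e * PP (snd p) x)"
      using L(1) by (intro PP_sum_list) auto
    also have "\<dots> = (\<Sum>p\<leftarrow>L. fst p e * w p x)"
      using w(2) that(2) by (intro arg_cong[where f = sum_list] map_cong) auto
    finally show ?thesis by (simp add: o_def)
  qed
  thus ?thesis unfolding sepol_def using w(1) L(1)
    by (intro exI[of _ "map (\<lambda>p. (fst p, w p)) L"] exI[of _ M]) auto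
qed

text \<open>\<open>1 / (1 - e x) = (1 + e x) / (1 - e^2 x^2)\<close> and
  \<open>1 - e^2 x^2 = (1 - 4 e^2) - e^2 (x^2 - 4)\<close>, so this is a finite geometric series in
  \<open>x^2 - 4\<close> with coefficients continuous at \<open>e = 0\<close>.\<close>

lemma inverse_lin_expansion:
  fixes e x :: complex
  assumes "1 - 4 * e\<^sup>2 \<noteq> 0" "1 - e * x \<noteq> 0"
  shows "1 / (1 - e * x) = (\<Sum>j<K. (e\<^sup>2) ^ j / (1 - 4 * e\<^sup>2) ^ Suc j * ((1 + e * x) * (x\<^sup>2 - 4) ^ j))
      + (e\<^sup>2 / (1 - 4 * e\<^sup>2)) ^ K * ((x\<^sup>2 - 4) ^ K / (1 - e * x))"
proof (induction K)
  case (Suc K)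
  define w S where "w = 1 - 4 * e\<^sup>2" and "S = x\<^sup>2 - 4"
  define D P where "D = 1 - e * x" and "P = (e\<^sup>2) ^ K * S ^ K"
  have nz: "w \<noteq> 0" "D \<noteq> 0" using assms by (auto simp: w_def D_def)
  have key: "(1 + e * x) * D + e\<^sup>2 * S = w"
    by (simp add: w_def S_def D_def algebra_simps power2_eq_square)
  have "(e\<^sup>2) ^ K / w ^ Suc K * ((1 + e * x) * S ^ K) + (e\<^sup>2 / w) ^ Suc K * (S ^ Suc K / D)
     = P * (1 + e * x) / w ^ Suc K + P * (e\<^sup>2 * S) / (w ^ Suc K * D)"
    by (simp add: P_def power_divide mult_ac)
  also have "\<dots> = P * ((1 + e * x) * D + e\<^sup>2 * S) / (w ^ Suc K * D)"
    using nz by (simp add: add_divide_distrib distrib_left)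
  also have "\<dots> = (e\<^sup>2 / w) ^ K * (S ^ K / D)"
    unfolding key using nz by (simp add: P_def power_divide)
  finally have "(e\<^sup>2) ^ K / w ^ Suc K * ((1 + e * x) * S ^ K) + (e\<^sup>2 / w) ^ Suc K * (S ^ Suc K / (1 - e * x))
     = (e\<^sup>2 / w) ^ K * (S ^ K / (1 - e * x))" by (simp only: D_def)
  thus ?case using Suc unfolding w_def S_def by (simp add: add.assoc del: power_Suc)
qed simp

text \<open>A pole bound uniform in \<open>e\<close> decides how far to expand
  \<open>1 / (1 - e x)\<close>: the remainder contains \<open>(x^2 - 4)^(M+1)\<close>, which cancels
  all poles, so the projection loses it.\<close>

lemma sepol_integrand:
  assumes "sep f"
  shows "sepol (\<lambda>e. PP (\<lambda>x. f e x / ((x\<^sup>2 - 4) * (1 - e * x))))"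
proof -
  obtain M where M: "\<And>e. e \<in> ball 0 (1/4) \<Longrightarrow> mer M (f e)" using sep_mer[OF assms] by blast
  \<comment> \<open>The truncated series, with \<open>1 + e x\<close> split so that each term is a
    function of \<open>e\<close> times a function of \<open>x\<close>.\<close>
  define h where "h = (\<lambda>e x. \<Sum>j<Suc M. ((e\<^sup>2) ^ j / (1 - 4 * e\<^sup>2) ^ Suc j * (x\<^sup>2 - 4) ^ j
                  + (e\<^sup>2) ^ j / (1 - 4 * e\<^sup>2) ^ Suc j * e * ((x\<^sup>2 - 4) ^ j * x :: complex)))"
  have "sep h" unfolding h_def
    by (intro sep_sum sep_add sep_single[where M = 0] mer_analytic)
       (auto intro!: continuous_intros analytic_intros)
  moreover have "sep (\<lambda>e x. 1 * (1 / (x\<^sup>2 - 4)))"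
    using mer_inverse_sq4[of 1] by (intro sep_single[where M = 1]) auto
  ultimately have s1: "sep (\<lambda>e x. f e x * h e x / (x\<^sup>2 - 4))"
    using sep_mult[OF sep_mult[OF assms]] by fastforce
  have "PP (\<lambda>x. f e x / ((x\<^sup>2 - 4) * (1 - e * x))) x0 = PP (\<lambda>x. f e x * h e x / (x\<^sup>2 - 4)) x0"
    if e: "e \<in> ball 0 (1/4)" and x0: "x0 \<notin> {2, - 2}" for e x0
  proof -
    have w: "1 - 4 * e\<^sup>2 \<noteq> 0"
    proof
      assume "1 - 4 * e\<^sup>2 = 0"
      hence "norm (4 * e\<^sup>2) = 1" by (metis eq_iff_diff_eq_0 norm_one)
      hence "norm e * norm e = 1 / 4" by (simp add: norm_mult norm_power power2_eq_square)
      moreover have "norm e * norm e < 1 / 4 * (1 / 4)" using e by (intro mult_strict_mono) auto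
      ultimately show False by simp
    qed
    define R where "R = (\<lambda>x. (e\<^sup>2 / (1 - 4 * e\<^sup>2)) ^ Suc M * ((x\<^sup>2 - 4) ^ M * f e x * (1 / (1 - e * x))))"
    have R: "mer 0 R" unfolding R_def
      by (rule mer_cmult) (use mer_mult[OF mer_sq4_mult[OF M[OF e] order.refl] mer_inverse_lin[OF e]] in simp)
    have m1: "mer (Suc M) (\<lambda>x. f e x * h e x / (x\<^sup>2 - 4))"
    proof -
      have "mer 0 (h e)" unfolding h_def by (intro mer_analytic analytic_intros)
      from mer_divide_sq4[OF mer_mult[OF M[OF e] this], of 1] show ?thesis by simp
    qed
    have "eventually (\<lambda>x. 1 - e * x \<noteq> 0) bp"
    proof (cases "e = 0")
      case False
      show ?thesis using eventually_bp_neq[of "1 / e"]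
        by eventually_elim (use False in \<open>auto simp: field_simps\<close>)
    qed simp
    hence "eventually (\<lambda>x. f e x / ((x\<^sup>2 - 4) * (1 - e * x)) = f e x * h e x / (x\<^sup>2 - 4) + R x) bp"
      using eventually_bp_sq4
    proof eventually_elim
      case (elim x)
      have hx: "h e x = (\<Sum>j<Suc M. (e\<^sup>2) ^ j / (1 - 4 * e\<^sup>2) ^ Suc j * ((1 + e * x) * (x\<^sup>2 - 4) ^ j))"
      proof -
        have "c * S + c * e * (S * x) = c * ((1 + e * x) * S)" for c S by (simp add: algebra_simps)
        thus ?thesis unfolding h_def by (intro sum.cong refl)
      qed
      have "f e x / ((x\<^sup>2 - 4) * (1 - e * x)) = f e x / (x\<^sup>2 - 4) * (1 / (1 - e * x))" by simp
      also have "\<dots> = f e x / (x\<^sup>2 - 4) * (h e x + (e\<^sup>2 / (1 - 4 * e\<^sup>2)) ^ Suc M * ((x\<^sup>2 - 4) ^ Suc M / (1 - e * x)))"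
        unfolding hx by (subst inverse_lin_expansion[OF w elim(1), of "Suc M"]) (rule refl)
      also have "\<dots> = f e x * h e x / (x\<^sup>2 - 4) + R x"
        using elim(2) by (simp add: distrib_left R_def)
      finally show ?case .
    qed
    hence "PP (\<lambda>x. f e x / ((x\<^sup>2 - 4) * (1 - e * x))) x0 = PP (\<lambda>x. f e x * h e x / (x\<^sup>2 - 4) + R x) x0"
      by (rule PP_cong)
    thus ?thesis using PP_add[OF m1 mer_mono[OF R], of x0] PP_regular[OF R x0] by simp
  qed
  thus ?thesis using sepol_PP[OF s1] unfolding sepol_def by simp
qed

text \<open>Induction along the recursion. The diagonal term is separated by the jet expansion of
  \<open>beta\<close>, whose order \<open>M\<close> serves all \<open>e\<close> in the disc at
  once.\<close>

lemma sep_Fm: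
  assumes "\<forall>b\<in>set bs. anl b"
  shows "sep (\<lambda>e. Fm e g bs) \<and> (stable g (length bs) \<longrightarrow> sepol (\<lambda>e. Fm e g bs))"
  using assms
proof (induction "2 * g + length bs" arbitrary: g bs rule: less_induct)
  case less
  show ?case
  proof (cases "stable g (length bs)")
    case False
    have "bs = [] \<or> (\<exists>b. bs = [b])" "g = 0" using False not_stable_iff by auto
    thus ?thesis using less.prems False sep_zero sep_single[of "\<lambda>_. 1" 0]
      by (auto simp: anl_def mer_analytic Fm_0_Nil' Fm_0_single')
  next
    case True
    obtain M where M: "\<And>g' n'. 2 * g' + n' < 2 * g + length bs \<Longrightarrow> Fm_struct M g' n'"
      using Fm_struct_ex[of "2 * g + length bs"] by blast
    have "sep (\<lambda>e. diag e g bs)"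
    proof (cases "g = 0 \<or> g = 1 \<and> bs = []")
      case True
      have "sep (\<lambda>e x. 1 * (1 / (x\<^sup>2 - 4)))"
        using mer_inverse_sq4[of 1] by (intro sep_single[where M = 1]) auto
      thus ?thesis using True sep_zero by (cases "g = 0") (auto simp: diag_def[abs_def])
    next
      case False
      have "sep (\<lambda>e x. \<Sum>i\<in>bidx M. (1 * cc i x) * Fm e (g - 1) (bb i # bs) x)"
        using False less.prems
        by (intro sep_sum sep_mult sep_single[where M = M] mer_cc conjunct1[OF less.hyps]) auto
      moreover have "eventually (\<lambda>x. (\<Sum>i\<in>bidx M. (1 * cc i x) * Fm e (g - 1) (bb i # bs) x) = diag e g bs x) bp"
        if "e \<in> ball 0 (1/4)" for e
        using eventually_bp_neq[of 2] eventually_bp_neq[of "- 2"]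
      proof eventually_elim
        case (elim x)
        thus ?case using diag_eq_sum[OF M that] less.prems False by auto
      qed
      ultimately show ?thesis by (rule sep_cong[rotated])
    qed
    moreover have "sep (\<lambda>e x. \<Sum>h\<le>g. spl (\<lambda>a b. Fm e h a x * Fm e (g - h) b x) bs)"
    proof (intro sep_sum sep_spl)
      fix h a b assume *: "h \<in> {..g}" "length a + length b = length bs" "set a \<subseteq> set bs" "set b \<subseteq> set bs"
      from *(1,2) have "h \<le> g" by simp
      thus "sep (\<lambda>e x. Fm e h a x * Fm e (g - h) b x)" using *(2)
      proof (cases rule: Fm_prod_cases)
        case 3
        show ?thesis using less.prems * 3 by (intro sep_mult conjunct1[OF less.hyps]) auto
      qed (auto simp: sep_zero)
    qed
    ultimately have "sep (\<lambda>e. Qm e g bs)" unfolding Qm_def[abs_def] by (rule sep_add)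
    moreover have "(\<lambda>e. PP (\<lambda>x. Qm e g bs x / ((x\<^sup>2 - 4) * (1 - e * x)))) = (\<lambda>e. Fm e g bs)"
      by (intro ext) (rule Fm_rec[OF True, symmetric])
    ultimately have "sepol (\<lambda>e. Fm e g bs)"
      using sepol_integrand[of "\<lambda>e. Qm e g bs"] by simp
    thus ?thesis using sepol_imp_sep by blast
  qed
qed

declare omega.simps(2) [simp del]

section \<open>Comparison with topological recursion\<close>

lemma xz_inverse: "xz (1 / z) = xz z"
  by (simp add: xz_def)

lemma inverse_generic:
  assumes "z \<notin> {0, 1, - 1 :: complex}"
  shows "1 / z \<notin> {0, 1, - 1}"
proof
  assume "1 / z \<in> {0, 1, - 1}"
  then consider "1 / z = 0" | "1 / z = 1" | "1 / z = - 1" by auto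
  thus False
  proof cases
    case 3
    have "z * (1 / z) = - z" unfolding 3 by simp
    hence "1 = - z" using assms by simp
    hence "z = - 1" by (metis minus_minus)
    thus False using assms by simp
  qed (use assms in auto)
qed

lemma xz_eq_iff:
  assumes "z \<noteq> 0" "w \<noteq> 0"
  shows "xz z = xz w \<longleftrightarrow> z = w \<or> z * w = 1"
proof -
  have "z * w * (xz z - xz w) = (z - w) * (z * w - 1)"
    using assms by (simp add: xz_def field_simps)
  thus ?thesis using assms by (metis eq_iff_diff_eq_0 mult_eq_0_iff)
qed

lemma xz_branch_value: "z \<noteq> 0 \<Longrightarrow> z \<noteq> 1 \<Longrightarrow> z \<noteq> - 1 \<Longrightarrow> xz z \<notin> {2, - 2}"
  using uz_nz[of z] uz_sq[of z] sq4_eq_0_iff[of "xz z"] by auto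

lemma stable_ge2: "stable g n \<Longrightarrow> 2 \<le> 2 * g + n"
  by (cases "g = 0") (auto simp: stable_def)

lemma spl_swap: "spl f xs = spl (\<lambda>a b. f b a) xs"
proof (induction xs arbitrary: f)
  case (Cons x xs)
  show ?case
    using Cons.IH[of "\<lambda>a b. f (x # a) b"] Cons.IH[of "\<lambda>a b. f a (x # b)"] by (simp add: add.commute)
qed auto

lemma spl_cong_mset:
  assumes "\<And>a b. mset a + mset b = mset xs \<Longrightarrow> f a b = g a b"
  shows "spl f xs = spl g xs"
  using assms
proof (induction xs arbitrary: f g)
  case (Cons x xs)
  show ?case unfolding spl.simps
    by (intro arg_cong2[of _ _ _ _ "(+)"] Cons.IH) (auto intro!: Cons.prems)
qed auto

lemma bergman_eq_beta:
  assumes "z \<noteq> 0" "w \<noteq> 0" "xz z \<noteq> xz w"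
  shows "z * w * bergman z w + w / z * bergman (1 / z) w = 2 * beta (xz z) (xz w)"
proof -
  have ne: "z - w \<noteq> 0" "z * w - 1 \<noteq> 0" using assms xz_eq_iff[of z w] by auto
  have "xz z - xz w = (z - w) * (z * w - 1) / (z * w)"
    using assms by (simp add: xz_def field_simps)
  hence X: "(xz z - xz w)\<^sup>2 = (z - w)\<^sup>2 * (z * w - 1)\<^sup>2 / (z * w)\<^sup>2"
    by (simp add: power_divide power_mult_distrib)
  have b1: "z * w * bergman z w = z * w / (z - w)\<^sup>2" by (simp add: bergman_def)
  have "1 / z - w = - (z * w - 1) / z" using assms by (simp add: field_simps)
  hence "(1 / z - w)\<^sup>2 = (z * w - 1)\<^sup>2 / z\<^sup>2" by (simp add: power_divide power2_commute)
  hence b2: "w / z * bergman (1 / z) w = z * w / (z * w - 1)\<^sup>2"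
  proof -
    have "w / z * (1 / (Q / z\<^sup>2)) = z * w / Q" for Q
      using assms by (simp add: power2_eq_square)
    thus ?thesis unfolding bergman_def \<open>(1 / z - w)\<^sup>2 = (z * w - 1)\<^sup>2 / z\<^sup>2\<close> .
  qed
  have "2 * beta (xz z) (xz w) = (xz z * xz w - 4) * (z * w)\<^sup>2 / ((z - w)\<^sup>2 * (z * w - 1)\<^sup>2)"
    using ne by (simp add: beta_def X)
  also have "(xz z * xz w - 4) * (z * w)\<^sup>2 = z * w * ((z - w)\<^sup>2 + (z * w - 1)\<^sup>2)"
    using assms by (simp add: xz_def field_simps power2_eq_square)
  also have "\<dots> / ((z - w)\<^sup>2 * (z * w - 1)\<^sup>2) = z * w / (z - w)\<^sup>2 + z * w / (z * w - 1)\<^sup>2"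
    using ne by (simp add: field_simps)
  finally show ?thesis unfolding b1 b2 by (simp only:)
qed

text \<open>The complement of \<open>beta\<close>: the part of the Bergman kernel that is even under
  conjugation as a form. It carries the factor \<open>uz z\<close>, so a product of two such parts
  contains \<open>x^2 - 4\<close> and cancels the pole of the recursion kernel.\<close>

lemma bergman_diff_beta:
  assumes "z \<noteq> 0" "w \<noteq> 0" "xz z \<noteq> xz w"
  shows "z * w * bergman z w - w / z * bergman (1 / z) w = uz z * uz w / (xz z - xz w)\<^sup>2"
proof -
  have ne: "z - w \<noteq> 0" "z * w - 1 \<noteq> 0" using assms xz_eq_iff[of z w] by auto
  have "xz z - xz w = (z - w) * (z * w - 1) / (z * w)"
    using assms by (simp add: xz_def field_simps)
  hence X: "(xz z - xz w)\<^sup>2 = (z - w)\<^sup>2 * (z * w - 1)\<^sup>2 / (z * w)\<^sup>2"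
    by (simp add: power_divide power_mult_distrib)
  have b1: "z * w * bergman z w = z * w / (z - w)\<^sup>2" by (simp add: bergman_def)
  have "1 / z - w = - (z * w - 1) / z" using assms by (simp add: field_simps)
  hence "(1 / z - w)\<^sup>2 = (z * w - 1)\<^sup>2 / z\<^sup>2" by (simp add: power_divide power2_commute)
  hence b2: "w / z * bergman (1 / z) w = z * w / (z * w - 1)\<^sup>2"
  proof -
    have "w / z * (1 / (Q / z\<^sup>2)) = z * w / Q" for Q
      using assms by (simp add: power2_eq_square)
    thus ?thesis unfolding bergman_def \<open>(1 / z - w)\<^sup>2 = (z * w - 1)\<^sup>2 / z\<^sup>2\<close> .
  qed
  have "uz z * uz w / (xz z - xz w)\<^sup>2 = uz z * uz w * (z * w)\<^sup>2 / ((z - w)\<^sup>2 * (z * w - 1)\<^sup>2)"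
    using ne by (simp add: X)
  also have "uz z * uz w * (z * w)\<^sup>2 = z * w * ((z * w - 1)\<^sup>2 - (z - w)\<^sup>2)"
    using assms by (simp add: uz_def field_simps power2_eq_square)
  also have "\<dots> / ((z - w)\<^sup>2 * (z * w - 1)\<^sup>2) = z * w / (z - w)\<^sup>2 - z * w / (z * w - 1)\<^sup>2"
    using ne by (simp add: field_simps)
  finally show ?thesis unfolding b1 b2 by (simp only:)
qed

lemma contour_integral_bergman:
  assumes "z0 \<notin> closed_segment a b"
  shows "contour_integral (linepath a b) (\<lambda>w. bergman w z0) = 1 / (a - z0) - 1 / (b - z0)"
proof -
  have "((\<lambda>w. bergman w z0) has_contour_integral
          (- 1 / (pathfinish (linepath a b) - z0)) - (- 1 / (pathstart (linepath a b) - z0))) (linepath a b)"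
  proof (rule contour_integral_primitive)
    show "((\<lambda>w. - 1 / (w - z0)) has_field_derivative bergman w z0) (at w within closed_segment a b)"
      if "w \<in> closed_segment a b" for w
      using that assms by (auto intro!: derivative_eq_intros simp: bergman_def power2_eq_square)
  qed auto
  from contour_integral_unique[OF this] show ?thesis by simp
qed

text \<open>Conjugation fixes \<open>r\<close>, so both end points enter every ball around
  \<open>r\<close>, and a ball that misses \<open>z0\<close> contains the whole segment.\<close>

lemma eventually_segment:
  assumes r: "r \<in> JM_branch_points" and "z0 \<noteq> r"
  shows "eventually (\<lambda>z. z0 \<notin> closed_segment z (1 / z)) (at r)"
proof -
  have "((\<lambda>z. z) \<longlongrightarrow> r) (at r)" by (rule tendsto_ident_at)
  moreover have "((\<lambda>z. 1 / z) \<longlongrightarrow> 1 / r) (at r)"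
    using branch_nz[OF r] by (intro tendsto_intros) auto
  moreover have "1 / r = r" using r by (auto simp: JM_branch_points_def)
  moreover have "r \<in> ball r (dist r z0)" using assms(2) by simp
  ultimately have "eventually (\<lambda>z. z \<in> ball r (dist r z0)) (at r)"
     "eventually (\<lambda>z. 1 / z \<in> ball r (dist r z0)) (at r)"
    using topological_tendstoD[OF _ open_ball, of "\<lambda>z. z" r "at r"]
      topological_tendstoD[OF _ open_ball, of "\<lambda>z. 1 / z" r "at r"] by simp_all
  thus ?thesis
  proof eventually_elim
    case (elim z)
    hence "closed_segment z (1 / z) \<subseteq> ball r (dist r z0)"
      by (intro closed_segment_subset) auto
    thus ?case by auto
  qed
qed

section \<open>Topological recursion on the Jimbo-Miwa curve\<close>

context
  fixes q \<gamma> \<theta> e :: complex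
  assumes q: "q \<noteq> 0" and \<theta>: "\<theta> \<noteq> 0" and \<gamma>: "(2 * \<gamma>)\<^sup>2 = - \<theta> / q"
    and e_def: "e = \<gamma> / (2 * q)"
begin

lemma gamma_sq: "4 * q * \<gamma>\<^sup>2 = - \<theta>"
  using \<gamma> q by (simp add: field_simps)

lemma deriv_JM_x: "z \<noteq> 0 \<Longrightarrow> deriv (JM_x q \<gamma>) z = \<gamma> * (1 - 1 / z\<^sup>2)"
proof -
  assume z: "z \<noteq> 0"
  have "((\<lambda>z. - q + \<gamma> * xz z) has_field_derivative \<gamma> * (1 - 1 / z\<^sup>2)) (at z)"
    using z by (auto intro!: derivative_eq_intros xz_deriv)
  moreover have "JM_x q \<gamma> = (\<lambda>z. - q + \<gamma> * xz z)" by (simp add: JM_x_def[abs_def] xz_def)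
  ultimately show ?thesis by (simp add: DERIV_imp_deriv)
qed

text \<open>Here the relation between \<open>\<gamma>\<close>, \<open>q\<close> and
  \<open>\<theta>\<close> enters: it leaves \<open>\<theta>\<close> and \<open>e\<close> as the only
  parameters of the form \<open>y dx\<close>.\<close>

lemma ydx_JM:
  assumes z: "z \<noteq> 0"
  shows "JM_y q \<gamma> z * deriv (JM_x q \<gamma>) z = \<theta> / 2 * (1 - e * xz z) * ((xz z)\<^sup>2 - 4) / z"
proof -
  have u: "1 - 1 / z\<^sup>2 = uz z / z" using z by (simp add: uz_def field_simps power2_eq_square)
  have "- 2 * q + \<gamma> * xz z = - 2 * q * (1 - e * xz z)" using q by (simp add: e_def field_simps)
  hence "JM_y q \<gamma> z * deriv (JM_x q \<gamma>) z = (\<gamma> * uz z * (- 2 * q * (1 - e * xz z))) * (\<gamma> * (uz z / z))"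
    by (simp add: JM_y_def deriv_JM_x[OF z] u uz_def xz_def)
  also have "\<dots> = (4 * q * \<gamma>\<^sup>2) * (- 1 / 2) * (1 - e * xz z) * (uz z)\<^sup>2 / z"
    by (simp add: power2_eq_square)
  finally show ?thesis unfolding gamma_sq uz_sq[OF z] by simp
qed

text \<open>\<open>y\<close> is odd under conjugation, so the denominator is twice
  \<open>y dx\<close>. The derivative of the conjugation is absorbed into the kernel, since each
  term of the bracket contains exactly one conjugate argument.\<close>

lemma kernel_JM:
  assumes z: "z \<noteq> 0" "z0 \<noteq> 0" and seg: "z0 \<notin> closed_segment z (1 / z)"
  shows "recursion_kernel (JM_x q \<gamma>) (JM_y q \<gamma>) (\<lambda>z. 1 / z) z0 z * deriv (\<lambda>z. 1 / z) z =
         1/2 * ((1 - 1 / z\<^sup>2) / (xz z0 - xz z)) / (\<theta> * z0 * (((xz z)\<^sup>2 - 4) * (1 - e * xz z)))"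
proof -
  have u: "1 - 1 / z\<^sup>2 = uz z / z" using z by (simp add: uz_def field_simps power2_eq_square)
  have d: "deriv (\<lambda>z. 1 / z) z = - 1 / z\<^sup>2"
    using z by (intro DERIV_imp_deriv) (auto intro!: derivative_eq_intros simp: power2_eq_square)
  have ys: "JM_y q \<gamma> (1 / z) = - JM_y q \<gamma> z" by (simp add: JM_y_def algebra_simps)
  have den: "(JM_y q \<gamma> z - JM_y q \<gamma> (1 / z)) * deriv (JM_x q \<gamma>) z = \<theta> * (1 - e * xz z) * ((xz z)\<^sup>2 - 4) / z"
  proof -
    have t: "(Y - - Y) * D = 2 * (Y * D)" for Y D :: complex by simp
    show ?thesis unfolding ys t ydx_JM[OF z(1)] by simp
  qed
  have ne: "z - z0 \<noteq> 0" "1 / z - z0 \<noteq> 0" using seg by auto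
  have "(z - z0) * (1 / z - z0) = z0 * (xz z0 - xz z)"
    using z by (simp add: xz_def field_simps)
  moreover have "1 / (z - z0) - 1 / (1 / z - z0) = - uz z / ((z - z0) * (1 / z - z0))"
  proof -
    have "1 / (z - z0) - 1 / (1 / z - z0) = ((1 / z - z0) - (z - z0)) / ((z - z0) * (1 / z - z0))"
      using diff_frac_eq[OF ne, of 1 1] by (simp only: mult_1)
    thus ?thesis by (simp add: uz_def)
  qed
  ultimately have c: "contour_integral (linepath z (1 / z)) (\<lambda>w. bergman w z0) = - uz z / (z0 * (xz z0 - xz z))"
    using contour_integral_bergman[OF seg] by simp
  have "1/2 * (- v / (z0 * A)) / (\<theta> * B * S / z) * (- 1 / z\<^sup>2) = 1/2 * ((v / z) / A) / (\<theta> * z0 * (S * B))"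
    for v A B S :: complex
    using z by (simp add: power2_eq_square)
  thus ?thesis unfolding recursion_kernel_def den c d u .
qed

abbreviation om :: "nat \<Rightarrow> complex list \<Rightarrow> complex" where
  "om \<equiv> omega (JM_x q \<gamma>) (JM_y q \<gamma>) (\<lambda>z. 1 / z) JM_branch_points"

lemma om_0_single: "om 0 [z, w] = bergman z w"
  by (subst omega.simps) simp

text \<open>A point \<open>w\<close> enters the recursion for \<open>Fm\<close> as the kernel with
  one end at \<open>x(w)\<close>.\<close>

definition psv :: "complex list \<Rightarrow> (complex \<Rightarrow> complex) list" where
  "psv zs = map (\<lambda>w X. beta X (xz w)) zs"

text \<open>The form \<open>y dx\<close> is replaced by zero, so that the sum may run over all
  splittings.\<close>

definition om' :: "nat \<Rightarrow> complex \<Rightarrow> complex list \<Rightarrow> complex" where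
  "om' h z a = (if h = 0 \<and> a = [] then 0 else om h (z # a))"

definition bracket :: "nat \<Rightarrow> complex list \<Rightarrow> complex \<Rightarrow> complex" where
  "bracket g zs z = (if g = 0 then 0 else om (g - 1) (z # 1 / z # zs)) +
     (\<Sum>h\<le>g. spl (\<lambda>a b. om' h z a * om' (g - h) (1 / z) b) zs)"

lemma om_rec:
  assumes "stable g (length zs)"
  shows "om g (z0 # zs) = res1 (\<lambda>z. recursion_kernel (JM_x q \<gamma>) (JM_y q \<gamma>) (\<lambda>z. 1 / z) z0 z
      * bracket g zs z * deriv (\<lambda>z. 1 / z) z)"
proof -
  have "(\<Sum>(h, I)\<in>splittings g (length zs). om h (z # nths zs I) *
           om (g - h) (1 / z # nths zs ({..<length zs} - I))) =
        (\<Sum>(h, I)\<in>splittings g (length zs). om' h z (nths zs I) *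
           om' (g - h) (1 / z) (nths zs ({..<length zs} - I)))" for z
  proof (rule sum.cong[OF refl], safe, goal_cases)
    case (1 h I)
    hence I: "I \<subseteq> {..<length zs}" and h: "h = 0 \<Longrightarrow> I \<noteq> {}" "g - h = 0 \<Longrightarrow> {..<length zs} - I \<noteq> {}"
      by (auto simp: splittings_def)
    have ne: "nths zs J \<noteq> []" if "J \<subseteq> {..<length zs}" "J \<noteq> {}" for J
    proof -
      have "card J > 0" using that finite_subset[OF that(1)] by (simp add: card_gt_0_iff)
      thus ?thesis using length_nths_subset[OF that(1)] by auto
    qed
    have "nths zs I \<noteq> []" if "h = 0" by (rule ne[OF I h(1)[OF that]])
    moreover have "nths zs ({..<length zs} - I) \<noteq> []" if "g - h = 0"
      by (rule ne[OF Diff_subset h(2)[OF that]])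
    ultimately have "om' h z (nths zs I) = om h (z # nths zs I)"
      "om' (g - h) (1 / z) (nths zs ({..<length zs} - I)) = om (g - h) (1 / z # nths zs ({..<length zs} - I))"
      unfolding om'_def by (metis (no_types))+
    thus ?case by (simp only:)
  qed
  also have "(\<Sum>(h, I)\<in>splittings g (length zs). om' h z (nths zs I) *
           om' (g - h) (1 / z) (nths zs ({..<length zs} - I))) =
        (\<Sum>h\<le>g. spl (\<lambda>a b. om' h z a * om' (g - h) (1 / z) b) zs)" for z
    by (rule splittings_sum) (auto simp: om'_def)
  finally have S: "(\<Sum>(h, I)\<in>splittings g (length zs). om h (z # nths zs I) *
           om (g - h) (1 / z # nths zs ({..<length zs} - I))) =
        (\<Sum>h\<le>g. spl (\<lambda>a b. om' h z a * om' (g - h) (1 / z) b) zs)" for z .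
  have "\<not> (g = 0 \<and> length zs = 0)" "\<not> (g = 0 \<and> length zs = 1)"
    using assms by (auto simp: stable_def)
  thus ?thesis
    by (subst omega.simps(2)) (simp only: if_False S res1_def bracket_def)
qed

text \<open>A stable form, written with \<open>dz/z\<close>, has a coefficient depending on
  \<open>x\<close> only, hence the same at \<open>z\<close> and \<open>1/z\<close>. For a Bergman
  factor, the two placements of \<open>z\<close> and \<open>1/z\<close> together select
  \<open>beta\<close>. Two Bergman factors are excluded by the last assumption, since their even
  parts would survive. The exponents of \<open>\<theta>\<close> add up to two less than
  \<open>2 g + n\<close>; the kernel supplies one more power.\<close>

lemma term_sym:
  assumes st: "\<And>u. stable h (length a) \<Longrightarrow> u \<notin> {0, 1, - 1} \<Longrightarrow>
        om h (u # a) * u * prod_list a * \<theta> ^ (2 * h + length a - 1) = Fm e h (psv a) (xz u)"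
    and st': "\<And>u. stable k (length b) \<Longrightarrow> u \<notin> {0, 1, - 1} \<Longrightarrow>
        om k (u # b) * u * prod_list b * \<theta> ^ (2 * k + length b - 1) = Fm e k (psv b) (xz u)"
    and z: "z \<notin> {0, 1, - 1}" and w: "\<And>w. w \<in> set a \<union> set b \<Longrightarrow> w \<notin> {0, 1, - 1} \<and> xz z \<noteq> xz w"
    and ns: "stable h (length a) \<or> h = 0 \<and> a = [] \<or> stable k (length b) \<or> k = 0 \<and> b = []"
  shows "(om' h z a * om' k (1 / z) b + om' k z b * om' h (1 / z) a) * (prod_list a * prod_list b)
          * \<theta> ^ (2 * (h + k) + (length a + length b) - 2) =
         2 * Fm e h (psv a) (xz z) * Fm e k (psv b) (xz z)"
proof (cases "h = 0 \<and> a = [] \<or> k = 0 \<and> b = []")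
  case True
  thus ?thesis by (auto simp: om'_def psv_def)
next
  case False
  define x where "x = xz z"
  define c where "c = (\<lambda>h a. \<theta> ^ (2 * h + length (a :: complex list) - 1))"
  have z': "1 / z \<notin> {0, 1, - 1}" using z by (rule inverse_generic)
  have 1: "2 * h + length a \<ge> 1" "2 * k + length b \<ge> 1" using False
    by (metis One_nat_def Suc_leI add_gr_0 length_greater_0_conv mult_pos_pos neq0_conv pos2)+
  hence c: "\<theta> ^ (2 * (h + k) + (length a + length b) - 2) = c h a * c k b"
    unfolding c_def power_add[symmetric] by (intro arg_cong2[of _ _ _ _ "(^)"]) auto
  have om'_om: "om' h u a = om h (u # a)" "om' k u b = om k (u # b)" for u
    using False by (auto simp: om'_def)
  \<comment> \<open>The mixed case: a Bergman factor with the single point \<open>v\<close> and a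
    stable factor.\<close>
  have gen: "(om l (z # [v]) * om m (1 / z # d) + om m (z # d) * om l (1 / z # [v])) * (v * prod_list d) * (1 * c m d)
      = 2 * beta x (xz v) * Fm e m (psv d) x"
    if "l = 0" "stable m (length d)" "v \<notin> {0, 1, - 1}" "xz z \<noteq> xz v" and
      st: "\<And>u. u \<notin> {0, 1, - 1} \<Longrightarrow> om m (u # d) * u * prod_list d * c m d = Fm e m (psv d) (xz u)" for l m v d
  proof -
    have a1: "om m (z # d) * prod_list d * c m d = Fm e m (psv d) x / z"
      using st[OF z] z by (simp add: x_def field_simps)
    have a2: "om m (1 / z # d) * prod_list d * c m d = Fm e m (psv d) x * z"
      using st[OF z'] z by (simp add: x_def xz_inverse field_simps)
    have "(om l (z # [v]) * om m (1 / z # d) + om m (z # d) * om l (1 / z # [v])) * (v * prod_list d) * (1 * c m d) =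
      v * bergman z v * (om m (1 / z # d) * prod_list d * c m d) + v * bergman (1 / z) v * (om m (z # d) * prod_list d * c m d)"
      using that(1) by (simp add: om_0_single algebra_simps)
    also have "\<dots> = (z * v * bergman z v + v / z * bergman (1 / z) v) * Fm e m (psv d) x"
      unfolding a1 a2 by (simp add: algebra_simps)
    also have "\<dots> = 2 * beta x (xz v) * Fm e m (psv d) x"
      using bergman_eq_beta[of z v] z that by (simp add: x_def)
    finally show ?thesis .
  qed
  show ?thesis
  proof (cases "stable h (length a) \<and> stable k (length b)")
    case True
    have s: "om h (u # a) * prod_list a * c h a = Fm e h (psv a) (xz u) / u"
            "om k (u # b) * prod_list b * c k b = Fm e k (psv b) (xz u) / u" if "u \<notin> {0, 1, - 1}" for u
      using st[of u] st'[of u] True that unfolding c_def by (auto simp: field_simps)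
    have "(om' h z a * om' k (1 / z) b + om' k z b * om' h (1 / z) a) * (prod_list a * prod_list b) * (c h a * c k b) =
      (om h (z # a) * prod_list a * c h a) * (om k (1 / z # b) * prod_list b * c k b) +
      (om k (z # b) * prod_list b * c k b) * (om h (1 / z # a) * prod_list a * c h a)"
      unfolding om'_om by (simp add: algebra_simps)
    also have "\<dots> = 2 * Fm e h (psv a) x * Fm e k (psv b) x"
      unfolding s[OF z] s[OF z'] xz_inverse x_def using z by simp
    finally show ?thesis unfolding c x_def .
  next
    case unst: False
    show ?thesis
    proof (cases "stable h (length a)")
      case True
      hence "\<not> stable k (length b)" using unst by blast
      then obtain v where v: "k = 0" "b = [v]" using False not_stable_iff[of k b] by auto
      hence cv: "c k b = 1" by (simp add: c_def)
      have "(om k (z # [v]) * om h (1 / z # a) + om h (z # a) * om k (1 / z # [v])) * (v * prod_list a) * (1 * c h a)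
            = 2 * beta x (xz v) * Fm e h (psv a) x"
        by (rule gen) (use v True w[of v] st in \<open>auto simp: c_def\<close>)
      thus ?thesis unfolding c cv om'_om using v by (simp add: x_def psv_def mult_ac add.commute)
    next
      case ua: False
      then obtain v where v: "h = 0" "a = [v]" using False not_stable_iff[of h a] by auto
      hence cv: "c h a = 1" by (simp add: c_def)
      have sb: "stable k (length b)" using ns False ua by auto
      have "(om h (z # [v]) * om k (1 / z # b) + om k (z # b) * om h (1 / z # [v])) * (v * prod_list b) * (1 * c k b)
            = 2 * beta x (xz v) * Fm e k (psv b) x"
        by (rule gen) (use v sb w[of v] st' in \<open>auto simp: c_def\<close>)
      thus ?thesis unfolding c cv om'_om using v by (simp add: x_def psv_def mult_ac add.commute)
    qed
  qed
qed

lemma psv_anl: "\<forall>w\<in>set zs. w \<notin> {0, 1, - 1} \<Longrightarrow> b \<in> set (psv zs) \<Longrightarrow> anl b"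
  unfolding psv_def using anl_beta xz_branch_value by auto

lemma eventually_generic:
  assumes "r \<in> JM_branch_points" "\<forall>w\<in>set zs. w \<notin> {0, 1, - 1}"
  shows "eventually (\<lambda>z. z \<notin> {0, 1, - 1} \<and> (\<forall>w\<in>set zs. xz z \<noteq> xz w)) (at r)"
proof -
  have "eventually (\<lambda>z. \<forall>w\<in>set zs. xz z \<noteq> xz w) (at r)"
    by (intro eventually_ball_finite ballI eventually_bp_xz[OF eventually_bp_neq assms(1)]) auto
  with eventually_branch[OF assms(1)] show ?thesis by eventually_elim auto
qed

text \<open>Exchanging the two factors turns the sum into symmetric pairs. Genus 0 with two points
  is the only case with two Bergman factors; there the product of their even parts leaves the
  regular remainder \<open>R\<close>.\<close>

lemma bracket_Qm:
  assumes IH: "\<And>h a u. stable h (length a) \<Longrightarrow> 2 * h + length a < 2 * g + length zs \<Longrightarrow> u \<notin> {0, 1, - 1} \<Longrightarrow>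
      \<forall>w\<in>set a. w \<notin> {0, 1, - 1} \<Longrightarrow>
      om h (u # a) * u * prod_list a * \<theta> ^ (2 * h + length a - 1) = Fm e h (psv a) (xz u)"
    and st: "stable g (length zs)" and zs: "\<forall>w\<in>set zs. w \<notin> {0, 1, - 1}"
  shows "\<exists>R. mer 0 R \<and> (\<forall>r\<in>JM_branch_points. eventually (\<lambda>z.
     bracket g zs z * prod_list zs * \<theta> ^ (2 * g + length zs - 2) =
     Qm e g (psv zs) (xz z) + ((xz z)\<^sup>2 - 4) * R (xz z)) (at r))"
proof (cases "g = 0 \<and> length zs = 2")
  case True
  then obtain w1 w2 where w: "zs = [w1, w2]" and g: "g = 0"
    by (auto simp: numeral_2_eq_2 length_Suc_conv)
  have w12: "w1 \<notin> {0, 1, - 1}" "w2 \<notin> {0, 1, - 1}" using zs w by auto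
  \<comment> \<open>The even parts enter through
    \<open>A B' + A' B = ((A + B)(A' + B') - (A - B)(A' - B')) / 2\<close>; division of the second
    product by \<open>x^2 - 4\<close> leaves \<open>R\<close>.\<close>
  define R where "R = (\<lambda>x. - 1 / 2 * (uz w1 * uz w2) / ((x - xz w1)\<^sup>2 * (x - xz w2)\<^sup>2))"
  have "mer 0 R" unfolding R_def
    using xz_branch_value[of w1] xz_branch_value[of w2] w12
    by (intro mer_analytic analytic_intros) auto
  moreover have "eventually (\<lambda>z. bracket g zs z * prod_list zs * \<theta> ^ (2 * g + length zs - 2) =
     Qm e g (psv zs) (xz z) + ((xz z)\<^sup>2 - 4) * R (xz z)) (at r)" if r: "r \<in> JM_branch_points" for r
    using eventually_generic[OF r zs]
  proof eventually_elim
    case (elim z)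
    define A B where "A = (\<lambda>w. z * w * bergman z w)" and "B = (\<lambda>w. w / z * bergman (1 / z) w)"
    have AB: "A v + B v = 2 * beta (xz z) (xz v)" "A v - B v = uz z * uz v / (xz z - xz v)\<^sup>2"
      if "v \<in> {w1, w2}" for v
      using bergman_eq_beta[of z v] bergman_diff_beta[of z v] elim w that w12 by (auto simp: A_def B_def)
    have "bracket g zs z * prod_list zs * \<theta> ^ (2 * g + length zs - 2) = A w1 * B w2 + A w2 * B w1"
      using elim by (simp add: bracket_def g w om'_def om_0_single A_def B_def field_simps)
    also have "\<dots> = 1 / 2 * ((A w1 + B w1) * (A w2 + B w2) - (A w1 - B w1) * (A w2 - B w2))"
      by (simp add: algebra_simps)
    also have "\<dots> = 2 * beta (xz z) (xz w1) * beta (xz z) (xz w2) - 1 / 2 * ((uz z)\<^sup>2 * uz w1 * uz w2 / ((xz z - xz w1)\<^sup>2 * (xz z - xz w2)\<^sup>2))"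
      unfolding AB[of w1, simplified] AB[of w2, simplified] by (simp add: power2_eq_square)
    also have "2 * beta (xz z) (xz w1) * beta (xz z) (xz w2) = Qm e g (psv zs) (xz z)"
      by (simp add: Qm_def diag_def g w psv_def)
    finally show ?case using elim by (simp add: R_def uz_sq)
  qed
  ultimately show ?thesis by blast
next
  case False
  have "eventually (\<lambda>z. bracket g zs z * prod_list zs * \<theta> ^ (2 * g + length zs - 2) =
     Qm e g (psv zs) (xz z) + ((xz z)\<^sup>2 - 4) * 0) (at r)" if r: "r \<in> JM_branch_points" for r
    using eventually_generic[OF r zs]
  proof eventually_elim
    case (elim z)
    define C where "C = prod_list zs * \<theta> ^ (2 * g + length zs - 2)"
    have z': "1 / z \<notin> {0, 1, - 1}" using elim by (intro inverse_generic) auto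
    have D: "(if g = 0 then 0 else om (g - 1) (z # 1 / z # zs)) * C = diag e g (psv zs) (xz z)"
    proof (cases "g = 0 \<or> g = 1 \<and> zs = []")
      case True
      have "bergman z (1 / z) = 1 / ((xz z)\<^sup>2 - 4)"
        using elim uz_sq[of z] by (simp add: bergman_def uz_def)
      thus ?thesis using True by (auto simp: diag_def C_def psv_def om_0_single)
    next
      case False
      have "om (g - 1) (z # 1 / z # zs) * z * prod_list (1 / z # zs) * \<theta> ^ (2 * (g - 1) + length (1 / z # zs) - 1)
         = Fm e (g - 1) (psv (1 / z # zs)) (xz z)"
        using False elim z' zs stable_diag[of g zs] by (intro IH) auto
      moreover have "2 * (g - 1) + length (1 / z # zs) - 1 = 2 * g + length zs - 2" using False by auto
      moreover have "psv (1 / z # zs) = (\<lambda>X. beta X (xz z)) # psv zs"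
        by (simp add: psv_def xz_inverse)
      ultimately show ?thesis using False elim by (auto simp: diag_def C_def psv_def mult.assoc)
    qed
    \<comment> \<open>Reflecting \<open>h\<close> to \<open>g - h\<close> and swapping the two lists
      represents the sum a second time; half the total consists of symmetric pairs.\<close>
    define t where "t = (\<lambda>h k a b. om' h z a * om' k (1 / z) b)"
    have "(\<Sum>h\<le>g. spl (\<lambda>a b. t h (g - h) a b) zs) = (\<Sum>h\<le>g. spl (\<lambda>a b. t (g - h) h a b) zs)"
      by (rule sum.reindex_bij_witness[of _ "\<lambda>h. g - h" "\<lambda>h. g - h"]) auto
    also have "\<dots> = (\<Sum>h\<le>g. spl (\<lambda>a b. t (g - h) h b a) zs)"
      by (intro sum.cong refl spl_swap)
    finally have "2 * (\<Sum>h\<le>g. spl (\<lambda>a b. t h (g - h) a b) zs) =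
      (\<Sum>h\<le>g. spl (\<lambda>a b. t h (g - h) a b + t (g - h) h b a) zs)"
      by (simp add: spl_add sum.distrib)
    hence "2 * (\<Sum>h\<le>g. spl (\<lambda>a b. t h (g - h) a b) zs) * C =
      (\<Sum>h\<le>g. spl (\<lambda>a b. C * (t h (g - h) a b + t (g - h) h b a)) zs)"
      by (simp add: spl_cmult sum_distrib_left sum_distrib_right mult.commute)
    also have "\<dots> = (\<Sum>h\<le>g. spl (\<lambda>a b. 2 * (Fm e h (psv a) (xz z) * Fm e (g - h) (psv b) (xz z))) zs)"
    proof (intro sum.cong refl spl_cong_mset)
      fix h a b assume h: "h \<in> {..g}" and m: "mset a + mset b = mset zs"
      have l: "length a + length b = length zs" using m by (metis size_mset size_union)
      have ss: "set a \<union> set b = set zs" using m by (metis set_mset_mset set_mset_union)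
      have p: "prod_list zs = prod_list a * prod_list b" using m
        by (metis prod_mset.union prod_mset_prod_list)
      from h have "h \<le> g" by simp
      thus "C * (t h (g - h) a b + t (g - h) h b a) = 2 * (Fm e h (psv a) (xz z) * Fm e (g - h) (psv b) (xz z))"
        using l
      proof (cases rule: Fm_prod_cases)
        case 3
        have "(om' h z a * om' (g - h) (1 / z) b + om' (g - h) z b * om' h (1 / z) a) * (prod_list a * prod_list b)
          * \<theta> ^ (2 * (h + (g - h)) + (length a + length b) - 2) =
         2 * Fm e h (psv a) (xz z) * Fm e (g - h) (psv b) (xz z)"
        proof (rule term_sym)
          show "stable h (length a) \<or> h = 0 \<and> a = [] \<or> stable (g - h) (length b) \<or> g - h = 0 \<and> b = []"
            using False l \<open>h \<le> g\<close> by (auto simp: stable_def length_Suc_conv)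
          show "om h (u # a) * u * prod_list a * \<theta> ^ (2 * h + length a - 1) = Fm e h (psv a) (xz u)"
            if "stable h (length a)" "u \<notin> {0, 1, - 1}" for u
            using IH[OF that(1) 3(1) that(2)] zs ss by blast
          show "om (g - h) (u # b) * u * prod_list b * \<theta> ^ (2 * (g - h) + length b - 1) = Fm e (g - h) (psv b) (xz u)"
            if "stable (g - h) (length b)" "u \<notin> {0, 1, - 1}" for u
            using IH[OF that(1) 3(2) that(2)] zs ss by blast
        qed (use elim zs ss in auto)
        moreover have "2 * (h + (g - h)) + (length a + length b) - 2 = 2 * g + length zs - 2" using h l by simp
        ultimately show ?thesis by (simp add: C_def t_def p mult_ac)
      qed (auto simp: t_def om'_def psv_def)
    qed
    also have "\<dots> = 2 * (\<Sum>h\<le>g. spl (\<lambda>a b. Fm e h (psv a) (xz z) * Fm e (g - h) (psv b) (xz z)) zs)"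
      by (simp add: spl_cmult sum_distrib_left)
    also have "\<dots> = 2 * (\<Sum>h\<le>g. spl (\<lambda>a b. Fm e h a (xz z) * Fm e (g - h) b (xz z)) (psv zs))"
      unfolding psv_def spl_map ..
    finally have S: "(\<Sum>h\<le>g. spl (\<lambda>a b. t h (g - h) a b) zs) * C =
       (\<Sum>h\<le>g. spl (\<lambda>a b. Fm e h a (xz z) * Fm e (g - h) b (xz z)) (psv zs))" by simp
    have "bracket g zs z * C = Qm e g (psv zs) (xz z)"
      unfolding bracket_def distrib_right D Qm_def using S by (simp add: t_def)
    thus ?case by (simp add: C_def mult.assoc)
  qed
  thus ?thesis using mer_const[of 0] by blast
qed

text \<open>Regular remainders are lost in the projection, so the induction only has to match
  brackets. Each kernel contributes one factor \<open>1 / \<theta>\<close>, which produces the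
  homogeneity exponent.\<close>

theorem omega_Fm:
  assumes e: "e \<in> ball 0 (1/4)"
  shows "stable g (length zs) \<Longrightarrow> z0 \<notin> {0, 1, - 1} \<Longrightarrow> \<forall>w\<in>set zs. w \<notin> {0, 1, - 1} \<Longrightarrow>
     om g (z0 # zs) * z0 * prod_list zs * \<theta> ^ (2 * g + length zs - 1) = Fm e g (psv zs) (xz z0)"
proof (induction "2 * g + length zs" arbitrary: g zs z0 rule: less_induct)
  case less
  obtain R where R: "mer 0 R" "\<And>r. r \<in> JM_branch_points \<Longrightarrow> eventually (\<lambda>z.
     bracket g zs z * prod_list zs * \<theta> ^ (2 * g + length zs - 2) =
     Qm e g (psv zs) (xz z) + ((xz z)\<^sup>2 - 4) * R (xz z)) (at r)"
    using bracket_Qm[of g zs, OF less.hyps] less.prems by (auto simp: less.prems)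
  define C where "C = prod_list zs * \<theta> ^ (2 * g + length zs - 2)"
  have "0 \<notin> set zs" using less.prems(3) by auto
  hence pz: "prod_list zs \<noteq> 0" by (simp add: prod_list_zero_iff)
  have C: "C \<noteq> 0" using pz \<theta> by (simp add: C_def)
  define f where "f = (\<lambda>x. Qm e g (psv zs) x / ((x\<^sup>2 - 4) * (1 - e * x)) + R x * (1 / (1 - e * x)))"
  have x0: "xz z0 \<notin> {2, - 2}" using less.prems(2) by (intro xz_branch_value) auto
  obtain M where M: "\<And>g' n'. 2 * g' + n' < 2 * g + length (psv zs) \<Longrightarrow> Fm_struct M g' n'"
    using Fm_struct_ex[of "2 * g + length (psv zs)"] by blast
  have mQ: "mer (2 * M + 1) (Qm e g (psv zs))"
    using psv_anl[OF less.prems(3)] by (intro mer_Qm[OF M e]) auto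
  have lp: "length (psv zs) = length zs" by (simp add: psv_def)
  have "om g (z0 # zs) = (\<Sum>r\<in>JM_branch_points. residue (\<lambda>z. 1 / (\<theta> * z0 * C) * (1/2 * (f (xz z) * (1 - 1 / z\<^sup>2) / (xz z0 - xz z)))) r)"
    unfolding om_rec[OF less.prems(1)] res1_def
  proof (intro sum.cong refl residue_meromorphic_cong)
    fix r assume r: "r \<in> JM_branch_points"
    have "z0 \<noteq> r" using r less.prems by (auto simp: JM_branch_points_def)
    show "\<forall>\<^sub>F z in at r. recursion_kernel (JM_x q \<gamma>) (JM_y q \<gamma>) (\<lambda>z. 1 / z) z0 z * bracket g zs z * deriv (\<lambda>z. 1 / z) z =
        1 / (\<theta> * z0 * C) * (1/2 * (f (xz z) * (1 - 1 / z\<^sup>2) / (xz z0 - xz z)))"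
      using eventually_segment[OF r \<open>z0 \<noteq> r\<close>] R(2)[OF r] eventually_branch[OF r] eventually_bp_xz[OF eventually_bp_sq4 r]
    proof eventually_elim
      case (elim z)
      have br: "bracket g zs z = (Qm e g (psv zs) (xz z) + ((xz z)\<^sup>2 - 4) * R (xz z)) / C"
        using elim(2) C by (simp add: C_def field_simps)
      have "recursion_kernel (JM_x q \<gamma>) (JM_y q \<gamma>) (\<lambda>z. 1 / z) z0 z * bracket g zs z * deriv (\<lambda>z. 1 / z) z =
         (recursion_kernel (JM_x q \<gamma>) (JM_y q \<gamma>) (\<lambda>z. 1 / z) z0 z * deriv (\<lambda>z. 1 / z) z) * bracket g zs z"
        by (simp only: mult_ac)
      also have "\<dots> = 1/2 * ((1 - 1 / z\<^sup>2) / (xz z0 - xz z)) / (\<theta> * z0 * (((xz z)\<^sup>2 - 4) * (1 - e * xz z))) *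
          ((Qm e g (psv zs) (xz z) + ((xz z)\<^sup>2 - 4) * R (xz z)) / C)"
        unfolding br using elim less.prems by (subst kernel_JM) auto
      also have "\<dots> = 1 / (\<theta> * z0 * C) * (1/2 * ((Qm e g (psv zs) (xz z) + ((xz z)\<^sup>2 - 4) * R (xz z)) /
           (((xz z)\<^sup>2 - 4) * (1 - e * xz z)) * (1 - 1 / z\<^sup>2) / (xz z0 - xz z)))"
        by (simp add: mult_ac)
      also have "(Qm e g (psv zs) (xz z) + ((xz z)\<^sup>2 - 4) * R (xz z)) / (((xz z)\<^sup>2 - 4) * (1 - e * xz z)) = f (xz z)"
        using elim by (simp add: f_def add_divide_distrib)
      finally show ?case .
    qed
  qed
  also have "\<dots> = (\<Sum>r\<in>JM_branch_points. 1 / (\<theta> * z0 * C) * (1/2 * residue (\<lambda>z. f (xz z) * (1 - 1 / z\<^sup>2) / (xz z0 - xz z)) r))"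
  proof (intro sum.cong refl)
    fix r assume r: "r \<in> JM_branch_points"
    have "mer (2 * M + 2) f" unfolding f_def
      using mer_add[OF mer_integrand[OF mQ e] mer_mono[OF mer_mult[OF R(1) mer_inverse_lin[OF e]]]] by simp
    note m = PP_meromorphic[OF this r, of "xz z0"]
    have "residue (\<lambda>z. 1 / (\<theta> * z0 * C) * (1/2 * (f (xz z) * (1 - 1 / z\<^sup>2) / (xz z0 - xz z)))) r =
       1 / (\<theta> * z0 * C) * residue (\<lambda>z. (1/2 * (f (xz z) * (1 - 1 / z\<^sup>2) / (xz z0 - xz z)))) r"
      using m by (intro residue_meromorphic_cmult meromorphic_on_mult meromorphic_on_const)
    moreover have "residue (\<lambda>z. (1/2 * (f (xz z) * (1 - 1 / z\<^sup>2) / (xz z0 - xz z)))) r =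
       1/2 * residue (\<lambda>z. (f (xz z) * (1 - 1 / z\<^sup>2) / (xz z0 - xz z))) r"
      using m by (rule residue_meromorphic_cmult)
    ultimately show "residue (\<lambda>z. 1 / (\<theta> * z0 * C) * (1/2 * (f (xz z) * (1 - 1 / z\<^sup>2) / (xz z0 - xz z)))) r =
        1 / (\<theta> * z0 * C) * (1/2 * residue (\<lambda>z. f (xz z) * (1 - 1 / z\<^sup>2) / (xz z0 - xz z)) r)"
      by (simp only:)
  qed
  also have "\<dots> = 1 / (\<theta> * z0 * C) * PP f (xz z0)"
    by (simp add: PP_def res1_def sum_distrib_left)
  also have "PP f (xz z0) = Fm e g (psv zs) (xz z0)"
  proof -
    have R': "mer 0 (\<lambda>x. R x * (1 / (1 - e * x)))" using mer_mult[OF R(1) mer_inverse_lin[OF e]] by simp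
    show ?thesis
      using PP_add[OF mer_integrand[OF mQ e] mer_mono[OF R'], of "xz z0"] PP_regular[OF R' x0]
        Fm_rec[of g "psv zs" e "xz z0"] less.prems(1) lp unfolding f_def by simp
  qed
  finally have F: "om g (z0 # zs) * (\<theta> * z0 * C) = Fm e g (psv zs) (xz z0)"
    using C \<theta> less.prems(2) by (simp add: field_simps)
  have "2 * g + length zs \<ge> 2" using less.prems(1) by (rule stable_ge2)
  hence "Suc (2 * g + length zs - 2) = 2 * g + length zs - 1" by simp
  hence "\<theta> * \<theta> ^ (2 * g + length zs - 2) = \<theta> ^ (2 * g + length zs - 1)"
    by (metis power_Suc)
  hence "om g (z0 # zs) * z0 * prod_list zs * \<theta> ^ (2 * g + length zs - 1) = om g (z0 # zs) * (\<theta> * z0 * C)"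
    unfolding C_def \<open>\<theta> * \<theta> ^ (2 * g + length zs - 2) = _\<close>[symmetric] by (simp only: mult_ac)
  thus ?case using F by (simp only:)
qed

end

section \<open>The Gaussian functional with squared Vandermonde weight\<close>

definition gaussm :: "real measure" where
  "gaussm = density lborel (\<lambda>x. ennreal (std_normal_density x))"

lemma integrable_gaussm_power: "integrable gaussm (\<lambda>x. x ^ k)"
  unfolding gaussm_def
  by (subst integrable_density) (auto intro!: integrable_std_normal_moment)

definition mo :: "nat \<Rightarrow> real" where "mo k = (\<integral>x. x ^ k \<partial>gaussm)"

lemma mo_eq: "mo k = integral\<^sup>L lborel (\<lambda>x. std_normal_density x * x ^ k)"
  unfolding mo_def gaussm_def by (subst integral_density) auto

lemma mo_0: "mo 0 = 1"
  using integral_std_normal_moment_even[of 0] by (simp add: mo_eq)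

text \<open>Gaussian integration by parts, read off from the known even and odd moments. At
  \<open>k = 0\<close> the factor \<open>of_nat k\<close> makes the truncated \<open>k - 1\<close>
  harmless.\<close>

lemma mo_Suc: "mo (Suc k) = of_nat k * mo (k - 1)"
proof (cases "even k")
  case True
  then obtain j where j: "k = 2 * j" by (elim evenE)
  have "mo (Suc k) = 0" using integral_std_normal_moment_odd[of j] by (simp add: mo_eq j)
  moreover have "of_nat k * mo (k - 1) = 0"
  proof (cases j)
    case (Suc i)
    hence "k - 1 = 2 * i + 1" using j by simp
    thus ?thesis using integral_std_normal_moment_odd[of i] by (simp add: mo_eq)
  qed (use j in simp)
  ultimately show ?thesis by simp
next
  case False
  then obtain j where j: "k = 2 * j + 1" by (elim oddE)
  have "mo (Suc k) = fact (2 * Suc j) / (2 ^ Suc j * fact (Suc j))"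
    using integral_std_normal_moment_even[of "Suc j"] by (simp add: mo_eq j)
  moreover have "mo (k - 1) = fact (2 * j) / (2 ^ j * fact j)"
    using integral_std_normal_moment_even[of j] by (simp add: mo_eq j)
  moreover have "fact (2 * Suc j) = ((2 * real j + 1) * fact (2 * j)) * (2 * (real j + 1))"
    by (simp add: algebra_simps)
  moreover have "2 ^ Suc j * fact (Suc j) = (2 ^ j * fact j) * (2 * (real j + 1))"
    by (simp add: algebra_simps)
  ultimately have "mo (Suc k) = ((2 * real j + 1) * fact (2 * j)) * (2 * (real j + 1)) / ((2 ^ j * fact j) * (2 * (real j + 1)))"
    by (simp only:)
  also have "\<dots> = (2 * real j + 1) * fact (2 * j) / (2 ^ j * fact j)"
    by (rule mult_divide_mult_cancel_right) simp
  finally show ?thesis using \<open>mo (k - 1) = _\<close> by (simp add: j)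
qed

interpretation gp: prob_space gaussm
  unfolding gaussm_def using prob_space_normal_density by simp

interpretation gpp: product_sigma_finite "\<lambda>_::nat. gaussm"
  by standard

section \<open>Polynomials in N Gaussian variables\<close>

definition mon :: "nat \<Rightarrow> (nat \<Rightarrow> nat) \<Rightarrow> (nat \<Rightarrow> real) \<Rightarrow> real" where
  "mon N \<alpha> x = (\<Prod>i<N. x i ^ \<alpha> i)"

definition gE :: "nat \<Rightarrow> ((nat \<Rightarrow> real) \<Rightarrow> real) \<Rightarrow> real" where
  "gE N f = (\<integral>x. f x \<partial>Pi\<^sub>M {..<N} (\<lambda>_. gaussm))"

lemma gE_prod:
  assumes "\<And>i. i < N \<Longrightarrow> integrable gaussm (f i)"
  shows "gE N (\<lambda>x. \<Prod>i<N. f i (x i)) = (\<Prod>i<N. \<integral>y. f i y \<partial>gaussm)"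
  unfolding gE_def using assms by (intro gpp.product_integral_prod) auto

lemma integrable_mon: "integrable (Pi\<^sub>M {..<N} (\<lambda>_. gaussm)) (mon N \<alpha>)"
  unfolding mon_def[abs_def] by (intro gpp.product_integrable_prod integrable_gaussm_power) auto

lemma gE_mon: "gE N (mon N \<alpha>) = (\<Prod>i<N. mo (\<alpha> i))"
  unfolding mon_def[abs_def] mo_def by (intro gE_prod integrable_gaussm_power)

text \<open>Explicit lists of monomials reduce integrability and linearity to products of
  one-dimensional moments.\<close>

definition polyf :: "nat \<Rightarrow> ((nat \<Rightarrow> real) \<Rightarrow> real) \<Rightarrow> bool" where
  "polyf N f \<longleftrightarrow> (\<exists>L. f = (\<lambda>x. \<Sum>p\<leftarrow>L. fst p * mon N (snd p) x))"

lemma polyf_mon: "polyf N (\<lambda>x. c * mon N \<alpha> x)"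
  unfolding polyf_def by (intro exI[of _ "[(c, \<alpha>)]"]) auto

lemma polyf_const: "polyf N (\<lambda>_. c)"
  using polyf_mon[of N c "\<lambda>_. 0"] by (simp add: mon_def)

lemma polyf_coord:
  assumes "i < N" shows "polyf N (\<lambda>x. x i)"
proof -
  have "mon N (\<lambda>j. if j = i then 1 else 0) x = x i" for x
  proof -
    have "(\<Prod>j<N. x j ^ (if j = i then 1 else 0)) = (\<Prod>j<N. if j = i then x j else 1)"
      by (intro prod.cong) auto
    thus ?thesis using assms by (simp add: mon_def prod.delta)
  qed
  thus ?thesis using polyf_mon[of N 1 "\<lambda>j. if j = i then 1 else 0"] by simp
qed

lemma polyf_add: "polyf N f \<Longrightarrow> polyf N g \<Longrightarrow> polyf N (\<lambda>x. f x + g x)"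
  unfolding polyf_def
proof (elim exE)
  fix L L' assume "f = (\<lambda>x. \<Sum>p\<leftarrow>L. fst p * mon N (snd p) x)" "g = (\<lambda>x. \<Sum>p\<leftarrow>L'. fst p * mon N (snd p) x)"
  thus "\<exists>L. (\<lambda>x. f x + g x) = (\<lambda>x. \<Sum>p\<leftarrow>L. fst p * mon N (snd p) x)"
    by (intro exI[of _ "L @ L'"]) simp
qed

lemma polyf_sum: "(\<And>i. i \<in> I \<Longrightarrow> polyf N (f i)) \<Longrightarrow> polyf N (\<lambda>x. \<Sum>i\<in>I. f i x)"
  by (induction I rule: infinite_finite_induct) (auto intro: polyf_add polyf_const)

lemma polyf_mon_mult: "polyf N f \<Longrightarrow> polyf N (\<lambda>x. c * mon N \<alpha> x * f x)"
proof -
  assume "polyf N f"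
  then obtain L where L: "f = (\<lambda>x. \<Sum>p\<leftarrow>L. fst p * mon N (snd p) x)" unfolding polyf_def by blast
  have "c * mon N \<alpha> x * (\<Sum>p\<leftarrow>L. fst p * mon N (snd p) x) =
      (\<Sum>p\<leftarrow>map (\<lambda>p. (c * fst p, \<lambda>i. \<alpha> i + snd p i)) L. fst p * mon N (snd p) x)" for x
    by (induction L) (auto simp: mon_def power_add prod.distrib algebra_simps)
  thus ?thesis unfolding polyf_def L by blast
qed

lemma polyf_mult: "polyf N f \<Longrightarrow> polyf N g \<Longrightarrow> polyf N (\<lambda>x. f x * g x)"
proof -
  assume "polyf N f" and g: "polyf N g"
  then obtain L where L: "f = (\<lambda>x. \<Sum>p\<leftarrow>L. fst p * mon N (snd p) x)" unfolding polyf_def by blast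
  have "polyf N (\<lambda>x. (\<Sum>p\<leftarrow>L. fst p * mon N (snd p) x) * g x)"
  proof (induction L)
    case (Cons p L)
    have "polyf N (\<lambda>x. fst p * mon N (snd p) x * g x + (\<Sum>p\<leftarrow>L. fst p * mon N (snd p) x) * g x)"
      by (intro polyf_add polyf_mon_mult[OF g] Cons)
    thus ?case by (simp add: distrib_right)
  qed (simp add: polyf_const)
  thus ?thesis by (simp add: L)
qed

lemma polyf_cmult: "polyf N f \<Longrightarrow> polyf N (\<lambda>x. c * f x)"
  using polyf_mult[OF polyf_const] .

lemma polyf_diff: "polyf N f \<Longrightarrow> polyf N g \<Longrightarrow> polyf N (\<lambda>x. f x - g x)"
  using polyf_add[OF _ polyf_cmult[of N g "- 1"]] by simp

lemma polyf_power: "polyf N f \<Longrightarrow> polyf N (\<lambda>x. f x ^ k)"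
  by (induction k) (auto intro: polyf_const polyf_mult)

lemma polyf_prod: "(\<And>i. i \<in> I \<Longrightarrow> polyf N (f i)) \<Longrightarrow> polyf N (\<lambda>x. \<Prod>i\<in>I. f i x)"
  by (induction I rule: infinite_finite_induct) (auto intro: polyf_mult polyf_const)

lemma integrable_polyf: "polyf N f \<Longrightarrow> integrable (Pi\<^sub>M {..<N} (\<lambda>_. gaussm)) f"
proof -
  assume "polyf N f"
  then obtain L where L: "f = (\<lambda>x. \<Sum>p\<leftarrow>L. fst p * mon N (snd p) x)" unfolding polyf_def by blast
  show ?thesis unfolding L by (induction L) (auto intro!: integrable_mon)
qed

lemma gE_add: "polyf N f \<Longrightarrow> polyf N g \<Longrightarrow> gE N (\<lambda>x. f x + g x) = gE N f + gE N g"
  unfolding gE_def by (intro Bochner_Integration.integral_add integrable_polyf)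

lemma gE_cmult: "gE N (\<lambda>x. c * f x) = c * gE N f"
  unfolding gE_def by simp

lemma gE_sum: "(\<And>i. i \<in> I \<Longrightarrow> polyf N (f i)) \<Longrightarrow> gE N (\<lambda>x. \<Sum>i\<in>I. f i x) = (\<Sum>i\<in>I. gE N (f i))"
  unfolding gE_def by (intro Bochner_Integration.integral_sum integrable_polyf)

section \<open>Virasoro constraints\<close>

text \<open>
  \<open>vder N m f f'\<close>: \<open>f'\<close> is the derivative of \<open>f\<close> along the vector field with components
  \<open>x\<^sub>i\<^sup>m\<close> (the Virasoro operator \<open>L\<^bsub>m-1\<^esub>\<close>).
\<close>
definition vder :: "nat \<Rightarrow> ((nat \<Rightarrow> real) \<Rightarrow> real) \<Rightarrow> ((nat \<Rightarrow> real) \<Rightarrow> real) \<Rightarrow> bool" where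
  "vder m f f' \<longleftrightarrow> (\<forall>x. ((\<lambda>t. f (\<lambda>i. x i + t * x i ^ m)) has_field_derivative f' x) (at 0))"

lemma vder_mult: "vder m f f' \<Longrightarrow> vder m g g' \<Longrightarrow> vder m (\<lambda>x. f x * g x) (\<lambda>x. f' x * g x + f x * g' x)"
  unfolding vder_def by (auto intro!: derivative_eq_intros)

lemma vder_add: "vder m f f' \<Longrightarrow> vder m g g' \<Longrightarrow> vder m (\<lambda>x. f x + g x) (\<lambda>x. f' x + g' x)"
  unfolding vder_def by (auto intro!: derivative_eq_intros)

lemma vder_const: "vder m (\<lambda>x. c) (\<lambda>x. 0)"
  unfolding vder_def by (auto intro!: derivative_eq_intros)

lemma vder_power: "vder m (\<lambda>x. x i ^ k) (\<lambda>x. of_nat k * x i ^ (m + k - 1))"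
  unfolding vder_def
proof
  fix x :: "nat \<Rightarrow> real"
  have "((\<lambda>t. (x i + t * x i ^ m) ^ k) has_field_derivative of_nat k * (x i ^ (k - 1) * x i ^ m)) (at 0)"
    by (auto intro!: derivative_eq_intros)
  thus "((\<lambda>t. (x i + t * x i ^ m) ^ k) has_field_derivative of_nat k * x i ^ (m + k - 1)) (at 0)"
    by (cases k) (auto simp flip: power_add simp: add.commute)
qed

lemma vder_unique: "vder m f f' \<Longrightarrow> vder m f f'' \<Longrightarrow> f' = f''"
  unfolding vder_def by (auto intro!: ext DERIV_unique)

lemma vder_log_prod:
  assumes "finite I" "\<And>i. i \<in> I \<Longrightarrow> vder m (f i) (\<lambda>x. f i x * a i x)"
  shows "vder m (\<lambda>x. \<Prod>i\<in>I. f i x) (\<lambda>x. (\<Prod>i\<in>I. f i x) * (\<Sum>i\<in>I. a i x))"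
  using assms
proof (induction I)
  case (insert j I)
  have "vder m (\<lambda>x. f j x * (\<Prod>i\<in>I. f i x)) (\<lambda>x. f j x * a j x * (\<Prod>i\<in>I. f i x) + f j x * ((\<Prod>i\<in>I. f i x) * (\<Sum>i\<in>I. a i x)))"
    by (intro vder_mult insert) (use insert in auto)
  thus ?case using insert(1,2) by (simp add: algebra_simps)
qed (simp add: vder_const)

lemma vder_mon:
  "vder m (mon N \<alpha>) (\<lambda>x. \<Sum>i<N. of_nat (\<alpha> i) * mon N (\<alpha>(i := m + \<alpha> i - 1)) x)"
proof -
  have *: "finite J \<Longrightarrow> vder m (\<lambda>x. \<Prod>i\<in>J. x i ^ \<alpha> i)
      (\<lambda>x. \<Sum>i\<in>J. of_nat (\<alpha> i) * (\<Prod>j\<in>J. x j ^ (\<alpha>(i := m + \<alpha> i - 1)) j))" for J :: "nat set"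
  proof (induction J rule: finite_induct)
    case (insert k J)
    have e1: "(\<Prod>j\<in>J. x j ^ (\<alpha>(k := m + \<alpha> k - 1)) j) = (\<Prod>j\<in>J. x j ^ \<alpha> j)" for x :: "nat \<Rightarrow> real"
      using insert(2) by (intro prod.cong) auto
    have e2: "of_nat (\<alpha> i) * (\<Prod>j\<in>insert k J. x j ^ (\<alpha>(i := m + \<alpha> i - 1)) j) =
        x k ^ \<alpha> k * (of_nat (\<alpha> i) * (\<Prod>j\<in>J. x j ^ (\<alpha>(i := m + \<alpha> i - 1)) j))" if "i \<in> J" for i and x :: "nat \<Rightarrow> real"
      using insert(1,2) that by auto
    have "vder m (\<lambda>x. x k ^ \<alpha> k * (\<Prod>i\<in>J. x i ^ \<alpha> i))
       (\<lambda>x. of_nat (\<alpha> k) * x k ^ (m + \<alpha> k - 1) * (\<Prod>i\<in>J. x i ^ \<alpha> i) +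
          x k ^ \<alpha> k * (\<Sum>i\<in>J. of_nat (\<alpha> i) * (\<Prod>j\<in>J. x j ^ (\<alpha>(i := m + \<alpha> i - 1)) j)))"
      by (intro vder_mult vder_power insert)
    moreover have "(\<Sum>i\<in>insert k J. of_nat (\<alpha> i) * (\<Prod>j\<in>insert k J. x j ^ (\<alpha>(i := m + \<alpha> i - 1)) j)) =
       of_nat (\<alpha> k) * x k ^ (m + \<alpha> k - 1) * (\<Prod>i\<in>J. x i ^ \<alpha> i) +
          x k ^ \<alpha> k * (\<Sum>i\<in>J. of_nat (\<alpha> i) * (\<Prod>j\<in>J. x j ^ (\<alpha>(i := m + \<alpha> i - 1)) j))" for x :: "nat \<Rightarrow> real"
      unfolding sum.insert[OF insert(1,2)] sum_distrib_left
      by (intro arg_cong2[of _ _ _ _ "(+)"] sum.cong refl e2) (use insert(1,2) e1 in auto)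
    ultimately show ?case using insert(1,2) by simp
  qed (simp add: vder_const)
  show ?thesis using *[of "{..<N}"] by (simp add: mon_def[abs_def])
qed

lemma mon_shift:
  assumes "i < N" shows "x i ^ k * mon N \<alpha> x = mon N (\<alpha>(i := \<alpha> i + k)) x"
proof -
  have "mon N (\<alpha>(i := \<alpha> i + k)) x = x i ^ (\<alpha> i + k) * (\<Prod>j\<in>{..<N} - {i}. x j ^ \<alpha> j)"
    unfolding mon_def using assms by (subst prod.remove[of _ i]) (auto intro!: prod.cong)
  moreover have "mon N \<alpha> x = x i ^ \<alpha> i * (\<Prod>j\<in>{..<N} - {i}. x j ^ \<alpha> j)"
    unfolding mon_def using assms by (subst prod.remove[of _ i]) auto
  ultimately show ?thesis by (simp add: power_add)
qed

lemma gE_mon_upd: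
  assumes "i < N" shows "gE N (mon N (\<alpha>(i := k))) = mo k * (\<Prod>j\<in>{..<N} - {i}. mo (\<alpha> j))"
  unfolding gE_mon using assms by (subst prod.remove[of _ i]) (auto intro!: prod.cong)

text \<open>Integration by parts along the field with components \<open>x_i^m\<close>; the last term
  is the divergence of the field. On monomials all of it reduces to the moment recursion in one
  variable.\<close>

lemma virasoro_mon:
  "gE N (\<lambda>x. (\<Sum>i<N. x i ^ Suc m) * mon N \<alpha> x) =
   gE N (\<lambda>x. \<Sum>i<N. of_nat (\<alpha> i) * mon N (\<alpha>(i := m + \<alpha> i - 1)) x) +
   of_nat m * gE N (\<lambda>x. (\<Sum>i<N. x i ^ (m - 1)) * mon N \<alpha> x)"
proof -
  have m: "polyf N (mon N \<alpha>)" for \<alpha> using polyf_mon[of N 1 \<alpha>] by simp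
  have ps: "gE N (\<lambda>x. (\<Sum>i<N. x i ^ k) * mon N \<alpha> x) = (\<Sum>i<N. gE N (mon N (\<alpha>(i := \<alpha> i + k))))" for k
  proof -
    have "gE N (\<lambda>x. (\<Sum>i<N. x i ^ k) * mon N \<alpha> x) = gE N (\<lambda>x. \<Sum>i<N. mon N (\<alpha>(i := \<alpha> i + k)) x)"
      by (simp add: sum_distrib_right mon_shift)
    thus ?thesis using m by (simp add: gE_sum)
  qed
  have "gE N (mon N (\<alpha>(i := \<alpha> i + Suc m))) = of_nat (\<alpha> i) * gE N (mon N (\<alpha>(i := m + \<alpha> i - 1)))
     + of_nat m * gE N (mon N (\<alpha>(i := \<alpha> i + (m - 1))))" if "i < N" for i
  proof -
    have "of_nat m * mo (\<alpha> i + (m - 1)) = of_nat m * mo (m + \<alpha> i - 1)"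
      by (cases m) (auto simp: add.commute)
    thus ?thesis using that mo_Suc[of "\<alpha> i + m"]
      by (cases m) (simp_all add: gE_mon_upd algebra_simps)
  qed
  hence "(\<Sum>i<N. gE N (mon N (\<alpha>(i := \<alpha> i + Suc m)))) =
     (\<Sum>i<N. of_nat (\<alpha> i) * gE N (mon N (\<alpha>(i := m + \<alpha> i - 1)))) +
     of_nat m * (\<Sum>i<N. gE N (mon N (\<alpha>(i := \<alpha> i + (m - 1)))))"
    by (simp add: sum.distrib sum_distrib_left)
  moreover have "gE N (\<lambda>x. \<Sum>i<N. of_nat (\<alpha> i) * mon N (\<alpha>(i := m + \<alpha> i - 1)) x) =
     (\<Sum>i<N. of_nat (\<alpha> i) * gE N (mon N (\<alpha>(i := m + \<alpha> i - 1))))"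
    using m by (subst gE_sum) (auto intro: polyf_mon simp: gE_cmult)
  ultimately show ?thesis unfolding ps by (simp only:)
qed

text \<open>Linear extension from monomials. Uniqueness of the derivative allows \<open>f'\<close>
  to come from product rules rather than from the monomial list of \<open>f\<close>.\<close>

lemma virasoro:
  assumes f: "polyf N f" and d: "vder m f f'"
  shows "gE N (\<lambda>x. (\<Sum>i<N. x i ^ Suc m) * f x) =
         gE N f' + of_nat m * gE N (\<lambda>x. (\<Sum>i<N. x i ^ (m - 1)) * f x)"
proof -
  obtain L where L: "f = (\<lambda>x. \<Sum>p\<leftarrow>L. fst p * mon N (snd p) x)" using f unfolding polyf_def by blast
  have mo: "polyf N (mon N \<alpha>)" for \<alpha> using polyf_mon[of N 1 \<alpha>] by simp
  have ps: "polyf N (\<lambda>x. \<Sum>i<N. x i ^ k)" for k by (intro polyf_sum polyf_power polyf_coord) auto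
  define D where "D = (\<lambda>L x. \<Sum>p\<leftarrow>L. fst p * (\<Sum>i<N. of_nat (snd p i) * mon N ((snd p)(i := m + snd p i - 1)) x))"
  have "vder m (\<lambda>x. \<Sum>p\<leftarrow>L. fst p * mon N (snd p) x) (D L)" for L
  proof (induction L)
    case (Cons p L)
    have "vder m (\<lambda>x. fst p * mon N (snd p) x + (\<Sum>p\<leftarrow>L. fst p * mon N (snd p) x))
       (\<lambda>x. (0 * mon N (snd p) x + fst p * (\<Sum>i<N. of_nat (snd p i) * mon N ((snd p)(i := m + snd p i - 1)) x)) + D L x)"
      by (intro vder_add vder_mult vder_const vder_mon Cons)
    thus ?case by (simp add: D_def)
  qed (simp add: D_def vder_const)
  with d have "f' = D L" using vder_unique unfolding L by blast
  moreover have "gE N (\<lambda>x. (\<Sum>i<N. x i ^ Suc m) * (\<Sum>p\<leftarrow>L. fst p * mon N (snd p) x)) =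
         gE N (D L) + of_nat m * gE N (\<lambda>x. (\<Sum>i<N. x i ^ (m - 1)) * (\<Sum>p\<leftarrow>L. fst p * mon N (snd p) x))" for L
  proof (induction L)
    case (Cons p L)
    have pl: "polyf N (\<lambda>x. \<Sum>p\<leftarrow>L. fst p * mon N (snd p) x)" unfolding polyf_def by blast
    have K: "gE N (\<lambda>x. (\<Sum>i<N. x i ^ k) * (\<Sum>p\<leftarrow>p # L. fst p * mon N (snd p) x)) =
       fst p * gE N (\<lambda>x. (\<Sum>i<N. x i ^ k) * mon N (snd p) x) +
       gE N (\<lambda>x. (\<Sum>i<N. x i ^ k) * (\<Sum>p\<leftarrow>L. fst p * mon N (snd p) x))" for k
    proof -
      have "gE N (\<lambda>x. fst p * ((\<Sum>i<N. x i ^ k) * mon N (snd p) x) + (\<Sum>i<N. x i ^ k) * (\<Sum>p\<leftarrow>L. fst p * mon N (snd p) x)) =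
        gE N (\<lambda>x. fst p * ((\<Sum>i<N. x i ^ k) * mon N (snd p) x)) + gE N (\<lambda>x. (\<Sum>i<N. x i ^ k) * (\<Sum>p\<leftarrow>L. fst p * mon N (snd p) x))"
        by (intro gE_add polyf_mult polyf_const mo ps pl)
      thus ?thesis by (simp add: gE_cmult distrib_left mult.left_commute)
    qed
    have DL: "gE N (D (p # L)) = fst p * gE N (\<lambda>x. \<Sum>i<N. of_nat (snd p i) * mon N ((snd p)(i := m + snd p i - 1)) x) + gE N (D L)"
    proof -
      have "polyf N (D L)"
      proof (induction L)
        case (Cons p L)
        have "polyf N (\<lambda>x. fst p * (\<Sum>i<N. of_nat (snd p i) * mon N ((snd p)(i := m + snd p i - 1)) x) + D L x)"
          by (intro polyf_add polyf_cmult polyf_sum polyf_mon Cons)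
        thus ?case by (simp add: D_def)
      qed (simp add: D_def polyf_const)
      hence "gE N (\<lambda>x. fst p * (\<Sum>i<N. of_nat (snd p i) * mon N ((snd p)(i := m + snd p i - 1)) x) + D L x) =
        gE N (\<lambda>x. fst p * (\<Sum>i<N. of_nat (snd p i) * mon N ((snd p)(i := m + snd p i - 1)) x)) + gE N (D L)"
        by (intro gE_add polyf_cmult polyf_sum polyf_mon)
      thus ?thesis by (simp add: gE_cmult D_def)
    qed
    show ?case unfolding K DL Cons virasoro_mon by (simp add: algebra_simps)
  qed (simp add: D_def gE_def)
  ultimately show ?thesis by (simp add: L)
qed

section \<open>Power sums under the squared Vandermonde weight\<close>

definition psum :: "nat \<Rightarrow> nat \<Rightarrow> (nat \<Rightarrow> real) \<Rightarrow> real" where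
  "psum N k x = (\<Sum>i<N. x i ^ k)"

definition vdm2 :: "nat \<Rightarrow> (nat \<Rightarrow> real) \<Rightarrow> real" where
  "vdm2 N x = (\<Prod>i<N. \<Prod>j<i. (x i - x j)\<^sup>2)"

text \<open>The companion of \<open>spl\<close> for a derivation acting on a product: one entry is
  singled out and \<open>r\<close> keeps the others.\<close>

fun dsum :: "('a \<Rightarrow> 'a list \<Rightarrow> 'b::comm_monoid_add) \<Rightarrow> 'a list \<Rightarrow> 'b" where
  "dsum f [] = 0"
| "dsum f (x # xs) = f x xs + dsum (\<lambda>y r. f y (x # r)) xs"

lemma polyf_psum: "polyf N (psum N k)"
  unfolding psum_def[abs_def] by (intro polyf_sum polyf_power polyf_coord) auto

lemma polyf_vdm2: "polyf N (vdm2 N)"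
  unfolding vdm2_def[abs_def] by (intro polyf_prod polyf_power polyf_diff polyf_coord) auto

lemma vder_psum: "vder m (psum N k) (\<lambda>x. of_nat k * psum N (m + k - 1) x)"
proof -
  have "finite I \<Longrightarrow> vder m (\<lambda>x. \<Sum>i\<in>I. x i ^ k) (\<lambda>x. \<Sum>i\<in>I. of_nat k * x i ^ (m + k - 1))" for I :: "nat set"
    by (induction I rule: finite_induct) (auto intro!: vder_add vder_const vder_power[unfolded One_nat_def])
  from this[of "{..<N}"] show ?thesis by (simp add: psum_def[abs_def] sum_distrib_left)
qed

text \<open>The divided difference \<open>(a^m - b^m) / (a - b)\<close>, in a form that also makes
  sense on the diagonal.\<close>

definition hsum :: "nat \<Rightarrow> real \<Rightarrow> real \<Rightarrow> real" where
  "hsum m a b = (\<Sum>l<m. a ^ l * b ^ (m - 1 - l))"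

lemma hsum_commute: "hsum m a b = hsum m b a"
  unfolding hsum_def by (rule sum.reindex_bij_witness[of _ "\<lambda>l. m - 1 - l" "\<lambda>l. m - 1 - l"]) auto

lemma hsum_diff: "(a - b) * hsum m a b = a ^ m - b ^ m"
  using power_diff_sumr2[of a m b] by (simp add: hsum_def mult_ac)

lemma hsum_diagonal: "hsum m b b = of_nat m * b ^ (m - 1)"
proof -
  have "b ^ l * b ^ (m - 1 - l) = b ^ (m - 1)" if "l < m" for l
    using that by (simp flip: power_add)
  thus ?thesis by (simp add: hsum_def)
qed

lemma vder_vdm2: "vder m (vdm2 N) (\<lambda>x. vdm2 N x * (\<Sum>i<N. \<Sum>j<i. 2 * hsum m (x i) (x j)))"
proof -
  have "vder m (\<lambda>x. (x i - x j)\<^sup>2) (\<lambda>x. (x i - x j)\<^sup>2 * (2 * hsum m (x i) (x j)))" for i j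
    unfolding vder_def
  proof
    fix x :: "nat \<Rightarrow> real"
    have "((\<lambda>t. ((x i + t * x i ^ m) - (x j + t * x j ^ m))\<^sup>2) has_field_derivative
        2 * (x i - x j) * (x i ^ m - x j ^ m)) (at 0)"
      by (auto intro!: derivative_eq_intros)
    also have "2 * (x i - x j) * (x i ^ m - x j ^ m) = (x i - x j)\<^sup>2 * (2 * hsum m (x i) (x j))"
      unfolding hsum_diff[symmetric] by (simp add: power2_eq_square)
    finally show "((\<lambda>t. ((x i + t * x i ^ m) - (x j + t * x j ^ m))\<^sup>2) has_field_derivative
        (x i - x j)\<^sup>2 * (2 * hsum m (x i) (x j))) (at 0)" .
  qed
  thus ?thesis unfolding vdm2_def[abs_def] by (intro vder_log_prod) auto
qed

text \<open>The squared Vandermonde factor counts each pair \<open>i, j\<close> twice, and the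
  divergence term supplies exactly the diagonal \<open>i = j\<close>; together they complete the
  double sum to products of power sums.\<close>

lemma psum_pairs:
  "(\<Sum>i<N. \<Sum>j<i. 2 * hsum m (x i) (x j)) + of_nat m * psum N (m - 1) x = (\<Sum>a<m. psum N a x * psum N (m - 1 - a) x)"
proof -
  have "(\<Sum>a<m. psum N a x * psum N (m - 1 - a) x) = (\<Sum>a<m. \<Sum>i<N. \<Sum>j<N. x i ^ a * x j ^ (m - 1 - a))"
    by (simp add: psum_def sum_product)
  also have "\<dots> = (\<Sum>i<N. \<Sum>j<N. hsum m (x i) (x j))"
    unfolding hsum_def by (subst sum.swap, rule sum.cong[OF refl], rule sum.swap)
  also have "\<dots> = (\<Sum>i<N. \<Sum>j<i. 2 * hsum m (x i) (x j)) + (\<Sum>i<N. hsum m (x i) (x i))"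
  proof (induction N)
    case (Suc N)
    have "(\<Sum>i<Suc N. \<Sum>j<Suc N. hsum m (x i) (x j)) =
      (\<Sum>i<N. \<Sum>j<N. hsum m (x i) (x j)) + (\<Sum>i<N. hsum m (x i) (x N)) + (\<Sum>j<N. hsum m (x N) (x j)) + hsum m (x N) (x N)"
      by (simp add: sum.distrib)
    also have "(\<Sum>i<N. hsum m (x i) (x N)) = (\<Sum>j<N. hsum m (x N) (x j))"
      by (intro sum.cong refl hsum_commute)
    finally show ?case using Suc by (simp add: sum_distrib_left[symmetric])
  qed simp
  finally show ?thesis by (simp add: psum_def sum_distrib_left hsum_diagonal)
qed

definition pprod :: "nat \<Rightarrow> nat list \<Rightarrow> (nat \<Rightarrow> real) \<Rightarrow> real" where
  "pprod N ms x = (\<Prod>m\<leftarrow>ms. psum N m x)"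

lemma polyf_pprod: "polyf N (pprod N ms)"
  unfolding pprod_def[abs_def] by (induction ms) (auto intro: polyf_const polyf_mult polyf_psum)

lemma dsum_cmult: "(c :: 'b::comm_semiring_0) * dsum f xs = dsum (\<lambda>y r. c * f y r) xs"
  by (induction xs arbitrary: f) (auto simp: distrib_left)

lemma vder_pprod:
  "vder m (pprod N ms) (\<lambda>x. dsum (\<lambda>k r. of_nat k * pprod N ((m + k - 1) # r) x) ms)"
proof (induction ms)
  case (Cons k ms)
  have "vder m (\<lambda>x. psum N k x * pprod N ms x) (\<lambda>x. of_nat k * psum N (m + k - 1) x * pprod N ms x +
      psum N k x * dsum (\<lambda>k r. of_nat k * pprod N ((m + k - 1) # r) x) ms)"
    by (intro vder_mult vder_psum Cons)
  thus ?case by (simp add: pprod_def dsum_cmult mult_ac)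
qed (simp add: pprod_def vder_const)

lemma polyf_dsum: "(\<And>y r. polyf N (f y r)) \<Longrightarrow> polyf N (\<lambda>x. dsum (\<lambda>y r. f y r x) ms)"
  by (induction ms arbitrary: f) (auto intro: polyf_const polyf_add)

lemma gE_dsum: "(\<And>y r. polyf N (f y r)) \<Longrightarrow> gE N (\<lambda>x. dsum (\<lambda>y r. f y r x) ms) = dsum (\<lambda>y r. gE N (f y r)) ms"
proof (induction ms arbitrary: f)
  case Nil thus ?case by (simp add: gE_def)
next
  case (Cons k ms)
  thus ?case by (simp add: gE_add polyf_dsum)
qed

definition gM :: "nat \<Rightarrow> nat list \<Rightarrow> real" where
  "gM N ms = gE N (\<lambda>x. pprod N ms x * vdm2 N x)"

text \<open>The Virasoro constraint for \<open>pprod\<close> times \<open>vdm2\<close>: weight and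
  divergence give the splitting terms, the derivative of the other power sums gives the joining
  terms.\<close>

lemma gM_Suc:
  "gM N (Suc m # ms) = (\<Sum>a<m. gM N (a # (m - 1 - a) # ms)) + dsum (\<lambda>k r. of_nat k * gM N ((m + k - 1) # r)) ms"
proof -
  let ?f = "\<lambda>x. pprod N ms x * vdm2 N x"
  let ?d = "\<lambda>x. dsum (\<lambda>k r. of_nat k * pprod N ((m + k - 1) # r) x) ms"
  let ?h = "\<lambda>x. \<Sum>i<N. \<Sum>j<i. 2 * hsum m (x i) (x j)"
  have pf: "polyf N ?f" by (intro polyf_mult polyf_pprod polyf_vdm2)
  have "polyf N ?h" unfolding hsum_def
    by (intro polyf_sum polyf_cmult polyf_mult polyf_power polyf_coord) auto
  hence ph: "polyf N (\<lambda>x. ?f x * ?h x)" by (intro polyf_mult pf)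
  have pd: "polyf N (\<lambda>x. ?d x * vdm2 N x)"
    by (intro polyf_mult polyf_dsum polyf_const polyf_pprod polyf_vdm2)
  have pm: "polyf N (\<lambda>x. psum N k x * ?f x)" for k by (intro polyf_mult pf polyf_psum)
  have "gM N (Suc m # ms) = gE N (\<lambda>x. (\<Sum>i<N. x i ^ Suc m) * ?f x)"
    by (simp add: gM_def pprod_def psum_def mult.assoc)
  also have "\<dots> = gE N (\<lambda>x. ?d x * vdm2 N x + pprod N ms x * (vdm2 N x * ?h x)) +
      of_nat m * gE N (\<lambda>x. (\<Sum>i<N. x i ^ (m - 1)) * ?f x)"
    by (intro virasoro pf vder_mult vder_pprod vder_vdm2)
  also have "gE N (\<lambda>x. ?d x * vdm2 N x + pprod N ms x * (vdm2 N x * ?h x)) =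
     gE N (\<lambda>x. ?d x * vdm2 N x) + gE N (\<lambda>x. ?f x * ?h x)"
    using gE_add[OF pd ph] by (simp add: mult.assoc)
  also have "gE N (\<lambda>x. ?d x * vdm2 N x) = dsum (\<lambda>k r. of_nat k * gM N ((m + k - 1) # r)) ms"
  proof -
    have "gE N (\<lambda>x. ?d x * vdm2 N x) = gE N (\<lambda>x. dsum (\<lambda>k r. of_nat k * (pprod N ((m + k - 1) # r) x * vdm2 N x)) ms)"
      by (simp add: mult.commute[of _ "vdm2 N _"] dsum_cmult mult.left_commute)
    also have "\<dots> = dsum (\<lambda>k r. gE N (\<lambda>x. of_nat k * (pprod N ((m + k - 1) # r) x * vdm2 N x))) ms"
      by (intro gE_dsum polyf_cmult polyf_mult polyf_pprod polyf_vdm2)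
    finally show ?thesis by (simp add: gE_cmult gM_def)
  qed
  also have "dsum (\<lambda>k r. of_nat k * gM N ((m + k - 1) # r)) ms + gE N (\<lambda>x. ?f x * ?h x) +
      of_nat m * gE N (\<lambda>x. (\<Sum>i<N. x i ^ (m - 1)) * ?f x) =
     dsum (\<lambda>k r. of_nat k * gM N ((m + k - 1) # r)) ms + gE N (\<lambda>x. ?f x * ?h x + of_nat m * (psum N (m - 1) x * ?f x))"
    using gE_add[OF ph polyf_cmult[OF pm]] by (simp add: gE_cmult psum_def)
  also have "gE N (\<lambda>x. ?f x * ?h x + of_nat m * (psum N (m - 1) x * ?f x)) =
      gE N (\<lambda>x. \<Sum>a<m. pprod N (a # (m - 1 - a) # ms) x * vdm2 N x)"
  proof -
    have "?f x * ?h x + of_nat m * (psum N (m - 1) x * ?f x) = ?f x * (?h x + of_nat m * psum N (m - 1) x)" for x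
      by (simp add: algebra_simps)
    also have "?f x * (?h x + of_nat m * psum N (m - 1) x) = (\<Sum>a<m. pprod N (a # (m - 1 - a) # ms) x * vdm2 N x)" for x
      unfolding psum_pairs sum_distrib_left by (simp add: pprod_def mult_ac)
    finally show ?thesis by simp
  qed
  also have "\<dots> = (\<Sum>a<m. gM N (a # (m - 1 - a) # ms))"
    unfolding gM_def by (intro gE_sum polyf_mult polyf_pprod polyf_vdm2)
  finally show ?thesis by simp
qed

lemma gM_0: "gM N (0 # ms) = of_nat N * gM N ms"
  by (simp add: gM_def pprod_def psum_def mult.assoc gE_cmult)

section \<open>Hermite polynomials and the Toda recursion\<close>

definition Lg :: "real poly \<Rightarrow> real" where "Lg p = (\<integral>x. poly p x \<partial>gaussm)"

lemma integrable_gaussm_poly: "integrable gaussm (poly p)"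
proof -
  have "poly p = (\<lambda>x. \<Sum>i\<le>degree p. coeff p i * x ^ i)" by (rule ext) (simp add: poly_altdef)
  thus ?thesis by (simp add: integrable_gaussm_power)
qed

lemma Lg_add: "Lg (p + q) = Lg p + Lg q"
proof -
  have "poly (p + q) = (\<lambda>x. poly p x + poly q x)" by (rule ext) simp
  thus ?thesis unfolding Lg_def by (simp add: integrable_gaussm_poly)
qed

lemma Lg_smult: "Lg (Polynomial.smult c p) = c * Lg p"
proof -
  have "poly (Polynomial.smult c p) = (\<lambda>x. c * poly p x)" by (rule ext) simp
  thus ?thesis unfolding Lg_def by simp
qed

lemma Lg_0 [simp]: "Lg 0 = 0"
  using Lg_smult[of 0 0] by simp

lemma Lg_diff: "Lg (p - q) = Lg p - Lg q"
  using Lg_add[of p "- q"] Lg_smult[of "- 1" q] by simp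

lemma Lg_monom: "Lg (monom c i) = c * mo i"
  by (simp add: Lg_def mo_def poly_monom)

lemma Lg_X: "Lg (pCons 0 p) = Lg (pderiv p)"
proof -
  have *: "Lg (pCons 0 (monom c i)) = Lg (pderiv (monom c i))" for c i
    using mo_Suc[of i] by (simp add: Lg_monom pderiv_monom flip: monom_Suc)
  have "Lg (pCons 0 (\<Sum>i\<in>I. monom (coeff p i) i)) = Lg (pderiv (\<Sum>i\<in>I. monom (coeff p i) i))" for I
  proof (induction I rule: infinite_finite_induct)
    case (insert i I)
    have "Lg (pCons 0 (a + b)) = Lg (pCons 0 a) + Lg (pCons 0 b)" for a b
      using Lg_add[of "pCons 0 a" "pCons 0 b"] by simp
    thus ?case using insert * by (simp add: Lg_add pderiv_add)
  qed auto
  from this[of "{..degree p}"] show ?thesis by (simp add: poly_as_sum_of_monoms)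
qed

fun He :: "nat \<Rightarrow> real poly" where
  "He 0 = 1"
| "He (Suc 0) = [:0, 1:]"
| "He (Suc (Suc n)) = pCons 0 (He (Suc n)) - Polynomial.smult (of_nat (Suc n)) (He n)"

lemma He_Suc: "He (Suc n) = pCons 0 (He n) - Polynomial.smult (of_nat n) (He (n - 1))"
  by (cases n) auto

lemma pderiv_He: "pderiv (He n) = Polynomial.smult (of_nat n) (He (n - 1))"
proof (induction n rule: He.induct)
  case (3 n)
  have "pderiv (He (Suc (Suc n))) = He (Suc n) + pCons 0 (Polynomial.smult (of_nat (Suc n)) (He n))
       - Polynomial.smult (of_nat (Suc n)) (Polynomial.smult (of_nat n) (He (n - 1)))"
    using 3 by (simp add: pderiv_diff pderiv_pCons pderiv_smult del: of_nat_Suc)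
  also have "\<dots> = He (Suc n) + Polynomial.smult (of_nat (Suc n)) (pCons 0 (He n) - Polynomial.smult (of_nat n) (He (n - 1)))"
    by (simp add: smult_diff_right)
  also have "\<dots> = He (Suc n) + Polynomial.smult (of_nat (Suc n)) (He (Suc n))"
    by (simp only: He_Suc[of n])
  also have "\<dots> = Polynomial.smult (of_nat (Suc (Suc n))) (He (Suc n))"
    by (simp only: of_nat_Suc[of "Suc n"] smult_add_left smult_1_left)
  finally show ?case by simp
qed (auto simp: pderiv_pCons)

lemma He_Suc': "He (Suc n) = pCons 0 (He n) - pderiv (He n)"
  by (simp only: He_Suc[of n] pderiv_He)

text \<open>\<open>He (Suc n)\<close> arises from \<open>He n\<close> by the adjoint of the
  derivative; repeated use moves all derivatives to the other factor and yields
  orthogonality.\<close>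

lemma Lg_He_Suc: "Lg (He (Suc n) * p) = Lg (He n * pderiv p)"
proof -
  have "Lg (He (Suc n) * p) = Lg (pCons 0 (He n * p)) - Lg (pderiv (He n) * p)"
    by (simp add: He_Suc' left_diff_distrib Lg_diff del: He.simps)
  thus ?thesis by (simp add: Lg_X pderiv_mult Lg_add mult.commute)
qed

lemma Lg_He_orth: "Lg (He a * He b) = (if a = b then fact a else 0)"
proof (induction a arbitrary: b)
  case 0
  show ?case
  proof (cases b)
    case 0
    thus ?thesis using Lg_monom[of 1 0] by (simp add: mo_0 monom_0 one_pCons)
  next
    case (Suc b')
    have "Lg (He (Suc b') * 1) = Lg (He b' * pderiv 1)" by (rule Lg_He_Suc)
    thus ?thesis using Suc by simp
  qed
next
  case (Suc a)
  show ?case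
  proof (cases b)
    case 0
    thus ?thesis using Lg_He_Suc[of a 1] by simp
  next
    case (Suc b')
    have "Lg (He (Suc a) * He b) = of_nat b * Lg (He a * He b')"
      unfolding Lg_He_Suc pderiv_He Suc by (simp add: Lg_smult)
    thus ?thesis using Suc.IH[of b'] Suc by simp
  qed
qed

lemma He_monic: "degree (He n) = n \<and> coeff (He n) n = 1"
proof (induction n rule: He.induct)
  case (3 n)
  have d: "degree (pCons 0 (He (Suc n))) = Suc (Suc n)" using 3 by (simp del: He.simps) (metis coeff_0 zero_neq_one)
  have l: "degree (Polynomial.smult (of_nat (Suc n)) (He n)) < Suc (Suc n)" using 3 by (simp del: of_nat_Suc)
  have "degree (He (Suc (Suc n))) = Suc (Suc n)"
    unfolding He.simps diff_conv_add_uminus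
    using degree_add_eq_left[of "- Polynomial.smult (of_nat (Suc n)) (He n)" "pCons 0 (He (Suc n))"] d l
    by (simp only: degree_minus)
  moreover have "coeff (He n) (Suc (Suc n)) = 0" using 3 by (intro coeff_eq_0) simp
  ultimately show ?case using 3 by simp
qed auto

section \<open>The Hermite determinant\<close>

definition nb :: "(nat \<Rightarrow> real) \<Rightarrow> nat \<Rightarrow> real poly" where
  "nb x k = (\<Prod>l<k. [:- x l, 1:])"

lemma nb_monic: "degree (nb x k) = k \<and> coeff (nb x k) k = 1"
proof (induction k)
  case (Suc k)
  have e: "nb x (Suc k) = nb x k * [:- x k, 1:]" by (simp add: nb_def)
  have "nb x k \<noteq> 0" using Suc by (metis coeff_0 zero_neq_one)
  hence "degree (nb x (Suc k)) = Suc k" unfolding e using Suc by (subst degree_mult_eq) auto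
  moreover have "coeff (nb x k) (Suc k) = 0" using Suc by (intro coeff_eq_0) simp
  hence "coeff (nb x (Suc k)) (Suc k) = 1" unfolding e using Suc by simp
  ultimately show ?case by simp
qed (simp add: nb_def)

lemma newton_basis:
  "degree p \<le> j \<Longrightarrow> \<exists>c. p = (\<Sum>k\<le>j. Polynomial.smult (c k) (nb x k)) \<and> c j = coeff p j"
proof (induction j arbitrary: p)
  case 0
  then obtain a where "p = [:a:]" by (metis degree_eq_zeroE le_zero_eq)
  thus ?case by (intro exI[of _ "\<lambda>_. a"]) (simp add: nb_def)
next
  case (Suc j)
  define q where "q = p - Polynomial.smult (coeff p (Suc j)) (nb x (Suc j))"
  have "degree q \<le> j"
  proof (rule degree_le, intro allI impI)
    fix i assume "j < i"
    thus "coeff q i = 0"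
    proof (cases "i = Suc j")
      case False
      with \<open>j < i\<close> have "coeff p i = 0" "coeff (nb x (Suc j)) i = 0"
        using Suc.prems nb_monic[of x "Suc j"] by (auto intro!: coeff_eq_0)
      thus ?thesis by (simp add: q_def)
    qed (use nb_monic[of x "Suc j"] in \<open>simp add: q_def\<close>)
  qed
  then obtain c where c: "q = (\<Sum>k\<le>j. Polynomial.smult (c k) (nb x k))" using Suc.IH by blast
  have "p = q + Polynomial.smult (coeff p (Suc j)) (nb x (Suc j))" by (simp add: q_def)
  hence "p = (\<Sum>k\<le>Suc j. Polynomial.smult ((c(Suc j := coeff p (Suc j))) k) (nb x k))" unfolding c by simp
  thus ?case by (intro exI[of _ "c(Suc j := coeff p (Suc j))"]) auto
qed

definition hdet :: "nat \<Rightarrow> (nat \<Rightarrow> real) \<Rightarrow> real" where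
  "hdet N x = (\<Sum>\<sigma> | \<sigma> permutes {..<N}. of_int (sign \<sigma>) * (\<Prod>i<N. poly (He (\<sigma> i)) (x i)))"

text \<open>The matrix factors through the Newton basis at the nodes. \<open>B\<close> is lower
  triangular because \<open>nb x k\<close> vanishes at the earlier nodes, with the Vandermonde
  products on its diagonal; the change of basis \<open>U\<close> is unitriangular because the
  polynomials are monic.\<close>

lemma hdet_vandermonde: "hdet N x = (\<Prod>i<N. \<Prod>j<i. (x i - x j))"
proof -
  define c where "c = (\<lambda>j. SOME c. He j = (\<Sum>k\<le>j. Polynomial.smult (c k) (nb x k)) \<and> c j = coeff (He j) j)"
  have c: "He j = (\<Sum>k\<le>j. Polynomial.smult (c j k) (nb x k))" "c j j = 1" for j
    using someI_ex[OF newton_basis[of "He j" j x]] He_monic[of j] unfolding c_def by auto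
  define A where "A = mat N N (\<lambda>(i, j). poly (He j) (x i))"
  define B where "B = mat N N (\<lambda>(i, k). poly (nb x k) (x i))"
  define U where "U = mat N N (\<lambda>(k, j). if k \<le> j then c j k else 0)"
  have "A = B * U"
  proof (rule eq_matI)
    fix i j assume "i < dim_row (B * U)" "j < dim_col (B * U)"
    hence ij: "i < N" "j < N" by (auto simp: B_def U_def)
    have "(B * U) $$ (i, j) = (\<Sum>k<N. poly (nb x k) (x i) * (if k \<le> j then c j k else 0))"
      using ij by (simp add: B_def U_def scalar_prod_def atLeast0LessThan)
    also have "\<dots> = (\<Sum>k\<le>j. poly (nb x k) (x i) * c j k)"
      using ij by (intro sum.mono_neutral_cong_right) auto
    also have "\<dots> = poly (\<Sum>k\<le>j. Polynomial.smult (c j k) (nb x k)) (x i)"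
      by (simp add: poly_sum mult.commute)
    also have "\<dots> = A $$ (i, j)" using ij by (simp add: A_def c(1)[symmetric])
    finally show "A $$ (i, j) = (B * U) $$ (i, j)" ..
  qed (auto simp: A_def B_def U_def)
  hence "Determinant.det A = Determinant.det B * Determinant.det U"
    using det_mult[of B N U] by (simp add: B_def U_def)
  moreover have "Determinant.det U = 1"
  proof -
    have "Determinant.det U = prod_list (diag_mat U)"
      by (rule det_upper_triangular[of _ N]) (auto simp: U_def)
    also have "\<dots> = (\<Prod>i<N. U $$ (i, i))"
      by (subst prod_list_diag_prod) (simp add: U_def atLeast0LessThan)
    also have "\<dots> = 1" using c(2) by (intro prod.neutral) (auto simp: U_def)
    finally show ?thesis .
  qed
  moreover have "Determinant.det B = (\<Prod>i<N. \<Prod>j<i. (x i - x j))"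
  proof -
    have "Determinant.det B = prod_list (diag_mat B)"
    proof (rule det_lower_triangular[of N])
      fix i j assume "i < j" "j < N"
      thus "B $$ (i, j) = 0" by (auto simp: B_def nb_def poly_prod)
    qed (auto simp: B_def)
    also have "\<dots> = (\<Prod>i<N. B $$ (i, i))"
      by (subst prod_list_diag_prod) (simp add: B_def atLeast0LessThan)
    also have "\<dots> = (\<Prod>i<N. \<Prod>j<i. (x i - x j))"
      by (intro prod.cong) (auto simp: B_def nb_def poly_prod)
    finally show ?thesis .
  qed
  moreover have "Determinant.det A = hdet N x"
    by (subst det_def'[of _ N]) (auto simp: A_def hdet_def atLeast0LessThan intro!: sum.cong prod.cong)
  ultimately show ?thesis by simp
qed

lemma vdm2_hdet: "vdm2 N x = (hdet N x)\<^sup>2"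
  by (simp add: vdm2_def hdet_vandermonde prod_power_distrib)

section \<open>One-point averages\<close>

lemma gE_poly_prod: "gE N (\<lambda>x. \<Prod>i<N. poly (p i) (x i)) = (\<Prod>i<N. Lg (p i))"
  unfolding Lg_def by (rule gE_prod) (rule integrable_gaussm_poly)

lemma polyf_poly: "i < N \<Longrightarrow> polyf N (\<lambda>x. poly p (x i))"
proof -
  assume i: "i < N"
  have "polyf N (\<lambda>x. \<Sum>k\<le>degree p. coeff p k * x i ^ k)"
    by (intro polyf_sum polyf_cmult polyf_power polyf_coord i)
  thus ?thesis by (simp add: poly_altdef)
qed

text \<open>Both determinants are expanded. Orthogonality at all sites except \<open>i\<close>
  forces the two permutations to agree there, hence everywhere, so a single sum over permutations
  with one weighted integral remains.\<close>

lemma gE_one_body: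
  "gE N (\<lambda>x. (\<Sum>i<N. poly \<phi> (x i)) * vdm2 N x) =
     fact N * (\<Prod>j<N. fact j) * (\<Sum>j<N. Lg (\<phi> * (He j * He j)) / fact j)"
proof -
  let ?P = "{\<sigma>. \<sigma> permutes {..<N}}"
  have fP: "finite ?P" by (intro finite_permutations) auto
  define w where "w = (\<lambda>i l :: nat. if l = i then \<phi> else (1 :: real poly))"
  define T where "T = (\<lambda>i \<sigma> \<tau> x. \<Prod>l<N. poly (w i l * (He (\<sigma> l) * He (\<tau> l))) (x l))"
  have pT: "polyf N (T i \<sigma> \<tau>)" for i \<sigma> \<tau> unfolding T_def by (intro polyf_prod polyf_poly) auto
  have "(\<Sum>i<N. poly \<phi> (x i)) * vdm2 N x =
     (\<Sum>i<N. \<Sum>\<sigma>\<in>?P. \<Sum>\<tau>\<in>?P. of_int (sign \<sigma>) * of_int (sign \<tau>) * T i \<sigma> \<tau> x)" for x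
  proof -
    have "poly \<phi> (x i) = (\<Prod>l<N. poly (w i l) (x l))" if "i < N" for i
    proof -
      have "(\<Prod>l<N. poly (w i l) (x l)) = (\<Prod>l<N. if l = i then poly \<phi> (x l) else 1)"
        by (intro prod.cong) (auto simp: w_def)
      thus ?thesis using that by simp
    qed
    hence "(\<Sum>i<N. poly \<phi> (x i)) * vdm2 N x = (\<Sum>i<N. (\<Prod>l<N. poly (w i l) (x l)) * (hdet N x * hdet N x))"
      by (simp add: vdm2_hdet power2_eq_square sum_distrib_right)
    also have "\<dots> = (\<Sum>i<N. \<Sum>\<sigma>\<in>?P. \<Sum>\<tau>\<in>?P. of_int (sign \<sigma>) * of_int (sign \<tau>) * T i \<sigma> \<tau> x)"
      unfolding hdet_def sum_product unfolding sum_distrib_left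
      by (intro sum.cong refl) (simp add: T_def prod.distrib mult_ac)
    finally show ?thesis .
  qed
  hence "gE N (\<lambda>x. (\<Sum>i<N. poly \<phi> (x i)) * vdm2 N x) =
     (\<Sum>i<N. \<Sum>\<sigma>\<in>?P. \<Sum>\<tau>\<in>?P. of_int (sign \<sigma>) * of_int (sign \<tau>) * gE N (T i \<sigma> \<tau>))"
    using pT by (simp add: gE_sum gE_cmult polyf_sum polyf_cmult)
  also have "\<dots> = (\<Sum>i<N. \<Sum>\<sigma>\<in>?P. (\<Prod>j<N. fact j) * (Lg (\<phi> * (He (\<sigma> i) * He (\<sigma> i))) / fact (\<sigma> i)))"
  proof (intro sum.cong refl)
    fix i \<sigma> assume i: "i \<in> {..<N}" and s: "\<sigma> \<in> ?P"
    have T: "gE N (T i \<sigma> \<tau>) = Lg (\<phi> * (He (\<sigma> i) * He (\<tau> i))) * (\<Prod>l\<in>{..<N} - {i}. if \<sigma> l = \<tau> l then fact (\<sigma> l) else 0)" for \<tau>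
      unfolding T_def gE_poly_prod using i
      by (subst prod.remove[of _ i]) (auto simp: w_def Lg_He_orth intro!: prod.cong)
    have z: "gE N (T i \<sigma> \<tau>) = 0" if t: "\<tau> \<in> ?P" "\<tau> \<noteq> \<sigma>" for \<tau>
    proof -
      have "\<exists>l\<in>{..<N} - {i}. \<sigma> l \<noteq> \<tau> l"
      proof (rule ccontr)
        assume "\<not> ?thesis"
        hence eq: "\<And>l. l \<noteq> i \<Longrightarrow> \<sigma> l = \<tau> l"
          using s t by (metis Diff_iff insertE mem_Collect_eq permutes_not_in singletonD emptyE)
        have "\<sigma> i = \<tau> i"
        proof (rule ccontr)
          assume ne: "\<sigma> i \<noteq> \<tau> i"
          obtain l where l: "\<sigma> l = \<tau> i" using s permutes_surj[of \<sigma>] by (metis mem_Collect_eq surjD)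
          hence "l \<noteq> i" using ne by auto
          hence "\<tau> l = \<tau> i" using eq l by metis
          hence "l = i" using t permutes_inj[of \<tau>] by (auto dest: injD)
          thus False using \<open>l \<noteq> i\<close> by blast
        qed
        hence "\<sigma> = \<tau>" using eq by (intro ext) metis
        thus False using t by blast
      qed
      thus ?thesis unfolding T by auto
    qed
    have "(\<Sum>\<tau>\<in>?P. of_int (sign \<sigma>) * of_int (sign \<tau>) * gE N (T i \<sigma> \<tau>)) =
          (\<Sum>\<tau>\<in>{\<sigma>}. of_int (sign \<sigma>) * of_int (sign \<tau>) * gE N (T i \<sigma> \<tau>))"
      using s fP z by (intro sum.mono_neutral_right) auto
    also have "\<dots> = gE N (T i \<sigma> \<sigma>)" by (simp flip: of_int_mult)
    also have "\<dots> = Lg (\<phi> * (He (\<sigma> i) * He (\<sigma> i))) * (\<Prod>l\<in>{..<N} - {i}. fact (\<sigma> l))"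
      by (simp add: T)
    also have "(\<Prod>l\<in>{..<N} - {i}. fact (\<sigma> l)) = (\<Prod>j<N. fact j) / (fact (\<sigma> i) :: real)"
    proof -
      have "(\<Prod>j<N. fact j) = (\<Prod>l<N. fact (\<sigma> l) :: real)"
        using s prod.permute[of \<sigma> "{..<N}" fact] by (simp add: o_def)
      also have "\<dots> = fact (\<sigma> i) * (\<Prod>l\<in>{..<N} - {i}. fact (\<sigma> l))"
        using i by (intro prod.remove) auto
      finally show ?thesis by simp
    qed
    finally show "(\<Sum>\<tau>\<in>?P. of_int (sign \<sigma>) * of_int (sign \<tau>) * gE N (T i \<sigma> \<tau>)) =
      (\<Prod>j<N. fact j) * (Lg (\<phi> * (He (\<sigma> i) * He (\<sigma> i))) / fact (\<sigma> i))" by simp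
  qed
  also have "\<dots> = (\<Sum>\<sigma>\<in>?P. \<Sum>i<N. (\<Prod>j<N. fact j) * (Lg (\<phi> * (He (\<sigma> i) * He (\<sigma> i))) / fact (\<sigma> i)))"
    by (rule sum.swap)
  also have "\<dots> = (\<Sum>\<sigma>\<in>?P. \<Sum>i<N. (\<Prod>j<N. fact j) * (Lg (\<phi> * (He i * He i)) / fact i))"
  proof (rule sum.cong[OF refl])
    fix \<sigma> assume "\<sigma> \<in> ?P"
    thus "(\<Sum>i<N. (\<Prod>j<N. fact j) * (Lg (\<phi> * (He (\<sigma> i) * He (\<sigma> i))) / fact (\<sigma> i))) =
      (\<Sum>i<N. (\<Prod>j<N. fact j) * (Lg (\<phi> * (He i * He i)) / fact i))"
      using sum.permute[of \<sigma> "{..<N}" "\<lambda>i. (\<Prod>j<N. fact j) * (Lg (\<phi> * (He i * He i)) / fact i)"]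
      by (simp add: o_def)
  qed
  also have "\<dots> = fact N * (\<Prod>j<N. fact j) * (\<Sum>j<N. Lg (\<phi> * (He j * He j)) / fact j)"
    by (simp add: card_permutations sum_distrib_left mult_ac)
  finally show ?thesis .
qed

definition mN :: "nat \<Rightarrow> nat \<Rightarrow> real" where
  "mN N k = (\<Sum>j<N. Lg (monom 1 k * (He j * He j)) / fact j)"

lemma gM_Nil: "N > 0 \<Longrightarrow> gM N [] = fact N * (\<Prod>j<N. fact j)"
proof -
  assume N: "N > 0"
  have "gE N (\<lambda>x. (\<Sum>i<N. poly 1 (x i)) * vdm2 N x) = of_nat N * gM N []"
    by (simp add: gM_def pprod_def gE_cmult)
  moreover have "(\<Sum>j<N. Lg (1 * (He j * He j)) / fact j) = of_nat N"
    by (simp add: Lg_He_orth)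
  ultimately show ?thesis using gE_one_body[of N 1] N by simp
qed

lemma gM_single: "N > 0 \<Longrightarrow> gM N [k] = gM N [] * mN N k"
  using gE_one_body[of N "monom 1 k"]
  by (simp add: gM_Nil mN_def gM_def[of N "[k]"] pprod_def psum_def poly_monom)

section \<open>The Toda recursion in N\<close>

lemma Lg_by_parts: "Lg (pderiv p * g) = Lg (p * (pCons 0 g - pderiv g))"
  using Lg_X[of "p * g"] by (simp add: pderiv_mult Lg_add Lg_diff right_diff_distrib mult.commute)

text \<open>An integrated form of the Christoffel-Darboux identity: after integration by parts the
  sum telescopes in \<open>j\<close>.\<close>

lemma one_body_deriv:
  "(\<Sum>j<Suc n. Lg (pderiv p * (He j * He j)) / fact j) = Lg (p * (He (Suc n) * He n)) / fact n"
proof (induction n)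
  case 0
  show ?case using Lg_by_parts[of p 1] by simp
next
  case (Suc n)
  let ?j = "Suc n"
  have "pCons 0 (He ?j * He ?j) - pderiv (He ?j * He ?j) = He (Suc ?j) * He ?j - He ?j * pderiv (He ?j)"
    unfolding He_Suc'[of ?j] by (simp add: pderiv_mult algebra_simps del: He.simps)
  also have "pderiv (He ?j) = Polynomial.smult (of_nat ?j) (He n)" using pderiv_He[of ?j] by simp
  finally have "Lg (pderiv p * (He ?j * He ?j)) = Lg (p * (He (Suc ?j) * He ?j)) - of_nat ?j * Lg (p * (He ?j * He n))"
    unfolding Lg_by_parts by (simp add: right_diff_distrib Lg_diff Lg_smult del: He.simps of_nat_Suc)
  hence "Lg (pderiv p * (He ?j * He ?j)) / fact ?j = Lg (p * (He (Suc ?j) * He ?j)) / fact ?j - Lg (p * (He ?j * He n)) / fact n"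
    by (simp add: diff_divide_distrib del: He.simps of_nat_Suc)
  thus ?case using Suc.IH unfolding sum.lessThan_Suc[of _ ?j] by (simp del: He.simps)
qed

text \<open>The same integration by parts for neighbouring Hermite polynomials, with
  \<open>He (Suc n) = x He n - (He n)'\<close>.\<close>

lemma two_body_deriv:
  "Lg (pderiv p * (He (Suc n) * He n)) / fact n =
   of_nat (Suc n) * (Lg (p * (He (Suc n) * He (Suc n))) / fact (Suc n) - Lg (p * (He n * He n)) / fact n)"
proof -
  have "pCons 0 (He (Suc n) * He n) - pderiv (He (Suc n) * He n) =
      He (Suc n) * (pCons 0 (He n) - pderiv (He n)) - pderiv (He (Suc n)) * He n"
    by (simp add: pderiv_mult algebra_simps del: He.simps)
  also have "\<dots> = He (Suc n) * He (Suc n) - Polynomial.smult (of_nat (Suc n)) (He n * He n)"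
    using pderiv_He[of "Suc n"] by (simp add: He_Suc'[symmetric] del: He.simps of_nat_Suc)
  finally have "Lg (pderiv p * (He (Suc n) * He n)) = Lg (p * (He (Suc n) * He (Suc n))) - of_nat (Suc n) * Lg (p * (He n * He n))"
    unfolding Lg_by_parts by (simp add: right_diff_distrib Lg_diff Lg_smult del: He.simps of_nat_Suc)
  moreover have "fact (Suc n) = real (Suc n) * fact n" by simp
  ultimately show ?thesis
    by (simp add: diff_divide_distrib right_diff_distrib del: He.simps of_nat_Suc fact_Suc)
qed

text \<open>Two derivatives lower \<open>x^(k+2)\<close> to \<open>x^k\<close>. Integrated by parts
  twice, they become a difference of two neighbouring squares, which is a second difference of
  \<open>mN\<close> in the number of variables.\<close>

lemma mN_toda:
  "of_nat (Suc n) * (mN (Suc (Suc n)) (k + 2) - 2 * mN (Suc n) (k + 2) + mN n (k + 2)) =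
   of_nat ((k + 2) * (k + 1)) * mN (Suc n) k"
proof -
  let ?p = "monom 1 (k + 2) :: real poly"
  have "of_nat ((k + 2) * (k + 1)) * mN (Suc n) k = (\<Sum>j<Suc n. Lg (pderiv (pderiv ?p) * (He j * He j)) / fact j)"
  proof -
    have "pderiv (pderiv ?p) = Polynomial.smult (of_nat ((k + 2) * (k + 1))) (monom 1 k)"
      by (simp add: pderiv_monom smult_monom algebra_simps)
    thus ?thesis by (simp add: mN_def sum_distrib_left Lg_smult del: of_nat_mult sum.lessThan_Suc)
  qed
  also have "\<dots> = of_nat (Suc n) * (Lg (?p * (He (Suc n) * He (Suc n))) / fact (Suc n) - Lg (?p * (He n * He n)) / fact n)"
    unfolding one_body_deriv two_body_deriv ..
  also have "Lg (?p * (He (Suc n) * He (Suc n))) / fact (Suc n) - Lg (?p * (He n * He n)) / fact n =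
     mN (Suc (Suc n)) (k + 2) - 2 * mN (Suc n) (k + 2) + mN n (k + 2)"
    unfolding mN_def sum.lessThan_Suc by simp
  finally show ?thesis ..
qed

section \<open>Loop equations and the genus expansion\<close>

lemma spl_fundef_cong [fundef_cong]:
  assumes "xs = ys" "\<And>a b. length a + length b = length ys \<Longrightarrow> f a b = g a b"
  shows "spl f xs = spl g ys"
  using assms spl_cong_length by blast

lemma spl_Nil_left: "spl (\<lambda>I J. if I = [] then f J else 0) xs = f xs"
  by (induction xs arbitrary: f) (auto simp: spl_zero)

lemma spl_assoc:
  "spl (\<lambda>I J. spl (\<lambda>I' J'. f I I' J') J) xs = spl (\<lambda>L J'. spl (\<lambda>I I'. f I I' J') L) xs"
proof (induction xs arbitrary: f)
  case (Cons x xs)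
  show ?case
    using Cons.IH[of "\<lambda>I I' J'. f (x # I) I' J'"] Cons.IH[of "\<lambda>I I' J'. f I (x # I') J'"]
      Cons.IH[of "\<lambda>I I' J'. f I I' (x # J')"]
    by (simp add: spl_add add.assoc)
qed simp

lemma dsum_add: "dsum (\<lambda>y r. f y r + g y r) xs = dsum f xs + dsum g xs"
  by (induction xs arbitrary: f g) (auto simp: algebra_simps)

lemma dsum_cong_mset:
  assumes "\<And>y r. mset (y # r) = mset xs \<Longrightarrow> f y r = g y r"
  shows "dsum f xs = dsum g xs"
  using assms
proof (induction xs arbitrary: f g)
  case (Cons x xs)
  have "dsum (\<lambda>y r. f y (x # r)) xs = dsum (\<lambda>y r. g y (x # r)) xs"
    by (rule Cons.IH) (rule Cons.prems, simp)
  thus ?case using Cons.prems[of x xs] by simp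
qed auto

lemma spl_dsum:
  "spl (\<lambda>I J. dsum (\<lambda>k r. f k r J) I) xs = dsum (\<lambda>k r. spl (\<lambda>I J. f k I J) r) xs"
proof (induction xs arbitrary: f)
  case (Cons x xs)
  show ?case
    using Cons.IH[of "\<lambda>k r J. f k (x # r) J"] Cons.IH[of "\<lambda>k r J. f k r (x # J)"]
    by (simp add: spl_add dsum_add add.assoc)
qed simp

lemma poly_spl: "poly (spl f xs) x = spl (\<lambda>a b. poly (f a b) x) xs"
  by (induction xs arbitrary: f) auto

lemma coeff_spl: "coeff (spl f xs) n = spl (\<lambda>a b. coeff (f a b) n) xs"
  by (induction xs arbitrary: f) auto

lemma coeff_dsum: "coeff (dsum f xs) n = dsum (\<lambda>a b. coeff (f a b) n) xs"
  by (induction xs arbitrary: f) auto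

lemma poly_dsum: "poly (dsum f xs) x = dsum (\<lambda>a b. poly (f a b) x) xs"
  by (induction xs arbitrary: f) auto

lemma of_real_dsum: "of_real (dsum f xs) = dsum (\<lambda>y r. of_real (f y r)) xs"
  by (induction xs arbitrary: f) auto

lemma dsum_divide: "dsum f xs / (c :: 'a :: field) = dsum (\<lambda>y r. f y r / c) xs"
  by (induction xs arbitrary: f) (auto simp: add_divide_distrib)

text \<open>Splitting and joining both lower the sum of the entries by 2, and removing a zero entry
  shortens the list; the induction measure combines the two.\<close>

lemma tutte_unique:
  fixes M M' :: "nat list \<Rightarrow> complex"
  assumes "M [] = M' []" "\<And>l. M (0 # l) = \<nu> * M l" "\<And>l. M' (0 # l) = \<nu> * M' l"
    and "\<And>m l. M (Suc m # l) = (\<Sum>a<m. M (a # (m - 1 - a) # l)) + dsum (\<lambda>k r. of_nat k * M ((m + k - 1) # r)) l"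
    and "\<And>m l. M' (Suc m # l) = (\<Sum>a<m. M' (a # (m - 1 - a) # l)) + dsum (\<lambda>k r. of_nat k * M' ((m + k - 1) # r)) l"
  shows "M l = M' l"
proof (induction "2 * sum_list l + length l" arbitrary: l rule: less_induct)
  case less
  show ?case
  proof (cases l)
    case Nil thus ?thesis using assms(1) by simp
  next
    case (Cons k l')
    show ?thesis
    proof (cases k)
      case 0
      have "M l' = M' l'" by (rule less) (simp add: Cons 0)
      thus ?thesis using assms(2,3) by (simp add: Cons 0)
    next
      case (Suc m)
      have "(\<Sum>a<m. M (a # (m - 1 - a) # l')) = (\<Sum>a<m. M' (a # (m - 1 - a) # l'))"
        by (intro sum.cong refl less) (auto simp: Cons Suc)
      moreover have "dsum (\<lambda>k r. of_nat k * M ((m + k - 1) # r)) l' = dsum (\<lambda>k r. of_nat k * M' ((m + k - 1) # r)) l'"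
      proof (rule dsum_cong_mset)
        fix y r assume "mset (y # r) = mset l'"
        hence s: "sum_list l' = y + sum_list r" "length l' = Suc (length r)"
          by (metis sum_mset_sum_list sum_list.Cons, metis length_Cons size_mset)
        show "of_nat y * M ((m + y - 1) # r) = of_nat y * M' ((m + y - 1) # r)"
        proof (cases y)
          case (Suc y')
          have "M ((m + y - 1) # r) = M' ((m + y - 1) # r)"
            by (rule less) (simp add: Cons \<open>k = Suc m\<close> s Suc)
          thus ?thesis by simp
        qed simp
      qed
      ultimately show ?thesis using assms(4,5) by (simp only: Cons Suc)
    qed
  qed
qed

section \<open>Tutte's equations for connected numbers, graded by genus\<close>

locale tutte =
  fixes \<kappa> :: "nat \<Rightarrow> nat list \<Rightarrow> complex"
  assumes \<kappa>_0: "\<kappa> g (0 # l) = (if g = 0 \<and> l = [] then 1 else 0)"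
    and \<kappa>_Suc: "\<kappa> g (Suc m # l) =
      (\<Sum>a<m. (if g = 0 then 0 else \<kappa> (g - 1) (a # (m - 1 - a) # l)) +
             (\<Sum>h\<le>g. spl (\<lambda>I J. \<kappa> h (a # I) * \<kappa> (g - h) ((m - 1 - a) # J)) l)) +
      dsum (\<lambda>k r. of_nat k * \<kappa> g ((m + k - 1) # r)) l"
begin

lemma mset_split_sums:
  assumes "mset a + mset b = mset (xs :: nat list)"
  shows "sum_list xs = sum_list a + sum_list b" "length xs = length a + length b"
  using assms by (metis sum_mset.union sum_mset_sum_list, metis size_mset size_union)

lemma mset_del_sums:
  assumes "mset (y # r) = mset (xs :: nat list)"
  shows "sum_list xs = y + sum_list r" "length xs = Suc (length r)"
  using assms by (metis sum_mset_sum_list sum_list.Cons, metis length_Cons size_mset)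

text \<open>For maps with the entries as vertex degrees, Euler's formula with at least one face
  requires the sum of degrees to be at least \<open>4 g + 2 length l\<close>. Here the bound is
  derived from the recursion.\<close>

lemma \<kappa>_vanish: "sum_list (k # l) < 4 * g + 2 * length l \<Longrightarrow> \<kappa> g (k # l) = 0"
proof (induction "sum_list (k # l)" arbitrary: g k l rule: less_induct)
  case less
  show ?case
  proof (cases k)
    case 0
    thus ?thesis using less.prems by (auto simp: \<kappa>_0)
  next
    case (Suc m)
    have 1: "(if g = 0 then 0 else \<kappa> (g - 1) (a # (m - 1 - a) # l)) = 0" if "a < m" for a
      using that less.prems Suc by (auto intro!: less.hyps)
    have 2: "spl (\<lambda>I J. \<kappa> h (a # I) * \<kappa> (g - h) ((m - 1 - a) # J)) l = 0" if "a < m" "h \<le> g" for a h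
    proof -
      have "spl (\<lambda>I J. \<kappa> h (a # I) * \<kappa> (g - h) ((m - 1 - a) # J)) l = spl (\<lambda>I J. 0) l"
      proof (rule spl_cong_mset)
        fix I J assume "mset I + mset J = mset l"
        note s = mset_split_sums[OF this]
        \<comment> \<open>Genera and lengths add up while the degrees lose 2, so one of the two
          factors inherits the strict inequality.\<close>
        have "sum_list (a # I) < 4 * h + 2 * length I \<or> sum_list ((m - 1 - a) # J) < 4 * (g - h) + 2 * length J"
          using less.prems s that Suc by auto
        thus "\<kappa> h (a # I) * \<kappa> (g - h) ((m - 1 - a) # J) = 0"
        proof
          assume *: "sum_list (a # I) < 4 * h + 2 * length I"
          have "\<kappa> h (a # I) = 0" by (rule less.hyps[OF _ *]) (use s Suc that in simp)
          thus ?thesis by simp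
        next
          assume *: "sum_list ((m - 1 - a) # J) < 4 * (g - h) + 2 * length J"
          have "\<kappa> (g - h) ((m - 1 - a) # J) = 0" by (rule less.hyps[OF _ *]) (use s Suc that in simp)
          thus ?thesis by simp
        qed
      qed
      thus ?thesis by (simp add: spl_zero)
    qed
    have 3: "dsum (\<lambda>k r. of_nat k * \<kappa> g ((m + k - 1) # r)) l = dsum (\<lambda>k r. 0 * 0) l"
    proof (rule dsum_cong_mset)
      fix y r assume "mset (y # r) = mset l"
      note s = mset_del_sums[OF this]
      show "of_nat y * \<kappa> g ((m + y - 1) # r) = 0 * 0"
      proof (cases y)
        case (Suc y')
        have "\<kappa> g ((m + y - 1) # r) = 0"
          by (rule less.hyps) (use less.prems s \<open>k = Suc m\<close> Suc in auto)
        thus ?thesis by simp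
      qed simp
    qed
    have "dsum (\<lambda>k r. 0 * 0 :: complex) l = 0" unfolding dsum_cmult[symmetric] by simp
    thus ?thesis unfolding Suc \<kappa>_Suc 3 using 1 2 by simp
  qed
qed

text \<open>Generating polynomial in the genus. For a nonempty list the cut at
  \<open>sum_list l\<close> loses nothing, by the vanishing just shown.\<close>

definition KP :: "nat list \<Rightarrow> complex poly" where
  "KP l = (\<Sum>g\<le>sum_list l. monom (\<kappa> g l) g)"

lemma coeff_KP: "coeff (KP (k # l)) g = \<kappa> g (k # l)"
proof -
  have "coeff (KP (k # l)) g = (if g \<le> sum_list (k # l) then \<kappa> g (k # l) else 0)"
    by (simp add: KP_def coeff_sum)
  thus ?thesis using \<kappa>_vanish[of k l g] by (cases "g \<le> sum_list (k # l)") auto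
qed

lemma KP_0: "KP (0 # l) = (if l = [] then 1 else 0)"
  by (rule poly_eqI) (auto simp: coeff_KP \<kappa>_0 coeff_1)

lemma KP_Suc:
  "KP (Suc m # l) = (\<Sum>a<m. pCons 0 (KP (a # (m - 1 - a) # l)) +
      spl (\<lambda>I J. KP (a # I) * KP ((m - 1 - a) # J)) l) +
      dsum (\<lambda>k r. of_nat k * KP ((m + k - 1) # r)) l"
proof (rule poly_eqI)
  fix g
  have s: "coeff (spl (\<lambda>I J. KP (a # I) * KP ((m - 1 - a) # J)) l) g =
     (\<Sum>h\<le>g. spl (\<lambda>I J. \<kappa> h (a # I) * \<kappa> (g - h) ((m - 1 - a) # J)) l)" for a
    by (simp add: coeff_spl coeff_mult coeff_KP spl_sum)
  have c: "coeff (pCons 0 (KP (a # b # l))) g = (if g = 0 then 0 else \<kappa> (g - 1) (a # b # l))" for a b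
    by (cases g) (auto simp: coeff_KP)
  have d: "coeff (of_nat k * KP (j # r)) g = of_nat k * \<kappa> g (j # r)" for k j r
    by (simp add: of_nat_poly coeff_KP)
  show "coeff (KP (Suc m # l)) g = coeff ((\<Sum>a<m. pCons 0 (KP (a # (m - 1 - a) # l)) +
      spl (\<lambda>I J. KP (a # I) * KP ((m - 1 - a) # J)) l) +
      dsum (\<lambda>k r. of_nat k * KP ((m + k - 1) # r)) l) g"
    unfolding coeff_add coeff_sum coeff_dsum s c d coeff_KP \<kappa>_Suc ..
qed

section \<open>From connected numbers to Gaussian moments\<close>

context
  fixes N :: nat and c :: complex
  assumes N: "N > 0" and c: "c\<^sup>2 = of_nat N"
begin

lemma c_nz: "c \<noteq> 0" using N c by auto

text \<open>In genus \<open>g\<close> the exponent of \<open>N = c^2\<close> is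
  \<open>sum_list l / 2 - length l + 2 - 2 g\<close>, the number of faces of a map. The square root
  \<open>c\<close> allows odd sums, and the denominators keep all exponents natural numbers.\<close>

definition KE :: "nat list \<Rightarrow> complex" where
  "KE l = c ^ (sum_list l + 4) / c ^ (2 * length l) * poly (KP l) (1 / c ^ 4)"

lemma KE_0: "KE (0 # l) = (if l = [] then of_nat N else 0)"
  using c_nz c by (simp add: KE_def KP_0 power4_eq_xxxx power2_eq_square)

lemma KE_scale:
  assumes "i + 2 * q = j + 2 * p"
  shows "c ^ i / c ^ (2 * p) = c ^ j / c ^ (2 * q)"
proof -
  have "c ^ i * c ^ (2 * q) = c ^ j * c ^ (2 * p)" using assms by (simp flip: power_add)
  thus ?thesis using c_nz by (simp add: field_simps)
qed

lemma KE_Suc: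
  "KE (Suc m # l) = (\<Sum>a<m. KE (a # (m - 1 - a) # l) + spl (\<lambda>I J. KE (a # I) * KE ((m - 1 - a) # J)) l)
     + dsum (\<lambda>k r. of_nat k * KE ((m + k - 1) # r)) l"
proof -
  define \<tau> where "\<tau> = 1 / c ^ 4"
  define C where "C = c ^ (sum_list (Suc m # l) + 4) / c ^ (2 * length (Suc m # l))"
  have 1: "C * (\<tau> * poly (KP (a # (m - 1 - a) # l)) \<tau>) = KE (a # (m - 1 - a) # l)" if "a < m" for a
  proof -
    have "c ^ (2 * (length (Suc m # l) + 2)) = c ^ (2 * length (Suc m # l)) * c ^ 4"
      unfolding power_add[symmetric] by (rule arg_cong[where f = "(^) c"]) simp
    hence "C * \<tau> = c ^ (sum_list (Suc m # l) + 4) / c ^ (2 * (length (Suc m # l) + 2))"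
      by (simp only: C_def \<tau>_def times_divide_times_eq mult_1_right)
    also have "\<dots> = c ^ (sum_list (a # (m - 1 - a) # l) + 4) / c ^ (2 * length (a # (m - 1 - a) # l))"
      by (rule KE_scale) (use that in auto)
    finally show ?thesis
      unfolding KE_def \<tau>_def[symmetric] mult.assoc[symmetric] by (simp only:)
  qed
  have 2: "C * spl (\<lambda>I J. poly (KP (a # I)) \<tau> * poly (KP ((m - 1 - a) # J)) \<tau>) l =
           spl (\<lambda>I J. KE (a # I) * KE ((m - 1 - a) # J)) l" if "a < m" for a
    unfolding spl_cmult[symmetric]
  proof (rule spl_cong_mset)
    fix I J assume "mset I + mset J = mset l"
    note s = mset_split_sums[OF this]
    have "C = c ^ ((sum_list (a # I) + 4) + (sum_list ((m - 1 - a) # J) + 4)) / c ^ (2 * (length (a # I) + length ((m - 1 - a) # J)))"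
      unfolding C_def by (rule KE_scale) (use s that in auto)
    also have "\<dots> = (c ^ (sum_list (a # I) + 4) / c ^ (2 * length (a # I))) *
         (c ^ (sum_list ((m - 1 - a) # J) + 4) / c ^ (2 * length ((m - 1 - a) # J)))"
      by (simp only: power_add distrib_left times_divide_times_eq)
    finally show "C * (poly (KP (a # I)) \<tau> * poly (KP ((m - 1 - a) # J)) \<tau>) = KE (a # I) * KE ((m - 1 - a) # J)"
      unfolding KE_def \<tau>_def by (simp only: mult_ac)
  qed
  have 3: "C * dsum (\<lambda>k r. of_nat k * poly (KP ((m + k - 1) # r)) \<tau>) l = dsum (\<lambda>k r. of_nat k * KE ((m + k - 1) # r)) l"
    unfolding dsum_cmult
  proof (rule dsum_cong_mset)
    fix y r assume "mset (y # r) = mset l"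
    note s = mset_del_sums[OF this]
    show "C * (of_nat y * poly (KP ((m + y - 1) # r)) \<tau>) = of_nat y * KE ((m + y - 1) # r)"
    proof (cases y)
      case (Suc y')
      have "C = c ^ (sum_list ((m + y - 1) # r) + 4) / c ^ (2 * length ((m + y - 1) # r))"
        unfolding C_def by (rule KE_scale) (use s Suc in auto)
      thus ?thesis unfolding KE_def \<tau>_def by (simp only: mult_ac)
    qed simp
  qed
  have "KE (Suc m # l) = C * poly (KP (Suc m # l)) \<tau>" by (simp only: KE_def C_def \<tau>_def)
  also have "\<dots> = (\<Sum>a<m. C * (\<tau> * poly (KP (a # (m - 1 - a) # l)) \<tau>) +
      C * spl (\<lambda>I J. poly (KP (a # I)) \<tau> * poly (KP ((m - 1 - a) # J)) \<tau>) l) +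
      C * dsum (\<lambda>k r. of_nat k * poly (KP ((m + k - 1) # r)) \<tau>) l"
    unfolding KP_Suc by (simp add: poly_sum poly_spl poly_dsum sum_distrib_left distrib_left)
  also have "\<dots> = (\<Sum>a<m. KE (a # (m - 1 - a) # l) + spl (\<lambda>I J. KE (a # I) * KE ((m - 1 - a) # J)) l)
     + dsum (\<lambda>k r. of_nat k * KE ((m + k - 1) # r)) l"
    unfolding 3 using 1 2 by simp
  finally show ?thesis .
qed

text \<open>Moments from cumulants: the cumulant of the first entry takes the sublist
  \<open>I\<close>, and a moment of the rest remains.\<close>

function NM :: "nat list \<Rightarrow> complex" where
  "NM [] = 1"
| "NM (k # l) = spl (\<lambda>I J. KE (k # I) * NM J) l"
  by pat_completeness auto
termination by (relation "Wellfounded.measure length") auto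

lemma NM_0: "NM (0 # l) = of_nat N * NM l"
proof -
  have "(\<lambda>I J. KE (0 # I) * NM J) = (\<lambda>I J. if I = [] then of_nat N * NM J else 0)"
    by (intro ext) (simp add: KE_0)
  thus ?thesis by (simp add: spl_Nil_left)
qed

text \<open>In a moment with two new entries, these lie in one cumulant or in two. These cases are
  precisely the two kinds of splitting terms in the cumulant equation, so both are absorbed into
  one.\<close>

lemma NM_Suc:
  "NM (Suc m # l) = (\<Sum>a<m. NM (a # (m - 1 - a) # l)) + dsum (\<lambda>k r. of_nat k * NM ((m + k - 1) # r)) l"
proof -
  have mult_spl: "spl f xs * y = spl (\<lambda>a b. f a b * y) xs" for f xs and y :: complex
    by (induction xs arbitrary: f) (auto simp: distrib_right)
  have mult_dsum: "dsum f xs * y = dsum (\<lambda>a b. f a b * y) xs" for f xs and y :: complex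
    by (induction xs arbitrary: f) (auto simp: distrib_right)
  have a: "NM (a # b # l) = spl (\<lambda>I J. KE (a # b # I) * NM J) l +
      spl (\<lambda>L J. spl (\<lambda>I I'. KE (a # I) * KE (b # I')) L * NM J) l" for a b
  proof -
    have "NM (a # b # l) = spl (\<lambda>I J. KE (a # b # I) * NM J) l + spl (\<lambda>I J. KE (a # I) * NM (b # J)) l"
      by simp
    also have "spl (\<lambda>I J. KE (a # I) * NM (b # J)) l = spl (\<lambda>I J. spl (\<lambda>I' J'. KE (a # I) * KE (b # I') * NM J') J) l"
      by (simp add: spl_cmult mult.assoc)
    finally show ?thesis unfolding spl_assoc mult_spl .
  qed
  have "NM (Suc m # l) = spl (\<lambda>I J. (\<Sum>a<m. KE (a # (m - 1 - a) # I) * NM J +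
        spl (\<lambda>I I'. KE (a # I) * KE ((m - 1 - a) # I')) I * NM J)
     + dsum (\<lambda>k r. of_nat k * KE ((m + k - 1) # r) * NM J) I) l"
    by (simp add: KE_Suc distrib_right sum_distrib_right mult_dsum)
  also have "\<dots> = (\<Sum>a<m. NM (a # (m - 1 - a) # l)) +
      dsum (\<lambda>k r. spl (\<lambda>I J. of_nat k * KE ((m + k - 1) # I) * NM J) r) l"
    unfolding spl_add spl_sum spl_dsum a ..
  finally show ?thesis by (simp add: mult.assoc spl_cmult)
qed

lemma NM_eq: "NM l = of_real (gM N l / gM N [])"
proof (rule tutte_unique[where M = NM and M' = "\<lambda>l. of_real (gM N l / gM N [])" and \<nu> = "of_nat N"])
  have nz: "gM N [] \<noteq> 0" using gM_Nil[OF N] by simp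
  show "NM [] = of_real (gM N [] / gM N [])" using nz by simp
  fix l
  show "NM (0 # l) = of_nat N * NM l" by (rule NM_0)
  show "complex_of_real (gM N (0 # l) / gM N []) = of_nat N * complex_of_real (gM N l / gM N [])"
    by (simp add: gM_0)
  fix m
  show "NM (Suc m # l) = (\<Sum>a<m. NM (a # (m - 1 - a) # l)) + dsum (\<lambda>k r. of_nat k * NM ((m + k - 1) # r)) l"
    by (rule NM_Suc)
  show "complex_of_real (gM N (Suc m # l) / gM N []) = (\<Sum>a<m. complex_of_real (gM N (a # (m - 1 - a) # l) / gM N [])) +
      dsum (\<lambda>k r. of_nat k * complex_of_real (gM N ((m + k - 1) # r) / gM N [])) l"
    unfolding gM_Suc add_divide_distrib dsum_divide sum_divide_distrib of_real_add of_real_dsum of_real_sum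
    by simp
qed

lemma KE_single: "KE [k] = of_real (mN N k)"
proof -
  have "gM N [] \<noteq> 0" using gM_Nil[OF N] by simp
  thus ?thesis using NM_eq[of "[k]"] gM_single[OF N, of k] by simp
qed

end

text \<open>Genera above \<open>n div 2\<close> vanish by the face count, so
  \<open>n + 1 - 2 * g\<close> is not truncated and the moment is a polynomial in
  \<open>N\<close>.\<close>

lemma mN_genus_expansion:
  assumes N: "N > 0"
  shows "of_real (mN N (2 * n)) = (\<Sum>g\<le>n div 2. \<kappa> g [2 * n] * of_nat N ^ (n + 1 - 2 * g))"
proof -
  define c :: complex where "c = of_real (sqrt (of_nat N))"
  have c: "c\<^sup>2 = of_nat N" by (simp add: c_def flip: of_real_power)
  have nz: "c \<noteq> 0" using N c by auto
  have "of_real (mN N (2 * n)) = c ^ (2 * n + 4) / c ^ 2 * poly (KP [2 * n]) (1 / c ^ 4)"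
    using KE_single[OF N c, of "2 * n"] KE_def[OF N c, of "[2 * n]"] by simp
  also have "poly (KP [2 * n]) (1 / c ^ 4) = (\<Sum>g\<le>2 * n. \<kappa> g [2 * n] * (1 / c ^ 4) ^ g)"
    by (simp add: KP_def poly_sum poly_monom)
  also have "\<dots> = (\<Sum>g\<le>n div 2. \<kappa> g [2 * n] * (1 / c ^ 4) ^ g)"
  proof (rule sum.mono_neutral_right)
    show "\<forall>i\<in>{..2 * n} - {..n div 2}. \<kappa> i [2 * n] * (1 / c ^ 4) ^ i = 0"
    proof
      fix i assume "i \<in> {..2 * n} - {..n div 2}"
      hence "n < 2 * i" by auto
      thus "\<kappa> i [2 * n] * (1 / c ^ 4) ^ i = 0"
        using \<kappa>_vanish[of "2 * n" "[]" i] by simp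
    qed
  qed auto
  also have "c ^ (2 * n + 4) / c ^ 2 * \<dots> = (\<Sum>g\<le>n div 2. \<kappa> g [2 * n] * of_nat N ^ (n + 1 - 2 * g))"
    unfolding sum_distrib_left
  proof (intro sum.cong refl)
    fix g assume "g \<in> {..n div 2}"
    hence g: "2 * g \<le> n" by auto
    have "c ^ 2 * c ^ (4 * g) * (c ^ 2) ^ (n + 1 - 2 * g) = c ^ (2 + 4 * g + 2 * (n + 1 - 2 * g))"
      by (simp only: power_add power_mult)
    also have "2 + 4 * g + 2 * (n + 1 - 2 * g) = 2 * n + 4" using g by simp
    finally have "c ^ (2 * n + 4) = c ^ 2 * c ^ (4 * g) * (c ^ 2) ^ (n + 1 - 2 * g)" ..
    hence "c ^ (2 * n + 4) / c ^ 2 * (1 / c ^ 4) ^ g = of_nat N ^ (n + 1 - 2 * g)"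
      using nz N by (simp add: c power_divide field_simps flip: power_mult)
    thus "c ^ (2 * n + 4) / c ^ 2 * (\<kappa> g [2 * n] * (1 / c ^ 4) ^ g) = \<kappa> g [2 * n] * of_nat N ^ (n + 1 - 2 * g)"
      by (metis mult.left_commute)
  qed
  finally show ?thesis .
qed

end

section \<open>Bernoulli numbers\<close>

definition bfps :: "complex fps" where "bfps = fps_X / (fps_exp 1 - 1)"

lemma bernoulli_bfps: "bernoulli n = fact n * fps_nth bfps n"
  by (simp add: bernoulli_def bfps_def)

lemma bfps_mult: "bfps * (fps_exp 1 - 1) = fps_X"
proof -
  have s: "subdegree (fps_exp 1 - 1 :: complex fps) = 1"
    by (intro subdegreeI) (auto simp: less_Suc_eq)
  hence "(fps_exp 1 - 1 :: complex fps) dvd fps_X"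
    by (subst fps_dvd_iff) auto
  thus ?thesis unfolding bfps_def by (rule dvd_div_mult_self)
qed

lemma bfps_exp: "bfps * fps_exp 1 = bfps + fps_X"
  using bfps_mult by (simp add: algebra_simps)

lemma exp_minus_1_nz: "fps_exp 1 - 1 \<noteq> (0 :: complex fps)"
proof
  assume "fps_exp 1 - 1 = (0 :: complex fps)"
  hence "fps_nth (fps_exp 1 - 1 :: complex fps) 1 = 0" by simp
  thus False by simp
qed

text \<open>\<open>- X / (e^(-X) - 1) = X e^X / (e^X - 1)\<close>, and
  \<open>bfps * e^X = bfps + X\<close>. Parity of the coefficients follows from it.\<close>

lemma bfps_compose_uminus: "bfps oo (- fps_X) = bfps + fps_X"
proof -
  let ?E = "fps_exp 1 :: complex fps"
  have E: "?E oo (- fps_X) = inverse ?E"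
    by (simp add: fps_compose_uminus' fps_exp_neg[symmetric] fps_eq_iff)
  have EE: "?E * inverse ?E = 1" by (rule inverse_mult_eq_1') simp
  have A: "(bfps oo (- fps_X)) * (inverse ?E - 1) = - fps_X"
  proof -
    have "(bfps * (?E - 1)) oo (- fps_X) = (bfps oo (- fps_X)) * ((?E - 1) oo (- fps_X))"
      by (rule fps_compose_mult_distrib) simp
    moreover have "(?E - 1) oo (- fps_X) = inverse ?E - 1"
      by (simp only: fps_compose_sub_distrib E fps_compose_1)
    moreover have "fps_X oo (- fps_X) = (- fps_X :: complex fps)" by simp
    ultimately show ?thesis by (simp only: bfps_mult)
  qed
  have B: "(inverse ?E - 1) * ?E = 1 - ?E"
    by (simp only: left_diff_distrib mult.commute[of "inverse ?E"] EE mult_1_left)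
  have "(bfps oo (- fps_X)) * (?E - 1) = - ((bfps oo (- fps_X)) * ((inverse ?E - 1) * ?E))"
    unfolding B by (simp add: algebra_simps)
  also have "\<dots> = fps_X * ?E"
    unfolding mult.assoc[symmetric] A by simp
  finally have "(bfps oo (- fps_X)) * (?E - 1) = fps_X * ?E" .
  also have "\<dots> = (bfps + fps_X) * (?E - 1)"
    using bfps_mult by (simp add: algebra_simps)
  finally show ?thesis using exp_minus_1_nz by simp
qed

lemma bfps_odd: "odd k \<Longrightarrow> k \<ge> 3 \<Longrightarrow> fps_nth bfps k = 0"
proof -
  assume k: "odd k" "k \<ge> 3"
  have "fps_nth (bfps oo (- fps_X)) k = fps_nth (bfps + fps_X) k" by (simp only: bfps_compose_uminus)
  hence "- fps_nth bfps k = fps_nth bfps k" using k by (simp add: fps_compose_uminus' fps_X_nth)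
  thus ?thesis by simp
qed

lemma bfps_0: "fps_nth bfps 0 = 1"
proof -
  have "fps_nth (bfps * (fps_exp 1 - 1)) 1 = fps_nth (fps_X :: complex fps) 1" by (simp only: bfps_mult)
  thus ?thesis by (simp add: fps_mult_nth)
qed

text \<open>
  Comparing coefficients of \<open>X\<^sup>n\<close> in \<open>(X \<beta>' - \<beta>) (e\<^sup>X - 1) = - X \<beta> - X\<^sup>2\<close> for even \<open>n \<ge> 4\<close>,
  where \<open>\<beta> = X / (e\<^sup>X - 1)\<close>.
\<close>
lemma bernoulli_sum:
  assumes g: "g \<ge> 1"
  shows "(\<Sum>h=1..g. of_nat ((2 * g) choose (2 * (g + 1 - h))) * (bernoulli (2 * h) / of_nat (2 * h))) =
     fact (2 * g) / fact (2 * g + 2)"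
proof -
  define n where "n = 2 * g + 2"
  let ?\<beta> = "fps_nth bfps"
  let ?D = "fps_X * fps_deriv bfps - bfps"
  have "fps_deriv (bfps * (fps_exp 1 - 1)) = 1" by (simp add: bfps_mult)
  hence d: "fps_deriv bfps * (fps_exp 1 - 1) = 1 - bfps * fps_exp 1" by (simp add: algebra_simps)
  have "?D * (fps_exp 1 - 1) = fps_X * (fps_deriv bfps * (fps_exp 1 - 1)) - bfps * (fps_exp 1 - 1)"
    by (simp add: algebra_simps)
  also have "\<dots> = - (fps_X * bfps) - fps_X * fps_X"
    unfolding d bfps_mult bfps_exp by (simp add: algebra_simps)
  finally have "fps_nth (?D * (fps_exp 1 - 1)) n = fps_nth (- (fps_X * bfps) - fps_X * fps_X) n" by (simp only:)
  also have "\<dots> = - ?\<beta> (n - 1)" using g by (simp add: n_def fps_X_nth)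
  also have "\<dots> = 0" using bfps_odd[of "n - 1"] g by (simp add: n_def)
  finally have "fps_nth (?D * fps_exp 1) n = fps_nth ?D n" by (simp add: algebra_simps)
  moreover have D: "fps_nth ?D k = (of_nat k - 1) * ?\<beta> k" for k by (cases k) (auto simp: algebra_simps)
  ultimately have "(\<Sum>k\<le>n. (of_nat k - 1) * ?\<beta> k / fact (n - k)) = (of_nat n - 1) * ?\<beta> n"
    by (simp only: fps_mult_nth D atLeast0AtMost) (simp add: divide_inverse)
  moreover have "{..n} = insert n {..<n}" by auto
  ultimately have "(\<Sum>k<n. (of_nat k - 1) * ?\<beta> k / fact (n - k)) = 0" by simp
  also have "(\<Sum>k<n. (of_nat k - 1) * ?\<beta> k / fact (n - k)) =
      (\<Sum>k\<in>(\<lambda>h. 2 * h) ` {..g}. (of_nat k - 1) * ?\<beta> k / fact (n - k))"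
  proof (rule sum.mono_neutral_right)
    show "(\<lambda>h. 2 * h) ` {..g} \<subseteq> {..<n}" by (auto simp: n_def)
    show "\<forall>k\<in>{..<n} - (\<lambda>h. 2 * h) ` {..g}. (of_nat k - 1) * ?\<beta> k / fact (n - k) = 0"
    proof
      fix k assume k: "k \<in> {..<n} - (\<lambda>h. 2 * h) ` {..g}"
      have "odd k"
      proof
        assume "even k"
        then obtain h where "k = 2 * h" by (elim evenE)
        thus False using k by (auto simp: n_def)
      qed
      thus "(of_nat k - 1) * ?\<beta> k / fact (n - k) = 0"
        using bfps_odd[of k] by (cases "k = 1") (auto elim!: oddE)
    qed
  qed auto
  also have "\<dots> = (\<Sum>h\<le>g. (of_nat (2 * h) - 1) * ?\<beta> (2 * h) / fact (n - 2 * h))"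
    by (subst sum.reindex) (auto simp: inj_on_def)
  also have "\<dots> = - 1 / fact n + (\<Sum>h=1..g. (of_nat (2 * h) - 1) * ?\<beta> (2 * h) / fact (n - 2 * h))"
  proof -
    have "{..g} = insert 0 {1..g}" by auto
    thus ?thesis by (simp add: bfps_0)
  qed
  finally have S: "(\<Sum>h=1..g. (of_nat (2 * h) - 1) * ?\<beta> (2 * h) / fact (n - 2 * h)) = 1 / fact n"
    by (simp add: add_eq_0_iff)
  have "(\<Sum>h=1..g. of_nat ((2 * g) choose (2 * (g + 1 - h))) * (bernoulli (2 * h) / of_nat (2 * h))) =
        (\<Sum>h=1..g. fact (2 * g) * ((of_nat (2 * h) - 1) * ?\<beta> (2 * h) / fact (n - 2 * h)))"
  proof (intro sum.cong refl)
    fix h assume h: "h \<in> {1..g}"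
    then obtain j where j: "h = Suc j" by (cases h) auto
    have e: "2 * (g + 1 - h) = n - 2 * h" "2 * g - (n - 2 * h) = 2 * j" "n - 2 * h \<le> 2 * g"
      using h by (auto simp: n_def j)
    have f: "fact (2 * h) = (of_nat (2 * h) * (of_nat (2 * h) - 1) * fact (2 * j) :: complex)"
      by (simp add: j algebra_simps)
    have "of_nat ((2 * g) choose (2 * (g + 1 - h))) = (fact (2 * g) / (fact (n - 2 * h) * fact (2 * j)) :: complex)"
      using binomial_fact[OF e(3), where 'a = complex] by (simp only: e)
    moreover have "bernoulli (2 * h) / of_nat (2 * h) = (of_nat (2 * h) - 1) * fact (2 * j) * ?\<beta> (2 * h)"
    proof -
      have "(k * (k - 1) * F * b) / k = (k - 1) * F * b" if "k \<noteq> 0" for k F b :: complex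
        using that by simp
      moreover have "of_nat (2 * h) \<noteq> (0 :: complex)" using h by (simp only: of_nat_eq_0_iff) simp
      ultimately show ?thesis unfolding bernoulli_bfps f by blast
    qed
    ultimately show "of_nat ((2 * g) choose (2 * (g + 1 - h))) * (bernoulli (2 * h) / of_nat (2 * h)) =
        fact (2 * g) * ((of_nat (2 * h) - 1) * ?\<beta> (2 * h) / fact (n - 2 * h))" by simp
  qed
  also have "\<dots> = fact (2 * g) / fact (2 * g + 2)"
    unfolding sum_distrib_left[symmetric] S by (simp add: n_def)
  finally show ?thesis .
qed

definition binp :: "complex \<Rightarrow> nat \<Rightarrow> complex poly" where
  "binp c k = Polynomial.smult (1 / fact k) (\<Prod>l<k. [:c - of_nat l, 1:])"

lemma poly_binp: "poly (binp c k) x = (x + c) gchoose k"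
  by (simp add: binp_def gbinomial_prod_rev poly_prod algebra_simps atLeast0LessThan)

lemma poly_eqI_nat:
  fixes p q :: "complex poly"
  assumes "\<And>n. n \<ge> m \<Longrightarrow> poly p (of_nat n) = poly q (of_nat n)"
  shows "p = q"
proof -
  have "infinite (of_nat ` {m..} :: complex set)"
    by (subst finite_image_iff) (auto simp: inj_on_def infinite_Ici)
  hence "infinite {x. poly (p - q) x = 0}"
    by (rule infinite_super[rotated]) (use assms in auto)
  thus ?thesis using poly_roots_finite[of "p - q"] by auto
qed

lemma coeff_monic_linear_power:
  "coeff ([:c, 1:] ^ n) i = of_nat (n choose i) * (c :: complex) ^ (n - i)"
proof (cases "i \<le> n")
  case False
  hence "coeff ([:c, 1:] ^ n) i = 0" by (intro coeff_eq_0) (simp add: degree_linear_power)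
  thus ?thesis using False by simp
qed (simp add: coeff_linear_poly_power)

section \<open>The linear coefficients and the Bernoulli recurrence\<close>

context tutte
begin

text \<open>The Toda recursion holds for all integers \<open>N >= 2\<close>, hence as an identity of
  polynomials in \<open>N\<close>, and the power \<open>N^(n+1-2g)\<close> is compared. The exponent
  differences \<open>2 (g + 1 - h)\<close> are even, so the second difference doubles each term; for
  \<open>h > g\<close> nothing remains.\<close>

lemma toda_coeff:
  assumes n: "2 * g \<le> n"
  shows "of_nat ((2 * n + 2) * (2 * n + 1)) * \<kappa> g [2 * n] =
    (\<Sum>h\<le>g. 2 * of_nat ((n + 2 - 2 * h) choose (n - 2 * g)) * \<kappa> h [2 * (n + 1)])"
proof -
  define H where "H = (n + 1) div 2"
  define a where "a = (\<lambda>h. n + 2 - 2 * h)"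
  \<comment> \<open>\<open>P c\<close> is the genus expansion of the moment of order
    \<open>2 (n + 1)\<close> at the shifted argument \<open>N + c\<close>.\<close>
  define P where "P = (\<lambda>c. \<Sum>h\<le>H. Polynomial.smult (\<kappa> h [2 * (n + 1)]) ([:c, 1:] ^ a h))"
  define R where "R = (\<Sum>h\<le>n div 2. monom (\<kappa> h [2 * n]) (n + 1 - 2 * h))"
  have pP: "poly (P c) (of_nat N) = of_real (mN M (2 * (n + 1)))" if "of_nat N + c = of_nat M" "M > 0" for c N M
    using that mN_genus_expansion[OF that(2), of "n + 1"]
    by (simp add: P_def H_def a_def poly_sum add.commute)
  have "[:0, 1:] * (P 1 - Polynomial.smult 2 (P 0) + P (- 1)) = Polynomial.smult (of_nat ((2 * n + 2) * (2 * n + 1))) R"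
  proof (rule poly_eqI_nat[of 2])
    fix N :: nat assume N: "N \<ge> 2"
    then obtain k where k: "N = Suc k" "k > 0" by (cases N) auto
    have "poly R (of_nat N) = of_real (mN N (2 * n))"
      using mN_genus_expansion[of N n] N by (simp add: R_def poly_sum poly_monom)
    moreover have "poly (P 1) (of_nat N) = of_real (mN (Suc N) (2 * (n + 1)))"
      "poly (P 0) (of_nat N) = of_real (mN N (2 * (n + 1)))"
      "poly (P (- 1)) (of_nat N) = of_real (mN k (2 * (n + 1)))"
      using pP[of N 1 "Suc N"] pP[of N 0 N] pP[of N "- 1" k] N k by simp_all
    ultimately show "poly ([:0, 1:] * (P 1 - Polynomial.smult 2 (P 0) + P (- 1))) (of_nat N) =
       poly (Polynomial.smult (of_nat ((2 * n + 2) * (2 * n + 1))) R) (of_nat N)"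
      using arg_cong[OF mN_toda[of k "2 * n"], of complex_of_real]
      by (simp add: k(1) algebra_simps)
  qed
  hence "coeff ([:0, 1:] * (P 1 - Polynomial.smult 2 (P 0) + P (- 1))) (Suc (n - 2 * g)) =
      coeff (Polynomial.smult (of_nat ((2 * n + 2) * (2 * n + 1))) R) (Suc (n - 2 * g))" by (simp only:)
  moreover have "coeff R (Suc (n - 2 * g)) = \<kappa> g [2 * n]"
  proof -
    have "coeff R (Suc (n - 2 * g)) = (\<Sum>h\<le>n div 2. if h = g then \<kappa> h [2 * n] else 0)"
      unfolding R_def coeff_sum coeff_monom using n by (intro sum.cong refl) auto
    thus ?thesis using n by auto
  qed
  moreover have "coeff ([:0, 1:] * (P 1 - Polynomial.smult 2 (P 0) + P (- 1))) (Suc (n - 2 * g)) =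
     (\<Sum>h\<le>g. 2 * of_nat ((n + 2 - 2 * h) choose (n - 2 * g)) * \<kappa> h [2 * (n + 1)])"
  proof -
    let ?b = "n - 2 * g"
    have c0: "coeff (P c) ?b = (\<Sum>h\<le>H. \<kappa> h [2 * (n + 1)] * (of_nat (a h choose ?b) * c ^ (a h - ?b)))" for c
      by (simp add: P_def coeff_sum coeff_monic_linear_power)
    have "coeff ([:0, 1:] * (P 1 - Polynomial.smult 2 (P 0) + P (- 1))) (Suc ?b) =
      coeff (P 1) ?b - 2 * coeff (P 0) ?b + coeff (P (- 1)) ?b" by simp
    also have "\<dots> = (\<Sum>h\<le>H. \<kappa> h [2 * (n + 1)] * (of_nat (a h choose ?b) *
         (1 ^ (a h - ?b) - 2 * 0 ^ (a h - ?b) + (- 1) ^ (a h - ?b))))"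
      unfolding c0 sum_distrib_left sum_subtractf[symmetric] sum.distrib[symmetric]
      by (intro sum.cong refl) (simp add: algebra_simps)
    also have "\<dots> = (\<Sum>h\<le>g. 2 * of_nat ((n + 2 - 2 * h) choose ?b) * \<kappa> h [2 * (n + 1)])"
    proof (rule sum.mono_neutral_cong_right)
      show "{..g} \<subseteq> {..H}" using n by (auto simp: H_def)
      show "\<forall>h\<in>{..H} - {..g}. \<kappa> h [2 * (n + 1)] * (of_nat (a h choose ?b) *
         (1 ^ (a h - ?b) - 2 * 0 ^ (a h - ?b) + (- 1) ^ (a h - ?b))) = 0"
      proof
        fix h assume "h \<in> {..H} - {..g}"
        hence "a h \<le> ?b" using n by (auto simp: a_def)
        thus "\<kappa> h [2 * (n + 1)] * (of_nat (a h choose ?b) *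
         (1 ^ (a h - ?b) - 2 * 0 ^ (a h - ?b) + (- 1) ^ (a h - ?b))) = 0" by simp
      qed
      fix h assume "h \<in> {..g}"
      hence "a h - ?b = 2 * (g + 1 - h)" "g + 1 - h > 0" using n by (auto simp: a_def)
      thus "\<kappa> h [2 * (n + 1)] * (of_nat (a h choose ?b) *
         (1 ^ (a h - ?b) - 2 * 0 ^ (a h - ?b) + (- 1) ^ (a h - ?b))) = 2 * of_nat ((n + 2 - 2 * h) choose ?b) * \<kappa> h [2 * (n + 1)]"
        by (simp add: a_def)
    qed auto
    finally show ?thesis .
  qed
  ultimately show ?thesis by simp
qed

text \<open>With \<open>m = n + 1\<close>, division by \<open>(2 m choose m)\<close> turns the Toda
  relation into a polynomial identity in \<open>m\<close> whose left side is divisible by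
  \<open>m^2\<close>. Its linear coefficient is a triangular system for the linear coefficients of
  the \<open>p h\<close>, and \<open>bernoulli_sum\<close> shows that
  \<open>- bernoulli (2 h) / (2 h)\<close> solves it.\<close>

lemma linear_coeff_bernoulli:
  fixes p :: "nat \<Rightarrow> complex poly"
  assumes p0: "\<And>n. \<kappa> 0 [2 * n] * of_nat (n + 1) = of_nat ((2 * n) choose n)"
    and p: "\<And>g n. g \<ge> 1 \<Longrightarrow> \<kappa> g [2 * n] = of_nat ((2 * n) choose n) * poly (p g) (of_nat n)"
    and z: "\<And>g. g \<ge> 1 \<Longrightarrow> coeff (p g) 0 = 0"
  shows "g \<ge> 1 \<Longrightarrow> coeff (p g) 1 = - bernoulli (2 * g) / of_nat (2 * g)"
proof (induction g rule: less_induct)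
  case (less g)
  define A where "A = (\<lambda>h. binp (1 - 2 * of_nat h) (2 * (g + 1 - h)))"
  \<comment> \<open>The genus zero term: \<open>(m + 1 choose 2 g + 2)\<close> divided by the factor
    \<open>m + 1\<close> of the Catalan numbers in \<open>p0\<close>.\<close>
  define B where "B = Polynomial.smult (1 / fact (2 * g + 2)) (\<Prod>l<2 * g + 1. [:- of_nat l, 1:] :: complex poly)"
  have id: "[:0, 0, 1:] * pcompose (p g) [:- 1, 1:] = (\<Sum>h=1..g. Polynomial.smult 2 (A h * p h)) + Polynomial.smult 2 B"
  proof (rule poly_eqI_nat[of "2 * g + 1"])
    fix m assume m: "m \<ge> 2 * g + 1"
    then obtain n where n: "m = Suc n" "2 * g \<le> n" by (cases m) auto
    define C where "C = (of_nat ((2 * n) choose n) :: complex)"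
    define C' where "C' = (of_nat ((2 * m) choose m) :: complex)"
    have "n + 1 \<le> 2 * n + 2" by simp
    have "of_nat ((Suc n * Suc n) * ((2 * m) choose m)) = (of_nat (((2 * n + 2) * (2 * n + 1)) * ((2 * n) choose n)) :: complex)"
    proof -
      have "Suc n * ((2 * m) choose m) = Suc (2 * n + 1) * ((2 * n + 1) choose n)"
        using Suc_times_binomial_eq[of "2 * n + 1" n] by (simp add: n mult.commute)
      moreover have "Suc n * ((2 * n + 1) choose n) = Suc (2 * n) * ((2 * n) choose n)"
      proof -
        have "(2 * n + 1) choose n = (2 * n + 1) choose (Suc n)"
          using binomial_symmetric[of n "2 * n + 1"] by simp
        thus ?thesis using Suc_times_binomial_eq[of "2 * n" n] by (simp add: mult.commute)
      qed
      ultimately have "Suc n * Suc n * ((2 * m) choose m) = Suc (2 * n + 1) * (Suc (2 * n) * ((2 * n) choose n))"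
        by (metis mult.assoc mult.left_commute)
      thus ?thesis by (intro arg_cong[where f = of_nat]) (simp add: algebra_simps)
    qed
    hence CC: "of_nat m ^ 2 * C' = of_nat ((2 * n + 2) * (2 * n + 1)) * C"
      by (simp only: of_nat_mult C_def C'_def n(1) power2_eq_square)
    have C'0: "C' \<noteq> 0" unfolding C'_def by simp
    have "of_nat m ^ 2 * C' * poly (p g) (of_nat n) = of_nat ((2 * n + 2) * (2 * n + 1)) * \<kappa> g [2 * n]"
      unfolding CC p[OF less.prems] C_def by simp
    also have "\<dots> = (\<Sum>h\<le>g. 2 * of_nat ((n + 2 - 2 * h) choose (n - 2 * g)) * \<kappa> h [2 * m])"
      using toda_coeff[OF n(2)] n(1) by simp
    also have "\<dots> = (\<Sum>h=1..g. 2 * of_nat ((n + 2 - 2 * h) choose (n - 2 * g)) * \<kappa> h [2 * m]) +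
                 2 * of_nat ((n + 2) choose (n - 2 * g)) * \<kappa> 0 [2 * m]"
    proof -
      have "{..g} = insert 0 {1..g}" by auto
      thus ?thesis by simp
    qed
    also have "(\<Sum>h=1..g. 2 * of_nat ((n + 2 - 2 * h) choose (n - 2 * g)) * \<kappa> h [2 * m]) =
       C' * (\<Sum>h=1..g. 2 * (poly (A h) (of_nat m) * poly (p h) (of_nat m)))"
      unfolding sum_distrib_left
    proof (intro sum.cong refl)
      fix h assume h: "h \<in> {1..g}"
      have "(n + 2 - 2 * h) choose (n - 2 * g) = (n + 2 - 2 * h) choose (2 * (g + 1 - h))"
      proof -
        have "n - 2 * g \<le> n + 2 - 2 * h" "n + 2 - 2 * h - (n - 2 * g) = 2 * (g + 1 - h)" using h n by auto
        thus ?thesis using binomial_symmetric by metis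
      qed
      hence "of_nat ((n + 2 - 2 * h) choose (n - 2 * g)) = (of_nat (n + 2 - 2 * h) gchoose (2 * (g + 1 - h)) :: complex)"
        by (simp only: binomial_gbinomial)
      also have "of_nat (n + 2 - 2 * h) = (of_nat m + (1 - 2 * of_nat h) :: complex)"
        using h n by (simp add: of_nat_diff)
      finally show "2 * of_nat ((n + 2 - 2 * h) choose (n - 2 * g)) * \<kappa> h [2 * m] =
        C' * (2 * (poly (A h) (of_nat m) * poly (p h) (of_nat m)))"
        using h p[of h m] by (simp add: A_def poly_binp C'_def)
    qed
    also have "2 * of_nat ((n + 2) choose (n - 2 * g)) * \<kappa> 0 [2 * m] = C' * (2 * poly B (of_nat m))"
    proof -
      have "(n + 2) choose (n - 2 * g) = (n + 2) choose (2 * g + 2)"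
        using binomial_symmetric[of "n - 2 * g" "n + 2"] n by simp
      hence "of_nat ((n + 2) choose (n - 2 * g)) = (of_nat (n + 2) gchoose (2 * g + 2) :: complex)"
        by (simp only: binomial_gbinomial)
      also have "\<dots> = (of_nat m + 1) * poly B (of_nat m)"
        unfolding gbinomial_prod_rev B_def
        by (simp add: poly_prod n atLeast0LessThan prod.lessThan_Suc_shift del: prod.lessThan_Suc)
      finally have "of_nat ((n + 2) choose (n - 2 * g)) * \<kappa> 0 [2 * m] = poly B (of_nat m) * (\<kappa> 0 [2 * m] * of_nat (m + 1))"
        by simp
      thus ?thesis unfolding p0 C'_def by simp
    qed
    finally have "C' * (of_nat m ^ 2 * poly (p g) (of_nat n)) =
       C' * ((\<Sum>h=1..g. 2 * (poly (A h) (of_nat m) * poly (p h) (of_nat m))) + 2 * poly B (of_nat m))"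
      by (simp add: algebra_simps)
    hence "of_nat m ^ 2 * poly (p g) (of_nat n) =
       (\<Sum>h=1..g. 2 * (poly (A h) (of_nat m) * poly (p h) (of_nat m))) + 2 * poly B (of_nat m)"
      using C'0 by simp
    thus "poly ([:0, 0, 1:] * pcompose (p g) [:- 1, 1:]) (of_nat m) =
      poly ((\<Sum>h=1..g. Polynomial.smult 2 (A h * p h)) + Polynomial.smult 2 B) (of_nat m)"
      by (simp add: poly_pcompose poly_sum n(1) power2_eq_square algebra_simps)
  qed
  have c1: "coeff (A h * p h) 1 = of_nat ((2 * g) choose (2 * (g + 1 - h))) * coeff (p h) 1" if h: "h \<in> {1..g}" for h
  proof -
    have "coeff (A h) 0 = (1 - 2 * of_nat h) gchoose (2 * (g + 1 - h))"
      using poly_binp[of "1 - 2 * of_nat h" "2 * (g + 1 - h)" 0] by (simp add: A_def poly_0_coeff_0)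
    \<comment> \<open>At \<open>m = 0\<close> the upper entry is negative. The reflection
      \<open>(-a choose k) = (a + k - 1 choose k)\<close>, valid for even \<open>k\<close>, produces
      the binomial of the Bernoulli recurrence.\<close>
    also have "\<dots> = (- of_nat (2 * h - 1)) gchoose (2 * (g + 1 - h))"
      using h by (simp add: of_nat_diff)
    also have "\<dots> = (of_nat (2 * h - 1) + of_nat (2 * (g + 1 - h)) - 1) gchoose (2 * (g + 1 - h))"
      unfolding gbinomial_minus by simp
    also have "of_nat (2 * h - 1) + of_nat (2 * (g + 1 - h)) - 1 = (of_nat (2 * g) :: complex)"
      using h by (simp add: of_nat_diff)
    finally have "coeff (A h) 0 = of_nat ((2 * g) choose (2 * (g + 1 - h)))"
      by (simp only: binomial_gbinomial)
    moreover have "coeff (A h * p h) 1 = coeff (A h) 0 * coeff (p h) 1 + coeff (A h) 1 * coeff (p h) 0"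
      by (simp add: coeff_mult)
    ultimately show ?thesis using z[of h] h by simp
  qed
  have cB: "coeff B 1 = fact (2 * g) / fact (2 * g + 2)"
  proof -
    have "(\<Prod>l<2 * g + 1. [:- of_nat l, 1:] :: complex poly) = [:0, 1:] * (\<Prod>l<2 * g. [:- of_nat (Suc l), 1:])"
      by (simp add: prod.lessThan_Suc_shift del: prod.lessThan_Suc)
    also have "coeff \<dots> 1 = poly (\<Prod>l<2 * g. [:- of_nat (Suc l), 1:]) 0"
      by (simp add: poly_0_coeff_0)
    also have "\<dots> = (\<Prod>l<2 * g. - of_nat (Suc l))" by (simp add: poly_prod)
    also have "\<dots> = (\<Prod>l<2 * g. - 1) * (\<Prod>l<2 * g. of_nat (Suc l))" by (simp only: prod.distrib[symmetric] mult_minus1)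
    also have "\<dots> = fact (2 * g)" by (simp add: fact_prod_Suc atLeast0LessThan)
    finally show ?thesis by (simp add: B_def)
  qed
  have "coeff ([:0, 0, 1:] * pcompose (p g) [:- 1, 1:]) 1 = 0" by (simp add: coeff_mult)
  hence "0 = (\<Sum>h=1..g. 2 * coeff (A h * p h) 1) + 2 * coeff B 1"
    unfolding id by (simp add: coeff_sum)
  also have "(\<Sum>h=1..g. 2 * coeff (A h * p h) 1) =
      2 * (\<Sum>h=1..g. of_nat ((2 * g) choose (2 * (g + 1 - h))) * coeff (p h) 1)"
    unfolding sum_distrib_left by (intro sum.cong refl) (simp only: c1)
  finally have S2: "0 = 2 * (\<Sum>h=1..g. of_nat ((2 * g) choose (2 * (g + 1 - h))) * coeff (p h) 1) + 2 * coeff B 1" .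
  have neg: "S = - F" if "0 = 2 * S + 2 * F" for S F :: complex
  proof -
    have "2 * (S + F) = 0" using that by (simp only: distrib_left)
    hence "S + F = 0" by (metis mult_eq_0_iff zero_neq_numeral)
    thus ?thesis by (simp only: eq_neg_iff_add_eq_0)
  qed
  have e1: "(\<Sum>h=1..g. of_nat ((2 * g) choose (2 * (g + 1 - h))) * coeff (p h) 1) = - (fact (2 * g) / fact (2 * g + 2))"
    by (rule neg[OF S2[unfolded cB]])
  have "(\<Sum>h=1..g. of_nat ((2 * g) choose (2 * (g + 1 - h))) * (coeff (p h) 1 + bernoulli (2 * h) / of_nat (2 * h))) = 0"
    unfolding distrib_left sum.distrib e1 bernoulli_sum[OF less.prems] by simp
  moreover have "{1..g} = insert g {1..<g}" using less.prems by auto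
  moreover have "(\<Sum>h\<in>{1..<g}. of_nat ((2 * g) choose (2 * (g + 1 - h))) * (coeff (p h) 1 + bernoulli (2 * h) / of_nat (2 * h))) = 0"
    using less.IH by (intro sum.neutral) auto
  ultimately have "of_nat ((2 * g) choose 2) * (coeff (p g) 1 + bernoulli (2 * g) / of_nat (2 * g)) = 0"
    by simp
  moreover have "of_nat ((2 * g) choose 2) \<noteq> (0 :: complex)" using less.prems by simp
  ultimately have "coeff (p g) 1 + bernoulli (2 * g) / of_nat (2 * g) = 0" by (simp only: mult_eq_0_iff) simp
  thus ?case by (simp add: add_eq_0_iff)
qed

end

section \<open>Expansion at infinity\<close>

definition meri :: "(complex \<Rightarrow> complex) \<Rightarrow> bool" where
  "meri f \<longleftrightarrow> (\<lambda>v. f (1 / v)) meromorphic_on {0}"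

text \<open>
  Expansion at \<open>x = \<infinity>\<close> in the variable \<open>v = 1/x\<close>; a dummy value if \<open>f\<close> is not meromorphic there.
\<close>
definition EXP :: "(complex \<Rightarrow> complex) \<Rightarrow> complex fls" where
  "EXP f = (THE F. (\<lambda>v. f (1 / v)) has_laurent_expansion F)"

lemma EXP_eqI: "(\<lambda>v. f (1 / v)) has_laurent_expansion F \<Longrightarrow> EXP f = F"
  unfolding EXP_def by (rule the_equality) (auto intro: has_laurent_expansion_unique)

lemma EXP_expansion: "meri f \<Longrightarrow> (\<lambda>v. f (1 / v)) has_laurent_expansion EXP f"
proof -
  assume "meri f"
  then obtain F where "(\<lambda>v. f (1 / v)) has_laurent_expansion F"
    unfolding meri_def meromorphic_on_def by auto
  thus ?thesis using EXP_eqI by metis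
qed

lemma meri_add: "meri f \<Longrightarrow> meri g \<Longrightarrow> meri (\<lambda>x. f x + g x)"
  and meri_mult: "meri f \<Longrightarrow> meri g \<Longrightarrow> meri (\<lambda>x. f x * g x)"
  and meri_divide: "meri f \<Longrightarrow> meri g \<Longrightarrow> meri (\<lambda>x. f x / g x)"
  and meri_const: "meri (\<lambda>x. c)"
  and meri_id: "meri (\<lambda>x. x)"
  unfolding meri_def by (auto intro!: meromorphic_intros)

lemma meri_power: "meri f \<Longrightarrow> meri (\<lambda>x. f x ^ k)"
  by (induction k) (auto intro: meri_const meri_mult)

lemma meri_diff: "meri f \<Longrightarrow> meri g \<Longrightarrow> meri (\<lambda>x. f x - g x)"
  unfolding meri_def by (auto intro!: meromorphic_intros)

lemma meri_sum: "(\<And>i. i \<in> I \<Longrightarrow> meri (f i)) \<Longrightarrow> meri (\<lambda>x. \<Sum>i\<in>I. f i x)"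
  by (induction I rule: infinite_finite_induct) (auto intro: meri_add meri_const)

lemmas meri_intros = meri_add meri_mult meri_divide meri_const meri_id meri_power meri_diff meri_sum

lemma poly_eq_sum: "poly p = (\<lambda>x::complex. \<Sum>i\<le>degree p. coeff p i * x ^ i)"
  by (rule ext) (rule poly_altdef)

lemma meri_poly: "meri (poly p)"
  by (subst poly_eq_sum) (intro meri_intros)

lemma eventually_at_infinity_point: "eventually (\<lambda>v. v \<noteq> 0 \<and> 1 / v \<notin> {2, - 2 :: complex}) (at 0)"
proof -
  have "eventually (\<lambda>v. v \<noteq> (0::complex)) (at 0)" by (rule eventually_neq_at_within)
  moreover have "eventually (\<lambda>v. v \<noteq> (1 / 2 :: complex)) (at 0)" "eventually (\<lambda>v. v \<noteq> (- 1 / 2 :: complex)) (at 0)"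
    by (rule eventually_neq_at_within)+
  ultimately show ?thesis
  proof eventually_elim
    case (elim v)
    have "1 / v \<noteq> c" if "v \<noteq> 1 / c" "c \<noteq> 0" for c
      using that elim by (auto simp: field_simps)
    from this[of 2] this[of "- 2"] have "1 / v \<noteq> 2" "1 / v \<noteq> - 2" using elim by auto
    thus ?case using elim by auto
  qed
qed

lemma EXP_cong:
  assumes "\<And>x. x \<notin> {2, - 2} \<Longrightarrow> f x = g x"
  shows "EXP f = EXP g" "meri f \<longleftrightarrow> meri g"
proof -
  have ev: "eventually (\<lambda>v. f (1 / v) = g (1 / v)) (at 0)"
    using eventually_at_infinity_point by eventually_elim (use assms in auto)
  hence "(\<lambda>v. f (1 / v)) has_laurent_expansion F \<longleftrightarrow> (\<lambda>v. g (1 / v)) has_laurent_expansion F" for F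
    by (intro has_laurent_expansion_cong) auto
  hence *: "(has_laurent_expansion) (\<lambda>v. f (1 / v)) = (has_laurent_expansion) (\<lambda>v. g (1 / v))"
    by (intro ext)
  thus "EXP f = EXP g" by (simp add: EXP_def)
  show "meri f \<longleftrightarrow> meri g" unfolding meri_def meromorphic_on_def using * by auto
qed

lemma EXP_add: "meri f \<Longrightarrow> meri g \<Longrightarrow> EXP (\<lambda>x. f x + g x) = EXP f + EXP g"
  by (intro EXP_eqI has_laurent_expansion_add EXP_expansion)

lemma EXP_mult: "meri f \<Longrightarrow> meri g \<Longrightarrow> EXP (\<lambda>x. f x * g x) = EXP f * EXP g"
  by (intro EXP_eqI has_laurent_expansion_mult EXP_expansion)

lemma EXP_divide: "meri f \<Longrightarrow> meri g \<Longrightarrow> EXP (\<lambda>x. f x / g x) = EXP f / EXP g"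
  by (intro EXP_eqI has_laurent_expansion_divide EXP_expansion)

lemma EXP_cmult: "meri f \<Longrightarrow> EXP (\<lambda>x. c * f x) = fls_const c * EXP f"
  by (intro EXP_eqI has_laurent_expansion_cmult_left EXP_expansion)

lemma EXP_0: "EXP (\<lambda>x. 0) = 0"
  by (intro EXP_eqI) auto

lemma EXP_sum: "(\<And>i. i \<in> I \<Longrightarrow> meri (f i)) \<Longrightarrow> EXP (\<lambda>x. \<Sum>i\<in>I. f i x) = (\<Sum>i\<in>I. EXP (f i))"
  by (intro EXP_eqI has_laurent_expansion_sum EXP_expansion)

lemma meri_spl:
  assumes "\<And>a b. set a \<subseteq> set xs \<Longrightarrow> set b \<subseteq> set xs \<Longrightarrow> meri (f a b)"
  shows "meri (\<lambda>x. spl (\<lambda>a b. f a b x) xs) \<and> EXP (\<lambda>x. spl (\<lambda>a b. f a b x) xs) = spl (\<lambda>a b. EXP (f a b)) xs"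
  using assms
proof (induction xs arbitrary: f)
  case (Cons y xs)
  have "meri (\<lambda>x. spl (\<lambda>a b. f (y # a) b x) xs) \<and> EXP (\<lambda>x. spl (\<lambda>a b. f (y # a) b x) xs) = spl (\<lambda>a b. EXP (f (y # a) b)) xs"
    "meri (\<lambda>x. spl (\<lambda>a b. f a (y # b) x) xs) \<and> EXP (\<lambda>x. spl (\<lambda>a b. f a (y # b) x) xs) = spl (\<lambda>a b. EXP (f a (y # b))) xs"
    by (rule Cons.IH; auto intro!: Cons.prems)+
  thus ?case by (auto simp: EXP_add meri_add)
qed auto

lemma EXP_order:
  assumes "k analytic_on {0}" "eventually (\<lambda>v. f (1 / v) = v ^ n * k v) (at 0)" "j < int n"
  shows "fls_nth (EXP f) j = 0"
proof -
  have "k has_fps_expansion fps_expansion k 0"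
    using assms(1) by (simp add: analytic_at_imp_has_fps_expansion_0)
  hence "(\<lambda>v. v ^ n * k v) has_laurent_expansion (fps_to_fls (fps_X ^ n) * fps_to_fls (fps_expansion k 0))"
    by (intro has_laurent_expansion_mult has_laurent_expansion_fps fps_expansion_intros)
  hence "(\<lambda>v. f (1 / v)) has_laurent_expansion (fps_to_fls (fps_X ^ n * fps_expansion k 0))"
    using assms(2) by (subst has_laurent_expansion_cong[OF assms(2) refl]) (simp add: fls_times_fps_to_fls)
  hence "EXP f = fps_to_fls (fps_X ^ n * fps_expansion k 0)" by (rule EXP_eqI)
  thus ?thesis using assms(3) by (auto simp: fps_X_power_mult_nth)
qed

lemma EXP_x: "EXP (\<lambda>x. x) = fls_X_inv"
  using has_laurent_expansion_fls_X_inv by (intro EXP_eqI) (simp add: divide_inverse)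

lemma EXP_const: "EXP (\<lambda>x. c) = fls_const c"
  by (intro EXP_eqI) auto

lemma EXP_power: "meri f \<Longrightarrow> EXP (\<lambda>x. f x ^ i) = EXP f ^ i"
  by (induction i) (simp_all add: EXP_mult meri_intros EXP_const)

lemma EXP_poly: "EXP (poly p) = (\<Sum>i\<le>degree p. fls_const (coeff p i) * fls_X_inv ^ i)"
proof -
  have t: "EXP (\<lambda>x. coeff p i * x ^ i) = fls_const (coeff p i) * fls_X_inv ^ i" for i
    by (simp add: EXP_cmult EXP_power meri_intros EXP_x)
  have "EXP (poly p) = EXP (\<lambda>x. \<Sum>i\<le>degree p. coeff p i * x ^ i)" by (subst poly_eq_sum) simp
  also have "\<dots> = (\<Sum>i\<le>degree p. EXP (\<lambda>x. coeff p i * x ^ i))"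
    by (intro EXP_sum meri_intros)
  finally show ?thesis unfolding t .
qed

lemma fls_nth_sum: "fls_nth (sum f I) n = (\<Sum>i\<in>I. fls_nth (f i) n)"
  by (induction I rule: infinite_finite_induct) auto

lemma EXP_poly_nth: "fls_nth (EXP (poly p)) n = (if n \<le> 0 then coeff p (nat (- n)) else 0)"
proof -
  have "fls_nth (EXP (poly p)) n = (\<Sum>i\<le>degree p. if n = - int i then coeff p i else 0)"
    unfolding EXP_poly fls_nth_sum fls_mult_const_nth fls_X_inv_power_nth by (intro sum.cong) auto
  also have "\<dots> = (\<Sum>i\<le>degree p. if i = nat (- n) then (if n \<le> 0 then coeff p i else 0) else 0)"
    by (intro sum.cong) auto
  also have "\<dots> = (if n \<le> 0 then coeff p (nat (- n)) else 0)"
    using coeff_eq_0[of p "nat (- n)"] by (auto simp: not_le)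
  finally show ?thesis .
qed

text \<open>A global condition, in contrast to \<open>mer\<close>: data near the branch values alone
  do not determine an expansion at infinity.\<close>

definition ratl :: "(complex \<Rightarrow> complex) \<Rightarrow> bool" where
  "ratl f \<longleftrightarrow> (\<exists>m p. \<forall>x. x \<notin> {2, - 2} \<longrightarrow> f x = poly p x / (x\<^sup>2 - 4) ^ m)"

lemma sq4_nz: "x \<notin> {2, - 2} \<Longrightarrow> x\<^sup>2 - 4 \<noteq> (0::complex)"
  using sq4_eq_0_iff by blast

lemma ratl_cong: "(\<And>x. x \<notin> {2, - 2} \<Longrightarrow> f x = g x) \<Longrightarrow> ratl f \<Longrightarrow> ratl g"
  unfolding ratl_def by metis

lemma ratl_poly: "ratl (poly p)"
  unfolding ratl_def by (intro exI[of _ 0] exI[of _ p]) auto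

lemma ratl_const: "ratl (\<lambda>x. c)"
  unfolding ratl_def by (intro exI[of _ 0] exI[of _ "[:c:]"]) auto

lemma ratl_mult:
  assumes "ratl f" "ratl g" shows "ratl (\<lambda>x. f x * g x)"
proof -
  obtain m p n q where "\<forall>x. x \<notin> {2, - 2} \<longrightarrow> f x = poly p x / (x\<^sup>2 - 4) ^ m"
    "\<forall>x. x \<notin> {2, - 2} \<longrightarrow> g x = poly q x / (x\<^sup>2 - 4) ^ n" using assms unfolding ratl_def by blast
  thus ?thesis unfolding ratl_def
    by (intro exI[of _ "m + n"] exI[of _ "p * q"]) (simp add: power_add)
qed

lemma ratl_add:
  assumes "ratl f" "ratl g" shows "ratl (\<lambda>x. f x + g x)"
proof -
  obtain m p n q where *: "\<forall>x. x \<notin> {2, - 2} \<longrightarrow> f x = poly p x / (x\<^sup>2 - 4) ^ m"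
    "\<forall>x. x \<notin> {2, - 2} \<longrightarrow> g x = poly q x / (x\<^sup>2 - 4) ^ n" using assms unfolding ratl_def by blast
  have "f x + g x = poly (p * [:- 4, 0, 1:] ^ n + q * [:- 4, 0, 1:] ^ m) x / (x\<^sup>2 - 4) ^ (m + n)"
    if "x \<notin> {2, - 2}" for x
  proof -
    have e: "poly [:- 4, 0, 1:] x = x\<^sup>2 - 4" by (simp add: power2_eq_square)
    have "A / s ^ m + B / s ^ n = (A * s ^ n + B * s ^ m) / s ^ (m + n)" if "s \<noteq> 0" for A B s :: complex
      using that by (simp add: field_simps power_add)
    thus ?thesis using * that sq4_nz[OF that] unfolding poly_add poly_mult poly_power e by simp
  qed
  thus ?thesis unfolding ratl_def by blast
qed

lemma ratl_sum: "(\<And>i. i \<in> I \<Longrightarrow> ratl (f i)) \<Longrightarrow> ratl (\<lambda>x. \<Sum>i\<in>I. f i x)"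
  by (induction I rule: infinite_finite_induct) (auto intro: ratl_add ratl_const)

lemma ratl_spl:
  assumes "\<And>a b. set a \<subseteq> set xs \<Longrightarrow> set b \<subseteq> set xs \<Longrightarrow> ratl (f a b)"
  shows "ratl (\<lambda>x. spl (\<lambda>a b. f a b x) xs)"
  using assms
proof (induction xs arbitrary: f)
  case (Cons y xs)
  show ?case unfolding spl.simps
    by (intro ratl_add Cons.IH) (auto intro!: Cons.prems)
qed auto

lemma ratl_term: "ratl (\<lambda>x. (a + b * x) / (x\<^sup>2 - 4) ^ k)"
  unfolding ratl_def by (intro exI[of _ k] exI[of _ "[:a, b:]"]) (simp add: mult.commute)

lemma ratl_polar: "ratl (polar M a b)"
  unfolding polar_def[abs_def] by (intro ratl_sum ratl_term)

text \<open>Partial fractions. What the projection removes is a polynomial, which is invisible in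
  the positive powers of \<open>1/x\<close>; this is how the recursion passes to infinity.\<close>

lemma ratl_PP:
  assumes "ratl f"
  shows "\<exists>r. \<forall>x. x \<notin> {2, - 2} \<longrightarrow> f x = PP f x + poly r x"
proof -
  have "\<exists>a b r. \<forall>x. x \<notin> {2, - 2} \<longrightarrow> poly p x / (x\<^sup>2 - 4) ^ m = polar m a b x + poly r x" for p m
  proof (induction m arbitrary: p)
    case 0
    show ?case by (intro exI[of _ "\<lambda>_. 0"] exI[of _ p]) (simp add: polar_def)
  next
    case (Suc m)
    let ?d = "[:- 4, 0, 1:] :: complex poly"
    define q r where "q = p div ?d" and "r = p mod ?d"
    have e: "poly ?d x = x\<^sup>2 - 4" for x by (simp add: power2_eq_square)
    have pqr: "poly p x = poly q x * (x\<^sup>2 - 4) + poly r x" for x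
      using arg_cong[OF div_mult_mod_eq[of p ?d], of "\<lambda>p. poly p x"] unfolding q_def r_def poly_add poly_mult e by simp
    have "degree r < 2" using degree_mod_less[of ?d p] by (auto simp: r_def)
    hence r: "poly r x = coeff r 0 + coeff r 1 * x" for x
      by (subst poly_altdef) (auto simp: less_2_cases_iff coeff_eq_0 atMost_Suc dest!: less_2_cases)
    obtain a b u where ab: "\<forall>x. x \<notin> {2, - 2} \<longrightarrow> poly q x / (x\<^sup>2 - 4) ^ m = polar m a b x + poly u x"
      using Suc.IH by blast
    have "poly p x / (x\<^sup>2 - 4) ^ Suc m = polar (Suc m) (a(m := coeff r 0)) (b(m := coeff r 1)) x + poly u x"
      if "x \<notin> {2, - 2}" for x
    proof -
      have "poly p x / (x\<^sup>2 - 4) ^ Suc m = poly q x / (x\<^sup>2 - 4) ^ m + (coeff r 0 + coeff r 1 * x) / (x\<^sup>2 - 4) ^ Suc m"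
        unfolding pqr r using sq4_nz[OF that] by (simp add: add_divide_distrib)
      moreover have "polar (Suc m) (a(m := coeff r 0)) (b(m := coeff r 1)) x = polar m a b x + (coeff r 0 + coeff r 1 * x) / (x\<^sup>2 - 4) ^ Suc m"
        unfolding polar_def by (simp del: power_Suc)
      ultimately show ?thesis using ab that by simp
    qed
    thus ?case by blast
  qed
  moreover obtain m p where mp: "\<And>x. x \<notin> {2, - 2} \<Longrightarrow> f x = poly p x / (x\<^sup>2 - 4) ^ m"
    using assms unfolding ratl_def by blast
  ultimately obtain a b r where abr: "\<And>x. x \<notin> {2, - 2} \<Longrightarrow> f x = polar m a b x + poly r x" by metis
  have "mer 0 (poly r)" by (intro mer_analytic, subst poly_eq_sum) (intro analytic_intros)
  hence "PP f x = polar m a b x" if "x \<notin> {2, - 2}" for x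
  proof -
    have "eventually (\<lambda>x. f x = polar m a b x + poly r x) bp"
      using eventually_bp_neq[of 2] eventually_bp_neq[of "- 2"] by eventually_elim (use abr in auto)
    from PP_cong[OF this] show ?thesis
      using PP_add[OF mer_polar mer_mono[OF \<open>mer 0 (poly r)\<close>]] PP_polar[OF that] PP_regular[OF \<open>mer 0 (poly r)\<close> that] by simp
  qed
  thus ?thesis using abr by auto
qed

lemma polar_order: "j < 1 \<Longrightarrow> fls_nth (EXP (polar M a b)) j = 0"
proof (rule EXP_order[where n = 1])
  let ?k = "\<lambda>v. \<Sum>k<M. (a k * v + b k) * v ^ (2 * k) / (1 - 4 * v\<^sup>2) ^ Suc k"
  show "?k analytic_on {0}" by (intro analytic_intros) auto
  show "eventually (\<lambda>v. polar M a b (1 / v) = v ^ 1 * ?k v) (at 0)"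
    using eventually_at_infinity_point
  proof eventually_elim
    case (elim v)
    have "(a k + b k * (1 / v)) / ((1 / v)\<^sup>2 - 4) ^ Suc k = v * ((a k * v + b k) * v ^ (2 * k) / (1 - 4 * v\<^sup>2) ^ Suc k)" for k
    proof -
      have "(1 / v)\<^sup>2 - 4 = (1 - 4 * v\<^sup>2) / v\<^sup>2" using elim by (simp add: field_simps power2_eq_square)
      hence "((1 / v)\<^sup>2 - 4) ^ Suc k = (1 - 4 * v\<^sup>2) ^ Suc k / (v * (v * v ^ (2 * k)))"
        by (simp add: power_divide flip: power_mult) (simp add: power2_eq_square)
      moreover have "a k + b k * (1 / v) = (a k * v + b k) / v" using elim by (simp add: field_simps)
      ultimately show ?thesis using elim by simp
    qed
    thus ?case by (simp add: polar_def sum_distrib_left)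
  qed
qed auto

section \<open>Expansions of the square root and of its odd powers\<close>

text \<open>
  \<open>SQ\<close> below is \<open>sqrt (x\<^sup>2 - 4) = x Rs(1/x)\<close>; the branch with \<open>Rs(0) = 1\<close> is taken.
\<close>
definition Rs :: "complex fps" where
  "Rs = fps_radical (\<lambda>_ _. 1) 2 (1 - 4 * fps_X\<^sup>2)"

definition Ri :: "complex fps" where "Ri = inverse Rs"

lemma Rs_sq: "Rs\<^sup>2 = 1 - 4 * fps_X\<^sup>2"
  unfolding Rs_def using power_radical[of "1 - 4 * fps_X\<^sup>2 :: complex fps" "\<lambda>_ _. 1" 1]
  by (simp add: numeral_2_eq_2)

lemma Rs_0: "fps_nth Rs 0 = 1"
  unfolding Rs_def by (simp add: fps_radical_def numeral_2_eq_2)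

lemma Rs_Ri: "Rs * Ri = 1" and Ri_Rs: "Ri * Rs = 1"
  unfolding Ri_def using Rs_0 by (simp_all add: inverse_mult_eq_1 inverse_mult_eq_1')

lemma Ri_0: "fps_nth Ri 0 = 1"
  unfolding Ri_def by (simp add: Rs_0)

lemma Rs_deriv: "fps_deriv Rs = - 4 * fps_X * Ri"
proof -
  have "fps_deriv (Rs\<^sup>2) = fps_deriv (1 - 4 * fps_X\<^sup>2)" by (simp add: Rs_sq)
  hence "2 * (Rs * fps_deriv Rs) = 2 * (- 4 * fps_X)"
    by (simp add: fps_deriv_power' power2_eq_square algebra_simps)
  hence "Rs * fps_deriv Rs = - 4 * fps_X" by (simp only: mult_cancel_left) simp
  hence "Ri * (Rs * fps_deriv Rs) = Ri * (- 4 * fps_X)" by simp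
  thus ?thesis by (simp add: Ri_Rs mult_ac flip: mult.assoc[of Ri Rs])
qed

lemma Ri_deriv: "fps_deriv Ri = 4 * fps_X * Ri ^ 3"
  unfolding Ri_def using Rs_0 Rs_deriv
  by (subst fps_inverse_deriv) (simp_all add: Ri_def power3_eq_cube power2_eq_square)

lemma Ri_sq: "(1 - 4 * fps_X\<^sup>2) * Ri\<^sup>2 = 1"
  unfolding Rs_sq[symmetric] by (simp add: Rs_Ri flip: power_mult_distrib)

lemma Ri_cube: "(1 - 4 * fps_X\<^sup>2) * Ri ^ 3 = Ri"
proof -
  have "(1 - 4 * fps_X\<^sup>2) * Ri ^ 3 = ((1 - 4 * fps_X\<^sup>2) * Ri\<^sup>2) * Ri"
    by (simp add: power3_eq_cube power2_eq_square)
  thus ?thesis by (simp add: Ri_sq)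
qed

lemma fps_numeral_mult_nth: "fps_nth (numeral k * f) n = numeral k * fps_nth f n"
  by (simp add: numeral_fps_const)

text \<open>The expansion of \<open>x (x^2 - 4)^(-k-1/2)\<close> in \<open>1/x\<close>.\<close>

definition Vs :: "nat \<Rightarrow> complex fps" where
  "Vs k = fps_X ^ (2 * k) * Ri ^ (2 * k + 1)"

lemma Vs_deriv: "fps_X * fps_deriv (Vs k) = of_nat (2 * k) * Vs k + of_nat (4 * (2 * k + 1)) * Vs (Suc k)"
proof -
  have p: "fps_X * (of_nat (2 * k) * fps_X ^ (2 * k - 1)) = of_nat (2 * k) * (fps_X :: complex fps) ^ (2 * k)"
    by (cases k) (simp_all add: algebra_simps)
  have d1: "fps_deriv (fps_X ^ (2 * k)) = of_nat (2 * k) * (fps_X :: complex fps) ^ (2 * k - 1)"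
    by (simp only: fps_deriv_power') simp
  have d2: "fps_deriv (Ri ^ (2 * k + 1)) = of_nat (4 * (2 * k + 1)) * fps_X * Ri ^ (2 * k + 3)"
    by (simp only: fps_deriv_power' Ri_deriv) (simp add: power_add power3_eq_cube algebra_simps)
  have "fps_X * fps_deriv (Vs k) = fps_X ^ (2 * k) * (fps_X * fps_deriv (Ri ^ (2 * k + 1))) + (fps_X * fps_deriv (fps_X ^ (2 * k))) * Ri ^ (2 * k + 1)"
    unfolding Vs_def fps_deriv_mult by (simp add: algebra_simps)
  also have "fps_X * fps_deriv (fps_X ^ (2 * k)) = of_nat (2 * k) * (fps_X :: complex fps) ^ (2 * k)"
    unfolding d1 by (rule p)
  finally show ?thesis unfolding d2
    by (simp add: Vs_def power_add power2_eq_square power3_eq_cube algebra_simps)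
qed

text \<open>The Euler operator multiplies the \<open>n\<close>-th coefficient by \<open>n\<close>
  and maps \<open>Vs k\<close> to a combination of \<open>Vs k\<close> and
  \<open>Vs (Suc k)\<close>, so one step in \<open>k\<close> costs a factor linear in
  \<open>n\<close>.\<close>

lemma Vs_rec: "of_nat (4 * (2 * k + 1)) * fps_nth (Vs (Suc k)) n = (of_nat n - of_nat (2 * k)) * fps_nth (Vs k) n"
proof -
  have "fps_nth (fps_X * fps_deriv (Vs k)) n = of_nat n * fps_nth (Vs k) n"
    by (cases n) auto
  moreover have "fps_nth (of_nat a * f) n = of_nat a * fps_nth f n" for a and f :: "complex fps"
    by (simp add: fps_of_nat[symmetric])
  ultimately show ?thesis unfolding Vs_deriv fps_add_nth by (simp only: left_diff_distrib eq_diff_eq add.commute)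
qed

lemma Ri_rec: "of_nat (Suc (Suc n)) * fps_nth Ri (Suc (Suc n)) = of_nat (4 * Suc n) * fps_nth Ri n" and Ri_1: "fps_nth Ri 1 = 0"
proof -
  have "(1 - 4 * fps_X\<^sup>2) * fps_deriv Ri = 4 * (fps_X * ((1 - 4 * fps_X\<^sup>2) * Ri ^ 3))"
    unfolding Ri_deriv by (simp add: mult_ac)
  hence eq: "(1 - 4 * fps_X\<^sup>2) * fps_deriv Ri = 4 * (fps_X * Ri)" unfolding Ri_cube .
  have eq': "fps_nth (fps_deriv Ri) m = 4 * fps_nth (fps_X * (fps_X * fps_deriv Ri)) m + 4 * fps_nth (fps_X * Ri) m" for m
    using arg_cong[OF eq, of "\<lambda>f. fps_nth f m"]
    by (simp only: left_diff_distrib fps_numeral_mult_nth power2_eq_square mult.assoc fps_sub_nth mult_1_left diff_eq_eq add.commute)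
  show "of_nat (Suc (Suc n)) * fps_nth Ri (Suc (Suc n)) = of_nat (4 * Suc n) * fps_nth Ri n"
    using eq'[of "Suc n"] by (cases n) (simp_all add: algebra_simps)
  show "fps_nth Ri 1 = 0" using eq'[of 0] by simp
qed

lemma Ri_odd: "fps_nth Ri (2 * n + 1) = 0"
proof (induction n)
  case (Suc n)
  have "of_nat (Suc (Suc (2 * n + 1))) * fps_nth Ri (Suc (Suc (2 * n + 1))) = 0"
    unfolding Ri_rec Suc by simp
  thus ?case unfolding mult_eq_0_iff of_nat_eq_0_iff by simp
qed (use Ri_1 in simp)

lemma central_binomial_Suc: "Suc n * ((2 * Suc n) choose Suc n) = 2 * (2 * n + 1) * ((2 * n) choose n)"
proof -
  have "Suc n * ((2 * Suc n) choose Suc n) = (2 * Suc n) * ((2 * n + 1) choose n)"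
    using Suc_times_binomial_eq[of "2 * n + 1" n] by (simp add: algebra_simps)
  also have "(2 * n + 1) choose n = (2 * n + 1) choose (Suc n)"
    by (subst binomial_symmetric) auto
  finally have "Suc n * (Suc n * ((2 * Suc n) choose Suc n)) = 2 * Suc n * (Suc n * ((2 * n + 1) choose (Suc n)))"
    by (simp add: algebra_simps)
  also have "Suc n * ((2 * n + 1) choose (Suc n)) = (2 * n + 1) * ((2 * n) choose n)"
    using Suc_times_binomial_eq[of "2 * n" n] by (simp add: algebra_simps)
  finally have "Suc n * (Suc n * ((2 * Suc n) choose Suc n)) = Suc n * (2 * (2 * n + 1) * ((2 * n) choose n))"
    by (simp only: algebra_simps)
  thus ?thesis by (simp only: mult_cancel1) simp
qed

lemma Ri_even: "fps_nth Ri (2 * n) = of_nat ((2 * n) choose n)"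
proof (induction n)
  case (Suc n)
  have "of_nat (2 * Suc n) * fps_nth Ri (2 * Suc n) = of_nat (4 * (2 * n + 1)) * fps_nth Ri (2 * n)"
    using Ri_rec[of "2 * n"] by simp
  also have "\<dots> = of_nat (2 * (2 * (2 * n + 1) * ((2 * n) choose n)))" unfolding Suc by (simp add: algebra_simps)
  also have "\<dots> = of_nat (2 * Suc n) * of_nat ((2 * Suc n) choose Suc n)"
    unfolding central_binomial_Suc[symmetric] by (simp add: algebra_simps)
  finally show ?case by (simp only: mult_cancel_left of_nat_eq_0_iff) simp
qed (simp add: Ri_0)

lemma Vs_odd: "fps_nth (Vs k) (2 * n + 1) = 0"
proof (induction k)
  case 0 show ?case using Ri_odd[of n] by (simp add: Vs_def)
next
  case (Suc k)
  have "of_nat (4 * (2 * k + 1)) * fps_nth (Vs (Suc k)) (2 * n + 1) = 0" unfolding Vs_rec Suc by simp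
  thus ?case unfolding mult_eq_0_iff of_nat_eq_0_iff by simp
qed

text \<open>
  \<open>tp k\<close> is the ratio of the \<open>2n\<close>-th coefficient of \<open>Vs k\<close> to that of \<open>Vs 0\<close>, as a polynomial in \<open>n\<close>.
\<close>
fun tp :: "nat \<Rightarrow> complex poly" where
  "tp 0 = 1"
| "tp (Suc k) = Polynomial.smult (1 / (2 * (2 * of_nat k + 1))) ([:- of_nat k, 1:] * tp k)"

lemma odd_of_nat_nz: "2 * of_nat k + 1 \<noteq> (0 :: complex)"
  using of_nat_eq_0_iff[of "2 * k + 1", where 'a = complex] by (simp add: add.commute)

lemma poly_tp_Suc: "poly (tp (Suc k)) x = 1 / (2 * (2 * of_nat k + 1)) * ((x - of_nat k) * poly (tp k) x)"
  by (simp add: left_diff_distrib)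

lemma Vs_even: "fps_nth (Vs k) (2 * n) = of_nat ((2 * n) choose n) * poly (tp k) (of_nat n)"
proof (induction k)
  case 0 show ?case using Ri_even[of n] by (simp add: Vs_def)
next
  case (Suc k)
  have "4 * (2 * of_nat k + 1) * fps_nth (Vs (Suc k)) (2 * n) = 2 * (of_nat n - of_nat k) * fps_nth (Vs k) (2 * n)"
    using Vs_rec[of k "2 * n"] by (simp add: algebra_simps)
  moreover have nz: "4 * (2 * of_nat k + 1) \<noteq> (0 :: complex)" using odd_of_nat_nz[of k] by (simp only: mult_eq_0_iff) simp
  ultimately have "fps_nth (Vs (Suc k)) (2 * n) = 2 * (of_nat n - of_nat k) * fps_nth (Vs k) (2 * n) / (4 * (2 * of_nat k + 1))"
    by (metis mult.commute nonzero_eq_divide_eq)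
  moreover have "2 * a * (C * P) / (4 * u) = C * (1 / (2 * u) * (a * P))" for a C P u :: complex by simp
  ultimately show ?case unfolding Suc poly_tp_Suc by (simp only:)
qed

lemma tp_coeff_0: "coeff (tp (Suc k)) 0 = 0"
proof (induction k)
  case (Suc k)
  show ?case unfolding tp.simps(2)[of "Suc k"] using Suc by (simp add: coeff_mult_0 del: tp.simps)
qed simp

lemma tp_coeff_1: "coeff (tp (Suc (Suc k))) 1 = - of_nat (Suc k) / (2 * (2 * of_nat (Suc k) + 1)) * coeff (tp (Suc k)) 1"
  "coeff (tp (Suc 0)) 1 = 1 / 2"
  using tp_coeff_0[of k] by (simp_all del: tp.simps(2) add: tp.simps(2)[of "Suc k"] tp.simps(2)[of 0] coeff_pCons)

text \<open>\<open>tp (Suc k)\<close> has the zeros \<open>0, ..., k\<close>, so only the first of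
  them survives at 1. This evaluates the moment of order 2.\<close>

lemma tp_at_1: "poly (tp (Suc k)) 1 = (if k = 0 then 1 / 2 else 0)"
proof (induction k)
  case (Suc k) show ?case unfolding poly_tp_Suc[of "Suc k"] Suc by simp
qed simp

section \<open>Coefficients of the kernel at infinity\<close>

text \<open>
  The coefficients of \<open>beta c x / sqrt (x\<^sup>2 - 4)\<close>, as a series in \<open>1/x\<close>, are the polynomials \<open>bpol \<nu>\<close> in \<open>c\<close>.
\<close>
definition bpol :: "nat \<Rightarrow> complex poly" where
  "bpol \<nu> = (\<Sum>i\<le>\<nu>. Polynomial.monom (of_nat \<nu> / 2 * fps_nth Rs i) (\<nu> - i))"

definition geo :: "complex \<Rightarrow> complex fps" where
  "geo c = Abs_fps (\<lambda>n. c ^ n)"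

lemma geo_mult: "geo c * (1 - fps_const c * fps_X) = 1"
  by (rule fps_ext) (auto simp: geo_def right_diff_distrib mult.assoc[symmetric] mult.commute[of _ "fps_X"] mult.left_commute[of _ fps_X] power_eq_if)

lemma geo_deriv: "fps_deriv (geo c) = fps_const c * (geo c)\<^sup>2"
proof -
  have "fps_deriv (geo c * (1 - fps_const c * fps_X)) = fps_deriv 1" by (simp only: geo_mult)
  hence "fps_deriv (geo c) * (1 - fps_const c * fps_X) = fps_const c * geo c"
    by (simp add: algebra_simps)
  note h = this
  have "fps_deriv (geo c) = fps_deriv (geo c) * (geo c * (1 - fps_const c * fps_X))" by (simp only: geo_mult mult_1_right)
  also have "\<dots> = (fps_deriv (geo c) * (1 - fps_const c * fps_X)) * geo c" by (simp only: mult_ac)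
  finally show ?thesis unfolding h by (simp add: power2_eq_square mult.assoc)
qed

lemma poly_bpol: "poly (bpol \<nu>) c = of_nat \<nu> / 2 * fps_nth (Rs * geo c) \<nu>"
  unfolding bpol_def poly_sum poly_monom fps_mult_nth sum_distrib_left atLeast0AtMost
  by (intro sum.cong) (auto simp: geo_def)

lemma coeff_bpol: "coeff (bpol \<nu>) k = (if k \<le> \<nu> then of_nat \<nu> / 2 * fps_nth Rs (\<nu> - k) else 0)"
proof -
  have "coeff (bpol \<nu>) k = (\<Sum>i\<le>\<nu>. if k \<le> \<nu> \<and> i = \<nu> - k then of_nat \<nu> / 2 * fps_nth Rs (\<nu> - k) else 0)"
    unfolding bpol_def coeff_sum by (intro sum.cong) auto
  thus ?thesis by (cases "k \<le> \<nu>") auto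
qed

text \<open>With \<open>v = 1/x\<close>, the kernel over the square root is \<open>v / 2\<close>
  times the Euler derivative of \<open>sqrt (1 - 4 v^2) / (1 - c v)\<close>. This is the origin of
  the factor \<open>\<nu> / 2\<close> in \<open>bpol\<close>.\<close>

lemma bpol_generating:
  "fps_nth (fps_const (1 / 2) * fps_X\<^sup>2 * (fps_const c - 4 * fps_X) * (geo c)\<^sup>2 * Ri) (Suc \<nu>) = poly (bpol \<nu>) c"
proof -
  have g1: "geo c = (geo c)\<^sup>2 * (1 - fps_const c * fps_X)"
    using geo_mult[of c] by (simp add: power2_eq_square mult.assoc)
  have r1: "Rs = (1 - 4 * fps_X\<^sup>2) * Ri"
    unfolding Rs_sq[symmetric] by (simp add: power2_eq_square mult.assoc Rs_Ri)
  have "fps_deriv (Rs * geo c) = Rs * (fps_const c * (geo c)\<^sup>2) + (- 4 * fps_X * Ri) * geo c"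
    unfolding fps_deriv_mult Rs_deriv geo_deriv ..
  also have "\<dots> = ((1 - 4 * fps_X\<^sup>2) * Ri) * (fps_const c * (geo c)\<^sup>2) + (- 4 * fps_X * Ri) * ((geo c)\<^sup>2 * (1 - fps_const c * fps_X))"
    by (simp only: g1[symmetric] r1[symmetric])
  also have "\<dots> = (fps_const c - 4 * fps_X) * (geo c)\<^sup>2 * Ri"
    by (simp add: power2_eq_square algebra_simps)
  finally have e: "fps_const (1 / 2) * fps_X\<^sup>2 * (fps_const c - 4 * fps_X) * (geo c)\<^sup>2 * Ri
      = fps_const (1 / 2) * (fps_X * (fps_X * fps_deriv (Rs * geo c)))"
    by (simp add: power2_eq_square mult.assoc)
  have "fps_nth (fps_X * fps_deriv (Rs * geo c)) \<nu> = of_nat \<nu> * fps_nth (Rs * geo c) \<nu>"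
    by (cases \<nu>) (auto simp del: fps_deriv_mult)
  thus ?thesis unfolding e poly_bpol by (simp del: fps_deriv_mult)
qed

definition SQ :: "complex fls" where "SQ = fls_X_inv * fps_to_fls Rs"
definition SQi :: "complex fls" where "SQi = fls_X * fps_to_fls Ri"

lemma fls_X_X_inv: "fls_X * fls_X_inv = (1 :: complex fls)" "fls_X_inv * fls_X = (1 :: complex fls)"
  by (simp_all add: fls_X_times_conv_shift fls_X_inv_times_conv_shift fls_eq_iff)

lemma SQ_SQi: "SQ * SQi = 1"
proof -
  have "SQ * SQi = (fls_X_inv * fls_X) * fps_to_fls (Rs * Ri)"
    by (simp only: SQ_def SQi_def fls_times_fps_to_fls mult_ac)
  thus ?thesis by (simp add: fls_X_X_inv Rs_Ri)
qed

lemma SQ_sq: "SQ\<^sup>2 = fls_X_inv\<^sup>2 - 4"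
proof -
  have "SQ\<^sup>2 = fls_X_inv\<^sup>2 * fps_to_fls (Rs\<^sup>2)"
    by (simp add: SQ_def power_mult_distrib fps_to_fls_power)
  also have "fps_to_fls (Rs\<^sup>2) = 1 - 4 * fls_X\<^sup>2"
    by (simp add: Rs_sq fls_times_fps_to_fls fps_to_fls_power)
  also have "fls_X_inv\<^sup>2 * (1 - 4 * fls_X\<^sup>2) = fls_X_inv\<^sup>2 - 4 * (fls_X_inv * fls_X :: complex fls)\<^sup>2"
  proof -
    have "A * (1 - 4 * B) = A - 4 * (A * B)" for A B :: "complex fls" by (simp add: algebra_simps)
    thus ?thesis unfolding power_mult_distrib .
  qed
  finally show ?thesis by (simp add: fls_X_X_inv)
qed

lemma meri_sq4: "meri (\<lambda>x. x\<^sup>2 - 4)"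
  by (intro meri_intros)

lemma EXP_sq4: "EXP (\<lambda>x. x\<^sup>2 - 4) = SQ\<^sup>2"
proof -
  have "EXP (\<lambda>x. x\<^sup>2 + - 4) = EXP (\<lambda>x. x\<^sup>2) + EXP (\<lambda>x. - 4)" by (intro EXP_add meri_intros)
  also have "\<dots> = fls_X_inv\<^sup>2 - 4" unfolding EXP_const by (simp add: EXP_power meri_id EXP_x fls_const_numeral)
  finally show ?thesis by (simp add: SQ_sq)
qed

lemma SQ_nz: "SQ \<noteq> 0" using SQ_SQi by auto

lemma EXP_div_sq4: "meri f \<Longrightarrow> EXP (\<lambda>x. f x / (x\<^sup>2 - 4) ^ k) = EXP f * SQi ^ (2 * k)"
proof -
  assume f: "meri f"
  have "EXP (\<lambda>x. f x / (x\<^sup>2 - 4) ^ k) = EXP f / (SQ\<^sup>2) ^ k"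
    using f meri_sq4 by (subst EXP_divide) (auto intro!: meri_intros simp: EXP_power EXP_sq4)
  moreover have "1 / (SQ\<^sup>2) ^ k = SQi ^ (2 * k)"
  proof -
    have "(SQ\<^sup>2) ^ k * SQi ^ (2 * k) = 1" by (simp add: SQ_SQi flip: power_mult power_mult_distrib)
    thus ?thesis using SQ_nz by (simp add: divide_eq_eq mult.commute)
  qed
  ultimately show ?thesis by (metis times_divide_eq_right mult_1_right)
qed

section \<open>Orders at infinity and convolutions\<close>

definition vanishes_below :: "int \<Rightarrow> complex fls \<Rightarrow> bool" where
  "vanishes_below k F \<longleftrightarrow> (\<forall>n<k. fls_nth F n = 0)"

lemma vanishes_belowD: "vanishes_below k F \<Longrightarrow> n < k \<Longrightarrow> fls_nth F n = 0"
  by (simp add: vanishes_below_def)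

lemma vanishes_below_mono: "vanishes_below k F \<Longrightarrow> l \<le> k \<Longrightarrow> vanishes_below l F"
  by (simp add: vanishes_below_def)

lemma fls_SQi_mult_nth: "fls_nth (F * SQi) (n + 1) = fls_nth (F * fps_to_fls Ri) n"
proof -
  have "F * SQi = fls_X * (F * fps_to_fls Ri)" by (simp add: SQi_def mult_ac)
  thus ?thesis by (simp add: fls_X_times_conv_shift)
qed

lemma vanishes_below_mult:
  assumes "vanishes_below k F" "vanishes_below l G"
  shows "vanishes_below (k + l) (F * G)"
proof (cases "F = 0 \<or> G = 0")
  case False
  have *: "k \<le> fls_subdegree F" if "vanishes_below k F" "F \<noteq> 0" for k and F :: "complex fls"
    using that by (auto simp: vanishes_below_def intro: fls_subdegree_geI)
  from *[OF assms(1)] *[OF assms(2)] False have "k + l \<le> fls_subdegree F + fls_subdegree G" by simp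
  thus ?thesis by (auto simp: vanishes_below_def intro!: fls_times_nth_eq0)
qed (auto simp: vanishes_below_def)

lemma vanishes_below_SQi: "vanishes_below k F \<Longrightarrow> vanishes_below (k + 1) (F * SQi)"
proof (rule vanishes_below_mult)
  show "vanishes_below 1 SQi"
    by (auto simp: vanishes_below_def SQi_def fls_X_times_conv_shift)
qed

text \<open>Exponents are shifted as in a resolvent: index \<open>a\<close> belongs to
  \<open>x^(-a-1)\<close>, so the indices of the two factors add up to \<open>m - 1\<close>, as in
  the splitting terms of the loop equations.\<close>

lemma fls_mult_nth_convolution:
  assumes "vanishes_below 1 F" "vanishes_below 1 G"
  shows "fls_nth (F * G) (int m + 1) = (\<Sum>a<m. fls_nth F (int a + 1) * fls_nth G (int (m - 1 - a) + 1))"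
proof -
  have e: "F = fps_to_fls (fls_regpart F)" if "vanishes_below 1 F" for F
    using that by (intro fls_eqI) (auto simp: vanishes_below_def)
  have "fls_nth (F * G) (int m + 1) = fps_nth (fls_regpart F * fls_regpart G) (Suc m)"
    by (subst e[OF assms(1)], subst e[OF assms(2)]) (simp flip: fls_times_fps_to_fls, simp add: nat_add_distrib)
  also have "\<dots> = (\<Sum>i=0..Suc m. fls_nth F (int i) * fls_nth G (int (Suc m - i)))"
    by (simp add: fps_mult_nth)
  also have "\<dots> = (\<Sum>i\<in>Suc ` {..<m}. fls_nth F (int i) * fls_nth G (int (Suc m - i)))"
  proof (rule sum.mono_neutral_right)
    show "\<forall>i\<in>{0..Suc m} - Suc ` {..<m}. fls_nth F (int i) * fls_nth G (int (Suc m - i)) = 0"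
    proof
      fix i assume i: "i \<in> {0..Suc m} - Suc ` {..<m}"
      have "i = 0 \<or> i = Suc m"
      proof (cases i)
        case (Suc j) with i show ?thesis by (cases "j < m") auto
      qed simp
      thus "fls_nth F (int i) * fls_nth G (int (Suc m - i)) = 0"
        using vanishes_belowD[OF assms(1), of 0] vanishes_belowD[OF assms(2), of 0] by auto
    qed
  qed auto
  also have "\<dots> = (\<Sum>a<m. fls_nth F (int (Suc a)) * fls_nth G (int (Suc m - Suc a)))"
    by (simp add: sum.reindex)
  also have "\<dots> = (\<Sum>a<m. fls_nth F (int a + 1) * fls_nth G (int (m - 1 - a) + 1))"
  proof (intro sum.cong refl)
    fix a assume "a \<in> {..<m}"
    hence "int (Suc m - Suc a) = int (m - 1 - a) + 1" "int (Suc a) = int a + 1" by auto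
    thus "fls_nth F (int (Suc a)) * fls_nth G (int (Suc m - Suc a)) = fls_nth F (int a + 1) * fls_nth G (int (m - 1 - a) + 1)"
      by presburger
  qed
  finally show ?thesis .
qed

lemma EXP_beta_nth: "meri (beta c)" "fls_nth (EXP (beta c) * SQi) (int b + 1) = poly (bpol b) c"
proof -
  show m: "meri (beta c)" unfolding beta_def[abs_def] by (intro meri_intros)
  have geo: "geo c = inverse (1 - fps_const c * fps_X)"
    using geo_mult[of c] by (metis fps_inverse_unique mult.commute)
  have "(\<lambda>v. 1 / 2 * v * (c - 4 * v) / (1 - c * v)\<^sup>2) has_fps_expansion
      (fps_const (1 / 2) * fps_X * (fps_const c - 4 * fps_X) / (1 - fps_const c * fps_X)\<^sup>2)"
    by (intro fps_expansion_intros) auto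
  also have "fps_const (1 / 2) * fps_X * (fps_const c - 4 * fps_X) / (1 - fps_const c * fps_X)\<^sup>2 =
      fps_const (1 / 2) * fps_X * (fps_const c - 4 * fps_X) * (geo c)\<^sup>2"
    unfolding geo by (subst fps_divide_unit) (auto simp: fps_inverse_power)
  finally have fe: "(\<lambda>v. 1 / 2 * v * (c - 4 * v) / (1 - c * v)\<^sup>2) has_fps_expansion
      (fps_const (1 / 2) * fps_X * (fps_const c - 4 * fps_X) * (geo c)\<^sup>2)" (is "?f has_fps_expansion ?F") .
  have ev: "eventually (\<lambda>v. beta c (1 / v) = ?f v) (at 0)"
    using eventually_at_infinity_point
  proof eventually_elim
    case (elim v)
    have "c * (1 / v) - 4 = (c - 4 * v) / v" "2 * (c - 1 / v)\<^sup>2 = 2 * (1 - c * v)\<^sup>2 / v\<^sup>2"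
      using elim by (simp_all add: field_simps power2_eq_square)
    thus ?case using elim by (simp add: beta_def power2_eq_square)
  qed
  have "(\<lambda>v. beta c (1 / v)) has_laurent_expansion fps_to_fls ?F"
    by (rule iffD2[OF has_laurent_expansion_cong[OF ev refl] has_laurent_expansion_fps[OF fe]])
  hence "EXP (beta c) = fps_to_fls ?F" by (rule EXP_eqI)
  hence "EXP (beta c) * SQi = fps_to_fls (?F * (fps_X * Ri))"
    by (simp only: SQi_def fls_times_fps_to_fls fps_X_to_fls)
  also have "?F * (fps_X * Ri) = fps_const (1 / 2) * fps_X\<^sup>2 * (fps_const c - 4 * fps_X) * (geo c)\<^sup>2 * Ri"
    by (simp only: power2_eq_square mult_ac)
  finally show "fls_nth (EXP (beta c) * SQi) (int b + 1) = poly (bpol b) c"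
    using bpol_generating[of c b] by (simp add: nat_add_distrib)
qed

text \<open>The planar one-point resolvent: the root of \<open>W^2 - x W + 1 = 0\<close> that
  vanishes at infinity, generating the Catalan numbers.\<close>

definition W0 :: "complex fls" where
  "W0 = fls_const (1 / 2) * (fls_X_inv - SQ)"

lemma W0_nth: "fls_nth W0 n = (if n < 1 then 0 else - fps_nth Rs (nat (n + 1)) / 2)"
proof -
  have "fls_nth SQ n = (if n + 1 < 0 then 0 else fps_nth Rs (nat (n + 1)))"
    by (simp add: SQ_def fls_X_inv_times_conv_shift)
  moreover have "fps_nth Rs 1 = 0"
    using arg_cong[OF Rs_deriv, of "\<lambda>f. fps_nth f 0"] by simp
  moreover have "n < - 1 \<or> n = - 1 \<or> n = 0 \<or> n \<ge> 1" by arith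
  ultimately show ?thesis by (auto simp: W0_def Rs_0)
qed

lemma Rs_Suc_Suc: "of_nat (n + 2) * fps_nth Rs (n + 2) = - 4 * fps_nth Ri n"
proof -
  have "fps_deriv Rs = - (4 * (fps_X * Ri))" unfolding Rs_deriv by (simp add: mult.assoc)
  from arg_cong[OF this, of "\<lambda>f. fps_nth f (Suc n)"] show ?thesis
    by (simp add: fps_numeral_mult_nth distrib_right)
qed

lemma W0_1: "fls_nth W0 1 = 1"
  using Rs_Suc_Suc[of 0] by (simp add: W0_nth Ri_0 nat_numeral) (simp add: numeral_2_eq_2)

lemma SQ_W0: "SQ = fls_X_inv - 2 * W0"
proof -
  have "2 * fls_const (1 / 2 :: complex) = 1" by (simp add: fls_const_mult_const[symmetric] flip: fls_const_numeral)
  hence "2 * W0 = fls_X_inv - SQ" by (simp add: W0_def flip: mult.assoc)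
  thus ?thesis by simp
qed

lemma W0_sq: "W0 * W0 = fls_X_inv * W0 - 1"
proof -
  have "4 * (W0 * W0) = (fls_X_inv - SQ)\<^sup>2" unfolding SQ_W0 by (simp add: power2_eq_square)
  also have "\<dots> = fls_X_inv\<^sup>2 - 2 * fls_X_inv * SQ + SQ\<^sup>2" by (simp add: power2_diff)
  also have "\<dots> = 4 * (fls_X_inv * W0 - 1)" unfolding SQ_sq unfolding SQ_W0 by (simp add: power2_eq_square algebra_simps)
  finally show ?thesis by (simp only: mult_cancel_left) simp
qed

section \<open>The undeformed recursion satisfies the loop equations\<close>

lemma ratl_meri: "ratl f \<Longrightarrow> meri f"
proof -
  assume "ratl f"
  then obtain m p where "\<And>x. x \<notin> {2, - 2} \<Longrightarrow> f x = poly p x / (x\<^sup>2 - 4) ^ m"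
    unfolding ratl_def by blast
  from EXP_cong(2)[OF this] show ?thesis by (simp add: meri_intros meri_poly)
qed

lemma anl_poly: "anl (poly p)"
  unfolding anl_def by (subst poly_eq_sum) (intro analytic_intros)

lemma ball_quarter_0: "(0 :: complex) \<in> ball 0 (1 / 4)" by simp

lemma Fm_polar_ex:
  assumes "stable g (length bs)" "\<And>b. b \<in> set bs \<Longrightarrow> anl b"
  shows "\<exists>M a b. \<forall>x. x \<notin> {2, - 2} \<longrightarrow> Fm 0 g bs x = polar M a b x"
proof -
  obtain M where "\<forall>g' n. 2 * g' + n < 2 * g + length bs + 1 \<longrightarrow> Fm_struct M g' n"
    using Fm_struct_ex by blast
  hence "Fm_struct M g (length bs)" by simp
  from Fm_structD_polar[OF this ball_quarter_0 assms(1) refl assms(2)] show ?thesis by blast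
qed

lemma ratl_Fm:
  assumes "stable g (length bs)" "\<And>b. b \<in> set bs \<Longrightarrow> anl b"
  shows "ratl (Fm 0 g bs)"
  using Fm_polar_ex[OF assms] ratl_cong[OF _ ratl_polar] by metis

lemma Fm_vanishes_below:
  assumes "stable g (length bs)" "\<And>b. b \<in> set bs \<Longrightarrow> anl b"
  shows "vanishes_below 2 (EXP (Fm 0 g bs) * SQi)"
proof -
  obtain M a b where "\<And>x. x \<notin> {2, - 2} \<Longrightarrow> Fm 0 g bs x = polar M a b x" using Fm_polar_ex[OF assms] by blast
  hence "EXP (Fm 0 g bs) = EXP (polar M a b)" by (rule EXP_cong)
  hence "vanishes_below 1 (EXP (Fm 0 g bs))" by (auto simp: vanishes_below_def polar_order)
  from vanishes_below_SQi[OF this] show ?thesis by simp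
qed

text \<open>Inserting \<open>poly (bpol \<nu>)\<close> as an argument extracts the coefficient of
  index \<open>\<nu>\<close> at infinity in that variable, by linearity of \<open>Fm\<close> in its
  arguments.\<close>

definition pm :: "nat list \<Rightarrow> (complex \<Rightarrow> complex) list" where
  "pm \<mu>s = map (\<lambda>\<nu>. poly (bpol \<nu>)) \<mu>s"

lemma pm_simps [simp]: "pm [] = []" "pm (\<mu> # \<mu>s) = poly (bpol \<mu>) # pm \<mu>s" "length (pm \<mu>s) = length \<mu>s"
  by (simp_all add: pm_def)

lemma anl_pm: "b \<in> set (pm \<mu>s) \<Longrightarrow> anl b"
  by (auto simp: pm_def anl_poly)

lemma ratl_Fm_pm: "ratl (Fm 0 g (pm \<mu>s))"
proof (cases "stable g (length \<mu>s)")
  case True thus ?thesis by (intro ratl_Fm) (auto intro: anl_pm)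
next
  case False thus ?thesis unfolding not_stable_iff by (auto simp: Fm_0_Nil' Fm_0_single' ratl_const ratl_poly)
qed

section \<open>Correlators with the unstable corrections\<close>

text \<open>
  \<open>Fm\<close> omits the two unstable cases \<open>(0,0)\<close> and \<open>(0,1)\<close>; with these corrections the loop equations
  hold uniformly.
\<close>
definition corr :: "nat \<Rightarrow> nat list \<Rightarrow> complex fls" where
  "corr g \<mu>s = (if g = 0 \<and> \<mu>s = [] then W0
     else if g = 0 \<and> length \<mu>s = 1 then fls_const (- of_nat (hd \<mu>s) / 2) * fls_shift (int (hd \<mu>s) - 1) 1
     else 0)"

text \<open>The factor \<open>SQi\<close>, the inverse of \<open>sqrt (x^2 - 4)\<close>, passes from
  the coefficient of \<open>dz/z\<close> to that of \<open>dx\<close>.\<close>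

definition UU :: "nat \<Rightarrow> nat list \<Rightarrow> complex fls" where
  "UU g \<mu>s = EXP (Fm 0 g (pm \<mu>s)) * SQi"

definition WW :: "nat \<Rightarrow> nat list \<Rightarrow> complex fls" where
  "WW g \<mu>s = UU g \<mu>s + corr g \<mu>s"

fun kap :: "nat \<Rightarrow> nat list \<Rightarrow> complex" where
  "kap g [] = 0"
| "kap g (k # \<mu>s) = fls_nth (WW g \<mu>s) (int k + 1)"

lemma corr_stable: "stable g (length \<mu>s) \<Longrightarrow> corr g \<mu>s = 0"
  by (auto simp: stable_def corr_def)

lemma corr_pos: "g > 0 \<Longrightarrow> corr g \<mu>s = 0"
  by (simp add: corr_def)

lemma corr_Nil: "corr 0 [] = W0"
  and corr_single: "corr 0 [\<mu>] = fls_const (- of_nat \<mu> / 2) * fls_shift (int \<mu> - 1) 1"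
  by (simp_all add: corr_def)

lemma fls_shift_1_mult_nth: "fls_nth (fls_shift k 1 * F) n = fls_nth (F :: complex fls) (n + k)"
  using fls_X_intpow_times_conv_shift(1)[of "- k" F] by simp

lemma WW_Nil: "WW 0 [] = W0"
  by (simp add: WW_def UU_def corr_Nil Fm_0_Nil' EXP_0)

text \<open>\<open>bpol b\<close> is the polynomial part of
  \<open>(b/2) x^(b-1) sqrt (x^2 - 4)\<close>, which the correction subtracts; this tail of negative
  powers of \<open>x\<close> remains.\<close>

definition tailb :: "nat \<Rightarrow> complex fps" where
  "tailb b = Abs_fps (\<lambda>n. if n = 0 then 0 else - of_nat b / 2 * fps_nth Rs (n + b))"

lemma WW_single: "WW 0 [b] = fps_to_fls (tailb b) * SQi"
  and SQ_WW_single: "SQ * WW 0 [b] = EXP (poly (bpol b)) + SQ * corr 0 [b]"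
proof -
  have SQn: "fls_nth SQ n = (if n + 1 < 0 then 0 else fps_nth Rs (nat (n + 1)))" for n
    by (simp add: SQ_def fls_X_inv_times_conv_shift)
  have "fls_nth (EXP (poly (bpol b)) + SQ * corr 0 [b]) n = fls_nth (fps_to_fls (tailb b)) n" for n
  proof -
    have c: "SQ * corr 0 [b] = fls_const (- of_nat b / 2) * (fls_shift (int b - 1) 1 * SQ)"
      unfolding corr_single by (simp only: mult_ac)
    have sc: "fls_nth (SQ * corr 0 [b]) n = - of_nat b / 2 * (if n + int b < 0 then 0 else fps_nth Rs (nat (n + int b)))"
      unfolding c fls_mult_const_nth fls_shift_1_mult_nth SQn by simp
    consider "n < - int b" | "- int b \<le> n" "n \<le> 0" | "n > 0" by linarith
    thus ?thesis
    proof cases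
      case 1 thus ?thesis using sc by (simp add: EXP_poly_nth coeff_bpol tailb_def)
    next
      case 2
      have "b - nat (- n) = nat (n + int b)" using 2 by simp
      thus ?thesis using 2 sc by (simp add: EXP_poly_nth coeff_bpol tailb_def)
    next
      case 3
      have "nat n + b = nat (n + int b)" using 3 by simp
      thus ?thesis using 3 sc by (simp add: EXP_poly_nth tailb_def)
    qed
  qed
  hence e: "EXP (poly (bpol b)) + SQ * corr 0 [b] = fps_to_fls (tailb b)" by (rule fls_eqI)
  have "WW 0 [b] = EXP (poly (bpol b)) * SQi + corr 0 [b] * (SQ * SQi)"
    by (simp add: WW_def UU_def Fm_0_single' SQ_SQi)
  also have "\<dots> = (EXP (poly (bpol b)) + SQ * corr 0 [b]) * SQi" by (simp add: algebra_simps)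
  finally have w: "WW 0 [b] = (EXP (poly (bpol b)) + SQ * corr 0 [b]) * SQi" .
  show "WW 0 [b] = fps_to_fls (tailb b) * SQi" using w e by simp
  have "SQ * WW 0 [b] = (EXP (poly (bpol b)) + SQ * corr 0 [b]) * (SQ * SQi)"
    unfolding w by (simp only: mult_ac)
  thus "SQ * WW 0 [b] = EXP (poly (bpol b)) + SQ * corr 0 [b]" by (simp add: SQ_SQi)
qed

text \<open>Polar parts decay like \<open>1/x\<close> and division by the square root gives one more
  power; of all correlators only the planar resolvent starts at \<open>1/x\<close>.\<close>

lemma WW_vanishes: "vanishes_below 1 (WW g \<mu>s)" "(g, \<mu>s) \<noteq> (0, []) \<Longrightarrow> fls_nth (WW g \<mu>s) 1 = 0"
proof -
  have "vanishes_below 2 (WW g \<mu>s)" if nz: "(g, \<mu>s) \<noteq> (0, [])"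
  proof (cases "stable g (length \<mu>s)")
    case True
    hence "vanishes_below 2 (UU g \<mu>s)" unfolding UU_def by (intro Fm_vanishes_below) (auto intro: anl_pm)
    thus ?thesis using True by (simp add: WW_def corr_stable)
  next
    case False
    then obtain b where b: "g = 0" "\<mu>s = [b]" using nz unfolding not_stable_iff by auto
    have "vanishes_below 1 (fps_to_fls (tailb b))" by (auto simp: vanishes_below_def tailb_def)
    from vanishes_below_SQi[OF this] show ?thesis using b by (simp add: WW_single)
  qed
  moreover have "vanishes_below 1 (WW 0 [])" by (auto simp: WW_Nil vanishes_below_def W0_nth)
  ultimately show "vanishes_below 1 (WW g \<mu>s)" "(g, \<mu>s) \<noteq> (0, []) \<Longrightarrow> fls_nth (WW g \<mu>s) 1 = 0"
    by (cases "g = 0 \<and> \<mu>s = []"; auto simp: vanishes_below_def)+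
qed

section \<open>The diagonal term at infinity\<close>

lemma ratl_cc: "ratl (cc i)"
proof (cases "snd i")
  case True
  have c: "cc i = (\<lambda>x. (0 + (2 * of_nat (fst i) + 1) / 2 * x) / (x\<^sup>2 - 4) ^ Suc (fst i))"
    using True by (auto simp: cc_def[abs_def])
  show ?thesis unfolding c by (rule ratl_term)
next
  case False
  have c: "cc i = (\<lambda>x. (2 * (2 * of_nat (fst i) + 1) + 0 * x) / (x\<^sup>2 - 4) ^ Suc (fst i) + (of_nat (fst i) + 0 * x) / (x\<^sup>2 - 4) ^ fst i)"
    using False by (auto simp: cc_def[abs_def])
  show ?thesis unfolding c by (rule ratl_add[OF ratl_term ratl_term])
qed

lemma vanishes_below_add: "vanishes_below k F \<Longrightarrow> vanishes_below k G \<Longrightarrow> vanishes_below k (F + G)"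
  by (simp add: vanishes_below_def)

lemma term_vanishes_below: "vanishes_below 1 (EXP (\<lambda>x. (a + b * x) / (x\<^sup>2 - 4) ^ Suc k))"
proof -
  have "(\<lambda>x. (a + b * x) / (x\<^sup>2 - 4) ^ Suc k) = polar (Suc k) (\<lambda>j. if j = k then a else 0) (\<lambda>j. if j = k then b else 0)"
    unfolding polar_def[abs_def] by (rule ext) (simp del: power_Suc)
  thus ?thesis unfolding vanishes_below_def using polar_order by metis
qed

lemma cc_vanishes_below: "vanishes_below 1 (EXP (cc i))"
proof (cases "snd i")
  case True
  have c: "cc i = (\<lambda>x. (0 + (2 * of_nat (fst i) + 1) / 2 * x) / (x\<^sup>2 - 4) ^ Suc (fst i))"
    using True by (auto simp: cc_def[abs_def])
  show ?thesis unfolding c by (rule term_vanishes_below)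
next
  case False
  show ?thesis
  proof (cases "fst i")
    case 0
    have c: "cc i = (\<lambda>x. (2 + 0 * x) / (x\<^sup>2 - 4) ^ Suc 0)"
      using False 0 by (auto simp: cc_def[abs_def])
    show ?thesis unfolding c by (rule term_vanishes_below)
  next
    case (Suc j)
    have c: "cc i = (\<lambda>x. (2 * (2 * of_nat (Suc j) + 1) + 0 * x) / (x\<^sup>2 - 4) ^ Suc (Suc j) + (of_nat (Suc j) + 0 * x) / (x\<^sup>2 - 4) ^ Suc j)"
      using False Suc by (auto simp: cc_def[abs_def] simp del: power_Suc)
    show ?thesis unfolding c
      by (subst EXP_add) (intro ratl_meri ratl_term vanishes_below_add term_vanishes_below)+
  qed
qed

text \<open>Two expansions of \<open>beta\<close> over the square root are compared at
  \<open>x^(-b-1)\<close>: the one at infinity and the one in the jet basis. The remainder of the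
  latter, before division by the square root, has order \<open>x^(-2M)\<close>, whence the bound on
  \<open>b\<close>.\<close>

lemma bpol_bb:
  assumes "b < 2 * M"
  shows "poly (bpol b) X = (\<Sum>i\<in>bidx M. fls_nth (EXP (cc i) * SQi) (int b + 1) * bb i X)"
proof -
  define rem where "rem = (\<lambda>x. ((X * x - 4) / 2 + of_nat M * x * (x - X)) / ((x\<^sup>2 - 4) ^ M * (x - X)\<^sup>2))"
  have mr: "meri rem" unfolding rem_def by (intro meri_intros)
  have mc: "meri (cc i)" for i by (rule ratl_meri[OF ratl_cc])
  have evX: "eventually (\<lambda>v. 1 / v \<noteq> X \<and> v * X \<noteq> 1) (at 0)"
  proof (cases "X = 0")
    case False
    show ?thesis using eventually_neq_at_within[of "1 / X" 0 UNIV] eventually_at_infinity_point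
      by eventually_elim (use False in \<open>auto simp: field_simps\<close>)
  qed (use eventually_at_infinity_point in \<open>auto elim!: eventually_mono\<close>)
  have "EXP (beta X) = EXP (\<lambda>x. (\<Sum>i\<in>bidx M. bb i X * cc i x) + (X\<^sup>2 - 4) ^ M * rem x)"
  proof -
    have ev: "eventually (\<lambda>v. beta X (1 / v) = (\<Sum>i\<in>bidx M. bb i X * cc i (1 / v)) + (X\<^sup>2 - 4) ^ M * rem (1 / v)) (at 0)"
      using eventually_at_infinity_point evX
    proof eventually_elim
      case (elim v)
      thus ?case using beta_expansion[of "1 / v" X M] sq4_nz[of "1 / v"]
        by (simp add: sum_bidx cc_def bb_def rem_def mult.commute del: power_Suc)
    qed
    have "(\<lambda>v. beta X (1 / v)) has_laurent_expansion EXP (\<lambda>x. (\<Sum>i\<in>bidx M. bb i X * cc i x) + (X\<^sup>2 - 4) ^ M * rem x)"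
      by (rule iffD2[OF has_laurent_expansion_cong[OF ev refl] EXP_expansion]) (intro meri_intros mr mc)
    thus ?thesis by (rule EXP_eqI)
  qed
  also have "\<dots> = (\<Sum>i\<in>bidx M. fls_const (bb i X) * EXP (cc i)) + fls_const ((X\<^sup>2 - 4) ^ M) * EXP rem"
    using mr mc by (subst EXP_add) (auto intro!: meri_intros simp: EXP_sum EXP_cmult meri_intros simp del: fls_const_power)
  finally have e: "EXP (beta X) * SQi = (\<Sum>i\<in>bidx M. fls_const (bb i X) * (EXP (cc i) * SQi)) + fls_const ((X\<^sup>2 - 4) ^ M) * (EXP rem * SQi)"
    by (simp only: distrib_right sum_distrib_right mult.assoc)
  have "vanishes_below (int (2 * M)) (EXP rem)" unfolding vanishes_below_def
  proof (intro allI impI)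
    fix j assume "j < int (2 * M)"
    let ?k = "\<lambda>v. ((X * v - 4 * v\<^sup>2) / 2 + of_nat M * (1 - X * v)) / ((1 - 4 * v\<^sup>2) ^ M * (1 - X * v)\<^sup>2)"
    show "fls_nth (EXP rem) j = 0"
    proof (rule EXP_order[OF _ _ \<open>j < int (2 * M)\<close>])
      show "?k analytic_on {0}" by (intro analytic_intros) auto
      show "eventually (\<lambda>v. rem (1 / v) = v ^ (2 * M) * ?k v) (at 0)"
        using eventually_at_infinity_point evX
      proof eventually_elim
        case (elim v)
        have n: "1 - X * v \<noteq> 0" "v \<noteq> 0" using elim by (auto simp: mult.commute)
        have "(1 / v)\<^sup>2 - 4 = (1 - 4 * v\<^sup>2) / v\<^sup>2" using elim by (simp add: field_simps power2_eq_square)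
        hence a: "((1 / v)\<^sup>2 - 4) ^ M = (1 - 4 * v\<^sup>2) ^ M / v ^ (2 * M)"
          by (simp add: power_divide flip: power_mult)
        have b: "(1 / v - X)\<^sup>2 = (1 - X * v)\<^sup>2 / v\<^sup>2" using n by (simp add: field_simps power2_eq_square)
        have c: "(X * (1 / v) - 4) / 2 + of_nat M * (1 / v) * (1 / v - X) = ((X * v - 4 * v\<^sup>2) / 2 + of_nat M * (1 - X * v)) / v\<^sup>2"
          using n by (simp add: field_simps power2_eq_square)
        show ?case unfolding rem_def a b c using n by simp
      qed
    qed
  qed
  from vanishes_below_SQi[OF this] have "fls_nth (EXP rem * SQi) (int b + 1) = 0"
    using assms by (intro vanishes_belowD) auto
  hence "fls_nth (EXP (beta X) * SQi) (int b + 1) = (\<Sum>i\<in>bidx M. bb i X * fls_nth (EXP (cc i) * SQi) (int b + 1))"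
    unfolding e by (simp add: fls_nth_sum mult.assoc)
  thus ?thesis unfolding EXP_beta_nth(2) by (simp add: mult.commute)
qed

lemma pm_eq_Nil [simp]: "pm \<mu>s = [] \<longleftrightarrow> \<mu>s = []"
  by (simp add: pm_def)

text \<open>The jet expansion writes the diagonal term as a sum of products in one variable, whose
  coefficients are convolutions. For each \<open>a\<close>, linearity reassembles the sum over the
  basis into a correlator with the argument \<open>bpol (m - 1 - a)\<close>.\<close>

lemma kap_diag_pos:
  assumes "g \<noteq> 0" "\<not> (g = 1 \<and> \<mu>s = [])"
  shows "ratl (diag 0 g (pm \<mu>s))"
    "fls_nth (EXP (diag 0 g (pm \<mu>s)) * SQi\<^sup>2) (int m + 1) = (\<Sum>a<m. kap (g - 1) (a # (m - 1 - a) # \<mu>s))"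
proof -
  let ?bs = "pm \<mu>s"
  obtain M0 where M0: "\<And>g' n. 2 * g' + n < 2 * g + length ?bs \<Longrightarrow> Fm_struct M0 g' n"
    using Fm_struct_ex by blast
  \<comment> \<open>Large enough for the pole bounds and, through the summand \<open>m\<close>, for
    the basis expansion of every \<open>bpol b\<close> with \<open>b < m\<close>.\<close>
  define M where "M = M0 + m"
  have M: "Fm_struct M g' n" if "2 * g' + n < 2 * g + length ?bs" for g' n
    using Fm_struct_mono[OF M0[OF that]] by (simp add: M_def)
  define \<psi> where "\<psi> = (\<lambda>i. Fm 0 (g - 1) (bb i # ?bs))"
  have st: "stable (g - 1) (Suc (length ?bs))" using assms by (intro stable_diag) auto
  have an: "b \<in> set ?bs \<Longrightarrow> anl b" for b by (rule anl_pm)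
  have d: "diag 0 g ?bs x = (\<Sum>i\<in>bidx M. \<psi> i x * cc i x)" if "x \<notin> {2, - 2}" for x
    unfolding \<psi>_def using diag_eq_sum[of g ?bs M 0 x] M an that assms by (auto simp: mult.commute)
  have r\<psi>: "ratl (\<psi> i)" for i
    unfolding \<psi>_def using st an by (intro ratl_Fm) auto
  have "ratl (\<lambda>x. \<Sum>i\<in>bidx M. \<psi> i x * cc i x)" by (intro ratl_sum ratl_mult r\<psi> ratl_cc)
  thus "ratl (diag 0 g ?bs)" by (rule ratl_cong[rotated]) (use d in simp)
  have v\<psi>: "vanishes_below 1 (EXP (\<psi> i) * SQi)" for i
    unfolding \<psi>_def using st an
    by (intro vanishes_below_mono[OF Fm_vanishes_below]) auto
  have vc: "vanishes_below 1 (EXP (cc i) * SQi)" for i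
    using vanishes_below_mono[OF vanishes_below_SQi[OF cc_vanishes_below[of i]], of 1] by simp
  have "EXP (diag 0 g ?bs) = EXP (\<lambda>x. \<Sum>i\<in>bidx M. \<psi> i x * cc i x)" by (rule EXP_cong[OF d])
  also have "\<dots> = (\<Sum>i\<in>bidx M. EXP (\<psi> i) * EXP (cc i))"
    using ratl_meri[OF r\<psi>] ratl_meri[OF ratl_cc] by (simp add: EXP_sum EXP_mult meri_intros)
  finally have "EXP (diag 0 g ?bs) * SQi\<^sup>2 = (\<Sum>i\<in>bidx M. (EXP (\<psi> i) * SQi) * (EXP (cc i) * SQi))"
    by (simp add: sum_distrib_left sum_distrib_right power2_eq_square mult_ac)
  hence "fls_nth (EXP (diag 0 g ?bs) * SQi\<^sup>2) (int m + 1) =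
      (\<Sum>i\<in>bidx M. \<Sum>a<m. fls_nth (EXP (\<psi> i) * SQi) (int a + 1) * fls_nth (EXP (cc i) * SQi) (int (m - 1 - a) + 1))"
    by (simp only: fls_nth_sum fls_mult_nth_convolution[OF v\<psi> vc])
  also have "\<dots> = (\<Sum>a<m. \<Sum>i\<in>bidx M. fls_nth (EXP (\<psi> i) * SQi) (int a + 1) * fls_nth (EXP (cc i) * SQi) (int (m - 1 - a) + 1))"
    by (rule sum.swap)
  also have "\<dots> = (\<Sum>a<m. kap (g - 1) (a # (m - 1 - a) # \<mu>s))"
  proof (intro sum.cong refl)
    fix a assume "a \<in> {..<m}"
    define b where "b = m - 1 - a"
    define c where "c = (\<lambda>i. fls_nth (EXP (cc i) * SQi) (int b + 1))"
    have "b < 2 * M" using \<open>a \<in> {..<m}\<close> by (auto simp: b_def M_def)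
    hence bp: "poly (bpol b) x = (\<Sum>i\<in>bidx M. c i * bb i x) + (x\<^sup>2 - 4) ^ M * 0" for x
      using bpol_bb by (simp add: c_def)
    have "Fm 0 (g - 1) ([] @ poly (bpol b) # ?bs) x = (\<Sum>i\<in>bidx M. c i * Fm 0 (g - 1) ([] @ bb i # ?bs) x)"
      if "x \<notin> {2, - 2}" for x
      by (rule Fm_structD_lin[where h = "\<lambda>_. 0" and M = M and b = "poly (bpol b)", OF M ball_quarter_0 st])
         (use that an assms bp in \<open>auto simp: anl_poly anl_def[of "\<lambda>_. 0"] intro: always_eventually\<close>)
    hence "EXP (Fm 0 (g - 1) (pm (b # \<mu>s))) = EXP (\<lambda>x. \<Sum>i\<in>bidx M. c i * \<psi> i x)"
      by (intro EXP_cong(1)) (simp add: \<psi>_def)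
    also have "\<dots> = (\<Sum>i\<in>bidx M. fls_const (c i) * EXP (\<psi> i))"
      using ratl_meri[OF r\<psi>] by (simp add: EXP_sum EXP_cmult meri_intros)
    finally have "UU (g - 1) (b # \<mu>s) = (\<Sum>i\<in>bidx M. fls_const (c i) * (EXP (\<psi> i) * SQi))"
      by (simp add: UU_def sum_distrib_right mult.assoc)
    moreover have "corr (g - 1) (b # \<mu>s) = 0" using st by (intro corr_stable) simp
    ultimately have "kap (g - 1) (a # b # \<mu>s) = (\<Sum>i\<in>bidx M. c i * fls_nth (EXP (\<psi> i) * SQi) (int a + 1))"
      by (simp add: WW_def fls_nth_sum)
    thus "(\<Sum>i\<in>bidx M. fls_nth (EXP (\<psi> i) * SQi) (int a + 1) * fls_nth (EXP (cc i) * SQi) (int (m - 1 - a) + 1)) = kap (g - 1) (a # (m - 1 - a) # \<mu>s)"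
      by (simp add: c_def b_def mult.commute)
  qed
  finally show "fls_nth (EXP (diag 0 g ?bs) * SQi\<^sup>2) (int m + 1) = (\<Sum>a<m. kap (g - 1) (a # (m - 1 - a) # \<mu>s))" .
qed

lemma sum_lessThan_nat: "(\<Sum>b<i. of_nat b) = of_nat i * (of_nat i - 1) / (2 :: complex)"
  by (induction i) (auto simp: field_simps)

lemma Rs_deriv2: "fps_deriv (fps_deriv Rs) * Ri = fps_const (- 4) * Ri ^ 4"
proof -
  have d: "fps_deriv Rs = fps_const (- 4) * (fps_X * Ri)"
    unfolding Rs_deriv by (simp add: numeral_fps_const mult.assoc)
  have "fps_deriv (fps_X * Ri) = Ri + 4 * fps_X\<^sup>2 * Ri ^ 3"
    by (simp add: Ri_deriv power2_eq_square mult_ac)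
  also have "\<dots> = (1 - 4 * fps_X\<^sup>2) * Ri ^ 3 + 4 * fps_X\<^sup>2 * Ri ^ 3" by (simp only: Ri_cube)
  also have "\<dots> = Ri ^ 3" by (simp add: algebra_simps)
  finally have "fps_deriv (fps_deriv Rs) = fps_const (- 4) * Ri ^ 3"
    unfolding d fps_deriv_mult_const_left by simp
  thus ?thesis by (simp add: power4_eq_xxxx power3_eq_cube mult.assoc)
qed

lemma kap_0_pair: "kap 0 [a, b] = - of_nat b / 2 * (\<Sum>i=Suc b..a + b. fps_nth Rs i * fps_nth Ri (a + b - i))"
proof -
  have "kap 0 [a, b] = fps_nth (tailb b * Ri) a"
    by (simp add: WW_single fls_SQi_mult_nth del: of_nat_Suc) (simp flip: fls_times_fps_to_fls)
  also have "\<dots> = (\<Sum>j=0..a. if j = 0 then 0 else - of_nat b / 2 * (fps_nth Rs (j + b) * fps_nth Ri (a - j)))"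
    unfolding fps_mult_nth by (intro sum.cong) (auto simp: tailb_def)
  also have "\<dots> = (\<Sum>j=1..a. - of_nat b / 2 * (fps_nth Rs (j + b) * fps_nth Ri (a - j)))"
    by (rule sum.mono_neutral_cong_right) auto
  also have "\<dots> = (\<Sum>i=1 + b..a + b. - of_nat b / 2 * (fps_nth Rs i * fps_nth Ri (a + b - i)))"
    by (subst sum.shift_bounds_cl_nat_ivl) simp
  finally show ?thesis by (simp add: sum_distrib_left)
qed

text \<open>Here the tied pair is the full Bergman kernel at \<open>(z, 1/z)\<close>, not its part
  \<open>beta\<close>, so linearity of \<open>Fm\<close> gives nothing and the planar two-point
  numbers are summed explicitly. The inner sum of \<open>b\<close> over \<open>b < i\<close> is
  \<open>i (i - 1) / 2\<close> and brings in the second derivative of \<open>Rs\<close>.\<close>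

lemma kap_diag_one:
  "fls_nth (EXP (diag 0 1 []) * SQi\<^sup>2) (int m + 1) = (\<Sum>a<m. kap 0 [a, m - 1 - a])"
proof -
  have "diag 0 1 [] = (\<lambda>x. 1 / (x\<^sup>2 - 4) ^ 1)" by (simp add: diag_def[abs_def])
  hence "EXP (diag 0 1 []) = EXP (\<lambda>x. 1 / (x\<^sup>2 - 4) ^ 1)" by simp
  also have "\<dots> = SQi\<^sup>2" by (subst EXP_div_sq4) (auto simp: meri_const EXP_const)
  finally have "EXP (diag 0 1 []) * SQi\<^sup>2 = fps_to_fls (fps_X ^ 4 * Ri ^ 4)"
    by (simp add: SQi_def fls_times_fps_to_fls fps_to_fls_power power_mult_distrib power4_eq_xxxx power2_eq_square mult_ac)
  hence L: "fls_nth (EXP (diag 0 1 []) * SQi\<^sup>2) (int m + 1) = fps_nth (fps_X ^ 4 * Ri ^ 4) (Suc m)"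
    by (simp add: nat_add_distrib)
  show ?thesis
  proof (cases m)
    case 0 thus ?thesis unfolding L by (simp add: fps_X_power_mult_nth)
  next
    case (Suc n)
    let ?c = "\<lambda>i. fps_nth Rs i * fps_nth Ri (n - i)"
    have "(\<Sum>a<m. kap 0 [a, m - 1 - a]) = (\<Sum>a<Suc n. (\<lambda>b. kap 0 [n - b, b]) (Suc n - Suc a))"
      unfolding Suc by (intro sum.cong) auto
    also have "\<dots> = (\<Sum>b<Suc n. kap 0 [n - b, b])" by (rule sum.nat_diff_reindex)
    also have "\<dots> = (\<Sum>b<Suc n. \<Sum>i<Suc n. if b < i then - (of_nat b * ?c i) / 2 else 0)"
    proof (intro sum.cong refl)
      fix b assume b: "b \<in> {..<Suc n}"
      have "kap 0 [n - b, b] = (\<Sum>i=Suc b..n. - (of_nat b * ?c i) / 2)"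
        using b by (subst kap_0_pair) (simp add: sum_distrib_left mult.assoc)
      also have "\<dots> = (\<Sum>i<Suc n. if b < i then - (of_nat b * ?c i) / 2 else 0)"
        by (rule sum.mono_neutral_cong_left) auto
      finally show "kap 0 [n - b, b] = (\<Sum>i<Suc n. if b < i then - (of_nat b * ?c i) / 2 else 0)" .
    qed
    also have "\<dots> = (\<Sum>i<Suc n. \<Sum>b<Suc n. if b < i then - (of_nat b * ?c i) / 2 else 0)" by (rule sum.swap)
    also have "\<dots> = (\<Sum>i<Suc n. - (1 / 4) * (of_nat i * (of_nat i - 1) * ?c i))"
    proof (intro sum.cong refl)
      fix i assume i: "i \<in> {..<Suc n}"
      have "(\<Sum>b<Suc n. if b < i then - (of_nat b * ?c i) / 2 else 0) = (\<Sum>b<i. - (of_nat b * ?c i) / 2)"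
        using i by (intro sum.mono_neutral_cong_right) auto
      also have "\<dots> = - ((\<Sum>b<i. of_nat b) * ?c i) / 2"
        by (simp add: sum_distrib_right sum_divide_distrib sum_negf)
      also have "\<dots> = - (1 / 4) * (of_nat i * (of_nat i - 1) * ?c i)" unfolding sum_lessThan_nat by simp
      finally show "(\<Sum>b<Suc n. if b < i then - (of_nat b * ?c i) / 2 else 0) = - (1 / 4) * (of_nat i * (of_nat i - 1) * ?c i)" .
    qed
    also have "\<dots> = - (1 / 4) * fps_nth ((fps_X\<^sup>2 * fps_deriv (fps_deriv Rs)) * Ri) n"
    proof -
      have "fps_nth (fps_X\<^sup>2 * fps_deriv (fps_deriv Rs)) i = of_nat i * (of_nat i - 1) * fps_nth Rs i" for i
      proof (cases "i < 2")
        case True thus ?thesis by (auto simp: fps_X_power_mult_nth less_2_cases_iff)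
      next
        case False
        then obtain j where "i = Suc (Suc j)" by (metis Suc_diff_Suc Suc_lessI not_less_eq numeral_2_eq_2 less_2_cases_iff not0_implies_Suc)
        moreover have "fps_nth (fps_X\<^sup>2 * fps_deriv (fps_deriv Rs)) (Suc (Suc j)) = fps_nth (fps_deriv (fps_deriv Rs)) j" for j
          by (simp add: fps_X_power_mult_nth del: fps_deriv_nth)
        ultimately show ?thesis by (simp add: algebra_simps)
      qed
      thus ?thesis unfolding fps_mult_nth[of _ Ri] sum_distrib_left by (intro sum.cong) auto
    qed
    also have "(fps_X\<^sup>2 * fps_deriv (fps_deriv Rs)) * Ri = fps_const (- 4) * (fps_X\<^sup>2 * Ri ^ 4)"
      unfolding mult.assoc Rs_deriv2 by (simp only: mult.left_commute)
    also have "- (1 / 4) * fps_nth (fps_const (- 4) * (fps_X\<^sup>2 * Ri ^ 4)) n = fps_nth (fps_X\<^sup>2 * Ri ^ 4) n" by simp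
    also have "\<dots> = fps_nth (fps_X ^ 4 * Ri ^ 4) (Suc m)"
      unfolding Suc fps_X_power_mult_nth by (cases "n < 2") auto
    finally show ?thesis unfolding L by simp
  qed
qed

lemma kap_diag:
  "ratl (diag 0 g (pm \<mu>s))"
  "fls_nth (EXP (diag 0 g (pm \<mu>s)) * SQi\<^sup>2) (int m + 1) = (if g = 0 then 0 else \<Sum>a<m. kap (g - 1) (a # (m - 1 - a) # \<mu>s))"
proof -
  have z: "diag 0 0 bs = (\<lambda>_. 0)" for bs by (simp add: diag_def[abs_def])
  have "diag 0 1 [] = (\<lambda>x. (1 + 0 * x) / (x\<^sup>2 - 4) ^ 1)" by (simp add: diag_def[abs_def])
  hence "ratl (diag 0 1 [])" using ratl_term[of 1 0 1] by simp
  thus "ratl (diag 0 g (pm \<mu>s))" using kap_diag_pos(1)[of g \<mu>s] by (cases "g = 0"; cases "g = 1 \<and> \<mu>s = []") (auto simp: z ratl_const)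
  show "fls_nth (EXP (diag 0 g (pm \<mu>s)) * SQi\<^sup>2) (int m + 1) = (if g = 0 then 0 else \<Sum>a<m. kap (g - 1) (a # (m - 1 - a) # \<mu>s))"
    using kap_diag_pos(2)[of g \<mu>s m] kap_diag_one[of m] by (cases "g = 0"; cases "g = 1 \<and> \<mu>s = []") (auto simp: z EXP_0)
qed

section \<open>The product terms and the corrections\<close>

lemma EXP_Qm:
  "ratl (Qm 0 g (pm \<mu>s))"
  "EXP (Qm 0 g (pm \<mu>s)) * SQi\<^sup>2 = EXP (diag 0 g (pm \<mu>s)) * SQi\<^sup>2 + (\<Sum>h\<le>g. spl (\<lambda>I J. UU h I * UU (g - h) J) \<mu>s)"
proof -
  let ?t = "\<lambda>h x. spl (\<lambda>I J. Fm 0 h (pm I) x * Fm 0 (g - h) (pm J) x) \<mu>s"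
  have Q: "Qm 0 g (pm \<mu>s) = (\<lambda>x. diag 0 g (pm \<mu>s) x + (\<Sum>h\<le>g. ?t h x))"
    by (rule ext) (simp add: Qm_def pm_def spl_map)
  have r: "ratl (?t h)" for h by (intro ratl_spl ratl_mult ratl_Fm_pm)
  show "ratl (Qm 0 g (pm \<mu>s))" unfolding Q by (intro ratl_add ratl_sum r kap_diag(1))
  have e: "EXP (?t h) = spl (\<lambda>I J. EXP (Fm 0 h (pm I)) * EXP (Fm 0 (g - h) (pm J))) \<mu>s" for h
  proof -
    have "EXP (?t h) = spl (\<lambda>I J. EXP (\<lambda>x. Fm 0 h (pm I) x * Fm 0 (g - h) (pm J) x)) \<mu>s"
      by (rule conjunct2[OF meri_spl]) (intro meri_mult ratl_meri ratl_Fm_pm)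
    thus ?thesis by (simp add: EXP_mult ratl_meri ratl_Fm_pm)
  qed
  have u: "SQi\<^sup>2 * EXP (?t h) = spl (\<lambda>I J. UU h I * UU (g - h) J) \<mu>s" for h
    unfolding e spl_cmult[symmetric] by (intro arg_cong2[of _ _ _ _ spl] ext refl) (simp add: UU_def power2_eq_square mult_ac)
  have "EXP (Qm 0 g (pm \<mu>s)) = EXP (diag 0 g (pm \<mu>s)) + (\<Sum>h\<le>g. EXP (?t h))"
    unfolding Q by (simp add: EXP_add EXP_sum ratl_meri kap_diag(1) r ratl_sum)
  hence E: "EXP (Qm 0 g (pm \<mu>s)) * SQi\<^sup>2 = EXP (diag 0 g (pm \<mu>s)) * SQi\<^sup>2 + (\<Sum>h\<le>g. SQi\<^sup>2 * EXP (?t h))"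
    by (simp add: distrib_right sum_distrib_right mult.commute[of "SQi\<^sup>2"])
  show "EXP (Qm 0 g (pm \<mu>s)) * SQi\<^sup>2 = EXP (diag 0 g (pm \<mu>s)) * SQi\<^sup>2 + (\<Sum>h\<le>g. spl (\<lambda>I J. UU h I * UU (g - h) J) \<mu>s)"
    unfolding E u ..
qed

text \<open>\<open>Fm\<close> differs from its integrand by a polynomial only, which does not reach
  the positive powers of \<open>1/x\<close>.\<close>

lemma SQ_WW_stable:
  assumes "stable g (length \<mu>s)"
  shows "fls_nth (SQ * WW g \<mu>s) (int m + 1) = fls_nth (EXP (Qm 0 g (pm \<mu>s)) * SQi\<^sup>2) (int m + 1)"
proof -
  let ?Q = "\<lambda>x. Qm 0 g (pm \<mu>s) x / (x\<^sup>2 - 4) ^ 1"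
  have "ratl (\<lambda>x. Qm 0 g (pm \<mu>s) x * ((1 + 0 * x) / (x\<^sup>2 - 4) ^ 1))" by (intro ratl_mult EXP_Qm(1) ratl_term)
  hence "ratl ?Q" by simp
  then obtain r where r: "\<And>x. x \<notin> {2, - 2} \<Longrightarrow> ?Q x = PP ?Q x + poly r x" using ratl_PP by blast
  have F: "Fm 0 g (pm \<mu>s) x = PP ?Q x" for x
    using Fm_rec[of g "pm \<mu>s" 0 x] assms by simp
  have "EXP ?Q = EXP (\<lambda>x. Fm 0 g (pm \<mu>s) x + poly r x)" by (rule EXP_cong) (use r F in simp)
  also have "\<dots> = EXP (Fm 0 g (pm \<mu>s)) + EXP (poly r)" by (intro EXP_add ratl_meri ratl_Fm_pm ratl_poly)
  finally have "EXP (Qm 0 g (pm \<mu>s)) * SQi\<^sup>2 = EXP (Fm 0 g (pm \<mu>s)) + EXP (poly r)"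
    by (subst (asm) EXP_div_sq4) (simp_all add: ratl_meri EXP_Qm(1))
  moreover have "SQ * WW g \<mu>s = EXP (Fm 0 g (pm \<mu>s)) * (SQ * SQi)"
    using assms by (simp add: WW_def corr_stable UU_def mult_ac)
  ultimately show ?thesis by (simp add: SQ_SQi EXP_poly_nth)
qed

text \<open>Corrections have at most one argument: the empty sublist yields \<open>W0\<close>, the
  singletons yield the terms of \<open>dsum\<close>.\<close>

lemma spl_corr:
  fixes G :: "nat list \<Rightarrow> complex fls"
  shows "spl (\<lambda>I J. corr 0 I * G J) xs = W0 * G xs + dsum (\<lambda>k r. corr 0 [k] * G r) xs"
proof -
  have "spl (\<lambda>I J. (if length I = 1 then corr 0 I else 0) * G J) xs = dsum (\<lambda>k r. corr 0 [k] * G r) xs"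
  proof (induction xs arbitrary: G)
    case (Cons x xs)
    have "(if length (x # I) = 1 then corr 0 (x # I) else 0) * G J = (if I = [] then corr 0 [x] * G J else 0)" for I J
      by simp
    thus ?case using Cons.IH[of "\<lambda>J. G (x # J)"] spl_Nil_left[of "\<lambda>J. corr 0 [x] * G J" xs] by simp
  qed simp
  moreover have "spl (\<lambda>I J. (if I = [] then W0 * G J else 0)) xs = W0 * G xs" by (rule spl_Nil_left)
  moreover have "corr 0 I * G J = (if I = [] then W0 * G J else 0) + (if length I = 1 then corr 0 I else 0) * G J" for I J
    by (auto simp: corr_def)
  ultimately show ?thesis by (simp only: spl_add)
qed

text \<open>A product of two single corrections with \<open>k, l > 0\<close> is a multiple of
  \<open>x^(k+l-2)\<close>, hence without positive powers of \<open>1/x\<close>. In longer lists one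
  of the factors has no correction.\<close>

lemma spl_corr_corr:
  assumes "length xs \<ge> 2"
  shows "fls_nth (spl (\<lambda>I J. corr 0 I * corr 0 J) xs) (int m + 1) = 0"
proof -
  have v: "fls_nth (corr 0 [k] * corr 0 [l]) (int m + 1) = 0" for k l :: nat
  proof -
    have "corr 0 [k] * corr 0 [l] = fls_const (of_nat k / 2 * (of_nat l / 2)) * (fls_shift (int k - 1) 1 * fls_shift (int l - 1) 1)"
    proof -
      have "(fls_const x * A) * (fls_const y * B) = fls_const (x * y) * (A * B)" for x y :: complex and A B
        unfolding fls_const_mult_const[symmetric] by (simp only: mult_ac)
      note e = this
      show ?thesis unfolding corr_single e by simp
    qed
    hence "fls_nth (corr 0 [k] * corr 0 [l]) (int m + 1) = of_nat k / 2 * (of_nat l / 2) * (if int m + 1 + (int k - 1) + (int l - 1) = 0 then 1 else 0)"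
      by (simp only: fls_mult_const_nth fls_shift_1_mult_nth fls_shift_nth fls_one_nth)
    thus ?thesis by (cases "k = 0 \<or> l = 0") auto
  qed
  have c: "corr 0 xs = 0" using assms by (auto simp: corr_def)
  have "spl (\<lambda>I J. corr 0 I * corr 0 J) xs = dsum (\<lambda>k r. corr 0 [k] * corr 0 r) xs"
    unfolding spl_corr c by simp
  also have "fls_nth (dsum (\<lambda>k r. corr 0 [k] * corr 0 r) xs) (int m + 1) = 0"
  proof (cases "length xs = 2")
    case True
    then obtain k l where "xs = [k, l]" by (auto simp: length_Suc_conv numeral_2_eq_2)
    thus ?thesis using v[of k l] v[of l k] by simp
  next
    case False
    hence "length xs \<ge> 3" using assms by simp
    have "dsum (\<lambda>k r. corr 0 [k] * H r) xs = 0" if "\<And>r. Suc (length r) = length xs \<Longrightarrow> H r = 0" for H :: "nat list \<Rightarrow> complex fls"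
      using that
    proof (induction xs arbitrary: H)
      case (Cons x xs)
      show ?case using Cons.IH[of "\<lambda>r. H (x # r)"] Cons.prems by simp
    qed simp
    moreover have "corr 0 r = 0" if "Suc (length r) = length xs" for r :: "nat list"
      using \<open>length xs \<ge> 3\<close> that by (auto simp: corr_def)
    ultimately have "dsum (\<lambda>k r. corr 0 [k] * corr 0 r) xs = 0" by blast
    thus ?thesis by simp
  qed
  finally show ?thesis .
qed

lemma fls_nth_spl: "fls_nth (spl f xs) n = spl (\<lambda>a b. fls_nth (f a b) n) xs"
  by (induction xs arbitrary: f) auto

lemma fls_nth_dsum: "fls_nth (dsum f xs) n = dsum (\<lambda>a b. fls_nth (f a b) n) xs"
  by (induction xs arbitrary: f) auto

text \<open>The factor \<open>x^(k-1)\<close> of the correction shifts the index by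
  \<open>k - 1\<close>; with the factor 2 of the cross terms this is the joining term of the loop
  equation.\<close>

lemma corr_single_mult_nth:
  "- 2 * fls_nth (corr 0 [k] * WW g r) (int m + 1) = of_nat k * kap g ((m + k - 1) # r)"
proof (cases "m + k = 0")
  case False
  hence e: "int m + 1 + (int k - 1) = int (m + k - 1) + 1" by linarith
  have c: "- 2 * (- of_nat k / 2 * x) = of_nat k * x" for x :: complex by simp
  show ?thesis unfolding corr_single mult.assoc[of _ "fls_shift _ _"] fls_mult_const_nth fls_shift_1_mult_nth kap.simps e
    by (rule c)
qed (simp add: corr_single)

text \<open>\<open>x = sqrt (x^2 - 4) + 2 W0\<close>, and multiplication by \<open>x\<close> is the
  index shift of the loop equation.\<close>

lemma WW_conv_shift: "fls_nth (WW g \<mu>s) (int m + 2) = fls_nth (SQ * WW g \<mu>s) (int m + 1) + 2 * fls_nth (W0 * WW g \<mu>s) (int m + 1)"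
proof -
  have "fls_X_inv * WW g \<mu>s = SQ * WW g \<mu>s + (W0 * WW g \<mu>s + W0 * WW g \<mu>s)"
    unfolding SQ_W0 by (simp add: algebra_simps)
  from arg_cong[OF this, of "\<lambda>F. fls_nth F (int m + 1)"] show ?thesis
    by (simp add: fls_X_inv_times_conv_shift add.assoc)
qed

lemma UU_conv: "UU g \<mu>s = WW g \<mu>s - corr g \<mu>s" by (simp add: WW_def)

lemma sum_h_corr:
  assumes "\<And>h. h > 0 \<Longrightarrow> f h = 0"
  shows "(\<Sum>h\<le>(g::nat). f h) = (f 0 :: complex fls)"
proof -
  have "(\<Sum>h\<le>g. f h) = (\<Sum>h\<le>g. if h = 0 then f 0 else 0)" using assms by (intro sum.cong) auto
  thus ?thesis by simp
qed

text \<open>Substitution of \<open>UU = WW - corr\<close>. The cross terms with \<open>W0\<close>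
  compensate the factors without arguments in genus 0, those with single corrections become the
  joining terms, and products of two corrections are invisible.\<close>

lemma spl_UU:
  assumes "stable g (length \<mu>s)"
  shows "fls_nth (\<Sum>h\<le>g. spl (\<lambda>I J. UU h I * UU (g - h) J) \<mu>s) (int m + 1) =
    fls_nth (\<Sum>h\<le>g. spl (\<lambda>I J. WW h I * WW (g - h) J) \<mu>s) (int m + 1)
    - 2 * fls_nth (W0 * WW g \<mu>s) (int m + 1) + dsum (\<lambda>k r. of_nat k * kap g ((m + k - 1) # r)) \<mu>s"
proof -
  define A where "A = (\<Sum>h\<le>g. spl (\<lambda>I J. corr h I * WW (g - h) J) \<mu>s)"
  define C where "C = (\<Sum>h\<le>g. spl (\<lambda>I J. corr h I * corr (g - h) J) \<mu>s)"
  have A: "A = W0 * WW g \<mu>s + dsum (\<lambda>k r. corr 0 [k] * WW g r) \<mu>s"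
    unfolding A_def by (subst sum_h_corr) (simp_all add: corr_pos spl_zero spl_corr)
  have A': "(\<Sum>h\<le>g. spl (\<lambda>I J. WW h I * corr (g - h) J) \<mu>s) = A"
  proof -
    have "(\<Sum>h\<le>g. spl (\<lambda>I J. WW h I * corr (g - h) J) \<mu>s) = (\<Sum>h\<le>g. spl (\<lambda>I J. WW (g - h) I * corr (g - (g - h)) J) \<mu>s)"
      using sum.nat_diff_reindex[of "\<lambda>h. spl (\<lambda>I J. WW h I * corr (g - h) J) \<mu>s" "Suc g"]
      by (simp only: lessThan_Suc_atMost diff_Suc_Suc)
    also have "\<dots> = A" unfolding A_def
    proof (intro sum.cong refl)
      fix h assume "h \<in> {..g}"
      hence "g - (g - h) = h" by simp
      thus "spl (\<lambda>I J. WW (g - h) I * corr (g - (g - h)) J) \<mu>s = spl (\<lambda>I J. corr h I * WW (g - h) J) \<mu>s"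
        by (subst spl_swap) (simp add: mult.commute)
    qed
    finally show ?thesis .
  qed
  have C: "fls_nth C (int m + 1) = 0"
  proof -
    have C0: "C = spl (\<lambda>I J. corr 0 I * corr g J) \<mu>s"
      unfolding C_def by (subst sum_h_corr) (simp_all add: corr_pos spl_zero)
    show ?thesis
    proof (cases "g = 0")
      case True
      hence "length \<mu>s \<noteq> 0" "length \<mu>s \<noteq> 1" using assms by (auto simp: stable_def)
      hence "length \<mu>s \<ge> 2" by linarith
      thus ?thesis unfolding C0 True by (rule spl_corr_corr)
    qed (simp add: C0 corr_pos spl_zero)
  qed
  have "UU h I * UU (g - h) J = (WW h I * WW (g - h) J + corr h I * corr (g - h) J) + - 1 * (corr h I * WW (g - h) J + WW h I * corr (g - h) J)" for h I J
    unfolding UU_conv by (simp add: algebra_simps)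
  hence "(\<Sum>h\<le>g. spl (\<lambda>I J. UU h I * UU (g - h) J) \<mu>s) =
      (\<Sum>h\<le>g. (spl (\<lambda>I J. WW h I * WW (g - h) J) \<mu>s + spl (\<lambda>I J. corr h I * corr (g - h) J) \<mu>s)
        + - 1 * (spl (\<lambda>I J. corr h I * WW (g - h) J) \<mu>s + spl (\<lambda>I J. WW h I * corr (g - h) J) \<mu>s))"
    by (simp only: spl_add spl_cmult)
  also have "\<dots> = (\<Sum>h\<le>g. spl (\<lambda>I J. WW h I * WW (g - h) J) \<mu>s) + C + - 1 * (A + A)"
    by (simp only: sum.distrib sum_distrib_left[symmetric] A_def[symmetric] A' C_def[symmetric])
  finally have "(\<Sum>h\<le>g. spl (\<lambda>I J. UU h I * UU (g - h) J) \<mu>s) = (\<Sum>h\<le>g. spl (\<lambda>I J. WW h I * WW (g - h) J) \<mu>s) + C + - 1 * (A + A)" .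
  moreover have "- 2 * fls_nth A (int m + 1) = - 2 * fls_nth (W0 * WW g \<mu>s) (int m + 1) + dsum (\<lambda>k r. of_nat k * kap g ((m + k - 1) # r)) \<mu>s"
  proof -
    have "- 2 * fls_nth (dsum (\<lambda>k r. corr 0 [k] * WW g r) \<mu>s) (int m + 1) = dsum (\<lambda>k r. - 2 * fls_nth (corr 0 [k] * WW g r) (int m + 1)) \<mu>s"
      by (simp only: fls_nth_dsum dsum_cmult)
    thus ?thesis unfolding A corr_single_mult_nth by (simp add: algebra_simps)
  qed
  ultimately show ?thesis using C by simp
qed

lemma WW_product_nth:
  "fls_nth (\<Sum>h\<le>g. spl (\<lambda>I J. WW h I * WW (g - h) J) \<mu>s) (int m + 1) =
   (\<Sum>a<m. \<Sum>h\<le>g. spl (\<lambda>I J. kap h (a # I) * kap (g - h) ((m - 1 - a) # J)) \<mu>s)"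
proof -
  have "fls_nth (\<Sum>h\<le>g. spl (\<lambda>I J. WW h I * WW (g - h) J) \<mu>s) (int m + 1) =
    (\<Sum>h\<le>g. spl (\<lambda>I J. \<Sum>a<m. kap h (a # I) * kap (g - h) ((m - 1 - a) # J)) \<mu>s)"
    by (simp only: fls_nth_sum fls_nth_spl fls_mult_nth_convolution[OF WW_vanishes(1) WW_vanishes(1)] kap.simps)
  also have "\<dots> = (\<Sum>h\<le>g. \<Sum>a<m. spl (\<lambda>I J. kap h (a # I) * kap (g - h) ((m - 1 - a) # J)) \<mu>s)"
    by (simp only: spl_sum)
  also have "\<dots> = (\<Sum>a<m. \<Sum>h\<le>g. spl (\<lambda>I J. kap h (a # I) * kap (g - h) ((m - 1 - a) # J)) \<mu>s)"
    by (rule sum.swap)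
  finally show ?thesis .
qed

text \<open>The stable equations are assembled from the preceding pieces. Without arguments in genus
  0 the equation is \<open>W0^2 = x W0 - 1\<close>; with one argument it says that
  \<open>bpol\<close> is invisible in the positive powers of \<open>1/x\<close>.\<close>

lemma tutte_kap: "tutte kap"
proof
  fix g l
  show "kap g (0 # l) = (if g = 0 \<and> l = [] then 1 else 0)"
    using WW_vanishes(2)[of g l] W0_1 by (auto simp: WW_Nil)
next
  fix g m l
  let ?P = "\<Sum>a<m. \<Sum>h\<le>g. spl (\<lambda>I J. kap h (a # I) * kap (g - h) ((m - 1 - a) # J)) l"
  let ?D = "dsum (\<lambda>k r. of_nat k * kap g ((m + k - 1) # r)) l"
  let ?G = "if g = 0 then 0 else \<Sum>a<m. kap (g - 1) (a # (m - 1 - a) # l)"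
  have K: "kap g (Suc m # l) = fls_nth (SQ * WW g l) (int m + 1) + 2 * fls_nth (W0 * WW g l) (int m + 1)"
    using WW_conv_shift[of g l m] by (simp add: add.commute)
  have "kap g (Suc m # l) = ?G + ?P + ?D"
  proof (cases "stable g (length l)")
    case True
    show ?thesis unfolding K SQ_WW_stable[OF True] EXP_Qm(2) fls_plus_nth kap_diag(2) spl_UU[OF True] WW_product_nth
      by simp
  next
    case False
    then consider "g = 0" "l = []" | \<mu> where "g = 0" "l = [\<mu>]" unfolding not_stable_iff by blast
    thus ?thesis
    proof cases
      case 1
      have "?P = fls_nth (W0 * W0) (int m + 1)" using WW_product_nth[of 0 "[]" m] 1 by (simp add: WW_Nil)
      also have "\<dots> = fls_nth W0 (int m + 2)" unfolding W0_sq by (simp add: fls_X_inv_times_conv_shift) (simp add: add.commute)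
      finally show ?thesis using 1 by (simp add: WW_Nil add.commute)
    next
      case 2
      have "?P = 2 * fls_nth (W0 * WW 0 [\<mu>]) (int m + 1)"
        using WW_product_nth[of 0 "[\<mu>]" m] 2 by (simp add: WW_Nil mult.commute)
      moreover have "fls_nth (SQ * WW 0 [\<mu>]) (int m + 1) = ?D"
      proof -
        have "SQ * corr 0 [\<mu>] = corr 0 [\<mu>] * fls_X_inv - (corr 0 [\<mu>] * WW 0 [] + corr 0 [\<mu>] * WW 0 [])"
          unfolding SQ_W0 WW_Nil by (simp add: algebra_simps)
        moreover have "fls_nth (corr 0 [\<mu>] * fls_X_inv) (int m + 1) = 0"
          unfolding corr_single mult.assoc fls_mult_const_nth fls_shift_1_mult_nth by simp
        ultimately have "fls_nth (SQ * WW 0 [\<mu>]) (int m + 1) = - 2 * fls_nth (corr 0 [\<mu>] * WW 0 []) (int m + 1)"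
          unfolding SQ_WW_single by (simp add: EXP_poly_nth mult.commute[of "WW 0 []"])
        thus ?thesis unfolding corr_single_mult_nth using 2 by simp
      qed
      ultimately show ?thesis unfolding K using 2 by simp
    qed
  qed
  thus "kap g (Suc m # l) = (\<Sum>a<m. (if g = 0 then 0 else kap (g - 1) (a # (m - 1 - a) # l)) +
        (\<Sum>h\<le>g. spl (\<lambda>I J. kap h (a # I) * kap (g - h) ((m - 1 - a) # J)) l)) + ?D"
    by (simp add: sum.distrib)
qed

section \<open>Even one-point numbers\<close>

lemma kap_0_even: "kap 0 [2 * n] * of_nat (n + 1) = of_nat ((2 * n) choose n)"
proof -
  have "kap 0 [2 * n] = - fps_nth Rs (2 * n + 2) / 2"
    by (simp add: WW_Nil W0_nth nat_add_distrib nat_mult_distrib)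
  moreover have "(2 * (of_nat n + 1)) * fps_nth Rs (2 * n + 2) = - 4 * of_nat ((2 * n) choose n)"
    using Rs_Suc_Suc[of "2 * n"] unfolding Ri_even by (simp add: add.commute)
  moreover have alg: "- r / 2 * (u + 1) = b" if "2 * (u + 1) * r = - 4 * b" for r u b :: complex
  proof -
    have "- 4 * (- r / 2 * (u + 1)) = 2 * (u + 1) * r" by (simp add: field_simps)
    thus ?thesis using that by (metis mult_cancel_left neg_equal_0_iff_equal zero_neq_numeral)
  qed
  ultimately have "- fps_nth Rs (2 * n + 2) / 2 * (of_nat n + 1) = of_nat ((2 * n) choose n)" by blast
  thus ?thesis unfolding \<open>kap 0 [2 * n] = _\<close> of_nat_add of_nat_1 .
qed

text \<open>A parity effect: each \<open>Vs\<close> contains even powers only, and the additional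
  \<open>x\<close> next to \<open>b k\<close> moves its contribution to odd moments. Even moments
  see only the coefficients \<open>a\<close>.\<close>

lemma kap_polar_even:
  assumes "g \<ge> 1" "\<And>x. x \<notin> {2, - 2} \<Longrightarrow> Fm 0 g [] x = polar M a b x"
  shows "kap g [2 * n] = of_nat ((2 * n) choose n) * poly (\<Sum>k<M. Polynomial.smult (a k) (tp (Suc k))) (of_nat n)"
proof -
  have t: "EXP (\<lambda>x. (a k + b k * x) / (x\<^sup>2 - 4) ^ Suc k) * SQi =
      fls_const (a k) * (fls_X * fps_to_fls (Vs (Suc k))) + fls_const (b k) * fps_to_fls (Vs (Suc k))" for k
  proof -
    have "EXP (\<lambda>x. a k + b k * x) = fls_const (a k) + fls_const (b k) * fls_X_inv"
      by (subst EXP_add) (auto simp: EXP_cmult EXP_const EXP_x meri_intros)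
    hence "EXP (\<lambda>x. (a k + b k * x) / (x\<^sup>2 - 4) ^ Suc k) * SQi = (fls_const (a k) + fls_const (b k) * fls_X_inv) * SQi ^ (2 * Suc k + 1)"
      by (subst EXP_div_sq4) (auto intro!: meri_intros simp: mult_ac)
    also have "SQi ^ (2 * Suc k + 1) = fls_X * fps_to_fls (Vs (Suc k))"
      by (simp add: SQi_def Vs_def power_mult_distrib fls_times_fps_to_fls fps_to_fls_power mult_ac)
    also have "(fls_const (a k) + fls_const (b k) * fls_X_inv) * (fls_X * fps_to_fls (Vs (Suc k))) =
      fls_const (a k) * (fls_X * fps_to_fls (Vs (Suc k))) + fls_const (b k) * ((fls_X_inv * fls_X) * fps_to_fls (Vs (Suc k)))"
    proof -
      have "(x + y * i) * (z * w) = x * (z * w) + y * ((i * z) * w)" for x y z w i :: "complex fls"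
        by (simp add: algebra_simps)
      thus ?thesis by blast
    qed
    finally show ?thesis by (simp add: fls_X_X_inv)
  qed
  have m: "meri (\<lambda>x. (a k + b k * x) / (x\<^sup>2 - 4) ^ Suc k)" for k by (intro meri_intros)
  have "EXP (Fm 0 g []) = EXP (\<lambda>x. \<Sum>k<M. (a k + b k * x) / (x\<^sup>2 - 4) ^ Suc k)"
    by (rule EXP_cong) (use assms(2) in \<open>simp add: polar_def\<close>)
  hence "WW g [] = (\<Sum>k<M. fls_const (a k) * (fls_X * fps_to_fls (Vs (Suc k))) + fls_const (b k) * fps_to_fls (Vs (Suc k)))"
    using m assms(1) by (simp add: WW_def UU_def corr_pos EXP_sum sum_distrib_right t del: power_Suc)
  hence "kap g [2 * n] = (\<Sum>k<M. a k * fps_nth (Vs (Suc k)) (2 * n) + b k * fps_nth (Vs (Suc k)) (2 * n + 1))"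
    by (simp add: fls_nth_sum fls_X_times_conv_shift nat_add_distrib nat_mult_distrib)
  also have "\<dots> = (\<Sum>k<M. of_nat ((2 * n) choose n) * (a k * poly (tp (Suc k)) (of_nat n)))"
    unfolding Vs_odd Vs_even by (simp add: mult_ac)
  finally show ?thesis by (simp add: poly_sum sum_distrib_left del: tp.simps)
qed

text \<open>The moments of genus \<open>g\<close> are central binomials times the polynomial with
  coefficients \<open>a k\<close> in the \<open>tp (Suc k)\<close>. Toda fixes its linear
  coefficient. Its value at 1 vanishes, as no map of positive genus has a single edge, and only
  \<open>tp (Suc 0)\<close> is nonzero there.\<close>

theorem Fm_one_point_linear:
  assumes "g \<ge> 1" "\<And>x. x \<notin> {2, - 2} \<Longrightarrow> Fm 0 g [] x = polar M a b x"
  shows "(\<Sum>k<M. a k * coeff (tp (Suc k)) 1) = - bernoulli (2 * g) / of_nat (2 * g)"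
    and "M > 0 \<Longrightarrow> a 0 = 0"
proof -
  interpret tutte kap by (rule tutte_kap)
  let ?Q = "\<lambda>h p. \<exists>M a b. (\<forall>x. x \<notin> {2, - 2} \<longrightarrow> Fm 0 h [] x = polar M a b x) \<and>
      p = (\<Sum>k<M. Polynomial.smult (a k) (tp (Suc k)))"
  have "\<forall>h. \<exists>p. h \<ge> 1 \<longrightarrow> ?Q h p"
  proof
    fix h
    show "\<exists>p. h \<ge> 1 \<longrightarrow> ?Q h p"
    proof (cases "h \<ge> 1")
      case True
      then obtain M a b where "\<forall>x. x \<notin> {2, - 2} \<longrightarrow> Fm 0 h [] x = polar M a b x"
        using Fm_polar_ex[of h "[]"] by (auto simp: stable_def)
      hence "?Q h (\<Sum>k<M. Polynomial.smult (a k) (tp (Suc k)))" by blast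
      thus ?thesis by blast
    qed simp
  qed
  from choice[OF this] obtain p0 where p0: "\<And>h. h \<ge> 1 \<Longrightarrow> ?Q h (p0 h)" by blast
  define P where "P = (\<Sum>k<M. Polynomial.smult (a k) (tp (Suc k)))"
  \<comment> \<open>In genus \<open>g\<close> the given polar form is used, in every other genus a
    chosen one.\<close>
  define p where "p = p0(g := P)"
  have pol: "\<exists>M a b. (\<forall>x. x \<notin> {2, - 2} \<longrightarrow> Fm 0 h [] x = polar M a b x) \<and> p h = (\<Sum>k<M. Polynomial.smult (a k) (tp (Suc k)))"
    if "h \<ge> 1" for h
  proof (cases "h = g")
    case True
    thus ?thesis using assms(2) by (intro exI[of _ M] exI[of _ a] exI[of _ b]) (simp add: p_def P_def del: tp.simps)
  next
    case False
    thus ?thesis using p0[OF that] by (simp add: p_def del: tp.simps)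
  qed
  have pk: "kap h [2 * n] = of_nat ((2 * n) choose n) * poly (p h) (of_nat n) \<and> coeff (p h) 0 = 0" if h: "h \<ge> 1" for h n
  proof -
    obtain M a b where 1: "\<And>x. x \<notin> {2, - 2} \<Longrightarrow> Fm 0 h [] x = polar M a b x"
      and 2: "p h = (\<Sum>k<M. Polynomial.smult (a k) (tp (Suc k)))" using pol[OF h] by blast
    have "kap h [2 * n] = of_nat ((2 * n) choose n) * poly (p h) (of_nat n)"
      unfolding 2 by (rule kap_polar_even[OF h 1])
    thus ?thesis unfolding 2 coeff_sum coeff_smult tp_coeff_0 by simp
  qed
  have "coeff (p g) 1 = - bernoulli (2 * g) / of_nat (2 * g)"
    by (rule linear_coeff_bernoulli[OF kap_0_even conjunct1[OF pk] conjunct2[OF pk] assms(1)])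
  thus "(\<Sum>k<M. a k * coeff (tp (Suc k)) 1) = - bernoulli (2 * g) / of_nat (2 * g)"
    by (simp add: p_def P_def coeff_sum del: tp.simps)
  show "a 0 = 0" if "M > 0"
  proof -
    have "kap g [2 * 1] = 0" using \<kappa>_vanish[of 2 "[]" g] assms(1) by simp
    hence "poly P 1 = 0" using pk[OF assms(1), of 1] by (simp add: p_def)
    hence "(\<Sum>k<M. if k = 0 then a 0 / 2 else 0) = 0"
      unfolding P_def poly_sum by (subst (asm) sum.cong[OF refl, of _ _ "\<lambda>k. if k = 0 then a 0 / 2 else 0"]) (auto simp: tp_at_1 simp del: tp.simps)
    thus ?thesis using that by simp
  qed
qed

section \<open>Residues of the logarithm\<close>

text \<open>The branch of the logarithm near \<open>r\<close> that vanishes at \<open>r\<close>;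
  another branch of \<open>log z\<close> differs from it by a constant.\<close>

definition lg :: "complex \<Rightarrow> complex \<Rightarrow> complex" where
  "lg r z = Ln (r * z)"

lemma ball_branch_Re:
  assumes "r \<in> JM_branch_points" "z \<in> ball r 1"
  shows "r * z \<notin> \<real>\<^sub>\<le>\<^sub>0" "z \<noteq> 0"
proof -
  have "norm (1 - r * z) = norm (r - z)"
    using assms(1) by (auto simp: JM_branch_points_def norm_minus_commute) (metis add.commute norm_minus_cancel minus_add_distrib uminus_add_conv_diff)
  hence "norm (1 - r * z) < 1" using assms(2) by (simp add: dist_norm)
  moreover have "1 - Re (r * z) \<le> norm (1 - r * z)" using complex_Re_le_cmod[of "1 - r * z"] by simp
  ultimately have "Re (r * z) > 0" by linarith
  thus "r * z \<notin> \<real>\<^sub>\<le>\<^sub>0" "z \<noteq> 0" by (auto simp: complex_nonpos_Reals_iff)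
qed

lemma lg_deriv:
  assumes "r \<in> JM_branch_points" "z \<in> ball r 1"
  shows "(lg r has_field_derivative 1 / z) (at z)"
proof -
  have "((\<lambda>z. Ln (r * z)) has_field_derivative inverse (r * z) * r) (at z)"
    using ball_branch_Re(1)[OF assms] by (auto intro!: derivative_eq_intros simp: field_simps)
  moreover have "inverse (r * z) * r = 1 / z"
    using branch_nz[OF assms(1)] ball_branch_Re(2)[OF assms] by (simp add: field_simps)
  ultimately show ?thesis unfolding lg_def[abs_def] by simp
qed

lemma eventually_branch_ball: "eventually (\<lambda>z. z \<in> ball r 1) (at r)" for r :: complex
  using eventually_at_in_open'[of "ball r 1" r] by simp

lemma lg_mero: "r \<in> JM_branch_points \<Longrightarrow> lg r meromorphic_on {r}"
proof (rule analytic_on_imp_meromorphic_on)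
  assume r: "r \<in> JM_branch_points"
  have "lg r holomorphic_on ball r 1"
    using lg_deriv[OF r] unfolding holomorphic_on_open[OF open_ball] by blast
  thus "lg r analytic_on {r}" by (auto simp: analytic_on_def intro!: exI[of _ 1])
qed

definition E0 :: "nat \<Rightarrow> complex \<Rightarrow> complex" where "E0 k z = 1 / ((xz z)\<^sup>2 - 4) ^ k / z"
definition E1 :: "nat \<Rightarrow> complex \<Rightarrow> complex" where "E1 k z = xz z / ((xz z)\<^sup>2 - 4) ^ k / z"

lemma E_mero: "r \<in> JM_branch_points \<Longrightarrow> E0 k meromorphic_on {r}" "r \<in> JM_branch_points \<Longrightarrow> E1 k meromorphic_on {r}"
  unfolding E0_def[abs_def] E1_def[abs_def] using branch_nz[of r] by (auto intro!: meromorphic_intros)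

lemma uz_pow_even: "z \<noteq> 0 \<Longrightarrow> uz z ^ (2 * k) = ((xz z)\<^sup>2 - 4) ^ k"
  by (simp add: power_mult uz_sq)

lemma xz_over: "z \<noteq> 0 \<Longrightarrow> 1 + 1 / z\<^sup>2 = xz z / z" and uz_over: "z \<noteq> 0 \<Longrightarrow> 1 - 1 / z\<^sup>2 = uz z / z"
  by (simp_all add: xz_def uz_def field_simps power2_eq_square)

lemma residue_E1:
  assumes r: "r \<in> JM_branch_points" shows "residue (E1 (Suc j)) r = 0"
proof -
  have "residue (E1 (Suc j)) r = residue (\<lambda>z. (1 + 1 / z\<^sup>2) / uz z ^ Suc (Suc (2 * j))) r"
  proof (rule residue_meromorphic_cong)
    show "eventually (\<lambda>z. E1 (Suc j) z = (1 + 1 / z\<^sup>2) / uz z ^ Suc (Suc (2 * j))) (at r)"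
      using eventually_branch[OF r]
    proof eventually_elim
      case (elim z)
      have "uz z ^ Suc (Suc (2 * j)) = ((xz z)\<^sup>2 - 4) ^ Suc j" using uz_pow_even[of z "Suc j"] elim by simp
      thus ?case using elim by (simp add: E1_def xz_over del: power_Suc)
    qed
  qed
  thus ?thesis using residue_uz_pow[OF r] by simp
qed

lemma uz_power_deriv:
  "z \<noteq> 0 \<Longrightarrow> ((\<lambda>z. uz z ^ (2 * k + 1)) has_field_derivative of_nat (2 * k + 1) * uz z ^ (2 * k) * (1 + 1 / z\<^sup>2)) (at z)"
  by (rule DERIV_cong[OF DERIV_power[OF uz_deriv]]) (auto simp: mult_ac)

text \<open>Follows from \<open>dx = u dz/z\<close>, \<open>du = x dz/z\<close> and
  \<open>x^2 = u^2 + 4\<close>; it links neighbouring exponents in \<open>E0\<close>.\<close>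

lemma deriv_pole_product:
  assumes z: "z \<noteq> 0" "z \<noteq> 1" "z \<noteq> - 1"
  shows "((\<lambda>z. xz z / uz z ^ (2 * k + 1)) has_field_derivative
     - of_nat (2 * k) * E0 k z - of_nat (4 * (2 * k + 1)) * E0 (Suc k) z) (at z)"
proof -
  have u: "uz z \<noteq> 0" by (rule uz_nz[OF z])
  have "((\<lambda>z. xz z / uz z ^ (2 * k + 1)) has_field_derivative
      ((1 - 1 / z\<^sup>2) * uz z ^ (2 * k + 1) - xz z * (of_nat (2 * k + 1) * uz z ^ (2 * k) * (1 + 1 / z\<^sup>2))) / (uz z ^ (2 * k + 1))\<^sup>2) (at z)"
    unfolding power2_eq_square[of "uz z ^ (2 * k + 1)"]
    by (rule DERIV_divide[OF xz_deriv[OF z(1)] uz_power_deriv[OF z(1)]]) (use u in simp)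
  also have "((1 - 1 / z\<^sup>2) * uz z ^ (2 * k + 1) - xz z * (of_nat (2 * k + 1) * uz z ^ (2 * k) * (1 + 1 / z\<^sup>2))) / (uz z ^ (2 * k + 1))\<^sup>2
     = ((uz z)\<^sup>2 - of_nat (2 * k + 1) * (xz z)\<^sup>2) / (uz z)\<^sup>2 / uz z ^ (2 * k) / z"
    unfolding xz_over[OF z(1)] uz_over[OF z(1)] using u z by (simp add: divide_simps power2_eq_square algebra_simps)
  also have "\<dots> = - of_nat (2 * k) * E0 k z - of_nat (4 * (2 * k + 1)) * E0 (Suc k) z"
  proof -
    have g: "(S - N * X) / S / P / z = - (N - 1) * (1 / P / z) - 4 * N * (1 / (S * P) / z)"
      if "S \<noteq> 0" "P \<noteq> 0" "X = S + 4" for S P N X :: complex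
      unfolding that(3) using that(1,2) z by (simp add: divide_simps) (simp add: algebra_simps)
    have s: "(xz z)\<^sup>2 - 4 \<noteq> 0" using u uz_sq[OF z(1)] by auto
    show ?thesis unfolding E0_def uz_sq[OF z(1)] uz_pow_even[OF z(1)]
      by (rule trans[OF g]) (use s in simp_all)
  qed
  finally show ?thesis .
qed

lemma pole_product_mero: "r \<in> JM_branch_points \<Longrightarrow> (\<lambda>z. xz z / uz z ^ (2 * k + 1)) meromorphic_on {r}"
  using branch_nz[of r] by (auto intro!: meromorphic_intros)

lemma odd_nat_complex_nz: "of_nat (4 * (2 * k + 1)) \<noteq> (0 :: complex)"
  by (subst of_nat_eq_0_iff) simp

lemma residue_E0:
  assumes r: "r \<in> JM_branch_points" shows "residue (E0 k) r = 0"
proof (induction k)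
  case 0
  have "E0 0 analytic_on {r}" unfolding E0_def[abs_def] using branch_nz[OF r] by (auto intro!: analytic_intros)
  thus ?case by (rule residue_analytic)
next
  case (Suc k)
  have "residue (\<lambda>z. - of_nat (2 * k) * E0 k z - of_nat (4 * (2 * k + 1)) * E0 (Suc k) z) r = 0"
    by (rule residue_meromorphic_deriv[OF pole_product_mero[OF r, of k]])
       (use eventually_branch[OF r] in eventually_elim, use deriv_pole_product in blast)
  moreover have "residue (\<lambda>z. - of_nat (2 * k) * E0 k z + (- of_nat (4 * (2 * k + 1))) * E0 (Suc k) z) r
      = - of_nat (2 * k) * residue (E0 k) r + (- of_nat (4 * (2 * k + 1))) * residue (E0 (Suc k)) r"
    by (intro residue_meromorphic_lincomb E_mero r)
  ultimately have "of_nat (4 * (2 * k + 1)) * residue (E0 (Suc k)) r = 0" unfolding Suc by (simp del: of_nat_mult of_nat_add of_nat_Suc)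
  thus ?case using odd_nat_complex_nz[of k] by (simp only: mult_eq_0_iff) simp
qed

lemma lg_E_mero:
  assumes "r \<in> JM_branch_points"
  shows "(\<lambda>z. lg r z * E0 k z) meromorphic_on {r}" "(\<lambda>z. lg r z * E1 k z) meromorphic_on {r}"
  using lg_mero E_mero assms by (auto intro!: meromorphic_intros)

text \<open>Integration by parts against the logarithm. Its derivative \<open>1/z\<close> leaves the
  form \<open>du / u^(2k+1)\<close>, which has a residue for \<open>k = 0\<close> only.\<close>

lemma residue_lg_E0_Suc:
  assumes r: "r \<in> JM_branch_points"
  shows "of_nat (4 * (2 * k + 1)) * residue (\<lambda>z. lg r z * E0 (Suc k) z) r =
    (if k = 0 then 1 else 0) - of_nat (2 * k) * residue (\<lambda>z. lg r z * E0 k z) r"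
proof -
  let ?h = "\<lambda>z. xz z / uz z ^ (2 * k + 1)"
  have "residue (\<lambda>z. ?h z / z + (- of_nat (2 * k) * (lg r z * E0 k z) + (- of_nat (4 * (2 * k + 1))) * (lg r z * E0 (Suc k) z))) r = 0"
  proof (rule residue_meromorphic_deriv)
    show "(\<lambda>z. lg r z * ?h z) meromorphic_on {r}" by (intro meromorphic_on_mult lg_mero pole_product_mero r)
    show "eventually (\<lambda>z. ((\<lambda>z. lg r z * ?h z) has_field_derivative
        (?h z / z + (- of_nat (2 * k) * (lg r z * E0 k z) + (- of_nat (4 * (2 * k + 1))) * (lg r z * E0 (Suc k) z)))) (at z)) (at r)"
      using eventually_branch[OF r] eventually_branch_ball[of r]
    proof eventually_elim
      case (elim z)
      have "((\<lambda>z. lg r z * ?h z) has_field_derivative (lg r z * (- of_nat (2 * k) * E0 k z - of_nat (4 * (2 * k + 1)) * E0 (Suc k) z) + 1 / z * ?h z)) (at z)"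
        by (rule DERIV_mult'[OF lg_deriv[OF r] deriv_pole_product]) (use elim in auto)
      thus ?case by (rule DERIV_cong) (simp add: algebra_simps)
    qed
  qed
  moreover have "residue (\<lambda>z. ?h z / z + (- of_nat (2 * k) * (lg r z * E0 k z) + (- of_nat (4 * (2 * k + 1))) * (lg r z * E0 (Suc k) z))) r
     = residue (\<lambda>z. ?h z / z) r + (- of_nat (2 * k) * residue (\<lambda>z. lg r z * E0 k z) r + (- of_nat (4 * (2 * k + 1))) * residue (\<lambda>z. lg r z * E0 (Suc k) z) r)"
  proof -
    have mh: "(\<lambda>z. ?h z / z) meromorphic_on {r}"
      by (rule meromorphic_on_divide[OF pole_product_mero[OF r]]) (auto intro!: meromorphic_intros)
    have m: "(\<lambda>z. - of_nat (2 * k) * (lg r z * E0 k z) + (- of_nat (4 * (2 * k + 1))) * (lg r z * E0 (Suc k) z)) meromorphic_on {r}"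
      by (intro meromorphic_on_add meromorphic_on_mult meromorphic_on_const lg_mero E_mero r)
    show ?thesis unfolding residue_meromorphic_add[OF mh m]
      residue_meromorphic_lincomb[OF lg_E_mero(1)[OF r] lg_E_mero(1)[OF r]] ..
  qed
  moreover have "residue (\<lambda>z. ?h z / z) r = (if k = 0 then 1 else 0)"
  proof -
    have "residue (\<lambda>z. ?h z / z) r = residue (\<lambda>z. (1 + 1 / z\<^sup>2) / uz z ^ Suc (2 * k)) r"
    proof (rule residue_meromorphic_cong)
      show "eventually (\<lambda>z. ?h z / z = (1 + 1 / z\<^sup>2) / uz z ^ Suc (2 * k)) (at r)"
        using eventually_branch[OF r] by eventually_elim (simp add: xz_over)
    qed
    thus ?thesis using residue_uz_log[OF r] residue_uz_pow[OF r, of "2 * (k - 1) + 1"] by (cases k) simp_all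
  qed
  ultimately show ?thesis by (simp add: algebra_simps)
qed

text \<open>The reduction for residues has the same ratio between consecutive terms as the recursion
  for the linear coefficients of \<open>tp\<close>; the initial values differ by the factor
  1/2.\<close>

lemma residue_lg_E0:
  assumes r: "r \<in> JM_branch_points"
  shows "residue (\<lambda>z. lg r z * E0 (Suc k) z) r = coeff (tp (Suc k)) 1 / 2"
proof (induction k)
  case 0
  have "4 * residue (\<lambda>z. lg r z * E0 (Suc 0) z) r = 1" using residue_lg_E0_Suc[OF r, of 0] by simp
  hence "residue (\<lambda>z. lg r z * E0 (Suc 0) z) r = 1 / 4" by (simp add: field_simps)
  thus ?case unfolding tp_coeff_1(2) by simp
next
  case (Suc k)
  have nz: "4 * (2 * of_nat (Suc k) + 1) \<noteq> (0 :: complex)" using odd_of_nat_nz[of "Suc k"] by (simp only: mult_eq_0_iff) simp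
  have "(4 * (2 * of_nat (Suc k) + 1)) * residue (\<lambda>z. lg r z * E0 (Suc (Suc k)) z) r = - (2 * of_nat (Suc k)) * (coeff (tp (Suc k)) 1 / 2)"
    using residue_lg_E0_Suc[OF r, of "Suc k"] unfolding Suc by (simp add: algebra_simps del: tp.simps)
  hence "residue (\<lambda>z. lg r z * E0 (Suc (Suc k)) z) r = - (2 * of_nat (Suc k)) * (coeff (tp (Suc k)) 1 / 2) / (4 * (2 * of_nat (Suc k) + 1))"
    using nz by (metis nonzero_mult_div_cancel_left)
  moreover have "- (2 * n) * (c / 2) / (4 * u) = - n / (2 * u) * c / 2" for n c u :: complex by simp
  ultimately show ?case unfolding tp_coeff_1(1) by (simp only:)
qed

lemma residue_lg_E1:
  assumes r: "r \<in> JM_branch_points"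
  shows "of_nat (2 * j + 1) * residue (\<lambda>z. lg r z * E1 (Suc j) z) r = residue (\<lambda>z. (1 - 1 / z\<^sup>2) / ((xz z)\<^sup>2 - 4) ^ Suc j) r"
proof -
  let ?h = "\<lambda>z. 1 / uz z ^ (2 * j + 1)" and ?d = "\<lambda>z. (1 - 1 / z\<^sup>2) / ((xz z)\<^sup>2 - 4) ^ Suc j"
  have md: "?d meromorphic_on {r}" using branch_nz[OF r] by (intro meromorphic_intros) auto
  have "residue (\<lambda>z. 1 * ?d z + (- of_nat (2 * j + 1)) * (lg r z * E1 (Suc j) z)) r = 0"
  proof (rule residue_meromorphic_deriv)
    show "(\<lambda>z. lg r z * ?h z) meromorphic_on {r}"
      using branch_nz[OF r] lg_mero[OF r] by (intro meromorphic_intros) auto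
    show "eventually (\<lambda>z. ((\<lambda>z. lg r z * ?h z) has_field_derivative
        1 * ?d z + (- of_nat (2 * j + 1)) * (lg r z * E1 (Suc j) z)) (at z)) (at r)"
      using eventually_branch[OF r] eventually_branch_ball[of r]
    proof eventually_elim
      case (elim z)
      have z: "z \<noteq> 0" "z \<noteq> 1" "z \<noteq> - 1" using elim by auto
      have u: "uz z \<noteq> 0" by (rule uz_nz[OF z])
      have hd: "(?h has_field_derivative - (of_nat (2 * j + 1) * uz z ^ (2 * j) * (1 + 1 / z\<^sup>2)) / (uz z ^ (2 * j + 1))\<^sup>2) (at z)"
        by (rule DERIV_cong[OF DERIV_divide[OF DERIV_const uz_power_deriv[OF z(1)]]]) (use u in \<open>simp_all add: power2_eq_square\<close>)
      have e1: "- (of_nat (2 * j + 1) * uz z ^ (2 * j) * (1 + 1 / z\<^sup>2)) / (uz z ^ (2 * j + 1))\<^sup>2 = - of_nat (2 * j + 1) * E1 (Suc j) z"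
      proof -
        have sq: "(uz z ^ (2 * j + 1))\<^sup>2 = uz z ^ (2 * j) * uz z ^ (2 * Suc j)" by (simp add: power2_eq_square)
        have g: "- (N * A * (x / z)) / (A * B) = - N * (x / B / z)" if "A \<noteq> 0" for N A B x :: complex
          using that by simp
        show ?thesis unfolding E1_def xz_over[OF z(1)] uz_pow_even[OF z(1), symmetric] sq
          by (rule g) (use u in simp)
      qed
      have e2: "1 / z * ?h z = ?d z"
        unfolding uz_over[OF z(1)] uz_pow_even[OF z(1), symmetric] using u by (simp add: power2_eq_square)
      have "((\<lambda>z. lg r z * ?h z) has_field_derivative (lg r z * (- of_nat (2 * j + 1) * E1 (Suc j) z) + 1 / z * ?h z)) (at z)"
        by (rule DERIV_mult'[OF lg_deriv[OF r] hd[unfolded e1]]) (use elim in auto)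
      thus ?case unfolding e2 by (rule DERIV_cong) (simp add: algebra_simps)
    qed
  qed
  thus ?thesis by (subst (asm) residue_meromorphic_lincomb[OF md lg_E_mero(2)[OF r]]) (simp add: algebra_simps)
qed

text \<open>Integration by parts removes the logarithm and leaves
  \<open>dx / (x^2 - 4)^(j+1)\<close>, whose residues at the two branch points are opposite.\<close>

lemma sum_residue_lg_E1: "(\<Sum>r\<in>JM_branch_points. residue (\<lambda>z. lg r z * E1 (Suc j) z) r) = 0"
proof -
  have "of_nat (2 * j + 1) * (\<Sum>r\<in>JM_branch_points. residue (\<lambda>z. lg r z * E1 (Suc j) z) r) = 0"
  proof -
    have "of_nat (2 * j + 1) * (\<Sum>r\<in>JM_branch_points. residue (\<lambda>z. lg r z * E1 (Suc j) z) r) =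
        (\<Sum>r\<in>JM_branch_points. residue (\<lambda>z. (1 - 1 / z\<^sup>2) / ((xz z)\<^sup>2 - 4) ^ Suc j) r)"
      unfolding sum_distrib_left by (intro sum.cong refl residue_lg_E1)
    thus ?thesis using res1_dx_pow[of "Suc j"] unfolding res1_def by (rule trans)
  qed
  thus ?thesis unfolding mult_eq_0_iff of_nat_eq_0_iff by simp
qed

text \<open>The single-valued part of a primitive of \<open>(x^2 - 4) dz/z\<close>; the complete
  primitive is \<open>G0 - 2 log z\<close>.\<close>

definition G0 :: "complex \<Rightarrow> complex" where "G0 z = xz z * uz z / 2"

lemma sum_residue_G0_E0: "(\<Sum>r\<in>JM_branch_points. residue (\<lambda>z. G0 z * E0 (Suc j) z) r) = (if j = 0 then 1 else 0)"
proof -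
  have "residue (\<lambda>z. G0 z * E0 (Suc j) z) r = 1 / 2 * residue (\<lambda>z. xz z * (1 - 1 / z\<^sup>2) / ((xz z)\<^sup>2 - 4) ^ Suc j) r"
    if r: "r \<in> JM_branch_points" for r
  proof -
    have "residue (\<lambda>z. G0 z * E0 (Suc j) z) r = residue (\<lambda>z. 1 / 2 * (xz z * (1 - 1 / z\<^sup>2) / ((xz z)\<^sup>2 - 4) ^ Suc j)) r"
      by (rule residue_meromorphic_cong, use eventually_branch[OF r] in eventually_elim) (simp add: G0_def E0_def uz_over)
    also have "\<dots> = 1 / 2 * residue (\<lambda>z. xz z * (1 - 1 / z\<^sup>2) / ((xz z)\<^sup>2 - 4) ^ Suc j) r"
      using branch_nz[OF r] by (intro residue_meromorphic_cmult meromorphic_intros) auto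
    finally show ?thesis .
  qed
  hence "(\<Sum>r\<in>JM_branch_points. residue (\<lambda>z. G0 z * E0 (Suc j) z) r) = 1 / 2 * res1 (\<lambda>z. xz z * (1 - 1 / z\<^sup>2) / ((xz z)\<^sup>2 - 4) ^ Suc j)"
    unfolding res1_def sum_distrib_left by (intro sum.cong) auto
  thus ?thesis unfolding res1_x_dx_pow by (cases j) simp_all
qed

lemma sum_residue_G0_E1: "(\<Sum>r\<in>JM_branch_points. residue (\<lambda>z. G0 z * E1 (Suc j) z) r) = 0"
proof -
  let ?d = "\<lambda>l z. (1 - 1 / z\<^sup>2) / ((xz z)\<^sup>2 - 4) ^ l"
  have "residue (\<lambda>z. G0 z * E1 (Suc j) z) r = 1 / 2 * residue (?d j) r + 2 * residue (?d (Suc j)) r"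
    if r: "r \<in> JM_branch_points" for r
  proof -
    have "residue (\<lambda>z. G0 z * E1 (Suc j) z) r = residue (\<lambda>z. 1 / 2 * ?d j z + 2 * ?d (Suc j) z) r"
    proof (rule residue_meromorphic_cong, use eventually_branch[OF r] in eventually_elim)
      case (elim z)
      hence s: "(xz z)\<^sup>2 - 4 \<noteq> 0" using uz_nz[of z] uz_sq[of z] by auto
      have "x * u / 2 * (x / ((x\<^sup>2 - 4) * P) / z) = 1 / 2 * (u / z / P) + 2 * (u / z / ((x\<^sup>2 - 4) * P))"
        if "x\<^sup>2 - 4 \<noteq> 0" "P \<noteq> 0" for x u P :: complex
        using that elim by (simp add: divide_simps) (simp add: algebra_simps power2_eq_square)
      from this[OF s, of "((xz z)\<^sup>2 - 4) ^ j" "uz z"] show ?case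
        using s elim by (simp add: G0_def E1_def uz_over)
    qed
    also have "\<dots> = 1 / 2 * residue (?d j) r + 2 * residue (?d (Suc j)) r"
      using branch_nz[OF r] by (intro residue_meromorphic_lincomb meromorphic_intros) auto
    finally show ?thesis .
  qed
  hence "(\<Sum>r\<in>JM_branch_points. residue (\<lambda>z. G0 z * E1 (Suc j) z) r) = 1 / 2 * res1 (?d j) + 2 * res1 (?d (Suc j))"
    unfolding res1_def sum_distrib_left sum.distrib[symmetric] by (intro sum.cong) auto
  thus ?thesis unfolding res1_dx_pow by simp
qed

section \<open>The primitive paired with a polar part\<close>

lemma polar_xz: "polar M a b (xz z) / z = (\<Sum>k<M. a k * E0 (Suc k) z + b k * E1 (Suc k) z)"
  unfolding polar_def E0_def E1_def by (simp add: sum_divide_distrib add_divide_distrib del: power_Suc)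

lemma polar_xz_mero: "r \<in> JM_branch_points \<Longrightarrow> (\<lambda>z. polar M a b (xz z) / z) meromorphic_on {r}"
  unfolding polar_xz by (intro meromorphic_on_sum meromorphic_intros E_mero)

lemma residue_mult_polar_xz:
  assumes r: "r \<in> JM_branch_points" and h: "h meromorphic_on {r}"
  shows "residue (\<lambda>z. h z * (polar M a b (xz z) / z)) r =
    (\<Sum>k<M. a k * residue (\<lambda>z. h z * E0 (Suc k) z) r + b k * residue (\<lambda>z. h z * E1 (Suc k) z) r)"
proof -
  have m: "(\<lambda>z. h z * E0 (Suc k) z) meromorphic_on {r}" "(\<lambda>z. h z * E1 (Suc k) z) meromorphic_on {r}" for k
    using h E_mero[OF r] by (auto intro!: meromorphic_intros)
  have "(\<lambda>z. h z * (polar M a b (xz z) / z)) = (\<lambda>z. \<Sum>k<M. a k * (h z * E0 (Suc k) z) + b k * (h z * E1 (Suc k) z))"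
    unfolding polar_xz sum_distrib_left by (intro ext sum.cong) (auto simp: algebra_simps)
  hence "residue (\<lambda>z. h z * (polar M a b (xz z) / z)) r = residue (\<lambda>z. \<Sum>k<M. a k * (h z * E0 (Suc k) z) + b k * (h z * E1 (Suc k) z)) r"
    by simp
  also have "\<dots> = (\<Sum>k<M. residue (\<lambda>z. a k * (h z * E0 (Suc k) z) + b k * (h z * E1 (Suc k) z)) r)"
    by (intro residue_meromorphic_sum meromorphic_on_add meromorphic_on_mult[OF meromorphic_on_const] m)
  also have "\<dots> = (\<Sum>k<M. a k * residue (\<lambda>z. h z * E0 (Suc k) z) r + b k * residue (\<lambda>z. h z * E1 (Suc k) z) r)"
    using m by (intro sum.cong residue_meromorphic_lincomb) auto
  finally show ?thesis .
qed

lemma residue_polar_xz: "r \<in> JM_branch_points \<Longrightarrow> residue (\<lambda>z. polar M a b (xz z) / z) r = 0"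
  using residue_mult_polar_xz[of r "\<lambda>_. 1" M a b, OF _ meromorphic_on_const] by (simp add: residue_E0 residue_E1)

lemma G0_mero: "r \<in> JM_branch_points \<Longrightarrow> G0 meromorphic_on {r}"
  unfolding G0_def[abs_def] using branch_nz[of r] by (auto intro!: meromorphic_intros)

text \<open>The single-valued part sees \<open>a 0\<close> only. The logarithm sees every
  \<open>a k\<close>, with equal contributions from the two branch points, while all
  \<open>b k\<close> cancel in the sum.\<close>

lemma sum_residue_primitive_polar:
  "(\<Sum>r\<in>JM_branch_points. residue (\<lambda>z. (G0 z - 2 * lg r z) * (polar M a b (xz z) / z)) r) =
     (if M = 0 then 0 else a 0) - 2 * (\<Sum>k<M. a k * coeff (tp (Suc k)) 1)"
proof -
  let ?B = "JM_branch_points"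
  have 1: "residue (\<lambda>z. (G0 z - 2 * lg r z) * (polar M a b (xz z) / z)) r =
     residue (\<lambda>z. G0 z * (polar M a b (xz z) / z)) r - 2 * residue (\<lambda>z. lg r z * (polar M a b (xz z) / z)) r" if "r \<in> ?B" for r
  proof -
    have "(\<lambda>z. (G0 z - 2 * lg r z) * (polar M a b (xz z) / z)) =
      (\<lambda>z. 1 * (G0 z * (polar M a b (xz z) / z)) + (- 2) * (lg r z * (polar M a b (xz z) / z)))"
      by (simp add: algebra_simps)
    moreover have "residue (\<lambda>z. 1 * (G0 z * (polar M a b (xz z) / z)) + (- 2) * (lg r z * (polar M a b (xz z) / z))) r =
      1 * residue (\<lambda>z. G0 z * (polar M a b (xz z) / z)) r + (- 2) * residue (\<lambda>z. lg r z * (polar M a b (xz z) / z)) r"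
      by (intro residue_meromorphic_lincomb meromorphic_on_mult G0_mero lg_mero polar_xz_mero that)
    ultimately show ?thesis by simp
  qed
  have 2: "(\<Sum>r\<in>?B. residue (\<lambda>z. G0 z * (polar M a b (xz z) / z)) r) = (if M = 0 then 0 else a 0)"
  proof -
    have "(\<Sum>r\<in>?B. residue (\<lambda>z. G0 z * (polar M a b (xz z) / z)) r) =
      (\<Sum>r\<in>?B. \<Sum>k<M. a k * residue (\<lambda>z. G0 z * E0 (Suc k) z) r + b k * residue (\<lambda>z. G0 z * E1 (Suc k) z) r)"
      by (intro sum.cong refl residue_mult_polar_xz G0_mero)
    also have "\<dots> = (\<Sum>k<M. \<Sum>r\<in>?B. a k * residue (\<lambda>z. G0 z * E0 (Suc k) z) r + b k * residue (\<lambda>z. G0 z * E1 (Suc k) z) r)"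
      by (rule sum.swap)
    also have "\<dots> = (\<Sum>k<M. if k = 0 then a 0 else 0)"
      by (intro sum.cong refl) (simp add: sum.distrib sum_distrib_left[symmetric] sum_residue_G0_E0 sum_residue_G0_E1)
    finally show ?thesis by simp
  qed
  have 3: "(\<Sum>r\<in>?B. residue (\<lambda>z. lg r z * (polar M a b (xz z) / z)) r) = (\<Sum>k<M. a k * coeff (tp (Suc k)) 1)"
  proof -
    have "(\<Sum>r\<in>?B. residue (\<lambda>z. lg r z * (polar M a b (xz z) / z)) r) =
      (\<Sum>r\<in>?B. \<Sum>k<M. a k * residue (\<lambda>z. lg r z * E0 (Suc k) z) r + b k * residue (\<lambda>z. lg r z * E1 (Suc k) z) r)"
      by (intro sum.cong refl residue_mult_polar_xz lg_mero)
    also have "\<dots> = (\<Sum>k<M. \<Sum>r\<in>?B. a k * residue (\<lambda>z. lg r z * E0 (Suc k) z) r + b k * residue (\<lambda>z. lg r z * E1 (Suc k) z) r)"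
      by (rule sum.swap)
    also have "\<dots> = (\<Sum>k<M. a k * (\<Sum>r\<in>?B. coeff (tp (Suc k)) 1 / 2))"
      by (intro sum.cong refl) (simp add: sum.distrib sum_distrib_left[symmetric] sum_residue_lg_E1 residue_lg_E0 del: tp.simps)
    also have "\<dots> = (\<Sum>k<M. a k * coeff (tp (Suc k)) 1)"
      by (intro sum.cong refl) (simp add: JM_branch_points_def del: tp.simps)
    finally show ?thesis .
  qed
  show ?thesis unfolding 2[symmetric] 3[symmetric] sum_distrib_left sum_subtractf[symmetric]
    by (intro sum.cong refl 1)
qed

section \<open>The limit of the symplectic invariants\<close>

lemma residue_sum_list:
  assumes "\<And>p. p \<in> set L \<Longrightarrow> f p meromorphic_on {r}"
  shows "residue (\<lambda>z. \<Sum>p\<leftarrow>L. c p * f p z) r = (\<Sum>p\<leftarrow>L. c p * residue (f p) r)"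
    and "(\<lambda>z. \<Sum>p\<leftarrow>L. c p * f p z) meromorphic_on {r}"
proof -
  have "residue (\<lambda>z. \<Sum>p\<leftarrow>L. c p * f p z) r = (\<Sum>p\<leftarrow>L. c p * residue (f p) r) \<and> (\<lambda>z. \<Sum>p\<leftarrow>L. c p * f p z) meromorphic_on {r}"
    using assms
  proof (induction L)
    case (Cons p L)
    have m: "f p meromorphic_on {r}" "(\<lambda>z. c p * f p z) meromorphic_on {r}"
      using Cons.prems by (auto intro!: meromorphic_intros)
    have IH: "residue (\<lambda>z. \<Sum>p\<leftarrow>L. c p * f p z) r = (\<Sum>p\<leftarrow>L. c p * residue (f p) r)" "(\<lambda>z. \<Sum>p\<leftarrow>L. c p * f p z) meromorphic_on {r}"
      using Cons by auto
    show ?case using residue_meromorphic_add[OF m(2) IH(2)] residue_meromorphic_cmult[OF m(1), of "c p"] IH(1) meromorphic_on_add[OF m(2) IH(2)]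
      by simp
  qed (simp add: residue_const meromorphic_on_const)
  thus "residue (\<lambda>z. \<Sum>p\<leftarrow>L. c p * f p z) r = (\<Sum>p\<leftarrow>L. c p * residue (f p) r)"
    "(\<lambda>z. \<Sum>p\<leftarrow>L. c p * f p z) meromorphic_on {r}" by auto
qed

lemma tendsto_sum_list:
  fixes f :: "'b \<Rightarrow> 'a \<Rightarrow> complex"
  assumes "\<And>p. p \<in> set L \<Longrightarrow> (f p \<longlongrightarrow> l p) F"
  shows "((\<lambda>t. \<Sum>p\<leftarrow>L. f p t) \<longlongrightarrow> (\<Sum>p\<leftarrow>L. l p)) F"
  using assms by (induction L) (auto intro!: tendsto_add)

text \<open>A primitive of \<open>x (x^2 - 4) dz/z\<close>, which comes from the term of first order
  in \<open>e\<close>; it contains no logarithm.\<close>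

definition H0 :: "complex \<Rightarrow> complex" where
  "H0 z = z ^ 3 / 3 - z + inverse z - inverse (z ^ 3) / 3"

lemma H0_mero: "r \<in> JM_branch_points \<Longrightarrow> H0 meromorphic_on {r}"
  unfolding H0_def[abs_def] using branch_nz[of r] by (auto intro!: meromorphic_intros)

lemma primitive_deriv:
  assumes r: "r \<in> JM_branch_points" and z: "z \<in> ball r 1"
  shows "((\<lambda>z. \<theta> / 2 * (G0 z - 2 * lg r z - e * H0 z)) has_field_derivative
     \<theta> / 2 * (1 - e * xz z) * ((xz z)\<^sup>2 - 4) / z) (at z)"
proof -
  have nz: "z \<noteq> 0" by (rule ball_branch_Re(2)[OF r z])
  have G: "(G0 has_field_derivative (xz z * (1 + 1 / z\<^sup>2) + (1 - 1 / z\<^sup>2) * uz z) / 2) (at z)"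
    unfolding G0_def[abs_def] by (rule DERIV_cdivide[OF DERIV_mult'[OF xz_deriv[OF nz] uz_deriv[OF nz]]])
  have H: "(H0 has_field_derivative (z\<^sup>2 - 1 - 1 / z\<^sup>2 + 1 / z ^ 4)) (at z)"
  proof -
    have "((\<lambda>z. z ^ 3 / 3 - z + inverse z - inverse (z ^ 3) / 3) has_field_derivative
        3 * z\<^sup>2 / 3 - 1 + - (inverse z * 1 * inverse z) - - (inverse (z ^ 3) * (3 * z\<^sup>2) * inverse (z ^ 3)) / 3) (at z)"
    proof -
      have p3: "((\<lambda>z. z ^ 3) has_field_derivative 3 * z\<^sup>2) (at z)"
        by (rule DERIV_cong[OF DERIV_power[OF DERIV_ident]]) simp
      have i1: "((\<lambda>z. inverse z) has_field_derivative - (inverse z * 1 * inverse z)) (at z)"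
        by (rule DERIV_cong[OF DERIV_inverse[OF nz]]) simp
      have i3: "((\<lambda>z. inverse (z ^ 3)) has_field_derivative - (inverse (z ^ 3) * (3 * z\<^sup>2) * inverse (z ^ 3))) (at z)"
        by (rule DERIV_inverse'[OF p3]) (use nz in simp)
      show ?thesis
        by (intro DERIV_diff DERIV_add DERIV_cdivide p3 DERIV_ident i1 i3)
    qed
    also have "3 * z\<^sup>2 / 3 - 1 + - (inverse z * 1 * inverse z) - - (inverse (z ^ 3) * (3 * z\<^sup>2) * inverse (z ^ 3)) / 3
        = z\<^sup>2 - 1 - 1 / z\<^sup>2 + 1 / z ^ 4"
    proof -
      have "inverse (z ^ 3) * (3 * z\<^sup>2) * inverse (z ^ 3) = 3 * (1 / z ^ 4)"
      proof -
        have "w ^ 3 * (3 * z\<^sup>2) * w ^ 3 = 3 * (w ^ 4 * (z * w)\<^sup>2)" for w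
          by (simp add: power2_eq_square power3_eq_cube power4_eq_xxxx mult_ac)
        from this[of "inverse z"] show ?thesis using nz by (simp add: power_inverse divide_inverse)
      qed
      moreover have "inverse z * 1 * inverse z = 1 / z\<^sup>2" using nz by (simp add: divide_simps power2_eq_square)
      moreover have "3 * A / 3 - 1 + - B - - (3 * C) / 3 = A - 1 - B + C" for A B C :: complex by simp
      ultimately show ?thesis by (simp only:)
    qed
    finally show ?thesis unfolding H0_def[abs_def] .
  qed
  have D: "((\<lambda>z. \<theta> / 2 * (G0 z - 2 * lg r z - e * H0 z)) has_field_derivative
     \<theta> / 2 * ((xz z * (1 + 1 / z\<^sup>2) + (1 - 1 / z\<^sup>2) * uz z) / 2 - 2 * (1 / z) - e * (z\<^sup>2 - 1 - 1 / z\<^sup>2 + 1 / z ^ 4))) (at z)"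
    by (intro DERIV_cmult DERIV_diff G lg_deriv[OF r z] H)
  have A: "(xz z * (1 + 1 / z\<^sup>2) + (1 - 1 / z\<^sup>2) * uz z) / 2 - 2 * (1 / z) = ((xz z)\<^sup>2 - 4) / z"
  proof -
    have "(z + w) * (1 + w\<^sup>2) + (1 - w\<^sup>2) * (z - w) = 2 * (((z + w)\<^sup>2 - 4) * w + 2 * w)" if zw: "z * w = 1" for w
    proof -
      have "((z + w)\<^sup>2 - 4) * w + 2 * w = z * (z * w) + 2 * (z * w) * w + w ^ 3 - 2 * w"
        by (simp add: algebra_simps power2_eq_square power3_eq_cube)
      also have "\<dots> = z + w ^ 3" unfolding zw by simp
      finally show ?thesis by (simp add: algebra_simps power2_eq_square power3_eq_cube)
    qed
    from this[of "1 / z"] have "xz z * (1 + 1 / z\<^sup>2) + (1 - 1 / z\<^sup>2) * uz z = 2 * (((xz z)\<^sup>2 - 4) * (1 / z) + 2 * (1 / z))"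
      using nz unfolding xz_def uz_def by (simp add: power_one_over)
    moreover have "2 * (s * i + 2 * i) / 2 - 2 * i = s * i" for s i :: complex by (simp add: add_divide_distrib)
    ultimately have "(xz z * (1 + 1 / z\<^sup>2) + (1 - 1 / z\<^sup>2) * uz z) / 2 - 2 * (1 / z) = ((xz z)\<^sup>2 - 4) * (1 / z)"
      by (simp only:)
    thus ?thesis by simp
  qed
  have B: "z\<^sup>2 - 1 - 1 / z\<^sup>2 + 1 / z ^ 4 = xz z * (((xz z)\<^sup>2 - 4) / z)"
  proof -
    have "z\<^sup>2 - 1 - w\<^sup>2 + w ^ 4 = (z + w) * (((z + w)\<^sup>2 - 4) * w)" if zw: "z * w = 1" for w
    proof -
      have "((z + w)\<^sup>2 - 4) * w = z * (z * w) + 2 * (z * w) * w + w ^ 3 - 4 * w"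
        by (simp add: algebra_simps power2_eq_square power3_eq_cube)
      also have "\<dots> = z + w ^ 3 - 2 * w" unfolding zw by simp
      finally have A: "((z + w)\<^sup>2 - 4) * w = z + w ^ 3 - 2 * w" .
      have "(z + w) * (z + w ^ 3 - 2 * w) = z\<^sup>2 - z * w + (z * w) * w\<^sup>2 + w ^ 4 - 2 * w\<^sup>2"
        by (simp add: algebra_simps power2_eq_square power3_eq_cube power4_eq_xxxx)
      also have "\<dots> = z\<^sup>2 - 1 - w\<^sup>2 + w ^ 4" unfolding zw by simp
      finally show ?thesis unfolding A ..
    qed
    from this[of "1 / z"] show ?thesis
      using nz unfolding xz_def by (simp add: power_one_over)
  qed
  have "t * (S * i - e * (x * (S * i))) = t * (1 - e * x) * S * i" for t S x i :: complex
    by (simp add: algebra_simps)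
  note gen = this
  show ?thesis by (rule DERIV_cong[OF D]) (unfold A B, unfold divide_inverse, rule gen)
qed

text \<open>The pairing with the primitive at \<open>e = 0\<close>, up to the factor
  \<open>\<theta> / 2\<close>; \<open>Hf\<close> is the pairing with its part of first order in
  \<open>e\<close>.\<close>

definition Tf :: "(complex \<Rightarrow> complex) \<Rightarrow> complex" where
  "Tf P = (\<Sum>r\<in>JM_branch_points. residue (\<lambda>z. (G0 z - 2 * lg r z) * (P (xz z) / z)) r)"

definition Hf :: "(complex \<Rightarrow> complex) \<Rightarrow> complex" where
  "Hf P = (\<Sum>r\<in>JM_branch_points. residue (\<lambda>z. H0 z * (P (xz z) / z)) r)"

lemma eventually_xz_generic:
  assumes "r \<in> JM_branch_points"
  shows "eventually (\<lambda>z. z \<noteq> 0 \<and> z \<noteq> 1 \<and> z \<noteq> - 1 \<and> xz z \<notin> {2, - 2}) (at r)"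
  using eventually_branch[OF assms] by eventually_elim (use xz_branch_value in blast)

lemma Tf_linear:
  assumes L: "\<And>p. p \<in> set L \<Longrightarrow> \<exists>a b. P p = polar M a b"
    and F: "\<And>x. x \<notin> {2, - 2} \<Longrightarrow> F x = (\<Sum>p\<leftarrow>L. c p * P p x)"
  shows "Tf F = (\<Sum>p\<leftarrow>L. c p * Tf (P p))"
proof -
  have "residue (\<lambda>z. (G0 z - 2 * lg r z) * (F (xz z) / z)) r = (\<Sum>p\<leftarrow>L. c p * residue (\<lambda>z. (G0 z - 2 * lg r z) * (P p (xz z) / z)) r)"
    if r: "r \<in> JM_branch_points" for r
  proof -
    have "residue (\<lambda>z. (G0 z - 2 * lg r z) * (F (xz z) / z)) r = residue (\<lambda>z. \<Sum>p\<leftarrow>L. c p * ((G0 z - 2 * lg r z) * (P p (xz z) / z))) r"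
    proof (rule residue_meromorphic_cong, use eventually_xz_generic[OF r] in eventually_elim)
      case (elim z)
      have "w * ((\<Sum>p\<leftarrow>L. c p * P p x) / z) = (\<Sum>p\<leftarrow>L. c p * (w * (P p x / z)))" for w x
        by (induction L) (simp_all add: algebra_simps add_divide_distrib)
      thus ?case using F[of "xz z"] elim by simp
    qed
    also have "\<dots> = (\<Sum>p\<leftarrow>L. c p * residue (\<lambda>z. (G0 z - 2 * lg r z) * (P p (xz z) / z)) r)"
    proof (rule residue_sum_list(1))
      fix p assume "p \<in> set L"
      then obtain a b where "P p = polar M a b" using L by blast
      thus "(\<lambda>z. (G0 z - 2 * lg r z) * (P p (xz z) / z)) meromorphic_on {r}"
        using polar_xz_mero[OF r, of M a b] G0_mero[OF r] lg_mero[OF r]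
        by (intro meromorphic_on_mult meromorphic_on_diff meromorphic_on_const) auto
    qed
    finally show ?thesis .
  qed
  note * = this
  have "Tf F = (\<Sum>r\<in>JM_branch_points. \<Sum>p\<leftarrow>L. c p * residue (\<lambda>z. (G0 z - 2 * lg r z) * (P p (xz z) / z)) r)"
    unfolding Tf_def by (intro sum.cong refl *)
  also have "\<dots> = (\<Sum>p\<leftarrow>L. c p * Tf (P p))"
    unfolding Tf_def JM_branch_points_def by (simp add: sum_list_addf[symmetric] distrib_left)
  finally show ?thesis .
qed

section \<open>The invariants of the Jimbo-Miwa curve for small e\<close>

context
  fixes q \<gamma> \<theta> e zo :: complex and p :: "complex \<Rightarrow> real \<Rightarrow> complex"
  assumes q: "q \<noteq> 0" and \<theta>: "\<theta> \<noteq> 0" and \<gamma>: "(2 * \<gamma>)\<^sup>2 = - \<theta> / q"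
    and e_def: "e = \<gamma> / (2 * q)" and paths: "JM_paths zo p" and e: "e \<in> ball 0 (1 / 4)"
begin

text \<open>The form is holomorphic off 0, so the integral splits into the value up to
  \<open>r\<close> and a local antiderivative on the disc around \<open>r\<close>. The path enters
  through the constant \<open>K\<close> alone.\<close>

lemma primitive_near:
  assumes r: "r \<in> JM_branch_points"
  shows "\<exists>K. eventually (\<lambda>z. primitive_ydx (JM_x q \<gamma>) (JM_y q \<gamma>) (p r) z = K + \<theta> / 2 * (G0 z - 2 * lg r z - e * H0 z)) (at r)"
proof -
  let ?f = "\<lambda>w. JM_y q \<gamma> w * deriv (JM_x q \<gamma>) w"
  define \<Psi> where "\<Psi> = (\<lambda>z. \<theta> / 2 * (G0 z - 2 * lg r z - e * H0 z))"
  have f: "?f z = \<theta> / 2 * (1 - e * xz z) * ((xz z)\<^sup>2 - 4) / z" if "z \<noteq> 0" for z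
    by (rule ydx_JM) (rule that q \<theta> \<gamma> e_def)+
  have pr: "valid_path (p r)" "pathfinish (p r) = r" "0 \<notin> path_image (p r)"
    using paths r by (auto simp: JM_paths_def)
  have "(\<lambda>z. \<theta> / 2 * (1 - e * xz z) * ((xz z)\<^sup>2 - 4) / z) holomorphic_on - {0}"
    by (auto intro!: holomorphic_intros analytic_imp_holomorphic[OF xz_analytic])
  hence holo: "?f holomorphic_on - {0}" by (rule holomorphic_transform) (use f in auto)
  have int: "?f contour_integrable_on p r"
    by (rule contour_integrable_holomorphic_simple[OF holo _ pr(1)]) (use pr in auto)
  have ev: "eventually (\<lambda>z. contour_integral (p r +++ linepath r z) ?f = contour_integral (p r) ?f - \<Psi> r + \<Psi> z) (at r)"
    using eventually_branch_ball[of r]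
  proof eventually_elim
    case (elim z)
    have sub: "path_image (linepath r z) \<subseteq> ball r 1"
      using elim by (simp add: closed_segment_subset)
    have d: "(\<Psi> has_field_derivative ?f w) (at w within ball r 1)" if "w \<in> ball r 1" for w
      unfolding f[OF ball_branch_Re(2)[OF r that]] \<Psi>_def by (rule has_field_derivative_at_within[OF primitive_deriv[OF r that]])
    have i: "(?f has_contour_integral \<Psi> z - \<Psi> r) (linepath r z)"
      using contour_integral_primitive[OF d valid_path_linepath sub] by simp
    show ?case
      using contour_integral_join[OF int has_contour_integral_integrable[OF i] pr(1) valid_path_linepath] contour_integral_unique[OF i]
      by simp
  qed
  show ?thesis
    by (rule exI[of _ "contour_integral (p r) ?f - \<Psi> r"])
       (use ev in \<open>simp add: primitive_ydx_def pr(2) \<Psi>_def\<close>)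
qed

text \<open>The constant of the primitive drops out at each branch point separately, since a polar
  part times \<open>dz/z\<close> has no residue there.\<close>

lemma residue_primitive_omega:
  assumes r: "r \<in> JM_branch_points" and g: "g \<ge> 1"
    and L: "\<forall>u\<in>set L. \<exists>a b. snd u = polar M a b"
    and F: "\<forall>x. x \<notin> {2, - 2} \<longrightarrow> Fm e g [] x = (\<Sum>u\<leftarrow>L. fst u e * snd u x)"
  shows "residue (\<lambda>z. primitive_ydx (JM_x q \<gamma>) (JM_y q \<gamma>) (p r) z *
      omega (JM_x q \<gamma>) (JM_y q \<gamma>) (\<lambda>z. 1 / z) JM_branch_points g [z]) r =
    \<theta> / 2 / \<theta> ^ (2 * g - 1) * (\<Sum>u\<leftarrow>L. fst u e *
      (residue (\<lambda>z. (G0 z - 2 * lg r z) * (snd u (xz z) / z)) r - e * residue (\<lambda>z. H0 z * (snd u (xz z) / z)) r))"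
proof -
  let ?om = "omega (JM_x q \<gamma>) (JM_y q \<gamma>) (\<lambda>z. 1 / z) JM_branch_points g"
  let ?pr = "primitive_ydx (JM_x q \<gamma>) (JM_y q \<gamma>) (p r)"
  let ?c = "\<theta> / 2 / \<theta> ^ (2 * g - 1)"
  obtain K where K: "eventually (\<lambda>z. ?pr z = K + \<theta> / 2 * (G0 z - 2 * lg r z - e * H0 z)) (at r)"
    using primitive_near[OF r] by blast
  define k where "k = K / \<theta> ^ (2 * g - 1)"
  let ?A = "\<lambda>u z. snd u (xz z) / z"
  let ?B = "\<lambda>u z. (G0 z - 2 * lg r z) * (snd u (xz z) / z)"
  let ?C = "\<lambda>u z. H0 z * (snd u (xz z) / z)"
  let ?t = "\<lambda>u z. k * ?A u z + 1 * (?c * ?B u z + (- e * ?c) * ?C u z)"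
  have "eventually (\<lambda>z. ?pr z * ?om [z] = (\<Sum>u\<leftarrow>L. fst u e * ?t u z)) (at r)"
    using eventually_xz_generic[OF r] K
  proof eventually_elim
    case (elim z)
    have "?om (z # []) * z * prod_list [] * \<theta> ^ (2 * g + length ([] :: complex list) - 1) = Fm e g (psv []) (xz z)"
      by (rule omega_Fm[OF q \<theta> \<gamma> e_def e]) (use elim g in \<open>auto simp: stable_def\<close>)
    hence "?om [z] * z * \<theta> ^ (2 * g - 1) = (\<Sum>u\<leftarrow>L. fst u e * snd u (xz z))"
      using F elim by (simp add: psv_def[OF q \<theta> \<gamma> e_def] del: omega.simps)
    hence om: "?om [z] = (\<Sum>u\<leftarrow>L. fst u e * snd u (xz z)) / z / \<theta> ^ (2 * g - 1)"
      using elim \<theta> by (simp add: field_simps)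
    have idn: "(k + c * (X - e * Y)) * ((f * s + S) * i * j) =
      f * (k * j * (s * i) + 1 * (c * j * (X * (s * i)) + (- e * (c * j)) * (Y * (s * i)))) + (k + c * (X - e * Y)) * (S * i * j)"
      for k c X Y f s S i j :: complex by (simp add: algebra_simps)
    have "(K + \<theta> / 2 * (X - e * Y)) * ((\<Sum>u\<leftarrow>L. fst u e * snd u x) / z / T) =
      (\<Sum>u\<leftarrow>L. fst u e * (K / T * (snd u x / z) + 1 * (\<theta> / 2 / T * (X * (snd u x / z)) + (- e * (\<theta> / 2 / T)) * (Y * (snd u x / z)))))"
      for X Y x T :: complex
    proof (induction L)
      case (Cons u L)
      have "(K + \<theta> / 2 * (X - e * Y)) * ((f * s + S) / z / T) =
          f * (K / T * (s / z) + 1 * (\<theta> / 2 / T * (X * (s / z)) + (- e * (\<theta> / 2 / T)) * (Y * (s / z)))) + (K + \<theta> / 2 * (X - e * Y)) * (S / z / T)"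
        for f s S unfolding divide_inverse by (rule idn)
      thus ?case unfolding list.map sum_list.Cons Cons.IH[symmetric] .
    qed simp
    thus ?case unfolding om elim(2) k_def .
  qed
  hence "residue (\<lambda>z. ?pr z * ?om [z]) r = residue (\<lambda>z. \<Sum>u\<leftarrow>L. fst u e * ?t u z) r"
    by (rule residue_meromorphic_cong)
  also have "\<dots> = (\<Sum>u\<leftarrow>L. fst u e * residue (?t u) r)"
  proof (rule residue_sum_list(1))
    fix u assume "u \<in> set L"
    then obtain a b where ab: "snd u = polar M a b" using L by blast
    show "?t u meromorphic_on {r}" unfolding ab
      by (intro meromorphic_on_add meromorphic_on_mult meromorphic_on_diff meromorphic_on_const polar_xz_mero G0_mero lg_mero H0_mero r)
  qed
  also have "\<dots> = (\<Sum>u\<leftarrow>L. ?c * (fst u e * (residue (?B u) r - e * residue (?C u) r)))"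
  proof (rule arg_cong[of _ _ sum_list], rule map_cong[OF refl])
    fix u assume "u \<in> set L"
    then obtain a b where ab: "snd u = polar M a b" using L by blast
    have mA: "?A u meromorphic_on {r}" unfolding ab by (rule polar_xz_mero[OF r])
    have mB: "?B u meromorphic_on {r}" unfolding ab
      by (intro meromorphic_on_mult meromorphic_on_diff meromorphic_on_const polar_xz_mero G0_mero lg_mero r)
    have mC: "?C u meromorphic_on {r}" unfolding ab by (intro meromorphic_on_mult polar_xz_mero H0_mero r)
    have "(\<lambda>z. ?c * ?B u z + (- e * ?c) * ?C u z) meromorphic_on {r}"
      by (intro meromorphic_on_add meromorphic_on_mult[OF meromorphic_on_const] mB mC)
    from residue_meromorphic_lincomb[OF mA this, of k 1] residue_meromorphic_lincomb[OF mB mC, of ?c "- e * ?c"]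
    have "residue (?t u) r = k * residue (?A u) r + 1 * (?c * residue (?B u) r + (- e * ?c) * residue (?C u) r)"
      by (simp only:)
    moreover have "residue (?A u) r = 0" unfolding ab by (rule residue_polar_xz[OF r])
    moreover have "f * (k * 0 + 1 * (c * B + (- e * c) * C)) = c * (f * (B - e * C))" for f c B C :: complex
      by (simp add: algebra_simps)
    ultimately show "fst u e * residue (?t u) r = ?c * (fst u e * (residue (?B u) r - e * residue (?C u) r))"
      by (simp only:)
  qed
  finally show ?thesis by (simp only: sum_list_const_mult)
qed

lemma JM_F_formula:
  assumes g: "g \<ge> 1"
    and L: "\<forall>u\<in>set L. \<exists>a b. snd u = polar M a b"
    and F: "\<forall>x. x \<notin> {2, - 2} \<longrightarrow> Fm e g [] x = (\<Sum>u\<leftarrow>L. fst u e * snd u x)"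
  shows "JM_F q \<gamma> p g = 1 / (2 - 2 * of_nat g) * (\<theta> / 2 / \<theta> ^ (2 * g - 1) *
     (\<Sum>u\<leftarrow>L. fst u e * (Tf (snd u) - e * Hf (snd u))))"
proof -
  have b: "1 \<in> JM_branch_points" "- 1 \<in> JM_branch_points" by (auto simp: JM_branch_points_def)
  note res1 = residue_primitive_omega[OF b(1) g L F] and res2 = residue_primitive_omega[OF b(2) g L F]
  have two: "sum f JM_branch_points = f 1 + f (- 1)" for f :: "complex \<Rightarrow> complex"
    by (simp add: JM_branch_points_def)
  have "(\<Sum>u\<leftarrow>L. fst u e * (A u - e * B u)) + (\<Sum>u\<leftarrow>L. fst u e * (A' u - e * B' u)) =
      (\<Sum>u\<leftarrow>L. fst u e * (A u + A' u - e * (B u + B' u)))" for A B A' B'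
    by (induction L) (simp_all add: algebra_simps)
  note idn = this
  show ?thesis
    unfolding JM_F_def symplectic_invariant_def two res1 res2 Tf_def Hf_def distrib_left[symmetric] idn ..
qed

end

lemma Tf_Fm_0:
  assumes g: "g \<ge> 1"
  shows "Tf (Fm 0 g []) = bernoulli (2 * g) / of_nat g"
proof -
  have "stable g (length ([] :: (complex \<Rightarrow> complex) list))" using g by (simp add: stable_def)
  from Fm_polar_ex[OF this] obtain M a b where P: "\<And>x. x \<notin> {2, - 2} \<Longrightarrow> Fm 0 g [] x = polar M a b x" by auto
  have "Tf (Fm 0 g []) = (\<Sum>u\<leftarrow>[()]. 1 * Tf (polar M a b))"
    by (rule Tf_linear) (auto simp: P)
  also have "\<dots> = Tf (polar M a b)" by simp
  also have "\<dots> = (if M = 0 then 0 else a 0) - 2 * (\<Sum>k<M. a k * coeff (tp (Suc k)) 1)"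
    unfolding Tf_def by (rule sum_residue_primitive_polar)
  also have "\<dots> = - 2 * (- bernoulli (2 * g) / of_nat (2 * g))"
  proof -
    have "(\<Sum>k<M. a k * coeff (tp (Suc k)) 1) = - bernoulli (2 * g) / of_nat (2 * g)"
      by (rule Fm_one_point_linear(1)[OF g]) (rule P)
    moreover have "a 0 = 0" if "M > 0"
      by (rule Fm_one_point_linear(2)[OF g _ that]) (rule P)
    ultimately show ?thesis by (simp del: tp.simps)
  qed
  finally show ?thesis by simp
qed

text \<open>Asymptotic equivalence eventually gives \<open>|q0| >= |s| / 2\<close>, and
  \<open>|s| = sqrt (|t| / 2)\<close>; where \<open>s\<close> vanishes the bound is trivial.\<close>

lemma q0_at_infinity:
  fixes s q0 :: "complex \<Rightarrow> complex"
  assumes "\<forall>t\<in>S. (s t)\<^sup>2 = - t / 2" and "q0 \<sim>[at_infinity_within S] s"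
  shows "filterlim q0 at_infinity (at_infinity_within S)"
proof -
  let ?F = "at_infinity_within S"
  have inS: "eventually (\<lambda>t. t \<in> S) ?F" by (simp add: eventually_inf_principal)
  have "filterlim (\<lambda>t. t) at_infinity ?F" by (rule filterlim_mono[OF filterlim_ident]) auto
  hence "filterlim norm at_top ?F" by (rule filterlim_at_infinity_imp_norm_at_top)
  hence "filterlim (\<lambda>t. sqrt (norm t / 2) / 2) at_top ?F"
  proof -
    assume n: "filterlim norm at_top ?F"
    have "filterlim (\<lambda>x::real. sqrt (x / 2) / 2) at_top at_top" by real_asymp
    from filterlim_compose[OF this n] show ?thesis .
  qed
  moreover have "eventually (\<lambda>t. sqrt (norm t / 2) / 2 \<le> norm (q0 t)) ?F"
  proof -
    have "((\<lambda>t. if q0 t = 0 \<and> s t = 0 then 1 else q0 t / s t) \<longlongrightarrow> 1) ?F"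
      using assms(2) by (simp add: asymp_equiv_def)
    hence "eventually (\<lambda>t. dist (if q0 t = 0 \<and> s t = 0 then 1 else q0 t / s t) 1 < 1 / 2) ?F"
      by (rule tendstoD) simp
    thus ?thesis using inS
    proof eventually_elim
      case (elim t)
      have "norm (s t) ^ 2 = norm t / 2" using assms(1) elim(2) by (metis norm_divide norm_minus_cancel norm_numeral norm_power)
      hence ns: "sqrt (norm t / 2) = norm (s t)" by (metis norm_ge_zero real_sqrt_unique)
      show ?case
      proof (cases "s t = 0")
        case False
        hence d: "norm (q0 t / s t - 1) < 1 / 2" using elim(1) by (simp add: dist_norm)
        have "1 \<le> norm (q0 t / s t) + norm (q0 t / s t - 1)"
          using norm_triangle_ineq4[of "q0 t / s t" "q0 t / s t - 1"] by simp
        hence "1 / 2 \<le> norm (q0 t / s t)" using d by linarith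
        hence "1 / 2 \<le> norm (q0 t) / norm (s t)" by (simp only: norm_divide)
        thus ?thesis unfolding ns using False by (simp add: field_simps)
      qed (simp add: ns)
    qed
  qed
  ultimately have "filterlim (\<lambda>t. norm (q0 t)) at_top ?F" by (rule filterlim_at_top_mono)
  thus ?thesis by (rule filterlim_norm_at_top_imp_at_infinity)
qed

theorem theorem3p7:
  fixes \<theta> zo :: complex and g :: nat and S :: "complex set"
    and q0 s \<gamma> :: "complex \<Rightarrow> complex" and p :: "complex \<Rightarrow> real \<Rightarrow> complex"
  assumes "\<theta> \<noteq> 0" and "g \<ge> 2"
    and "q0_branch \<theta> S q0"
    and "s holomorphic_on S" and "\<forall>t\<in>S. (s t)\<^sup>2 = - t / 2"
    and "end_B S s q0 \<or> end_C S s q0"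
    and "\<forall>t\<in>S. (2 * \<gamma> t)\<^sup>2 = - \<theta> / q0 t"
    and "JM_paths zo p"
  shows "((\<lambda>t. JM_F (q0 t) (\<gamma> t) p g) \<longlongrightarrow>
           - bernoulli (2 * g) / (2 * of_nat g * (2 * of_nat g - 2) * \<theta> ^ (2 * g - 2)))
         (at_infinity_within S)"
proof -
  let ?F = "at_infinity_within S"
  define e where "e = (\<lambda>t. \<gamma> t / (2 * q0 t))"
  have g: "g \<ge> 1" using assms(2) by simp
  have inS: "eventually (\<lambda>t. t \<in> S) ?F" by (simp add: eventually_inf_principal)
  \<comment> \<open>At \<open>q0 t = 0\<close> the cubic equation would read
    \<open>\<theta> = 0\<close>.\<close>
  have qnz: "q0 t \<noteq> 0" if "t \<in> S" for t
    using assms(1,3) that by (auto simp: q0_branch_def dest!: bspec[of S _ t])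
  have qinf: "filterlim q0 at_infinity ?F"
    using assms(6) q0_at_infinity[OF assms(5)] q0_at_infinity[of S "\<lambda>t. - s t" q0] assms(5)
    by (auto simp: end_B_def end_C_def)
  have e0: "(e \<longlongrightarrow> 0) ?F"
  proof -
    \<comment> \<open>Only the square of \<open>\<gamma>\<close> is prescribed, so the limit is
      taken through \<open>e^2 = \<gamma>^2 / (4 q0^2) = - \<theta> / (16 q0^3)\<close>.\<close>
    have "((\<lambda>t. - \<theta> / 16 * inverse (q0 t) ^ 3) \<longlongrightarrow> - \<theta> / 16 * 0 ^ 3) ?F"
      by (intro tendsto_intros filterlim_compose[OF tendsto_inverse_0 qinf])
    hence lim: "((\<lambda>t. - \<theta> / 16 * inverse (q0 t) ^ 3) \<longlongrightarrow> 0) ?F"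
      by (simp only: power_zero_numeral mult_zero_right)
    have "((\<lambda>t. (e t)\<^sup>2) \<longlongrightarrow> 0) ?F"
    proof (rule Lim_transform_eventually[OF lim])
      show "eventually (\<lambda>t. - \<theta> / 16 * inverse (q0 t) ^ 3 = (e t)\<^sup>2) ?F" using inS
      proof eventually_elim
        case (elim t)
        have "4 * (\<gamma> t)\<^sup>2 = - \<theta> / q0 t" using assms(7) elim by (simp add: power_mult_distrib)
        hence "4 * (\<gamma> t)\<^sup>2 / 4 = - \<theta> / q0 t / 4" by simp
        hence g2: "(\<gamma> t)\<^sup>2 = - \<theta> / (4 * q0 t)" by (simp add: mult.commute)
        have "(e t)\<^sup>2 = (\<gamma> t)\<^sup>2 / (4 * (q0 t)\<^sup>2)" by (simp add: e_def power_divide power_mult_distrib)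
        also have "\<dots> = - \<theta> / 16 * inverse (q0 t) ^ 3" unfolding g2
          using qnz[OF elim] by (simp add: field_simps power2_eq_square power3_eq_cube)
        finally show ?case by simp
      qed
    qed
    hence "((\<lambda>t. sqrt (norm ((e t)\<^sup>2))) \<longlongrightarrow> sqrt (norm (0 :: complex))) ?F" by (intro tendsto_intros)
    hence "((\<lambda>t. norm (e t)) \<longlongrightarrow> 0) ?F" by (simp add: norm_power)
    thus ?thesis by (rule tendsto_norm_zero_cancel)
  qed
  have "sepol (\<lambda>e. Fm e g [])" using sep_Fm[of "[]" g] g by (simp add: stable_def)
  then obtain L M where L: "\<And>u. u \<in> set L \<Longrightarrow> isCont (fst u) 0" "\<And>u. u \<in> set L \<Longrightarrow> \<exists>a b. snd u = polar M a b"
    and F: "\<And>e x. e \<in> ball 0 (1 / 4) \<Longrightarrow> x \<notin> {2, - 2} \<Longrightarrow> Fm e g [] x = (\<Sum>u\<leftarrow>L. fst u e * snd u x)"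
    unfolding sepol_def by blast
  let ?c = "\<theta> / 2 / \<theta> ^ (2 * g - 1)"
  let ?v = "\<lambda>e. 1 / (2 - 2 * of_nat g) * (?c * (\<Sum>u\<leftarrow>L. fst u e * (Tf (snd u) - e * Hf (snd u))))"
  have "((\<lambda>t. ?v (e t)) \<longlongrightarrow> 1 / (2 - 2 * of_nat g) * (?c * (\<Sum>u\<leftarrow>L. fst u 0 * (Tf (snd u) - 0 * Hf (snd u))))) ?F"
    by (intro tendsto_mult tendsto_const tendsto_sum_list tendsto_diff e0 isCont_tendsto_compose[OF L(1) e0])
  moreover have "(\<Sum>u\<leftarrow>L. fst u 0 * (Tf (snd u) - 0 * Hf (snd u))) = bernoulli (2 * g) / of_nat g"
  proof -
    have "Tf (Fm 0 g []) = (\<Sum>u\<leftarrow>L. fst u 0 * Tf (snd u))"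
      by (rule Tf_linear[OF L(2) F]) auto
    thus ?thesis using Tf_Fm_0[OF g] by simp
  qed
  \<comment> \<open>The factor \<open>\<theta> / 2\<close> comes from \<open>y dx\<close>, the power
    \<open>\<theta> ^ (2 * g - 1)\<close> from the homogeneity of the one-point form; the sign of
    \<open>2 - 2 g\<close> gives the sign of the limit.\<close>
  moreover have "1 / (2 - 2 * of_nat g) * (?c * (bernoulli (2 * g) / of_nat g)) =
      - bernoulli (2 * g) / (2 * of_nat g * (2 * of_nat g - 2) * \<theta> ^ (2 * g - 2))"
  proof -
    have t: "\<theta> ^ (2 * g - 1) = \<theta> * \<theta> ^ (2 * g - 2)"
      using g by (cases g) simp_all
    have "1 / (2 - d) * (\<theta> / 2 / (\<theta> * T) * (B / G)) = - B / (2 * G * (d - 2) * T)" for d T B G :: complex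
      using assms(1) by (simp add: divide_simps) (simp add: algebra_simps)
    thus ?thesis unfolding t .
  qed
  moreover have "eventually (\<lambda>t. ?v (e t) = JM_F (q0 t) (\<gamma> t) p g) ?F"
    using inS tendstoD[OF e0, of "1 / 4", simplified]
  proof eventually_elim
    case (elim t)
    hence t: "t \<in> S" and d: "dist (e t) 0 < 1 / 4" by auto
    have eb: "e t \<in> ball 0 (1 / 4)" using d by (simp add: dist_commute)
    have "(2 * \<gamma> t)\<^sup>2 = - \<theta> / q0 t" "e t = \<gamma> t / (2 * q0 t)" using assms(7) t by (simp_all add: e_def)
    moreover have "\<forall>u\<in>set L. \<exists>a b. snd u = polar M a b" using L(2) by blast
    moreover have "\<forall>x. x \<notin> {2, - 2} \<longrightarrow> Fm (e t) g [] x = (\<Sum>u\<leftarrow>L. fst u (e t) * snd u x)" using F[OF eb] by blast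
    ultimately have "JM_F (q0 t) (\<gamma> t) p g = ?v (e t)"
      by (rule JM_F_formula[OF qnz[OF t] assms(1) _ _ assms(8) eb g])
    thus ?case by (rule sym)
  qed
  ultimately show ?thesis using Lim_transform_eventually by (simp only:)
qed

end
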